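(* Let $n\ge 1$, $\tau\in\mathbb{C}$ with $\mathrm{im}\,\tau>0$, $\Lambda_\tau=\mathbb{Z}\oplus\mathbb{Z}\tau$ and $E=\mathbb{C}/\Lambda_\tau$. Let $w_1,\dots,w_n\in\mathbb{C}$ be generic parameters, in the sense that $\sum_{i\in I}w_i\notin\Lambda_\tau$ for every nonempty $I\subseteq\{1,\dots,n\}$. Let $z_1,\dots,z_n$ be the linear coordinates on $E^n$ and let $$\omega_n=\frac{\theta(\sum_{i=1}^n w_i)}{\prod_{i=1}^n\theta(w_i)}\cdot\frac{\prod_{i<j}\theta(z_i+w_i-z_j-w_j)\,\theta(z_i-z_j)}{\prod_{i<j}\theta(z_i+w_i-z_j)\,\theta(z_i-w_j-z_j)}\cdot\bigwedge_{i=1}^n\frac{\mathbf{i}\,dz_i\wedge d\bar z_i}{2\,\mathrm{im}\,\tau}.$$ Then the regularized integral of $\omega_n$ over $E^n$ (denoted $\mathrm{reg}\!\int_{E^n}$) satisfies $$\mathrm{reg}\!\int_{E^n}\omega_n=\sum_{j=1}^{n}\ \sum_{\pi\in\Pi_{\{1,\dots,n\}\setminus\{j\}}}\ \prod_{k=1}^{\ell}\frac{\widehat{B}_{|\pi_k|}\big(\sum_{i\in\pi_k}w_i\big)}{|\pi_k|},$$ where $\Pi_S$ denotes the set of set partitions $\pi=\{\pi_1,\dots,\pi_\ell\}$ of $S$ into nonempty blocks (for $S=\emptyset$ there is exactly one, empty, partition, contributing the empty product $1$).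
   Context: **Theta function.** $\theta$ is the odd Jacobi theta function normalized by $\theta'(0)=1$: the entire odd function on $\mathbb{C}$ with simple zeros exactly at $\Lambda_\tau$, $\theta'(0)=1$, $\theta(z+1)=-\theta(z)$, $\theta(z+\tau)=-e^{-\pi\mathbf{i}\tau}e^{-2\pi\mathbf{i}z}\theta(z)$. **Eisenstein-Kronecker series and $\widehat B_m$.** For $m\ge1$ let $2G_m=\sum_{\lambda\in\Lambda_\tau\setminus\{0\}}\lambda^{-m}$, which is $0$ for $m$ odd, and for $m=2$ is summed in the Eisenstein order (for $\lambda=a+b\tau$, sum over $a$ first, then over $b$). Put $$\widehat{\mathcal{E}}^*_m(w)=\partial_w^m\ln\theta(w)+(m-1)!\,2G_m+\delta_{m,1}\Big(-\frac{\pi}{\mathrm{im}\,\tau}\Big)(\bar w-w).$$ Equivalently, $\widehat{\mathcal{E}}^*_m(w)=(-1)^{m-1}(m-1)!\sum_{\lambda\in\Lambda_\tau}(w+\lambda)^{-m}+(m-1)!\,2G_m+\delta_{m,1}(-\pi/\mathrm{im}\,\tau)(\bar w-w)$ with Eisenstein summation. The function $\widehat{B}_m(w)$ is the complete Bell polynomial in the $\widehat{\mathcal{E}}^*_k(w)$: $\widehat{B}_m(w)=m!\,[t^m]\exp\big(\sum_{k\ge1}\frac{t^k}{k!}\widehat{\mathcal{E}}^*_k(w)\big)$. **Regularized integral.** A function on a complex manifold is said to be smooth with holomorphic poles along a divisor $D$ if locally it is $g/h^k$ with $g$ smooth, $h$ a local holomorphic defining equation of $D$, $k\geq 0$. For a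 2-form $\omega$ on $E$ that is smooth with holomorphic poles at a finite set $D\subset E$, $\mathrm{reg}\!\int_E\omega:=\lim_{\varepsilon\to0}\int_{E\setminus\bigcup_{p\in D}\{|z-p|<\varepsilon\}}\omega$ (the limit exists). On $E^n$ the regularized integral is the iterated one: one applies $\mathrm{reg}\!\int_E$ successively in the variables $z_1,z_2,\dots,z_n$ (with the remaining variables generic at each stage); the result does not depend on the order of the variables. *)

theory Defs
  imports "HOL-Complex_Analysis.Complex_Analysis" "HOL-Library.Disjoint_Sets"
begin

definition lattice :: "complex \<Rightarrow> complex set" where
  "lattice \<tau> = {of_int a + of_int b * \<tau> | a b. True}"

definition fundamental_parallelogram :: "complex \<Rightarrow> complex set" where
  "fundamental_parallelogram \<tau> =
     {of_real s + of_real t * \<tau> | s t. s \<in> {0..<1} \<and> t \<in> {0..<1}}"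


text \<open>The conditions below determine \<open>\<theta>\<close> uniquely when \<open>Im \<tau> > 0\<close>.\<close>

definition odd_jacobi_theta :: "complex \<Rightarrow> (complex \<Rightarrow> complex) \<Rightarrow> bool" where
  "odd_jacobi_theta \<tau> \<theta> \<longleftrightarrow>
     \<theta> holomorphic_on UNIV \<and>
     (\<forall>z. \<theta> (- z) = - \<theta> z) \<and>
     (\<forall>z. \<theta> z = 0 \<longleftrightarrow> z \<in> lattice \<tau>) \<and>
     (\<forall>z\<in>lattice \<tau>. zorder \<theta> z = 1) \<and>
     deriv \<theta> 0 = 1 \<and>
     (\<forall>z. \<theta> (z + 1) = - \<theta> z) \<and>
     (\<forall>z. \<theta> (z + \<tau>) = - exp (- pi * \<i> * \<tau>) * exp (- 2 * pi * \<i> * z) * \<theta> z)"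


text \<open>
  This is \<open>2 G\<^sub>m\<close>. For \<open>m = 2\<close> the inner sum (over \<open>a\<close>) and the outer sum (over \<open>b\<close>)
  each converge absolutely, although the double series does not; for even \<open>m \<ge> 4\<close>
  the series over the lattice converges absolutely.
\<close>

definition eisenstein_2G :: "complex \<Rightarrow> nat \<Rightarrow> complex" where
  "eisenstein_2G \<tau> m =
     (if odd m then 0
      else if m = 2 then
        (\<Sum>\<^sub>\<infinity>b\<in>(UNIV :: int set). \<Sum>\<^sub>\<infinity>a\<in>{a :: int. (a, b) \<noteq> (0, 0)}.
            1 / (of_int a + of_int b * \<tau>) ^ 2)
      else (\<Sum>\<^sub>\<infinity>l\<in>lattice \<tau> - {0}. 1 / l ^ m))"

text \<open>
  For \<open>m \<ge> 1\<close>, the \<open>m\<close>-th derivative of the multivalued function \<open>ln \<theta>\<close> is the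
  \<open>(m - 1)\<close>-st derivative of \<open>\<theta>' / \<theta>\<close>. The principal branch \<open>Ln (\<theta> w)\<close> would not do:
  it is discontinuous where \<open>\<theta> w\<close> is a negative real.
\<close>

definition EK_star :: "complex \<Rightarrow> (complex \<Rightarrow> complex) \<Rightarrow> nat \<Rightarrow> complex \<Rightarrow> complex" where
  "EK_star \<tau> \<theta> m w =
     (deriv ^^ (m - 1)) (\<lambda>u. deriv \<theta> u / \<theta> u) w
     + fact (m - 1) * eisenstein_2G \<tau> m
     + (if m = 1 then - (of_real pi / of_real (Im \<tau>)) * (cnj w - w) else 0)"

definition B_hat :: "complex \<Rightarrow> (complex \<Rightarrow> complex) \<Rightarrow> nat \<Rightarrow> complex \<Rightarrow> complex" where
  "B_hat \<tau> \<theta> m w =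
     fact m * fps_nth (fps_exp 1 oo
       Abs_fps (\<lambda>k. if k = 0 then 0 else EK_star \<tau> \<theta> k w / fact k)) m"


text \<open>
  Differentiability in the real sense on an open set \<open>S\<close>: \<open>fx\<close> and \<open>fy\<close> are the partial
  derivatives of \<open>f\<close> with respect to \<open>x = Re z\<close> and \<open>y = Im z\<close>.
\<close>

primrec Ck_on :: "nat \<Rightarrow> complex set \<Rightarrow> (complex \<Rightarrow> complex) \<Rightarrow> bool" where
  "Ck_on 0 S f \<longleftrightarrow> continuous_on S f"
| "Ck_on (Suc k) S f \<longleftrightarrow>
     (\<exists>fx fy. (\<forall>z\<in>S. (f has_derivative (\<lambda>h. of_real (Re h) * fx z + of_real (Im h) * fy z)) (at z)) \<and>
              Ck_on k S fx \<and> Ck_on k S fy)"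

definition smooth_on :: "complex set \<Rightarrow> (complex \<Rightarrow> complex) \<Rightarrow> bool" where
  "smooth_on S f \<longleftrightarrow> (\<forall>k. Ck_on k S f)"

text \<open>
  A function on \<open>E = \<complex> / \<Lambda>\<^sub>\<tau>\<close> is given by its pullback to the complex plane, and \<open>D\<close> is the
  preimage of the pole divisor. The values of \<open>f\<close> on \<open>D\<close> are irrelevant.
\<close>

definition smooth_with_holomorphic_poles ::
    "complex \<Rightarrow> complex set \<Rightarrow> (complex \<Rightarrow> complex) \<Rightarrow> bool" where
  "smooth_with_holomorphic_poles \<tau> D f \<longleftrightarrow>
     (\<forall>z l. z \<notin> D \<longrightarrow> l \<in> lattice \<tau> \<longrightarrow> f (z + l) = f z) \<and>
     smooth_on (- D) f \<and>
     (\<forall>p\<in>D. \<exists>r>0. \<exists>k g. smooth_on (ball p r) g \<and>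
        (\<forall>z\<in>ball p r - {p}. f z = g z / (z - p) ^ k))"

text \<open>
  \<open>has_reg_integral_E \<tau> f I\<close>: the 2-form \<open>\<omega> = f (\<i>/2) dz \<and> d(cnj z) = f dx \<and> dy\<close> on \<open>E\<close> is
  smooth with holomorphic poles along a finite set, and \<open>I\<close> is its regularized integral.
  \<open>I\<close> does not depend on the choice of \<open>S\<close>, since enlarging \<open>S\<close> by points at which \<open>f\<close> is
  smooth does not change the limit.
\<close>

definition has_reg_integral_E :: "complex \<Rightarrow> (complex \<Rightarrow> complex) \<Rightarrow> complex \<Rightarrow> bool" where
  "has_reg_integral_E \<tau> f I \<longleftrightarrow>
     (\<exists>S. finite S \<and>
       (let D = {p + l | p l. p \<in> S \<and> l \<in> lattice \<tau>} in
          smooth_with_holomorphic_poles \<tau> D f \<and>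
          ((\<lambda>\<epsilon>. set_lebesgue_integral lborel
                  (fundamental_parallelogram \<tau> - (\<Union>p\<in>D. ball p \<epsilon>)) f)
             \<longlongrightarrow> I) (at_right 0)))"

text \<open>
  Iterated regularized integral, in the variables \<open>z k\<close> for \<open>k\<close> running through the list
  from left to right. \<open>G\<close> is the result of integrating out the first variable; ``generic''
  values of the remaining variables means almost all of them. A null set of exceptional
  values does not affect the next step, because a slice of \<open>G\<close> must again be smooth off a
  discrete set. When no variable is left, \<open>F\<close> is evaluated at the only point of the empty
  product \<open>PiM {}\<close>.
\<close>

primrec has_iterated_reg_integral ::
    "complex \<Rightarrow> nat list \<Rightarrow> ((nat \<Rightarrow> complex) \<Rightarrow> complex) \<Rightarrow> complex \<Rightarrow> bool" where
  "has_iterated_reg_integral \<tau> [] F I \<longleftrightarrow> F (\<lambda>_. undefined) = I"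
| "has_iterated_reg_integral \<tau> (k # ks) F I \<longleftrightarrow>
     (\<exists>G. (AE z in PiM (set ks) (\<lambda>_. lborel).
              has_reg_integral_E \<tau> (\<lambda>u. F (z(k := u))) (G z)) \<and>
          has_iterated_reg_integral \<tau> ks G I)"

text \<open>
  Regularized integral over \<open>E\<^sup>n\<close> of the form with coefficient \<open>F\<close> with respect to the wedge
  product of the \<open>(\<i>/2) dz\<^sub>i \<and> d(cnj z\<^sub>i)\<close>; \<open>F\<close> depends on \<open>z 1, \<dots>, z n\<close> only.
\<close>

definition has_reg_integral_En ::
    "complex \<Rightarrow> nat \<Rightarrow> ((nat \<Rightarrow> complex) \<Rightarrow> complex) \<Rightarrow> complex \<Rightarrow> bool" where
  "has_reg_integral_En \<tau> n F I \<longleftrightarrow> has_iterated_reg_integral \<tau> [1..<Suc n] F I"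


text \<open>
  The coefficient of \<open>\<omega>\<^sub>n\<close> with respect to the wedge product of the
  \<open>(\<i>/2) dz\<^sub>i \<and> d(cnj z\<^sub>i)\<close>, whence the factors \<open>1 / Im \<tau>\<close>.
\<close>

definition omega ::
    "complex \<Rightarrow> (complex \<Rightarrow> complex) \<Rightarrow> nat \<Rightarrow> (nat \<Rightarrow> complex) \<Rightarrow> (nat \<Rightarrow> complex) \<Rightarrow> complex" where
  "omega \<tau> \<theta> n w z =
     \<theta> (\<Sum>i=1..n. w i) / (\<Prod>i=1..n. \<theta> (w i))
     * ((\<Prod>i=1..n. \<Prod>j=i+1..n. \<theta> (z i + w i - z j - w j) * \<theta> (z i - z j))
        / (\<Prod>i=1..n. \<Prod>j=i+1..n. \<theta> (z i + w i - z j) * \<theta> (z i - w j - z j)))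
     * (\<Prod>i=1..n. 1 / of_real (Im \<tau>))"

end

theory Submission
  imports Defs "HOL-Combinatorics.Permutations"
begin

text \<open>
  Fix an auxiliary parameter \<open>s\<close> and let \<open>\<phi>(x, s)\<close> be the Kronecker function
  \<open>\<theta>(x + s) / (\<theta>(x) \<theta>(s))\<close> times the exponential factor \<open>exp (- \<pi> (cnj x - x) s / Im \<tau>)\<close>, which
  makes it doubly periodic in \<open>x\<close>. By Frobenius' determinant formula the integrand is, up to a
  power of \<open>Im \<tau>\<close>, the determinant of the matrix \<open>\<phi>(z\<^sub>i + w\<^sub>i - z\<^sub>j, s)\<close> divided by
  \<open>\<phi>(w\<^sub>1 + \<dots> + w\<^sub>n, s)\<close>. In the expansion of the determinant every variable is integrated by a
  convolution: by Stokes' theorem, the Taylor coefficients of \<open>\<phi>\<close> in \<open>s\<close> of orders \<open>m\<close> and \<open>n\<close>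
  convolve to minus \<open>Im \<tau>\<close> times the one of order \<open>m + n + 1\<close>, and the sign is absorbed by the sign
  of the permutation. So a cycle on a block \<open>B\<close> contributes the coefficient of order
  \<open>|B| - 1\<close> at the sum of the \<open>w\<^sub>i\<close> over \<open>B\<close>, and the integral of the determinant is a sum over
  set partitions. As a function of \<open>s\<close> this sum has the same quasi-periods as
  \<open>\<phi>(w\<^sub>1 + \<dots> + w\<^sub>n, s)\<close> and at most a simple pole, at \<open>s = 0\<close>, since the higher poles cancel, so
  by Liouville's theorem it is a multiple of it. The factor is the residue at \<open>0\<close>, which follows
  from the fact that \<open>s \<phi>(x, s)\<close> is the exponential generating function of the \<open>B_hat m x\<close>.
\<close>

section \<open>Sums over set partitions\<close>

text \<open>Every function that is integrated below has at worst simple poles in the variable of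
  integration, and \<open>1 / |z|\<close> is locally integrable in the plane. So the integrals
  converge absolutely, and the cut-off in the regularized integral is removed by dominated
  convergence. The delicate point is Stokes' theorem: the derivatives of a simple pole are no longer
  integrable, so it is applied only to functions that are bounded near their poles. The coefficients
  of order at least 1 are of this kind; the one of order 0 has residue 1 and needs a correction. The
  expansion in the second variable is taken at one fixed \<open>s\<close> off the lattice, where the
  determinant formula is valid. The last claim of the overview hides the role of the constants
  \<open>2G\<close>: they must be, up to sign and factorials, the Taylor coefficients at 0 of the
  logarithmic derivative of \<open>\<theta> s / s\<close>. For m = 2 this depends on the order of
  summation. It is proved by expanding the logarithmic derivative of \<open>\<theta>\<close> into
  one cotangent per row of the lattice, which is summation in the Eisenstein order.\<close>

definition partition_sum :: "'a set \<Rightarrow> ('a set \<Rightarrow> 'b::comm_ring_1) \<Rightarrow> 'b" where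
  "partition_sum S g = (\<Sum>\<pi> | partition_on S \<pi>. \<Prod>B\<in>\<pi>. g B)"

lemma partition_sum_empty [simp]: "partition_sum {} g = 1"
  by (simp add: partition_sum_def partition_on_empty)

lemma partition_sum_cong:
  assumes "\<And>B. B \<subseteq> S \<Longrightarrow> B \<noteq> {} \<Longrightarrow> g B = h B"
  shows "partition_sum S g = partition_sum S h"
  unfolding partition_sum_def
proof (rule sum.cong[OF refl], rule prod.cong[OF refl])
  fix \<pi> B assume "\<pi> \<in> {\<pi>. partition_on S \<pi>}" "B \<in> \<pi>"
  then have "partition_on S \<pi>" "B \<in> \<pi>" by auto
  then show "g B = h B"
    using partition_onD1[of S \<pi>] partition_onD3[of S \<pi>] by (intro assms) auto
qed

text \<open>Sort the partitions by the block that contains \<open>k\<close>, written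
  \<open>insert k A\<close>; the other blocks form an arbitrary partition of
  \<open>S - A\<close>.\<close>

lemma partition_sum_insert:
  assumes S: "finite S" and k: "k \<notin> S"
  shows "partition_sum (insert k S) g = (\<Sum>A\<in>Pow S. g (insert k A) * partition_sum (S - A) g)"
proof -
  \<comment> \<open>The union runs over a family with exactly one member, so this is the block of
    \<open>k\<close>, obtained without a choice operator.\<close>
  define blk where "blk = (\<lambda>\<pi>. \<Union>{B\<in>\<pi>. k \<in> B})"
  have blk: "blk \<pi> \<in> \<pi> \<and> k \<in> blk \<pi>" if p: "partition_on (insert k S) \<pi>" for \<pi>
  proof -
    obtain B where B: "B \<in> \<pi>" "k \<in> B"
      using partition_onD1[OF p] by auto
    have "{B\<in>\<pi>. k \<in> B} = {B}"
      using B partition_onD2[OF p] by (auto simp: disjoint_def)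
    then show ?thesis using B by (simp add: blk_def)
  qed
  have fin: "finite {\<pi>. partition_on (S - A) \<pi>}" for A
    using S by (intro finitely_many_partition_on) auto
  have notin: "insert k A \<notin> \<pi>" if "partition_on (S - A) \<pi>" for A \<pi>
    using partition_onD1[OF that] k by auto
  have dj: "disjnt (insert k A) (\<Union>\<pi>)" if "partition_on (S - A) \<pi>" for A \<pi>
    using partition_onD1[OF that] k by (auto simp: disjnt_def)
  have "(\<Sum>A\<in>Pow S. g (insert k A) * partition_sum (S - A) g)
      = (\<Sum>A\<in>Pow S. \<Sum>\<pi> | partition_on (S - A) \<pi>. g (insert k A) * (\<Prod>B\<in>\<pi>. g B))"
    by (simp add: partition_sum_def sum_distrib_left)
  also have "\<dots> = (\<Sum>(A, \<pi>)\<in>Sigma (Pow S) (\<lambda>A. {\<pi>. partition_on (S - A) \<pi>}).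
      g (insert k A) * (\<Prod>B\<in>\<pi>. g B))"
    using S fin by (subst sum.Sigma) auto
  also have "\<dots> = (\<Sum>\<pi> | partition_on (insert k S) \<pi>. \<Prod>B\<in>\<pi>. g B)"
  proof (rule sum.reindex_bij_witness[where i = "\<lambda>\<pi>. (blk \<pi> - {k}, \<pi> - {blk \<pi>})"
        and j = "\<lambda>(A, \<pi>). insert (insert k A) \<pi>"], goal_cases)
    case (1 a)
    obtain A \<pi> where a: "a = (A, \<pi>)" by fastforce
    with 1 have A: "A \<subseteq> S" and p: "partition_on (S - A) \<pi>" by auto
    have "{B \<in> insert (insert k A) \<pi>. k \<in> B} = {insert k A}"
      using partition_onD1[OF p] k by auto
    then have "blk (insert (insert k A) \<pi>) = insert k A" by (simp add: blk_def)
    with a A k notin[OF p] show ?case by auto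
  next
    case (2 a)
    obtain A \<pi> where a: "a = (A, \<pi>)" by fastforce
    with 2 have A: "A \<subseteq> S" and p: "partition_on (S - A) \<pi>" by auto
    have "insert k S - insert k A = S - A" using k by auto
    then show ?case
      using partition_on_insert[OF dj[OF p], of "insert k S"] A p a by auto
  next
    case (3 \<pi>)
    then show ?case using blk[of \<pi>] by (auto simp: insert_absorb)
  next
    case (4 \<pi>)
    then have p: "partition_on (insert k S) \<pi>" by simp
    note b = blk[OF p]
    have "disjnt (blk \<pi>) (\<Union>(\<pi> - {blk \<pi>}))"
      using partition_onD2[OF p] b by (auto simp: disjnt_def disjoint_def)
    from partition_on_insert[OF this, of "insert k S"] b p
    have "partition_on (insert k S - blk \<pi>) (\<pi> - {blk \<pi>})" "blk \<pi> \<subseteq> insert k S"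
      by (auto simp: insert_absorb)
    moreover have "insert k S - blk \<pi> = S - (blk \<pi> - {k})" using b k by auto
    ultimately show ?case by auto
  next
    case (5 a)
    obtain A \<pi> where a: "a = (A, \<pi>)" by fastforce
    with 5 have p: "partition_on (S - A) \<pi>" by auto
    have "finite \<pi>" using finite_elements[OF _ p] S by auto
    then show ?case using a notin[OF p] by simp
  qed
  finally show ?thesis by (simp add: partition_sum_def)
qed

text \<open>
  The weight of a block counts its cyclic arrangements: merging the label of \<open>k\<close> into that of
  \<open>i\<close> corresponds to removing \<open>k\<close> from a cycle in which it follows \<open>i\<close>.
\<close>

definition cycle_weight ::
    "(nat \<Rightarrow> 'c \<Rightarrow> 'b::{comm_ring_1,ring_char_0}) \<Rightarrow> ('a \<Rightarrow> nat) \<Rightarrow> ('a \<Rightarrow> 'c::comm_monoid_add) \<Rightarrow> 'a set \<Rightarrow> 'b" where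
  "cycle_weight F N W B = fact (card B - 1) * F (\<Sum>i\<in>B. N i) (\<Sum>i\<in>B. W i)"

text \<open>This recursion will be matched with the integration of one variable. The first summand
  is the singleton block of \<open>k\<close>. A block \<open>insert k A\<close> with nonempty
  \<open>A\<close> has the weight factor \<open>fact (card A) = card A * fact (card A - 1)\<close>,
  which is shared equally by the \<open>card A\<close> possible predecessors \<open>i\<close> of
  \<open>k\<close>.\<close>

lemma partition_sum_cycle_weight_insert:
  assumes S: "finite S" and k: "k \<notin> S"
  shows "partition_sum (insert k S) (cycle_weight F N W)
    = F (N k) (W k) * partition_sum S (cycle_weight F N W)
      + (\<Sum>i\<in>S. partition_sum S (cycle_weight F (N(i := N i + N k)) (W(i := W i + W k))))"
proof -
  define g where "g = cycle_weight F N W"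
  define h where "h = (\<lambda>A. fact (card A - 1) * F ((\<Sum>i\<in>A. N i) + N k) ((\<Sum>i\<in>A. W i) + W k))"
  have fin: "finite A" if "A \<subseteq> S" for A using that S finite_subset by auto
  have gh: "g (insert k A) = (\<Sum>i\<in>A. h A)" if A: "A \<in> Pow S - {{}}" for A
  proof -
    have "finite A" "k \<notin> A" "card A > 0"
      using A k fin by (auto simp: card_gt_0_iff)
    then show ?thesis
      by (cases "card A") (auto simp: g_def cycle_weight_def h_def algebra_simps)
  qed
  have step: "partition_sum S (cycle_weight F (N(i := N i + N k)) (W(i := W i + W k)))
      = (\<Sum>A | A \<in> Pow S - {{}} \<and> i \<in> A. h A * partition_sum (S - A) g)" if i: "i \<in> S" for i
  proof -
    define g' where "g' = cycle_weight F (N(i := N i + N k)) (W(i := W i + W k))"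
    have Si: "S = insert i (S - {i})" using i by auto
    have "partition_sum S g' = partition_sum (insert i (S - {i})) g'"
      using i by (simp add: insert_absorb)
    also have "\<dots> = (\<Sum>A\<in>Pow (S - {i}). g' (insert i A) * partition_sum (S - {i} - A) g')"
      using S by (intro partition_sum_insert) auto
    also have "\<dots> = (\<Sum>A\<in>Pow (S - {i}). h (insert i A) * partition_sum (S - insert i A) g)"
    proof (rule sum.cong[OF refl], rule arg_cong2[where f = "(*)"])
      fix A assume A: "A \<in> Pow (S - {i})"
      then have f: "finite A" "i \<notin> A" using fin[of A] by auto
      have n: "(\<Sum>j\<in>A. (N(i := N i + N k)) j) = (\<Sum>j\<in>A. N j)"
        by (rule sum.cong) (use f in auto)
      have w: "(\<Sum>j\<in>A. (W(i := W i + W k)) j) = (\<Sum>j\<in>A. W j)"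
        by (rule sum.cong) (use f in auto)
      show "g' (insert i A) = h (insert i A)"
        using f n w by (simp add: g'_def h_def cycle_weight_def ac_simps)
      have "S - {i} - A = S - insert i A" by auto
      moreover have "partition_sum (S - insert i A) g' = partition_sum (S - insert i A) g"
      proof (rule partition_sum_cong)
        fix B assume B: "B \<subseteq> S - insert i A"
        have "(\<Sum>j\<in>B. (N(i := N i + N k)) j) = (\<Sum>j\<in>B. N j)"
          "(\<Sum>j\<in>B. (W(i := W i + W k)) j) = (\<Sum>j\<in>B. W j)"
          using B by (auto intro!: sum.cong)
        then show "g' B = g B" by (simp add: g_def g'_def cycle_weight_def)
      qed
      ultimately show "partition_sum (S - {i} - A) g' = partition_sum (S - insert i A) g" by simp
    qed
    also have "\<dots> = (\<Sum>A | A \<in> Pow S - {{}} \<and> i \<in> A. h A * partition_sum (S - A) g)"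
      by (rule sum.reindex_bij_witness[where i = "\<lambda>A. A - {i}" and j = "insert i"])
        (use i in \<open>auto simp: insert_absorb\<close>)
    finally show ?thesis by (simp add: g'_def)
  qed
  have "partition_sum (insert k S) g = (\<Sum>A\<in>Pow S. g (insert k A) * partition_sum (S - A) g)"
    by (rule partition_sum_insert[OF S k])
  also have "\<dots> = g {k} * partition_sum S g
      + (\<Sum>A\<in>Pow S - {{}}. g (insert k A) * partition_sum (S - A) g)"
    using S by (subst sum.remove[of _ "{}"]) auto
  also have "(\<Sum>A\<in>Pow S - {{}}. g (insert k A) * partition_sum (S - A) g)
      = (\<Sum>A\<in>Pow S - {{}}. \<Sum>i | i \<in> S \<and> i \<in> A. h A * partition_sum (S - A) g)"
  proof (rule sum.cong[OF refl])
    fix A assume A: "A \<in> Pow S - {{}}"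
    then have "{i. i \<in> S \<and> i \<in> A} = A" by auto
    then show "g (insert k A) * partition_sum (S - A) g
        = (\<Sum>i | i \<in> S \<and> i \<in> A. h A * partition_sum (S - A) g)"
      by (simp add: gh[OF A])
  qed
  also have "\<dots> = (\<Sum>i\<in>S. \<Sum>A | A \<in> Pow S - {{}} \<and> i \<in> A. h A * partition_sum (S - A) g)"
    using S by (intro sum.swap_restrict) auto
  also have "\<dots> = (\<Sum>i\<in>S. partition_sum S (cycle_weight F (N(i := N i + N k)) (W(i := W i + W k))))"
    by (rule sum.cong[OF refl]) (simp add: step)
  finally show ?thesis by (simp add: g_def[symmetric]) (simp add: g_def cycle_weight_def)
qed

text \<open>
  The weights \<open>(-1)\<^sup>b\<^sup>-\<^sup>1 (b - 1)! x\<^sup>b\<close> alone sum to \<open>1 + x\<close> on a singleton and to \<open>0\<close> on larger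
  sets, because permutations of at least two elements have vanishing total sign.
\<close>

lemma partition_sum_add_alternating:
  fixes x :: "'b::{comm_ring_1,ring_char_0}"
  assumes "finite S"
  shows "partition_sum S (\<lambda>B. (-1) ^ (card B - 1) * fact (card B - 1) * x ^ card B + r B)
    = partition_sum S r + x * (\<Sum>j\<in>S. partition_sum (S - {j}) r)"
  using assms
proof (induction "card S" arbitrary: S rule: less_induct)
  case less
  define p where "p = (\<lambda>B::'a set. (-1) ^ (card B - 1) * fact (card B - 1) * x ^ card B)"
  show ?case
  proof (cases "S = {}")
    case False
    then obtain k where "k \<in> S" by auto
    define T where "T = S - {k}"
    have T: "S = insert k T" "k \<notin> T" "finite T" using \<open>k \<in> S\<close> less by (auto simp: T_def)
    have IH: "partition_sum (T - A) (\<lambda>B. p B + r B)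
        = partition_sum (T - A) r + x * (\<Sum>j\<in>T - A. partition_sum (T - A - {j}) r)" for A
      unfolding p_def using T by (intro less) (auto simp: less_Suc_eq_le card_mono)
    have fin: "finite A" if "A \<in> Pow T" for A using that T finite_subset by auto
    let ?P = "\<lambda>A. partition_sum A r"
    have sw: "(\<Sum>A\<in>Pow T. \<Sum>j\<in>T - A. u A j) = (\<Sum>j\<in>T. \<Sum>A\<in>Pow (T - {j}). u A j)"
      for u :: "'a set \<Rightarrow> 'a \<Rightarrow> 'b"
    proof -
      have "(\<Sum>A\<in>Pow T. \<Sum>j\<in>T - A. u A j) = (\<Sum>A\<in>Pow T. \<Sum>j | j \<in> T \<and> j \<notin> A. u A j)"
        by (intro sum.cong refl) auto
      also have "\<dots> = (\<Sum>j\<in>T. \<Sum>A | A \<in> Pow T \<and> j \<notin> A. u A j)"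
        using T by (intro sum.swap_restrict) auto
      also have "\<dots> = (\<Sum>j\<in>T. \<Sum>A\<in>Pow (T - {j}). u A j)"
        by (intro sum.cong refl) auto
      finally show ?thesis .
    qed
    have r1: "(\<Sum>A\<in>Pow T. r (insert k A) * ?P (T - A)) = ?P S"
      using T by (simp add: partition_sum_insert)
    have r2: "(\<Sum>A\<in>Pow T. \<Sum>j\<in>T - A. r (insert k A) * ?P (T - A - {j}))
        = (\<Sum>j\<in>T. ?P (S - {j}))"
      unfolding sw
    proof (rule sum.cong[OF refl])
      fix j assume j: "j \<in> T"
      have "S - {j} = insert k (T - {j})" using T j by auto
      moreover have "T - A - {j} = T - {j} - A" for A by auto
      ultimately show "(\<Sum>A\<in>Pow (T - {j}). r (insert k A) * ?P (T - A - {j})) = ?P (S - {j})"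
        using T by (simp add: partition_sum_insert)
    qed
    \<comment> \<open>A pair of a set \<open>A\<close> and a point \<open>j\<close> outside it
      becomes the nonempty set \<open>insert j A\<close> with a marked element; summing over the
      marks gives the factor \<open>card A\<close>.\<close>
    have p2: "(\<Sum>A\<in>Pow T. \<Sum>j\<in>T - A. p (insert k A) * ?P (T - A - {j}))
        = (\<Sum>A\<in>Pow T. of_nat (card A) * ((-1) ^ (card A - 1) * fact (card A - 1) * x ^ card A) * ?P (T - A))"
    proof -
      have "(\<Sum>A\<in>Pow T. \<Sum>j\<in>T - A. p (insert k A) * ?P (T - A - {j}))
          = (\<Sum>j\<in>T. \<Sum>A\<in>Pow (T - {j}). p (insert k A) * ?P (T - A - {j}))"
        by (rule sw)
      also have "\<dots> = (\<Sum>j\<in>T. \<Sum>A | A \<in> Pow T \<and> j \<in> A. p (insert k (A - {j})) * ?P (T - A))"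
      proof (rule sum.cong[OF refl])
        fix j assume j: "j \<in> T"
        show "(\<Sum>A\<in>Pow (T - {j}). p (insert k A) * ?P (T - A - {j}))
            = (\<Sum>A | A \<in> Pow T \<and> j \<in> A. p (insert k (A - {j})) * ?P (T - A))"
        proof (rule sum.reindex_bij_witness[where i = "\<lambda>A. A - {j}" and j = "insert j"], goal_cases)
          case (5 A)
          then have "T - insert j A = T - A - {j}" "insert j A - {j} = A" by auto
          then show ?case by simp
        qed (use j in \<open>auto simp: insert_absorb\<close>)
      qed
      also have "\<dots> = (\<Sum>A\<in>Pow T. \<Sum>j | j \<in> T \<and> j \<in> A. p (insert k (A - {j})) * ?P (T - A))"
        using T by (intro sum.swap_restrict) auto
      also have "\<dots> = (\<Sum>A\<in>Pow T. of_nat (card A) *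
          ((-1) ^ (card A - 1) * fact (card A - 1) * x ^ card A) * ?P (T - A))"
      proof (rule sum.cong[OF refl])
        fix A assume A: "A \<in> Pow T"
        have "(\<Sum>j | j \<in> T \<and> j \<in> A. p (insert k (A - {j})) * ?P (T - A))
            = (\<Sum>j\<in>A. (-1) ^ (card A - 1) * fact (card A - 1) * x ^ card A * ?P (T - A))"
        proof (rule sum.cong)
          fix j assume j: "j \<in> A"
          have "card (insert k (A - {j})) = card A"
            using A j T fin[OF A] card_Suc_Diff1[of A j] by (subst card_insert_disjoint) auto
          then show "p (insert k (A - {j})) * ?P (T - A)
              = (-1) ^ (card A - 1) * fact (card A - 1) * x ^ card A * ?P (T - A)"
            by (simp add: p_def)
        qed (use A in auto)
        then show "(\<Sum>j | j \<in> T \<and> j \<in> A. p (insert k (A - {j})) * ?P (T - A))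
            = of_nat (card A) * ((-1) ^ (card A - 1) * fact (card A - 1) * x ^ card A) * ?P (T - A)"
          by (simp add: mult.assoc)
      qed
      finally show ?thesis .
    qed
    \<comment> \<open>For nonempty \<open>A\<close> the two contributions agree up to sign, because
      \<open>insert k A\<close> has one element more than \<open>A\<close>. Only
      \<open>A = {}\<close> survives, with weight \<open>x\<close>.\<close>
    have p12: "(\<Sum>A\<in>Pow T. p (insert k A) * ?P (T - A))
        + x * (\<Sum>A\<in>Pow T. \<Sum>j\<in>T - A. p (insert k A) * ?P (T - A - {j})) = x * ?P T"
    proof -
      have "(\<Sum>A\<in>Pow T. p (insert k A) * ?P (T - A))
          + x * (\<Sum>A\<in>Pow T. \<Sum>j\<in>T - A. p (insert k A) * ?P (T - A - {j}))
        = (\<Sum>A\<in>Pow T. p (insert k A) * ?P (T - A)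
           + x * (of_nat (card A) * ((-1) ^ (card A - 1) * fact (card A - 1) * x ^ card A) * ?P (T - A)))"
        by (simp add: p2 sum.distrib sum_distrib_left)
      also have "\<dots> = (\<Sum>A\<in>Pow T. if A = {} then x * ?P T else 0)"
      proof (rule sum.cong[OF refl])
        fix A assume A: "A \<in> Pow T"
        have "k \<notin> A" using A T by auto
        then have c: "card (insert k A) = Suc (card A)" using fin[OF A] by simp
        show "p (insert k A) * ?P (T - A) + x * (of_nat (card A) *
            ((-1) ^ (card A - 1) * fact (card A - 1) * x ^ card A) * ?P (T - A))
            = (if A = {} then x * ?P T else 0)"
        proof (cases "card A")
          case 0
          then show ?thesis using fin[OF A] by (simp add: p_def)
        next
          case (Suc m)
          then show ?thesis using c by (auto simp: p_def algebra_simps)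
        qed
      qed
      also have "\<dots> = x * ?P T" using T by (simp add: sum.delta)
      finally show ?thesis .
    qed
    have "partition_sum S (\<lambda>B. p B + r B) = (\<Sum>A\<in>Pow T. (p (insert k A) + r (insert k A)) *
        (?P (T - A) + x * (\<Sum>j\<in>T - A. ?P (T - A - {j}))))"
      using T by (simp add: partition_sum_insert IH)
    also have "\<dots> = (\<Sum>A\<in>Pow T. r (insert k A) * ?P (T - A))
        + x * (\<Sum>A\<in>Pow T. \<Sum>j\<in>T - A. r (insert k A) * ?P (T - A - {j}))
        + ((\<Sum>A\<in>Pow T. p (insert k A) * ?P (T - A))
        + x * (\<Sum>A\<in>Pow T. \<Sum>j\<in>T - A. p (insert k A) * ?P (T - A - {j})))"
      unfolding sum_distrib_left sum.distrib[symmetric]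
      by (intro sum.cong refl) (simp add: algebra_simps sum_distrib_left sum.distrib)
    also have "\<dots> = ?P S + x * (\<Sum>j\<in>T. ?P (S - {j})) + x * ?P T"
      by (simp only: r1 r2 p12)
    also have "\<dots> = ?P S + x * (\<Sum>j\<in>S. ?P (S - {j}))"
    proof -
      have "S - {k} = T" using T by auto
      then show ?thesis using T by (simp add: algebra_simps)
    qed
    finally show ?thesis by (simp add: p_def)
  qed simp
qed

section \<open>Wirtinger derivatives and integrals over the fundamental parallelogram\<close>

text \<open>\<open>a\<close> and \<open>b\<close> are the derivatives of \<open>f\<close> with
  respect to \<open>z\<close> and \<open>cnj z\<close>. Stating them through the Frechet derivative
  makes all calculus rules instances of those for \<open>has_derivative\<close>.\<close>

definition has_wirtinger :: "(complex \<Rightarrow> complex) \<Rightarrow> complex \<Rightarrow> complex \<Rightarrow> complex \<Rightarrow> bool" where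
  "has_wirtinger f z a b \<longleftrightarrow> (f has_derivative (\<lambda>h. a * h + b * cnj h)) (at z)"

lemma has_wirtinger_unique:
  assumes "has_wirtinger f z a b" "has_wirtinger f z a' b'"
  shows "a = a'" "b = b'"
proof -
  have *: "(\<lambda>h. a * h + b * cnj h) = (\<lambda>h. a' * h + b' * cnj h)"
    using assms has_derivative_unique unfolding has_wirtinger_def by blast
  have 1: "a + b = a' + b'" using fun_cong[OF *, of 1] by simp
  have "\<i> * (a - b) = \<i> * (a' - b')" using fun_cong[OF *, of \<i>] by (simp add: algebra_simps)
  then have "a - b = a' - b'" by simp
  with 1 show "a = a'" "b = b'" by (simp_all add: complex_eq_iff)
qed

lemma has_wirtinger_const: "has_wirtinger (\<lambda>_. k) z 0 0"
  by (simp add: has_wirtinger_def)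

lemma has_wirtinger_cnj: "has_wirtinger cnj z 0 1"
  by (simp add: has_wirtinger_def bounded_linear_imp_has_derivative bounded_linear_cnj)

lemma has_wirtinger_holomorphic:
  "(f has_field_derivative f') (at z) \<Longrightarrow> has_wirtinger f z f' 0"
  by (simp add: has_wirtinger_def has_field_derivative_def)

lemma has_wirtinger_add:
  assumes "has_wirtinger f z a b" "has_wirtinger g z a' b'"
  shows "has_wirtinger (\<lambda>z. f z + g z) z (a + a') (b + b')"
  using has_derivative_add[OF assms[unfolded has_wirtinger_def]]
  by (simp add: has_wirtinger_def algebra_simps)

lemma has_wirtinger_diff:
  assumes "has_wirtinger f z a b" "has_wirtinger g z a' b'"
  shows "has_wirtinger (\<lambda>z. f z - g z) z (a - a') (b - b')"
  using has_derivative_diff[OF assms[unfolded has_wirtinger_def]]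
  by (simp add: has_wirtinger_def algebra_simps)

lemma has_wirtinger_mult:
  assumes "has_wirtinger f z a b" "has_wirtinger g z a' b'"
  shows "has_wirtinger (\<lambda>z. f z * g z) z (a * g z + f z * a') (b * g z + f z * b')"
  using has_derivative_mult[OF assms[unfolded has_wirtinger_def]]
  by (simp add: has_wirtinger_def algebra_simps)

lemma has_wirtinger_sum:
  assumes "\<And>i. i \<in> I \<Longrightarrow> has_wirtinger (f i) z (a i) (b i)"
  shows "has_wirtinger (\<lambda>z. \<Sum>i\<in>I. f i z) z (\<Sum>i\<in>I. a i) (\<Sum>i\<in>I. b i)"
  using assms
  by (induction I rule: infinite_finite_induct)
    (auto intro!: has_wirtinger_add has_wirtinger_const)

lemma has_wirtinger_compose:
  assumes "has_wirtinger f z a b" "(g has_field_derivative g') (at (f z))"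
  shows "has_wirtinger (\<lambda>z. g (f z)) z (g' * a) (g' * b)"
proof -
  have "((\<lambda>x. g (f x)) has_derivative (\<lambda>h. g' * (a * h + b * cnj h))) (at z)"
    using assms unfolding has_wirtinger_def has_field_derivative_def
    by (rule has_derivative_compose)
  then show ?thesis by (simp add: has_wirtinger_def algebra_simps)
qed

lemma has_wirtinger_reflect:
  assumes "has_wirtinger f (c - z) a b"
  shows "has_wirtinger (\<lambda>z. f (c - z)) z (- a) (- b)"
proof -
  have "((\<lambda>x. f (c - x)) has_derivative (\<lambda>h. a * (0 - h) + b * cnj (0 - h))) (at z)"
    by (rule has_derivative_compose[where f = "\<lambda>x. c - x"])
      (use assms in \<open>auto simp: has_wirtinger_def intro!: derivative_eq_intros\<close>)
  then show ?thesis by (simp add: has_wirtinger_def algebra_simps)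
qed

lemma has_wirtinger_translate:
  assumes "has_wirtinger f (z - c) a b"
  shows "has_wirtinger (\<lambda>z. f (z - c)) z a b"
proof -
  have "((\<lambda>x. f (x - c)) has_derivative (\<lambda>h. a * (h - 0) + b * cnj (h - 0))) (at z)"
    by (rule has_derivative_compose[where f = "\<lambda>x. x - c"])
      (use assms in \<open>auto simp: has_wirtinger_def intro!: derivative_eq_intros\<close>)
  then show ?thesis by (simp add: has_wirtinger_def algebra_simps)
qed

lemma has_wirtinger_iff_partials:
  "(f has_derivative (\<lambda>h. of_real (Re h) * fx + of_real (Im h) * fy)) (at z)
    \<longleftrightarrow> has_wirtinger f z ((fx - \<i> * fy) / 2) ((fx + \<i> * fy) / 2)"
proof -
  have "of_real (Re h) * fx + of_real (Im h) * fy
      = (fx - \<i> * fy) / 2 * h + (fx + \<i> * fy) / 2 * cnj h" for h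
    by (simp add: complex_eq_iff field_simps)
  then show ?thesis by (simp add: has_wirtinger_def)
qed

section \<open>Closure properties of smooth functions\<close>

lemma Ck_on_SucI:
  assumes "\<And>z. z \<in> S \<Longrightarrow> (f has_derivative (\<lambda>h. of_real (Re h) * fx z + of_real (Im h) * fy z)) (at z)"
    "Ck_on k S fx" "Ck_on k S fy"
  shows "Ck_on (Suc k) S f"
  using assms unfolding Ck_on.simps by blast

lemma Ck_on_SucE:
  assumes "Ck_on (Suc k) S f"
  obtains fx fy where
    "\<And>z. z \<in> S \<Longrightarrow> (f has_derivative (\<lambda>h. of_real (Re h) * fx z + of_real (Im h) * fy z)) (at z)"
    "Ck_on k S fx" "Ck_on k S fy"
  using assms unfolding Ck_on.simps by blast

lemma Ck_on_imp_Ck_on: "Ck_on (Suc k) S f \<Longrightarrow> Ck_on k S f"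
proof (induction k arbitrary: f)
  case 0
  then obtain fx fy where
    "\<And>z. z \<in> S \<Longrightarrow> (f has_derivative (\<lambda>h. of_real (Re h) * fx z + of_real (Im h) * fy z)) (at z)"
    using Ck_on_SucE by blast
  then show ?case
    by (auto intro!: continuous_at_imp_continuous_on dest: has_derivative_continuous)
next
  case (Suc k)
  obtain fx fy where
    "\<And>z. z \<in> S \<Longrightarrow> (f has_derivative (\<lambda>h. of_real (Re h) * fx z + of_real (Im h) * fy z)) (at z)"
    "Ck_on (Suc k) S fx" "Ck_on (Suc k) S fy" using Ck_on_SucE[OF Suc.prems(1)] by blast
  then show ?case using Suc.IH by (intro Ck_on_SucI)
qed

lemma Ck_on_subset: "Ck_on k S f \<Longrightarrow> T \<subseteq> S \<Longrightarrow> Ck_on k T f"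
proof (induction k arbitrary: f)
  case 0
  then show ?case by (auto intro: continuous_on_subset)
next
  case (Suc k)
  obtain fx fy where
    "\<And>z. z \<in> S \<Longrightarrow> (f has_derivative (\<lambda>h. of_real (Re h) * fx z + of_real (Im h) * fy z)) (at z)"
    "Ck_on k S fx" "Ck_on k S fy" using Ck_on_SucE[OF Suc.prems(1)] by blast
  with Suc.prems(2) show ?case by (intro Ck_on_SucI[where fx = fx and fy = fy] Suc.IH) auto
qed

lemma Ck_on_cong:
  assumes "Ck_on k S f" "open S" "\<And>z. z \<in> S \<Longrightarrow> f z = g z"
  shows "Ck_on k S g"
proof (cases k)
  case 0
  then show ?thesis using assms by (auto cong: continuous_on_cong)
next
  case (Suc k')
  with assms(1) obtain fx fy where *:
    "\<And>z. z \<in> S \<Longrightarrow> (f has_derivative (\<lambda>h. of_real (Re h) * fx z + of_real (Im h) * fy z)) (at z)"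
    "Ck_on k' S fx" "Ck_on k' S fy" by (auto elim: Ck_on_SucE)
  show ?thesis unfolding Suc
  proof (rule Ck_on_SucI[OF _ *(2,3)])
    show "(g has_derivative (\<lambda>h. of_real (Re h) * fx z + of_real (Im h) * fy z)) (at z)" if "z \<in> S" for z
      by (rule has_derivative_transform_within_open[of f]) (use * assms that in auto)
  qed
qed

lemma Ck_on_const: "Ck_on k S (\<lambda>_. c)"
proof (induction k arbitrary: c)
  case (Suc k)
  show ?case by (rule Ck_on_SucI[OF _ Suc.IH[of 0] Suc.IH[of 0]]) simp
qed simp

lemma Ck_on_add:
  assumes "Ck_on k S f" "Ck_on k S g"
  shows "Ck_on k S (\<lambda>z. f z + g z)"
  using assms
proof (induction k arbitrary: f g)
  case 0
  then show ?case by (auto intro: continuous_on_add)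
next
  case (Suc k)
  obtain fx fy where f: "\<And>z. z \<in> S \<Longrightarrow> (f has_derivative (\<lambda>h. of_real (Re h) * fx z + of_real (Im h) * fy z)) (at z)"
    "Ck_on k S fx" "Ck_on k S fy" using Ck_on_SucE[OF Suc.prems(1)] by blast
  obtain gx gy where g: "\<And>z. z \<in> S \<Longrightarrow> (g has_derivative (\<lambda>h. of_real (Re h) * gx z + of_real (Im h) * gy z)) (at z)"
    "Ck_on k S gx" "Ck_on k S gy" using Ck_on_SucE[OF Suc.prems(2)] by blast
  show ?case
  proof (rule Ck_on_SucI)
    show "((\<lambda>z. f z + g z) has_derivative (\<lambda>h. of_real (Re h) * (fx z + gx z) + of_real (Im h) * (fy z + gy z))) (at z)"
      if "z \<in> S" for z
      by (rule has_derivative_eq_rhs, rule has_derivative_add[OF f(1)[OF that] g(1)[OF that]])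
        (auto simp: algebra_simps)
  qed (intro Suc.IH f g)+
qed

lemma Ck_on_mult:
  assumes "Ck_on k S f" "Ck_on k S g"
  shows "Ck_on k S (\<lambda>z. f z * g z)"
  using assms
proof (induction k arbitrary: f g)
  case 0
  then show ?case by (auto intro: continuous_on_mult)
next
  case (Suc k)
  obtain fx fy where f: "\<And>z. z \<in> S \<Longrightarrow> (f has_derivative (\<lambda>h. of_real (Re h) * fx z + of_real (Im h) * fy z)) (at z)"
    "Ck_on k S fx" "Ck_on k S fy" using Ck_on_SucE[OF Suc.prems(1)] by blast
  obtain gx gy where g: "\<And>z. z \<in> S \<Longrightarrow> (g has_derivative (\<lambda>h. of_real (Re h) * gx z + of_real (Im h) * gy z)) (at z)"
    "Ck_on k S gx" "Ck_on k S gy" using Ck_on_SucE[OF Suc.prems(2)] by blast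
  have fg: "Ck_on k S f" "Ck_on k S g" using Suc.prems by (simp_all only: Ck_on_imp_Ck_on)
  show ?case
  proof (rule Ck_on_SucI)
    show "((\<lambda>z. f z * g z) has_derivative (\<lambda>h. of_real (Re h) * (f z * gx z + fx z * g z)
        + of_real (Im h) * (f z * gy z + fy z * g z))) (at z)" if "z \<in> S" for z
      by (rule has_derivative_eq_rhs, rule has_derivative_mult[OF f(1)[OF that] g(1)[OF that]])
        (auto simp: algebra_simps)
  qed (intro Ck_on_add Suc.IH f g fg)+
qed

lemma Ck_on_holomorphic:
  assumes "f holomorphic_on S" "open S"
  shows "Ck_on k S f"
  using assms(1)
proof (induction k arbitrary: f)
  case 0
  then show ?case by (auto intro: holomorphic_on_imp_continuous_on)
next
  case (Suc k)
  have h: "deriv f holomorphic_on S" using Suc.prems assms(2) by (rule holomorphic_deriv)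
  show ?case
  proof (rule Ck_on_SucI)
    show "(f has_derivative (\<lambda>h. of_real (Re h) * deriv f z + of_real (Im h) * (\<i> * deriv f z))) (at z)"
      if "z \<in> S" for z
    proof -
      have *: "of_real (Re h) * deriv f z + of_real (Im h) * (\<i> * deriv f z) = deriv f z * h" for h
        by (simp add: complex_eq_iff algebra_simps)
      show ?thesis unfolding *
        using holomorphic_derivI[OF Suc.prems assms(2) that] by (simp add: has_field_derivative_def)
    qed
    show "Ck_on k S (deriv f)" "Ck_on k S (\<lambda>z. \<i> * deriv f z)"
      by (rule Suc.IH, use h in \<open>auto intro: holomorphic_intros\<close>)+
  qed
qed

lemma Ck_on_cnj: "Ck_on k S cnj"
proof (cases k)
  case (Suc k')
  show ?thesis unfolding Suc
  proof (rule Ck_on_SucI[OF _ Ck_on_const[of _ _ 1] Ck_on_const[of _ _ "- \<i>"]])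
    have "(\<lambda>h. of_real (Re h) * 1 + of_real (Im h) * (- \<i>)) = cnj"
      by (auto simp: complex_eq_iff)
    then show "(cnj has_derivative (\<lambda>h. of_real (Re h) * 1 + of_real (Im h) * (- \<i>))) (at z)" for z
      by (simp only: bounded_linear_imp_has_derivative bounded_linear_cnj)
  qed
qed (auto intro!: continuous_intros)

lemma Ck_on_exp:
  assumes "Ck_on k S f"
  shows "Ck_on k S (\<lambda>z. exp (f z))"
  using assms
proof (induction k arbitrary: f)
  case 0
  then show ?case by (auto intro: continuous_intros)
next
  case (Suc k)
  obtain fx fy where f: "\<And>z. z \<in> S \<Longrightarrow> (f has_derivative (\<lambda>h. of_real (Re h) * fx z + of_real (Im h) * fy z)) (at z)"
    "Ck_on k S fx" "Ck_on k S fy" using Ck_on_SucE[OF Suc.prems(1)] by blast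
  have e: "Ck_on k S (\<lambda>z. exp (f z))" using Suc.IH[OF Ck_on_imp_Ck_on[OF Suc.prems]] .
  show ?case
  proof (rule Ck_on_SucI)
    show "((\<lambda>z. exp (f z)) has_derivative (\<lambda>h. of_real (Re h) * (exp (f z) * fx z)
      + of_real (Im h) * (exp (f z) * fy z))) (at z)" if "z \<in> S" for z
    proof -
      have "((\<lambda>z. exp (f z)) has_derivative (\<lambda>h. exp (f z) * (of_real (Re h) * fx z + of_real (Im h) * fy z))) (at z)"
        by (rule has_derivative_compose[where g = exp])
          (use f(1)[OF that] DERIV_exp[of "f z"] in \<open>auto simp: has_field_derivative_def\<close>)
      then show ?thesis by (simp add: algebra_simps)
    qed
  qed (intro Ck_on_mult e f)+
qed

lemma smooth_on_subset: "smooth_on S f \<Longrightarrow> T \<subseteq> S \<Longrightarrow> smooth_on T f"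
  by (auto simp: smooth_on_def intro: Ck_on_subset)

lemma smooth_on_cong: "smooth_on S f \<Longrightarrow> open S \<Longrightarrow> (\<And>z. z \<in> S \<Longrightarrow> f z = g z) \<Longrightarrow> smooth_on S g"
  by (auto simp: smooth_on_def intro: Ck_on_cong)

lemma smooth_on_const: "smooth_on S (\<lambda>_. c)"
  by (auto simp: smooth_on_def intro: Ck_on_const)

lemma smooth_on_add: "smooth_on S f \<Longrightarrow> smooth_on S g \<Longrightarrow> smooth_on S (\<lambda>z. f z + g z)"
  by (auto simp: smooth_on_def intro: Ck_on_add)

lemma smooth_on_mult: "smooth_on S f \<Longrightarrow> smooth_on S g \<Longrightarrow> smooth_on S (\<lambda>z. f z * g z)"
  by (auto simp: smooth_on_def intro: Ck_on_mult)

lemma smooth_on_holomorphic: "f holomorphic_on S \<Longrightarrow> open S \<Longrightarrow> smooth_on S f"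
  by (auto simp: smooth_on_def intro: Ck_on_holomorphic)

lemma smooth_on_cnj: "smooth_on S cnj"
  by (auto simp: smooth_on_def intro: Ck_on_cnj)

lemma smooth_on_exp: "smooth_on S f \<Longrightarrow> smooth_on S (\<lambda>z. exp (f z))"
  by (auto simp: smooth_on_def intro: Ck_on_exp)

lemma smooth_on_sum:
  "(\<And>i. i \<in> I \<Longrightarrow> smooth_on S (f i)) \<Longrightarrow> smooth_on S (\<lambda>z. \<Sum>i\<in>I. f i z)"
  by (induction I rule: infinite_finite_induct) (auto intro: smooth_on_add smooth_on_const)

lemma smooth_on_power: "smooth_on S f \<Longrightarrow> smooth_on S (\<lambda>z. f z ^ n)"
  by (induction n) (auto intro: smooth_on_mult smooth_on_const)

section \<open>Lebesgue measure in lattice coordinates\<close>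

lemma lborel_complex_eq:
  "(lborel :: complex measure) = distr (lborel \<Otimes>\<^sub>M lborel) borel (\<lambda>(x, y). Complex x y)"
proof (rule lborel_eqI)
  have [measurable]: "(\<lambda>(x, y). Complex x y) \<in> borel_measurable (lborel \<Otimes>\<^sub>M lborel)"
    unfolding Complex_eq by measurable
  fix l u :: complex assume lu: "\<And>b. b \<in> Basis \<Longrightarrow> l \<bullet> b \<le> u \<bullet> b"
  have "(\<lambda>(x, y). Complex x y) -` box l u \<inter> space (lborel \<Otimes>\<^sub>M lborel) = {Re l<..<Re u} \<times> {Im l<..<Im u}"
    by (auto simp: box_def Basis_complex_def space_pair_measure)
  moreover have "Re l \<le> Re u" "Im l \<le> Im u"
    using lu[of 1] lu[of \<i>] by (auto simp: Basis_complex_def)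
  ultimately show "emeasure (distr (lborel \<Otimes>\<^sub>M lborel) borel (\<lambda>(x, y). Complex x y)) (box l u)
      = (\<Prod>b\<in>Basis. (u - l) \<bullet> b)"
    by (simp add: emeasure_distr lborel.emeasure_pair_measure_Times Basis_complex_def
        ennreal_mult[symmetric])
qed simp

text \<open>The linear map is a scaling of the imaginary part by \<open>Im \<tau>\<close> followed
  by a translation of every horizontal line. The scaling produces the density, and the translations
  preserve length, so only one-dimensional affine substitutions occur.\<close>

lemma lborel_complex_lattice:
  assumes "Im \<tau> > 0"
  shows "(lborel :: complex measure) = density (distr (lborel \<Otimes>\<^sub>M lborel) borel
    (\<lambda>(t, s). of_real s + of_real t * \<tau>)) (\<lambda>_. ennreal (Im \<tau>))" (is "_ = ?M")
proof (rule measure_eqI)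
  have [measurable]: "(\<lambda>(x, y). Complex x y) \<in> borel_measurable (lborel \<Otimes>\<^sub>M lborel)"
    unfolding Complex_eq by measurable
  have m[measurable]: "(\<lambda>(t, s). of_real s + of_real t * \<tau>) \<in> borel_measurable (lborel \<Otimes>\<^sub>M lborel)"
    by measurable
  fix A :: "complex set" assume "A \<in> sets lborel"
  then have [measurable]: "A \<in> sets borel" by simp
  have "emeasure lborel A = (\<integral>\<^sup>+z. indicator A z \<partial>lborel)" by simp
  also have "\<dots> = (\<integral>\<^sup>+p. indicator A (case p of (x, y) \<Rightarrow> Complex x y) \<partial>(lborel \<Otimes>\<^sub>M lborel))"
    by (subst lborel_complex_eq, subst nn_integral_distr) auto
  also have "\<dots> = (\<integral>\<^sup>+y. (\<integral>\<^sup>+x. indicator A (Complex x y) \<partial>lborel) \<partial>lborel)"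
    by (subst lborel_pair.nn_integral_snd[symmetric]) auto
  also have "\<dots> = ennreal (Im \<tau>) * (\<integral>\<^sup>+t. (\<integral>\<^sup>+x. indicator A (Complex x (Im \<tau> * t)) \<partial>lborel) \<partial>lborel)"
    using assms by (subst nn_integral_real_affine[where c = "Im \<tau>" and t = 0])
      (auto simp: Complex_eq)
  also have "\<dots> = ennreal (Im \<tau>) * (\<integral>\<^sup>+t. (\<integral>\<^sup>+s. indicator A (Complex (t * Re \<tau> + 1 * s) (Im \<tau> * t)) \<partial>lborel) \<partial>lborel)"
    (is "_ = _ * ?R")
  proof -
    have "(\<integral>\<^sup>+x. indicator A (Complex x (Im \<tau> * t)) \<partial>lborel)
        = (\<integral>\<^sup>+s. indicator A (Complex (t * Re \<tau> + 1 * s) (Im \<tau> * t)) \<partial>lborel)" for t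
      by (subst nn_integral_real_affine[where c = 1 and t = "t * Re \<tau>"]) (auto simp: Complex_eq)
    then show ?thesis by simp
  qed
  also have "?R = (\<integral>\<^sup>+t. (\<integral>\<^sup>+s. indicator A (of_real s + of_real t * \<tau>) \<partial>lborel) \<partial>lborel)"
  proof -
    have "Complex (t * Re \<tau> + 1 * s) (Im \<tau> * t) = of_real s + of_real t * \<tau>" for t s
      by (simp add: complex_eq_iff)
    then show ?thesis by simp
  qed
  also have "\<dots> = (\<integral>\<^sup>+p. indicator A (case p of (t, s) \<Rightarrow> of_real s + of_real t * \<tau>) \<partial>(lborel \<Otimes>\<^sub>M lborel))"
    by (subst lborel.nn_integral_fst[symmetric]) auto
  also have "(\<integral>\<^sup>+p. indicator A (case p of (t, s) \<Rightarrow> of_real s + of_real t * \<tau>) \<partial>(lborel \<Otimes>\<^sub>M lborel))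
      = emeasure (distr (lborel \<Otimes>\<^sub>M lborel) borel (\<lambda>(t, s). of_real s + of_real t * \<tau>)) A"
    using nn_integral_distr[OF m, of "indicator A"] by simp
  also have "ennreal (Im \<tau>) * \<dots> = emeasure ?M A"
    by (simp add: emeasure_density nn_integral_cmult)
  finally show "emeasure lborel A = emeasure ?M A" .
qed simp

lemma lborel_complex_lattice_integral:
  fixes f :: "complex \<Rightarrow> complex"
  assumes "Im \<tau> > 0" and f: "integrable lborel f"
  shows "integrable (lborel \<Otimes>\<^sub>M lborel) (\<lambda>(t, s). f (of_real s + of_real t * \<tau>))" (is ?I)
    and "integral\<^sup>L lborel f
      = Im \<tau> *\<^sub>R integral\<^sup>L (lborel \<Otimes>\<^sub>M lborel) (\<lambda>(t, s). f (of_real s + of_real t * \<tau>))" (is ?E)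
proof -
  have m[measurable]: "(\<lambda>(t, s). of_real s + of_real t * \<tau>) \<in> borel_measurable (lborel \<Otimes>\<^sub>M lborel)"
    by measurable
  have [measurable]: "f \<in> borel_measurable borel" using f by auto
  have "integrable (density (distr (lborel \<Otimes>\<^sub>M lborel) borel
    (\<lambda>(t, s). of_real s + of_real t * \<tau>)) (\<lambda>_. ennreal (Im \<tau>))) f"
    using f lborel_complex_lattice[OF assms(1)] by simp
  then have "integrable (lborel \<Otimes>\<^sub>M lborel) (\<lambda>(t, s). Im \<tau> *\<^sub>R f (of_real s + of_real t * \<tau>))"
    using assms(1) by (subst (asm) integrable_density) (auto simp: integrable_distr_eq split_beta')
  from integrable_scaleR_right[OF this, of "1 / Im \<tau>"] show ?I
    using assms(1) by (simp add: split_beta')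
  have "integral\<^sup>L lborel f = integral\<^sup>L (density (distr (lborel \<Otimes>\<^sub>M lborel) borel
    (\<lambda>(t, s). of_real s + of_real t * \<tau>)) (\<lambda>_. ennreal (Im \<tau>))) f"
    using lborel_complex_lattice[OF assms(1)] by simp
  also have "\<dots> = Im \<tau> *\<^sub>R integral\<^sup>L (lborel \<Otimes>\<^sub>M lborel) (\<lambda>(t, s). f (of_real s + of_real t * \<tau>))"
    using assms(1) by (subst integral_density) (auto simp: integral_distr split_beta')
  finally show ?E .
qed

lemma fundamental_parallelogram_iff:
  assumes "Im \<tau> > 0"
  shows "of_real s + of_real t * \<tau> \<in> fundamental_parallelogram \<tau> \<longleftrightarrow> s \<in> {0..<1} \<and> t \<in> {0..<1}"
proof
  assume "of_real s + of_real t * \<tau> \<in> fundamental_parallelogram \<tau>"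
  then obtain s' t' where *: "of_real s + of_real t * \<tau> = of_real s' + of_real t' * \<tau>"
    "s' \<in> {0..<1}" "t' \<in> {0..<1}" by (auto simp: fundamental_parallelogram_def)
  have "t = t'" using arg_cong[OF *(1), of Im] assms by simp
  moreover from this have "s = s'" using arg_cong[OF *(1), of Re] by simp
  ultimately show "s \<in> {0..<1} \<and> t \<in> {0..<1}" using * by simp
qed (auto simp: fundamental_parallelogram_def)

lemma fundamental_parallelogram_alt:
  assumes "Im \<tau> > 0"
  shows "fundamental_parallelogram \<tau>
    = {z. Re z - Im z / Im \<tau> * Re \<tau> \<in> {0..<1} \<and> Im z / Im \<tau> \<in> {0..<1}}"
proof -
  have "z = of_real (Re z - Im z / Im \<tau> * Re \<tau>) + of_real (Im z / Im \<tau>) * \<tau>" for z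
    using assms by (simp add: complex_eq_iff)
  then show ?thesis
    using fundamental_parallelogram_iff[OF assms] by (metis (mono_tags, lifting) Collect_cong Collect_mem_eq)
qed

lemma fundamental_parallelogram_measurable [measurable]:
  assumes "Im \<tau> > 0"
  shows "fundamental_parallelogram \<tau> \<in> sets borel"
  unfolding fundamental_parallelogram_alt[OF assms] by measurable

lemma fundamental_parallelogram_bounded: "bounded (fundamental_parallelogram \<tau>)"
proof (rule boundedI)
  fix z assume "z \<in> fundamental_parallelogram \<tau>"
  then obtain s t where z: "z = of_real s + of_real t * \<tau>" "s \<in> {0..<1}" "t \<in> {0..<1}"
    by (auto simp: fundamental_parallelogram_def)
  have "norm z \<le> norm (of_real s :: complex) + norm (of_real t * \<tau>)" unfolding z(1) by (rule norm_triangle_ineq)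
  also have "\<dots> \<le> 1 + norm \<tau>"
    using z by (auto simp: norm_mult intro!: add_mono mult_left_le_one_le)
  finally show "norm z \<le> 1 + norm \<tau>" by simp
qed

text \<open>The closure is compact, so finitely many of the balls cover it and integrability near
  every point suffices.\<close>

lemma set_integrable_fundamental_parallelogram:
  assumes "Im \<tau> > 0" and loc: "\<And>p. \<exists>r>0. set_integrable lborel (ball p r) f"
  shows "set_integrable lborel (fundamental_parallelogram \<tau>) (f :: complex \<Rightarrow> complex)"
proof -
  obtain r where r: "\<And>p. r p > 0" "\<And>p. set_integrable lborel (ball p (r p)) f"
    using loc by metis
  have "compact (closure (fundamental_parallelogram \<tau>))"
    using fundamental_parallelogram_bounded by (simp add: compact_closure)
  then obtain C where C: "finite C" "closure (fundamental_parallelogram \<tau>) \<subseteq> (\<Union>p\<in>C. ball p (r p))"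
    by (rule compactE_image[where C = UNIV and f = "\<lambda>p. ball p (r p)"]) (use r(1) in \<open>auto, metis dist_self\<close>)
  have "set_integrable lborel (\<Union>p\<in>C. ball p (r p)) f"
    using C r by (intro set_integrable_UN) auto
  then show ?thesis
    using C closure_subset fundamental_parallelogram_measurable[OF assms(1)]
    by (elim set_integrable_subset) auto
qed

lemma nn_integral_inverse_sqrt:
  fixes c r :: real
  assumes "r > 0"
  shows "(\<integral>\<^sup>+x. ennreal (indicator {-r..r} (x - c) * \<bar>x - c\<bar> powr (-1/2)) \<partial>lborel) < \<infinity>"
proof -
  define I where "I = r powr (-1/2+1) / (-1/2+1)"
  have pos: "(\<integral>\<^sup>+x. ennreal (x powr (-1/2)) * indicator {0..r} x \<partial>lborel) = ennreal I"
    using has_integral_powr_from_0[of "-1/2" r] assms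
    unfolding I_def by (intro nn_integral_has_integral_lebesgue') auto
  have neg: "(\<integral>\<^sup>+x. ennreal (\<bar>x\<bar> powr (-1/2)) * indicator {-r..0} x \<partial>lborel) = ennreal I"
    unfolding pos[symmetric]
    by (subst nn_integral_real_affine[where c = "-1" and t = 0])
      (auto intro!: nn_integral_cong split: split_indicator)
  have "(\<integral>\<^sup>+x. ennreal (indicator {-r..r} (x - c) * \<bar>x - c\<bar> powr (-1/2)) \<partial>lborel)
     = (\<integral>\<^sup>+x. ennreal (indicator {-r..r} x * \<bar>x\<bar> powr (-1/2)) \<partial>lborel)"
    by (subst nn_integral_real_affine[where c = 1 and t = c]) auto
  also have "\<dots> \<le> (\<integral>\<^sup>+x. ennreal (x powr (-1/2)) * indicator {0..r} x
      + ennreal (\<bar>x\<bar> powr (-1/2)) * indicator {-r..0} x \<partial>lborel)"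
    by (rule nn_integral_mono) (auto split: split_indicator)
  also have "\<dots> = ennreal I + ennreal I"
    by (subst nn_integral_add) (auto simp: pos[simplified] neg[simplified])
  finally show ?thesis by (simp add: le_less_trans)
qed

text \<open>The estimate \<open>1 / |z| \<le> |Re z|\<^sup>-\<^sup>1\<^sup>/\<^sup>2 |Im z|\<^sup>-\<^sup>1\<^sup>/\<^sup>2\<close> reduces integrability to one variable.\<close>

lemma set_integrable_simple_pole:
  fixes f :: "complex \<Rightarrow> complex"
  assumes "continuous_on (ball p r - {p}) f" and r: "r > 0"
    and bd: "\<And>z. z \<in> ball p r - {p} \<Longrightarrow> norm (f z) \<le> M / norm (z - p)"
  shows "set_integrable lborel (ball p r) f"
proof -
  define h where "h = (\<lambda>(b::complex) x. indicator {-r..r} (x - p \<bullet> b) * \<bar>x - p \<bullet> b\<bar> powr (-1/2))"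
  define g where "g = (\<lambda>z. indicator (ball p r - {p}) z *\<^sub>R f z)"
  have g[measurable]: "g \<in> borel_measurable borel"
    unfolding g_def using assms(1) by (intro borel_measurable_continuous_on_indicator) auto
  have M: "M \<ge> 0"
  proof -
    have "p + of_real (r/2) \<in> ball p r - {p}" using r by (auto simp: dist_norm)
    from bd[OF this] r show ?thesis
      by (auto simp: field_simps) (smt (verit) mult_nonneg_nonneg norm_ge_zero)
  qed
  have hg: "norm (g z) \<le> M * (\<Prod>b\<in>Basis. h b (z \<bullet> b))"
    if "Re z \<noteq> Re p" "Im z \<noteq> Im p" for z
  proof (cases "z \<in> ball p r - {p}")
    case True
    then have zr: "norm (z - p) < r" by (auto simp: dist_norm norm_minus_commute)
    define x y where "x = \<bar>Re (z - p)\<bar>" and "y = \<bar>Im (z - p)\<bar>"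
    have xy: "x > 0" "y > 0" "x \<le> norm (z - p)" "y \<le> norm (z - p)"
      using that abs_Re_le_cmod[of "z - p"] abs_Im_le_cmod[of "z - p"] by (auto simp: x_def y_def)
    have "sqrt (x * y) \<le> sqrt (norm (z - p) * norm (z - p))"
      using xy by (intro real_sqrt_le_mono mult_mono) auto
    then have le: "sqrt (x * y) \<le> norm (z - p)" by simp
    have "norm (f z) \<le> M / norm (z - p)" using bd True by blast
    also have "\<dots> \<le> M / sqrt (x * y)"
      using le xy M by (intro divide_left_mono mult_pos_pos) auto
    also have "1 / sqrt (x * y) = x powr (-1/2) * y powr (-1/2)"
      using xy by (simp add: powr_minus powr_half_sqrt real_sqrt_mult field_simps)
    then have "M / sqrt (x * y) = M * (x powr (-1/2) * y powr (-1/2))"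
      by (metis mult.right_neutral times_divide_eq_right)
    also have "x powr (-1/2) * y powr (-1/2) = (\<Prod>b\<in>Basis. h b (z \<bullet> b))"
      using xy zr by (auto simp: h_def Basis_complex_def x_def y_def indicator_def)
    finally show ?thesis using True by (simp add: g_def)
  next
    case False
    then have "g z = 0" by (simp add: g_def)
    moreover have "(\<Prod>b\<in>Basis. h b (z \<bullet> b)) \<ge> 0" by (intro prod_nonneg) (auto simp: h_def)
    ultimately show ?thesis using M by simp
  qed
  \<comment> \<open>On the two lines through \<open>p\<close> parallel to the axes the majorant is
    0, because \<open>0 powr (-1/2) = 0\<close>. The estimate is therefore claimed only off this
    null set.\<close>
  have ae: "AE z in lborel. Re z \<noteq> Re p \<and> Im z \<noteq> Im p"
  proof -
    have "AE q in lborel \<Otimes>\<^sub>M (lborel :: real measure). fst q \<noteq> Re p \<and> snd q \<noteq> Im p"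
    proof (rule lborel_pair.AE_pair_measure)
      show "{q \<in> space (lborel \<Otimes>\<^sub>M lborel). fst q \<noteq> Re p \<and> snd q \<noteq> Im p}
          \<in> sets (lborel \<Otimes>\<^sub>M (lborel :: real measure))"
        by measurable
      show "AE x in lborel. AE y in lborel. fst (x, y) \<noteq> Re p \<and> snd (x, y) \<noteq> Im p"
        using AE_lborel_singleton[of "Re p"]
      proof eventually_elim
        case (elim x)
        show ?case using AE_lborel_singleton[of "Im p"] elim by (auto elim!: eventually_mono)
      qed
    qed
    then show ?thesis
      by (subst lborel_complex_eq) (auto simp: AE_distr_iff Complex_eq split_beta')
  qed
  have "(\<integral>\<^sup>+z. ennreal (norm (g z)) \<partial>lborel) \<le> (\<integral>\<^sup>+z. ennreal M * ennreal (\<Prod>b\<in>Basis. h b (z \<bullet> b)) \<partial>lborel)"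
    by (rule nn_integral_mono_AE, use ae in eventually_elim)
      (use hg M in \<open>auto simp: ennreal_mult'[symmetric] intro!: ennreal_leI\<close>)
  also have "\<dots> = ennreal M * (\<integral>\<^sup>+z. (\<Prod>b\<in>Basis. ennreal (h b (z \<bullet> b))) \<partial>lborel)"
    by (subst nn_integral_cmult) (auto simp: h_def prod_ennreal)
  also have "\<dots> = ennreal M * (\<Prod>b\<in>Basis. \<integral>\<^sup>+x. ennreal (h b x) \<partial>lborel)"
    by (subst nn_integral_lborel_prod) (auto simp: h_def)
  also have "\<dots> < \<infinity>"
    using nn_integral_inverse_sqrt[OF r]
    by (auto simp: ennreal_mult_less_top h_def Basis_complex_def)
  finally have "integrable lborel g" by (intro integrableI_bounded) auto
  then have "integrable lborel (\<lambda>z. indicator (ball p r) z *\<^sub>R f z)"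
    by (rule integrable_discrete_difference[where X = "{p}", THEN iffD1, rotated -1])
      (auto simp: g_def indicator_def)
  then show ?thesis by (simp add: set_integrable_def)
qed

lemma set_integrable_discrete_difference:
  fixes f g :: "complex \<Rightarrow> complex"
  assumes "countable D" "\<And>z. z \<in> A \<Longrightarrow> z \<notin> D \<Longrightarrow> f z = g z" "set_integrable lborel A f"
  shows "set_integrable lborel A g"
  using assms(3) unfolding set_integrable_def
  by (rule integrable_discrete_difference[where X = D, THEN iffD1, rotated -1])
    (use assms in \<open>auto simp: indicator_def\<close>)

lemma set_lebesgue_integral_discrete_difference:
  fixes f g :: "complex \<Rightarrow> complex"
  assumes "countable D" "\<And>z. z \<in> A \<Longrightarrow> z \<notin> D \<Longrightarrow> f z = g z"
  shows "set_lebesgue_integral lborel A f = set_lebesgue_integral lborel A g"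
  unfolding set_lebesgue_integral_def
  by (rule integral_discrete_difference[where X = D]) (use assms in \<open>auto simp: indicator_def\<close>)

section \<open>Stokes' theorem on the torus\<close>

text \<open>Points of smoothness are included, with numerator \<open>f z * (z - p)\<close>, so the
  condition can be imposed at every \<open>p\<close> without naming the poles.\<close>

definition simple_pole_at :: "(complex \<Rightarrow> complex) \<Rightarrow> complex \<Rightarrow> bool" where
  "simple_pole_at f p \<longleftrightarrow>
    (\<exists>r>0. \<exists>g. smooth_on (ball p r) g \<and> (\<forall>z\<in>ball p r - {p}. f z = g z / (z - p)))"

text \<open>The numerator vanishes at \<open>p\<close> only as a smooth function, as in
  \<open>cnj (z - p) / (z - p)\<close>: such an \<open>f\<close> is bounded near \<open>p\<close>
  but in general not continuous there.\<close>

definition bounded_pole_at :: "(complex \<Rightarrow> complex) \<Rightarrow> complex \<Rightarrow> bool" where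
  "bounded_pole_at f p \<longleftrightarrow>
    (\<exists>r>0. \<exists>g. smooth_on (ball p r) g \<and> g p = 0 \<and> (\<forall>z\<in>ball p r - {p}. f z = g z / (z - p)))"

lemma smooth_on_imp_continuous_on: "smooth_on S f \<Longrightarrow> continuous_on S f"
  unfolding smooth_on_def using Ck_on.simps(1) by blast

lemma smooth_on_wirtinger:
  assumes "smooth_on S f"
  obtains a b where "\<And>z. z \<in> S \<Longrightarrow> has_wirtinger f z (a z) (b z)"
    "continuous_on S a" "continuous_on S b"
proof -
  have "Ck_on (Suc 0) S f" using assms unfolding smooth_on_def by blast
  then obtain fx fy where f:
    "\<And>z. z \<in> S \<Longrightarrow> (f has_derivative (\<lambda>h. of_real (Re h) * fx z + of_real (Im h) * fy z)) (at z)"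
    and c: "continuous_on S fx" "continuous_on S fy"
    by (rule Ck_on_SucE) auto
  show ?thesis
  proof (rule that)
    show "has_wirtinger f z ((fx z - \<i> * fy z) / 2) ((fx z + \<i> * fy z) / 2)" if "z \<in> S" for z
      using f[OF that] has_wirtinger_iff_partials by blast
  qed (use c in \<open>auto intro!: continuous_intros\<close>)
qed

lemma simple_pole_at_integrable:
  assumes "simple_pole_at f p"
  shows "\<exists>r>0. set_integrable lborel (ball p r) f"
proof -
  obtain r g where r: "r > 0" and g: "smooth_on (ball p r) g"
    and f: "\<And>z. z \<in> ball p r - {p} \<Longrightarrow> f z = g z / (z - p)"
    using assms unfolding simple_pole_at_def by blast
  have cg: "continuous_on (ball p r) g" by (rule smooth_on_imp_continuous_on[OF g])
  have "bounded (g ` cball p (r/2))"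
    using r by (intro compact_imp_bounded compact_continuous_image continuous_on_subset[OF cg]) auto
  then obtain M where M: "\<And>z. z \<in> cball p (r/2) \<Longrightarrow> norm (g z) \<le> M"
    unfolding bounded_iff by blast
  have "set_integrable lborel (ball p (r/2)) f"
  proof (rule set_integrable_simple_pole)
    have "continuous_on (ball p (r/2) - {p}) (\<lambda>z. g z / (z - p))"
      using r by (intro continuous_intros continuous_on_subset[OF cg]) auto
    then show "continuous_on (ball p (r/2) - {p}) f"
      using f r by (subst continuous_on_cong[OF refl, of _ f "\<lambda>z. g z / (z - p)"]) auto
    show "norm (f z) \<le> M / norm (z - p)" if "z \<in> ball p (r/2) - {p}" for z
      using that f[of z] M[of z] r by (auto simp: norm_divide intro!: divide_right_mono)
  qed (use r in auto)
  then show ?thesis using r by (intro exI[of _ "r/2"]) auto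
qed

text \<open>A smooth numerator that vanishes at \<open>p\<close> is Lipschitz, hence bounded by a
  multiple of \<open>norm (z - p)\<close>. Therefore all terms in the derivatives of
  \<open>g z / (z - p)\<close> are bounded by a multiple of \<open>1 / norm (z - p)\<close>. A
  numerator with \<open>g p \<noteq> 0\<close> would give the exponent 2, which is not
  integrable.\<close>

lemma bounded_pole_at_wirtinger_integrable:
  assumes "bounded_pole_at f p" and D: "countable D"
    and AB: "\<And>z. z \<notin> D \<Longrightarrow> has_wirtinger f z (A z) (B z)"
  shows "\<exists>r>0. set_integrable lborel (ball p r) A \<and> set_integrable lborel (ball p r) B"
proof -
  obtain r g where r: "r > 0" and g: "smooth_on (ball p r) g" and gp: "g p = 0"
    and f: "\<And>z. z \<in> ball p r - {p} \<Longrightarrow> f z = g z / (z - p)"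
    using assms unfolding bounded_pole_at_def by blast
  obtain a b where ab: "\<And>z. z \<in> ball p r \<Longrightarrow> has_wirtinger g z (a z) (b z)"
    and ca: "continuous_on (ball p r) a" and cb: "continuous_on (ball p r) b"
    using smooth_on_wirtinger[OF g] by blast
  have cg: "continuous_on (ball p r) g" by (rule smooth_on_imp_continuous_on[OF g])
  have "bounded (a ` cball p (r/2))" "bounded (b ` cball p (r/2))"
    using r by (auto intro!: compact_imp_bounded compact_continuous_image
        continuous_on_subset[OF ca] continuous_on_subset[OF cb])
  then obtain Ma Mb where M: "\<And>z. z \<in> cball p (r/2) \<Longrightarrow> norm (a z) \<le> Ma"
      "\<And>z. z \<in> cball p (r/2) \<Longrightarrow> norm (b z) \<le> Mb"
    unfolding bounded_iff by blast
  have lip: "norm (g z) \<le> (Ma + Mb) * norm (z - p)" if z: "z \<in> cball p (r/2)" for z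
  proof -
    have "norm (g z - g p) \<le> (Ma + Mb) * norm (z - p)"
    proof (rule differentiable_bound[of "cball p (r/2)"])
      fix x assume x: "x \<in> cball p (r/2)"
      then show "(g has_derivative (\<lambda>h. a x * h + b x * cnj h)) (at x within cball p (r/2))"
        using ab[of x] r by (auto simp: has_wirtinger_def intro: has_derivative_at_withinI)
      show "onorm (\<lambda>h. a x * h + b x * cnj h) \<le> Ma + Mb"
      proof (rule onorm_le)
        fix h
        have "norm (a x * h + b x * cnj h) \<le> norm (a x) * norm h + norm (b x) * norm h"
          by (metis complex_mod_cnj norm_mult norm_triangle_ineq)
        also have "\<dots> \<le> Ma * norm h + Mb * norm h"
          using M[OF x] by (intro add_mono mult_right_mono) auto
        finally show "norm (a x * h + b x * cnj h) \<le> (Ma + Mb) * norm h"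
          by (simp add: algebra_simps)
      qed
    qed (use z r in auto)
    then show ?thesis by (simp add: gp)
  qed
  define A0 B0 where "A0 = (\<lambda>z. a z / (z - p) - g z / (z - p) ^ 2)" and "B0 = (\<lambda>z. b z / (z - p))"
  have W: "has_wirtinger f z (A0 z) (B0 z)" if z: "z \<in> ball p r - {p}" for z
  proof -
    have "has_wirtinger (\<lambda>z. inverse (z - p)) z (- 1 / (z - p)^2) 0"
      by (rule has_wirtinger_holomorphic)
        (use z in \<open>auto intro!: derivative_eq_intros simp: power2_eq_square divide_inverse\<close>)
    from has_wirtinger_mult[OF ab this, of ] z
    have "has_wirtinger (\<lambda>z. g z * inverse (z - p)) z (A0 z) (B0 z)"
      by (simp add: A0_def B0_def divide_inverse algebra_simps)
    then have "((\<lambda>z. g z * inverse (z - p)) has_derivative (\<lambda>h. A0 z * h + B0 z * cnj h)) (at z)"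
      by (simp add: has_wirtinger_def)
    then have "(f has_derivative (\<lambda>h. A0 z * h + B0 z * cnj h)) (at z)"
      by (rule has_derivative_transform_within_open[of _ _ _ UNIV "ball p r - {p}"])
        (use z f in \<open>auto simp: divide_inverse\<close>)
    then show ?thesis by (simp add: has_wirtinger_def)
  qed
  have eq: "A0 z = A z" "B0 z = B z" if "z \<in> ball p (r/2)" "z \<notin> insert p D" for z
    using has_wirtinger_unique[OF W[of z] AB[of z]] that r by auto
  have "set_integrable lborel (ball p (r/2)) B0"
  proof (rule set_integrable_simple_pole)
    show "continuous_on (ball p (r/2) - {p}) B0"
      unfolding B0_def using r by (intro continuous_intros continuous_on_subset[OF cb]) auto
    show "norm (B0 z) \<le> Mb / norm (z - p)" if "z \<in> ball p (r/2) - {p}" for z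
      using that M(2)[of z] by (auto simp: B0_def norm_divide intro!: divide_right_mono)
  qed (use r in auto)
  then have "set_integrable lborel (ball p (r/2)) B"
    by (rule set_integrable_discrete_difference[where D = "insert p D", rotated 2]) (use D eq in auto)
  moreover have "set_integrable lborel (ball p (r/2)) A0"
  proof (rule set_integrable_simple_pole)
    show "continuous_on (ball p (r/2) - {p}) A0"
      unfolding A0_def using r
      by (intro continuous_intros continuous_on_subset[OF ca] continuous_on_subset[OF cg]) auto
    show "norm (A0 z) \<le> (Ma + (Ma + Mb)) / norm (z - p)" if z: "z \<in> ball p (r/2) - {p}" for z
    proof -
      have "norm (A0 z) \<le> norm (a z) / norm (z - p) + norm (g z) / norm (z - p) ^ 2"
        unfolding A0_def by (rule order.trans[OF norm_triangle_ineq4]) (simp add: norm_divide norm_power)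
      also have "\<dots> \<le> Ma / norm (z - p) + ((Ma + Mb) * norm (z - p)) / norm (z - p) ^ 2"
        using z M(1)[of z] lip[of z] by (intro add_mono divide_right_mono) auto
      also have "\<dots> = (Ma + (Ma + Mb)) / norm (z - p)"
        using z by (simp add: field_simps power2_eq_square)
      finally show ?thesis .
    qed
  qed (use r in auto)
  then have "set_integrable lborel (ball p (r/2)) A"
    by (rule set_integrable_discrete_difference[where D = "insert p D", rotated 2]) (use D eq in auto)
  ultimately show ?thesis using r by (intro exI[of _ "r/2"]) auto
qed

text \<open>Fubini's theorem in both orders: lines parallel to 1 call for the inner integral over
  \<open>s\<close>, lines parallel to \<tau> for the inner integral over \<open>t\<close>.\<close>

lemma set_lebesgue_integral_fundamental_parallelogram:
  fixes h :: "complex \<Rightarrow> complex"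
  assumes \<tau>: "Im \<tau> > 0" and h: "set_integrable lborel (fundamental_parallelogram \<tau>) h"
  defines "H \<equiv> \<lambda>t s. indicator {0..<1} t *\<^sub>R indicator {0..<1} s *\<^sub>R h (of_real s + of_real t * \<tau>)"
  shows "set_lebesgue_integral lborel (fundamental_parallelogram \<tau>) h
      = Im \<tau> *\<^sub>R (\<integral>t. \<integral>s. H t s \<partial>lborel \<partial>lborel)"
    and "set_lebesgue_integral lborel (fundamental_parallelogram \<tau>) h
      = Im \<tau> *\<^sub>R (\<integral>s. \<integral>t. H t s \<partial>lborel \<partial>lborel)"
proof -
  have "(\<lambda>(t, s). indicator (fundamental_parallelogram \<tau>) (of_real s + of_real t * \<tau>)
      *\<^sub>R h (of_real s + of_real t * \<tau>)) = (\<lambda>(t, s). H t s)"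
    unfolding H_def using fundamental_parallelogram_iff[OF \<tau>]
    by (auto simp: fun_eq_iff indicator_def simp del: atLeastLessThan_iff)
  note * = lborel_complex_lattice_integral[OF \<tau> h[unfolded set_integrable_def], unfolded this]
  show "set_lebesgue_integral lborel (fundamental_parallelogram \<tau>) h
      = Im \<tau> *\<^sub>R (\<integral>t. \<integral>s. H t s \<partial>lborel \<partial>lborel)"
    unfolding set_lebesgue_integral_def using *(2) lborel_pair.integral_fst[OF *(1)] by simp
  show "set_lebesgue_integral lborel (fundamental_parallelogram \<tau>) h
      = Im \<tau> *\<^sub>R (\<integral>s. \<integral>t. H t s \<partial>lborel \<partial>lborel)"
    unfolding set_lebesgue_integral_def using *(2) lborel_pair.integral_snd[OF *(1)] by simp
qed

lemma integral_directional_derivative_periodic: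
  fixes g :: "complex \<Rightarrow> complex"
  assumes W: "\<And>x. x \<in> {0..1} \<Longrightarrow> has_wirtinger g (c + of_real x * e) (A (c + of_real x * e)) (B (c + of_real x * e))"
    and cont: "continuous_on {0..1} (\<lambda>x. A (c + of_real x * e) * e + B (c + of_real x * e) * cnj e)"
    and per: "g (c + e) = g c"
  shows "(\<integral>x. indicator {0..<1::real} x *\<^sub>R (A (c + of_real x * e) * e + B (c + of_real x * e) * cnj e) \<partial>lborel) = 0"
proof -
  have "(\<integral>x. indicator {0..1} x *\<^sub>R (A (c + of_real x * e) * e + B (c + of_real x * e) * cnj e) \<partial>lborel)
     = g (c + of_real 1 * e) - g (c + of_real 0 * e)"
  proof (rule integral_FTC_Icc[OF _ _ cont])
    fix x :: real assume x: "0 \<le> x" "x \<le> 1"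
    have "((\<lambda>x. c + of_real x * e) has_derivative (\<lambda>y. of_real y * e)) (at x within {0..1})"
      by (auto intro!: derivative_eq_intros)
    from has_derivative_compose[OF this W[of x, unfolded has_wirtinger_def]] x
    show "((\<lambda>x. g (c + of_real x * e)) has_vector_derivative
        (A (c + of_real x * e) * e + B (c + of_real x * e) * cnj e)) (at x within {0..1})"
      unfolding has_vector_derivative_def by (simp add: scaleR_conv_of_real algebra_simps)
  qed simp
  also have "\<dots> = 0" using per by simp
  also have "(\<integral>x. indicator {0..1} x *\<^sub>R (A (c + of_real x * e) * e + B (c + of_real x * e) * cnj e) \<partial>lborel)
     = (\<integral>x. indicator {0..<1} x *\<^sub>R (A (c + of_real x * e) * e + B (c + of_real x * e) * cnj e) \<partial>lborel)"
    by (rule integral_discrete_difference[where X = "{1}"]) (auto simp: indicator_def)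
  finally show ?thesis .
qed

text \<open>
  Stokes' theorem on the torus: on almost every line parallel to \<open>1\<close> or to \<open>\<tau>\<close> the directional
  derivative integrates to \<open>0\<close> over a period.
\<close>

lemma integral_dbar_eq_0:
  fixes g :: "complex \<Rightarrow> complex"
  assumes \<tau>: "Im \<tau> > 0" and D: "countable D" and g: "smooth_on (- D) g"
    and per: "\<And>z. g (z + 1) = g z" "\<And>z. g (z + \<tau>) = g z"
    and pole: "\<And>p. bounded_pole_at g p"
    and B: "\<And>z. z \<notin> D \<Longrightarrow> \<exists>a. has_wirtinger g z a (B z)"
  shows "set_lebesgue_integral lborel (fundamental_parallelogram \<tau>) B = 0"
proof -
  obtain a b where ab: "\<And>z. z \<notin> D \<Longrightarrow> has_wirtinger g z (a z) (b z)"
    and ca: "continuous_on (- D) a" and cb: "continuous_on (- D) b"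
    using smooth_on_wirtinger[OF g] by (metis ComplI)
  let ?P = "fundamental_parallelogram \<tau>"
  have int: "set_integrable lborel ?P a" "set_integrable lborel ?P b"
    using bounded_pole_at_wirtinger_integrable[OF pole D ab]
    by (auto intro!: set_integrable_fundamental_parallelogram[OF \<tau>])
  \<comment> \<open>The lines of either direction that meet \<open>D\<close> are countably many, so
    almost every line avoids all poles.\<close>
  have cD: "countable ((\<lambda>z. Im z / Im \<tau>) ` D)" "countable ((\<lambda>z. Re z - Im z / Im \<tau> * Re \<tau>) ` D)"
    using D by auto
  have line: "(\<integral>x. indicator {0..<1::real} x *\<^sub>R (a (c + of_real x * e) * e + b (c + of_real x * e) * cnj e) \<partial>lborel) = 0"
    if e: "\<And>z. g (z + e) = g z" and nD: "\<And>x. c + of_real x * e \<notin> D" for c e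
  proof (rule integral_directional_derivative_periodic[where g = g])
    show "continuous_on {0..1} (\<lambda>x. a (c + of_real x * e) * e + b (c + of_real x * e) * cnj e)"
      using nD by (intro continuous_intros continuous_on_compose2[OF ca] continuous_on_compose2[OF cb]) auto
  qed (use that ab in auto)
  have "set_lebesgue_integral lborel ?P (\<lambda>z. a z * 1 + b z * cnj 1) = 0"
  proof -
    have i: "set_integrable lborel ?P (\<lambda>z. a z * 1 + b z * cnj 1)" using int by simp
    have "AE t in lborel. (\<integral>s. indicator {0..<1} t *\<^sub>R indicator {0..<1} s *\<^sub>R
      (a (of_real s + of_real t * \<tau>) * 1 + b (of_real s + of_real t * \<tau>) * cnj 1) \<partial>lborel) = 0"
      using AE_not_in[OF countable_imp_null_set_lborel[OF cD(1)]]
    proof eventually_elim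
      case (elim t)
      have "of_real t * \<tau> + of_real s * 1 \<notin> D" for s
      proof
        assume "of_real t * \<tau> + of_real s * 1 \<in> D"
        then have "Im (of_real t * \<tau> + of_real s * 1) / Im \<tau> \<in> (\<lambda>z. Im z / Im \<tau>) ` D" by blast
        then show False using elim \<tau> by simp
      qed
      from line[of 1, OF per(1) this] show ?case
        by (simp add: add.commute scaleR_scaleR[symmetric] del: scaleR_scaleR)
    qed
    then show ?thesis
      unfolding set_lebesgue_integral_fundamental_parallelogram(1)[OF \<tau> i]
      by (simp add: integral_eq_zero_AE)
  qed
  then have 1: "set_lebesgue_integral lborel ?P a + set_lebesgue_integral lborel ?P b = 0"
    using int by (simp add: set_integral_add)
  have "set_lebesgue_integral lborel ?P (\<lambda>z. a z * \<tau> + b z * cnj \<tau>) = 0"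
  proof -
    have i: "set_integrable lborel ?P (\<lambda>z. a z * \<tau> + b z * cnj \<tau>)" using int by auto
    have "AE s in lborel. (\<integral>t. indicator {0..<1} t *\<^sub>R indicator {0..<1} s *\<^sub>R
      (a (of_real s + of_real t * \<tau>) * \<tau> + b (of_real s + of_real t * \<tau>) * cnj \<tau>) \<partial>lborel) = 0"
      using AE_not_in[OF countable_imp_null_set_lborel[OF cD(2)]]
    proof eventually_elim
      case (elim s)
      have "of_real s + of_real t * \<tau> \<notin> D" for t
      proof
        assume *: "of_real s + of_real t * \<tau> \<in> D"
        have eq: "Re (of_real s + of_real t * \<tau>) - Im (of_real s + of_real t * \<tau>) / Im \<tau> * Re \<tau> = s"
          using \<tau> by simp
        show False
          using imageI[OF *, of "\<lambda>z. Re z - Im z / Im \<tau> * Re \<tau>"] elim unfolding eq by blast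
      qed
      from line[of \<tau>, OF per(2) this]
      have "indicator {0..<1} s *\<^sub>R (\<integral>t. indicator {0..<1::real} t *\<^sub>R
        (a (of_real s + of_real t * \<tau>) * \<tau> + b (of_real s + of_real t * \<tau>) * cnj \<tau>) \<partial>lborel) = (0::complex)"
        by (simp add: add.commute)
      then show ?case
        unfolding integral_scaleR_right[symmetric] by (simp add: mult.commute)
    qed
    then show ?thesis
      unfolding set_lebesgue_integral_fundamental_parallelogram(2)[OF \<tau> i]
      by (simp add: integral_eq_zero_AE)
  qed
  then have "set_lebesgue_integral lborel ?P a * \<tau> + set_lebesgue_integral lborel ?P b * cnj \<tau> = 0"
    using int by (simp add: set_integral_add)
  \<comment> \<open>The two directions give two linear equations for the integrals of
    \<open>a\<close> and \<open>b\<close>; their determinant is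
    \<open>cnj \<tau> - \<tau>\<close>.\<close>
  with 1 have "set_lebesgue_integral lborel ?P b * (cnj \<tau> - \<tau>) = 0"
    by (simp add: algebra_simps eq_neg_iff_add_eq_0[symmetric])
  moreover have "cnj \<tau> - \<tau> \<noteq> 0" using \<tau> by (auto simp: complex_eq_iff)
  ultimately have "set_lebesgue_integral lborel ?P b = 0" by simp
  also have "set_lebesgue_integral lborel ?P b = set_lebesgue_integral lborel ?P B"
  proof (rule set_lebesgue_integral_discrete_difference[OF D])
    fix z assume "z \<notin> D"
    then show "b z = B z" using has_wirtinger_unique(2)[OF ab[of z]] B[of z] by auto
  qed
  finally show ?thesis .
qed

section \<open>Periodic functions and regularized integrals\<close>

lemma latticeI: "of_int a + of_int b * \<tau> \<in> lattice \<tau>"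
  unfolding lattice_def by blast

lemma latticeE:
  assumes "l \<in> lattice \<tau>"
  obtains a b where "l = of_int a + of_int b * \<tau>"
  using assms unfolding lattice_def by blast

lemma lattice_0 [simp]: "0 \<in> lattice \<tau>"
  using latticeI[of 0 0] by simp

lemma lattice_1 [simp]: "1 \<in> lattice \<tau>"
  using latticeI[of 1 0] by simp

lemma lattice_tau [simp]: "\<tau> \<in> lattice \<tau>"
  using latticeI[of 0 1] by simp

lemma lattice_add: "x \<in> lattice \<tau> \<Longrightarrow> y \<in> lattice \<tau> \<Longrightarrow> x + y \<in> lattice \<tau>"
proof (elim latticeE)
  fix a b c d assume "x = of_int a + of_int b * \<tau>" "y = of_int c + of_int d * \<tau>"
  then show ?thesis using latticeI[of "a + c" "b + d" \<tau>] by (simp add: algebra_simps)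
qed

lemma lattice_minus: "x \<in> lattice \<tau> \<Longrightarrow> - x \<in> lattice \<tau>"
proof (elim latticeE)
  fix a b assume "x = of_int a + of_int b * \<tau>"
  then show ?thesis using latticeI[of "- a" "- b" \<tau>] by simp
qed

lemma lattice_diff: "x \<in> lattice \<tau> \<Longrightarrow> y \<in> lattice \<tau> \<Longrightarrow> x - y \<in> lattice \<tau>"
  using lattice_add[of x \<tau> "- y"] lattice_minus[of y \<tau>] by simp

lemma lattice_minus_iff [simp]: "- x \<in> lattice \<tau> \<longleftrightarrow> x \<in> lattice \<tau>"
  using lattice_minus[of x \<tau>] lattice_minus[of "- x" \<tau>] by auto

lemma lattice_diff_commute: "x - y \<in> lattice \<tau> \<longleftrightarrow> y - x \<in> lattice \<tau>"
  by (metis lattice_minus_iff minus_diff_eq)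

lemma lattice_add_iff: "l \<in> lattice \<tau> \<Longrightarrow> z + l \<in> lattice \<tau> \<longleftrightarrow> z \<in> lattice \<tau>"
  using lattice_add[of z \<tau> l] lattice_diff[of "z + l" \<tau> l] by auto

lemma lattice_periodic:
  assumes "\<And>z. f (z + 1) = f z" "\<And>z. f (z + \<tau>) = f z" and l: "l \<in> lattice \<tau>"
  shows "f (z + l) = f z"
proof -
  have P: "f (z + of_int a * e) = f z" if "\<And>z. f (z + e) = f z" for a :: int and e z
  proof (induction a arbitrary: z rule: int_induct[of _ 0])
    case (step1 i)
    then show ?case using that[of "z + of_int i * e"] by (simp add: algebra_simps)
  next
    case (step2 i)
    then show ?case using that[of "z + of_int (i - 1) * e"] by (simp add: algebra_simps)
  qed simp
  obtain a b where "l = of_int a + of_int b * \<tau>" using l by (rule latticeE)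
  then show ?thesis using P[OF assms(1), of _ a] P[OF assms(2), of _ b]
    by (metis add.assoc mult.right_neutral)
qed

lemma countable_lattice: "countable (lattice \<tau>)"
proof -
  have "lattice \<tau> = (\<lambda>(a, b). of_int a + of_int b * \<tau>) ` UNIV"
    unfolding lattice_def by auto
  then show ?thesis by (metis countable_image countableI_type)
qed

lemma lattice_discrete:
  assumes \<tau>: "Im \<tau> > 0"
  shows "\<exists>\<delta>>0. \<forall>l\<in>lattice \<tau> - {0}. \<delta> \<le> norm l"
proof (intro exI conjI ballI)
  show "min 1 (Im \<tau>) > 0" using \<tau> by simp
  fix l assume "l \<in> lattice \<tau> - {0}"
  then obtain a b where l: "l = of_int a + of_int b * \<tau>" "l \<noteq> 0" by (auto elim: latticeE)
  show "min 1 (Im \<tau>) \<le> norm l"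
  proof (cases "b = 0")
    case True
    then have "norm l = \<bar>of_int a\<bar>" "a \<noteq> 0" using l by auto
    then show ?thesis by (simp add: min.coboundedI1)
  next
    case False
    then have "1 \<le> \<bar>real_of_int b\<bar>" by linarith
    then have "Im \<tau> \<le> \<bar>of_int b\<bar> * Im \<tau>" using \<tau> by simp
    also have "\<dots> = \<bar>Im l\<bar>" using l \<tau> by (simp add: abs_mult)
    also have "\<dots> \<le> norm l" by (rule abs_Im_le_cmod)
    finally show ?thesis by simp
  qed
qed

section \<open>Pole sets: lattice translates of finite sets\<close>

definition translates :: "complex \<Rightarrow> complex set \<Rightarrow> complex set" where
  "translates \<tau> S = {p + l | p l. p \<in> S \<and> l \<in> lattice \<tau>}"

lemma translates_iff: "z \<in> translates \<tau> S \<longleftrightarrow> (\<exists>p\<in>S. z - p \<in> lattice \<tau>)"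
proof
  assume "z \<in> translates \<tau> S"
  then obtain p l where "z = p + l" "p \<in> S" "l \<in> lattice \<tau>" unfolding translates_def by blast
  then show "\<exists>p\<in>S. z - p \<in> lattice \<tau>" by (intro bexI[of _ p]) auto
next
  assume "\<exists>p\<in>S. z - p \<in> lattice \<tau>"
  then obtain p where "p \<in> S" "z - p \<in> lattice \<tau>" by blast
  then have "\<exists>l. z = p + l \<and> p \<in> S \<and> l \<in> lattice \<tau>" by (intro exI[of _ "z - p"]) simp
  then show "z \<in> translates \<tau> S" unfolding translates_def by blast
qed

lemma translates_Un: "translates \<tau> (S \<union> T) = translates \<tau> S \<union> translates \<tau> T"
  by (auto simp: translates_iff)

lemma translates_add_iff: "l \<in> lattice \<tau> \<Longrightarrow> z + l \<in> translates \<tau> S \<longleftrightarrow> z \<in> translates \<tau> S"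
  unfolding translates_iff by (intro bex_cong refl) (metis diff_add_eq lattice_add_iff)

lemma countable_translates: "finite S \<Longrightarrow> countable (translates \<tau> S)"
proof -
  assume "finite S"
  have "translates \<tau> S = (\<Union>p\<in>S. (+) p ` lattice \<tau>)" unfolding translates_def by auto
  then show ?thesis using \<open>finite S\<close> countable_lattice by (auto intro: countable_finite)
qed

text \<open>Every subset of a uniformly discrete set is closed, so an arbitrary \<open>X\<close> may
  be removed. Taking \<open>X\<close> to be a single point gives punctured balls free of poles;
  removing the integers or 0 from the lattice gives the domains of regular parts.\<close>

lemma closed_translates:
  assumes \<tau>: "Im \<tau> > 0" and S: "finite S"
  shows "closed (translates \<tau> S - X)"
proof -
  obtain \<delta> where \<delta>: "\<delta> > 0" "\<And>l. l \<in> lattice \<tau> \<Longrightarrow> norm l < \<delta> \<Longrightarrow> l = 0"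
    using lattice_discrete[OF \<tau>] by (metis DiffI not_le singletonD)
  have "closed {z. z - p \<in> lattice \<tau> \<and> z \<notin> X}" for p
  proof (rule discrete_imp_closed[OF \<delta>(1)], safe)
    fix x y assume "x - p \<in> lattice \<tau>" "y - p \<in> lattice \<tau>" "dist y x < \<delta>"
    then show "y = x" using \<delta>(2)[of "y - x"] lattice_diff[of "y - p" \<tau> "x - p"] by (simp add: dist_norm)
  qed
  moreover have "translates \<tau> S - X = (\<Union>p\<in>S. {z. z - p \<in> lattice \<tau> \<and> z \<notin> X})"
    by (auto simp: translates_iff)
  ultimately show ?thesis using S by auto
qed

lemma closed_translates' : "Im \<tau> > 0 \<Longrightarrow> finite S \<Longrightarrow> closed (translates \<tau> S)"
  using closed_translates[of \<tau> S "{}"] by simp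

lemma translates_punctured_ball:
  assumes \<tau>: "Im \<tau> > 0" and S: "finite S" and r: "r > 0"
  obtains r' where "r' > 0" "r' \<le> r" "ball p r' - {p} \<subseteq> - translates \<tau> S"
proof -
  have "open (- (translates \<tau> S - {p}))" using closed_translates[OF \<tau> S, of "{p}"] by blast
  moreover have "p \<in> - (translates \<tau> S - {p})" by simp
  ultimately obtain e where "e > 0" "ball p e \<subseteq> - (translates \<tau> S - {p})"
    by (meson open_contains_ball)
  then have "min e r > 0" "ball p (min e r) - {p} \<subseteq> - translates \<tau> S" using r by auto
  then show ?thesis using that[of "min e r"] by auto
qed

text \<open>The absolutely convergent case of the regularized integral. The finite set
  \<open>S\<close> is quantified existentially so that functions with different poles can be
  added.\<close>

definition torus_integral :: "complex \<Rightarrow> (complex \<Rightarrow> complex) \<Rightarrow> complex \<Rightarrow> bool" where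
  "torus_integral \<tau> f I \<longleftrightarrow> (\<exists>S. finite S \<and> smooth_on (- translates \<tau> S) f \<and>
    (\<forall>z l. z \<notin> translates \<tau> S \<longrightarrow> l \<in> lattice \<tau> \<longrightarrow> f (z + l) = f z) \<and>
    (\<forall>p. simple_pole_at f p) \<and>
    set_lebesgue_integral lborel (fundamental_parallelogram \<tau>) f = I)"

lemma torus_integrable:
  assumes "Im \<tau> > 0" "\<forall>p. simple_pole_at f p"
  shows "set_integrable lborel (fundamental_parallelogram \<tau>) f"
  using assms simple_pole_at_integrable by (intro set_integrable_fundamental_parallelogram) auto

lemma simple_pole_at_add:
  assumes "simple_pole_at f p" "simple_pole_at g p"
  shows "simple_pole_at (\<lambda>z. f z + g z) p"
proof -
  obtain r f' where f: "r > 0" "smooth_on (ball p r) f'" "\<forall>z\<in>ball p r - {p}. f z = f' z / (z - p)"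
    using assms(1) unfolding simple_pole_at_def by blast
  obtain s g' where g: "s > 0" "smooth_on (ball p s) g'" "\<forall>z\<in>ball p s - {p}. g z = g' z / (z - p)"
    using assms(2) unfolding simple_pole_at_def by blast
  have "smooth_on (ball p (min r s)) (\<lambda>z. f' z + g' z)"
    by (intro smooth_on_add smooth_on_subset[OF f(2)] smooth_on_subset[OF g(2)]) auto
  then show ?thesis unfolding simple_pole_at_def using f g
    by (intro exI[of _ "min r s"] conjI exI[of _ "\<lambda>z. f' z + g' z"]) (auto simp: add_divide_distrib)
qed

lemma torus_integral_add:
  assumes \<tau>: "Im \<tau> > 0" and "torus_integral \<tau> f I" "torus_integral \<tau> g J"
  shows "torus_integral \<tau> (\<lambda>z. f z + g z) (I + J)"
proof -
  obtain S where S: "finite S" "smooth_on (- translates \<tau> S) f"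
    "\<forall>z l. z \<notin> translates \<tau> S \<longrightarrow> l \<in> lattice \<tau> \<longrightarrow> f (z + l) = f z"
    "\<forall>p. simple_pole_at f p" "set_lebesgue_integral lborel (fundamental_parallelogram \<tau>) f = I"
    using assms(2) unfolding torus_integral_def by blast
  obtain T where T: "finite T" "smooth_on (- translates \<tau> T) g"
    "\<forall>z l. z \<notin> translates \<tau> T \<longrightarrow> l \<in> lattice \<tau> \<longrightarrow> g (z + l) = g z"
    "\<forall>p. simple_pole_at g p" "set_lebesgue_integral lborel (fundamental_parallelogram \<tau>) g = J"
    using assms(3) unfolding torus_integral_def by blast
  have "set_lebesgue_integral lborel (fundamental_parallelogram \<tau>) (\<lambda>z. f z + g z) = I + J"
    using S T torus_integrable[OF \<tau>] by (simp add: set_integral_add)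
  moreover have "smooth_on (- translates \<tau> (S \<union> T)) (\<lambda>z. f z + g z)"
    by (intro smooth_on_add smooth_on_subset[OF S(2)] smooth_on_subset[OF T(2)]) (auto simp: translates_Un)
  ultimately show ?thesis unfolding torus_integral_def using S T
    by (intro exI[of _ "S \<union> T"] conjI) (auto simp: translates_Un intro!: simple_pole_at_add)
qed

lemma torus_integral_cmult:
  assumes "torus_integral \<tau> f I"
  shows "torus_integral \<tau> (\<lambda>z. c * f z) (c * I)"
proof -
  obtain S where S: "finite S" "smooth_on (- translates \<tau> S) f"
    "\<forall>z l. z \<notin> translates \<tau> S \<longrightarrow> l \<in> lattice \<tau> \<longrightarrow> f (z + l) = f z"
    "\<forall>p. simple_pole_at f p" "set_lebesgue_integral lborel (fundamental_parallelogram \<tau>) f = I"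
    using assms unfolding torus_integral_def by blast
  have "simple_pole_at (\<lambda>z. c * f z) p" for p
  proof -
    obtain r g where "r > 0" "smooth_on (ball p r) g" "\<forall>z\<in>ball p r - {p}. f z = g z / (z - p)"
      using S(4) unfolding simple_pole_at_def by blast
    then show ?thesis unfolding simple_pole_at_def
      by (intro exI[of _ r] conjI exI[of _ "\<lambda>z. c * g z"]) (auto intro: smooth_on_mult smooth_on_const)
  qed
  moreover have "smooth_on (- translates \<tau> S) (\<lambda>z. c * f z)"
    by (intro smooth_on_mult smooth_on_const S)
  moreover have "set_lebesgue_integral lborel (fundamental_parallelogram \<tau>) (\<lambda>z. c * f z) = c * I"
    using S(5) by simp
  ultimately show ?thesis unfolding torus_integral_def using S by (intro exI[of _ S] conjI) auto
qed

lemma torus_integral_const: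
  assumes \<tau>: "Im \<tau> > 0"
  shows "torus_integral \<tau> (\<lambda>_. c) (of_real (Im \<tau>) * c)"
proof -
  have sp: "simple_pole_at (\<lambda>_. k) p" for k p
    unfolding simple_pole_at_def
    by (intro exI[of _ 1] conjI exI[of _ "\<lambda>z. k * (z - p)"])
      (auto intro!: smooth_on_holomorphic holomorphic_intros)
  have H: "(indicator {0..<1} t *\<^sub>R indicator {0..<1} s *\<^sub>R c :: complex)
      = indicator {0..<1} t *\<^sub>R (indicator {0..<1} s *\<^sub>R c)" for t s :: real by simp
  have "set_integrable lborel (fundamental_parallelogram \<tau>) (\<lambda>_. c)"
    using torus_integrable[OF \<tau>] sp by blast
  from set_lebesgue_integral_fundamental_parallelogram(1)[OF \<tau> this]
  have "set_lebesgue_integral lborel (fundamental_parallelogram \<tau>) (\<lambda>_. c) = of_real (Im \<tau>) * c"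
    by (simp add: scaleR_conv_of_real)
  moreover have "smooth_on (- translates \<tau> {}) (\<lambda>_. c)" by (rule smooth_on_const)
  ultimately show ?thesis unfolding torus_integral_def using sp
    by (intro exI[of _ "{}"] conjI) auto
qed

lemma torus_integral_sum:
  assumes \<tau>: "Im \<tau> > 0" and "finite A" "\<And>i. i \<in> A \<Longrightarrow> torus_integral \<tau> (f i) (I i)"
  shows "torus_integral \<tau> (\<lambda>z. \<Sum>i\<in>A. f i z) (\<Sum>i\<in>A. I i)"
  using assms(2,3)
proof (induction A)
  case empty
  then show ?case using torus_integral_const[OF \<tau>, of 0] by simp
next
  case (insert i A)
  then show ?case using torus_integral_add[OF \<tau>, of "f i" "I i" "\<lambda>z. \<Sum>i\<in>A. f i z"] by simp
qed

text \<open>Identities between theta quotients hold only away from zeros of denominators, where the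
  convention for division by 0 takes over; here they are still allowed to be used under the
  integral.\<close>

lemma torus_integral_cong:
  assumes \<tau>: "Im \<tau> > 0" and "torus_integral \<tau> f I" and T: "finite T"
    and eq: "\<And>z. z \<notin> translates \<tau> T \<Longrightarrow> f z = g z"
  shows "torus_integral \<tau> g I"
proof -
  obtain S where S: "finite S" "smooth_on (- translates \<tau> S) f"
    "\<forall>z l. z \<notin> translates \<tau> S \<longrightarrow> l \<in> lattice \<tau> \<longrightarrow> f (z + l) = f z"
    "\<forall>p. simple_pole_at f p" "set_lebesgue_integral lborel (fundamental_parallelogram \<tau>) f = I"
    using assms unfolding torus_integral_def by blast
  have "simple_pole_at g p" for p
  proof -
    obtain r h where r: "r > 0" "smooth_on (ball p r) h" "\<forall>z\<in>ball p r - {p}. f z = h z / (z - p)"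
      using S(4) unfolding simple_pole_at_def by blast
    obtain r' where r': "r' > 0" "r' \<le> r" "ball p r' - {p} \<subseteq> - translates \<tau> T"
      using translates_punctured_ball[OF \<tau> T r(1)] .
    have "smooth_on (ball p r') h" by (rule smooth_on_subset[OF r(2)]) (use r' in auto)
    moreover have "\<forall>z\<in>ball p r' - {p}. g z = h z / (z - p)"
    proof
      fix z assume z: "z \<in> ball p r' - {p}"
      then have "z \<in> ball p r - {p}" using r' by auto
      then show "g z = h z / (z - p)" using r(3) eq[of z] r'(3) z by auto
    qed
    ultimately show ?thesis unfolding simple_pole_at_def using r' by blast
  qed
  moreover have "smooth_on (- translates \<tau> (S \<union> T)) g"
  proof (rule smooth_on_cong)
    show "smooth_on (- translates \<tau> (S \<union> T)) f"
      by (rule smooth_on_subset[OF S(2)]) (auto simp: translates_Un)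
    show "open (- translates \<tau> (S \<union> T))"
      using closed_translates'[OF \<tau>, of "S \<union> T"] S T by (simp add: open_Compl)
  qed (use eq in \<open>auto simp: translates_Un\<close>)
  moreover have "set_lebesgue_integral lborel (fundamental_parallelogram \<tau>) g = I"
    unfolding S(5)[symmetric]
    by (rule set_lebesgue_integral_discrete_difference[symmetric, OF countable_translates[OF T]])
      (use eq in auto)
  moreover have "g (z + l) = g z" if "z \<notin> translates \<tau> (S \<union> T)" "l \<in> lattice \<tau>" for z l
    using that S(3) eq[of z] eq[of "z + l"] translates_add_iff[of l \<tau> z T] by (auto simp: translates_Un)
  ultimately show ?thesis unfolding torus_integral_def using S(1) T
    by (intro exI[of _ "S \<union> T"]) auto
qed

text \<open>Dominated convergence with majorant \<open>norm (f z)\<close>, integrable because all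
  poles are simple. A point outside the closed pole set has positive distance from it and is left by
  the balls for small radius.\<close>

lemma torus_integral_imp_reg_integral:
  assumes \<tau>: "Im \<tau> > 0" and "torus_integral \<tau> f I"
  shows "has_reg_integral_E \<tau> f I"
proof -
  obtain S where S: "finite S" "smooth_on (- translates \<tau> S) f"
    "\<forall>z l. z \<notin> translates \<tau> S \<longrightarrow> l \<in> lattice \<tau> \<longrightarrow> f (z + l) = f z"
    "\<forall>p. simple_pole_at f p" "set_lebesgue_integral lborel (fundamental_parallelogram \<tau>) f = I"
    using assms unfolding torus_integral_def by blast
  let ?D = "translates \<tau> S" and ?P = "fundamental_parallelogram \<tau>"
  have "smooth_with_holomorphic_poles \<tau> ?D f"
    unfolding smooth_with_holomorphic_poles_def
  proof (intro conjI ballI S)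
    fix p
    obtain r g where "r > 0" "smooth_on (ball p r) g" "\<forall>z\<in>ball p r - {p}. f z = g z / (z - p)"
      using S(4) unfolding simple_pole_at_def by blast
    then show "\<exists>r>0. \<exists>k g. smooth_on (ball p r) g \<and> (\<forall>z\<in>ball p r - {p}. f z = g z / (z - p) ^ k)"
      by (intro exI[of _ r] conjI exI[of _ 1] exI[of _ g]) auto
  qed
  moreover have "((\<lambda>\<epsilon>. set_lebesgue_integral lborel (?P - (\<Union>p\<in>?D. ball p \<epsilon>)) f) \<longlongrightarrow> I) (at_right 0)"
  proof (rule tendsto_at_right_sequentially[of 0 1])
    fix X :: "nat \<Rightarrow> real" assume X: "\<And>n. 0 < X n" "X \<longlonglongrightarrow> 0"
    have int: "integrable lborel (\<lambda>z. indicator ?P z *\<^sub>R f z)"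
      using torus_integrable[OF \<tau> S(4)] by (simp add: set_integrable_def)
    have Pm: "?P \<in> sets borel" using \<tau> by measurable
    have "(\<lambda>n. \<integral>z. indicator (?P - (\<Union>p\<in>?D. ball p (X n))) z *\<^sub>R f z \<partial>lborel)
        \<longlonglongrightarrow> (\<integral>z. indicator ?P z *\<^sub>R f z \<partial>lborel)"
    proof (rule integral_dominated_convergence)
      show "integrable lborel (\<lambda>z. norm (indicator ?P z *\<^sub>R f z))" using int by (rule integrable_norm)
      show "(\<lambda>z. indicator ?P z *\<^sub>R f z) \<in> borel_measurable lborel" using int by auto
      show "(\<lambda>z. indicator (?P - (\<Union>p\<in>?D. ball p (X n))) z *\<^sub>R f z) \<in> borel_measurable lborel" for n
      proof -
        have "integrable lborel (\<lambda>z. indicator (- (\<Union>p\<in>?D. ball p (X n))) z *\<^sub>R (indicator ?P z *\<^sub>R f z))"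
        proof (rule integrable_mult_indicator[OF _ int])
          have "open (\<Union>p\<in>?D. ball p (X n))" by auto
          then show "- (\<Union>p\<in>?D. ball p (X n)) \<in> sets lborel"
            by (simp only: borel_comp borel_open sets_lborel)
        qed
        also have "(\<lambda>z. indicator (- (\<Union>p\<in>?D. ball p (X n))) z *\<^sub>R (indicator ?P z *\<^sub>R f z))
            = (\<lambda>z. indicator (?P - (\<Union>p\<in>?D. ball p (X n))) z *\<^sub>R f z)"
          by (auto simp: indicator_def fun_eq_iff)
        finally show ?thesis by auto
      qed
      show "AE z in lborel. norm (indicator (?P - (\<Union>p\<in>?D. ball p (X n))) z *\<^sub>R f z)
          \<le> norm (indicator ?P z *\<^sub>R f z)" for n
        by (auto simp: indicator_def)
      show "AE z in lborel. (\<lambda>n. indicator (?P - (\<Union>p\<in>?D. ball p (X n))) z *\<^sub>R f z)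
          \<longlonglongrightarrow> indicator ?P z *\<^sub>R f z"
        using AE_not_in[OF countable_imp_null_set_lborel[OF countable_translates[OF S(1), of \<tau>]]]
      proof eventually_elim
        case (elim z)
        have "open (- ?D)" using closed_translates'[OF \<tau> S(1)] by (simp add: open_Compl)
        then obtain e where e: "e > 0" "ball z e \<subseteq> - ?D" using elim by (meson ComplI open_contains_ball)
        have "eventually (\<lambda>n. X n < e) sequentially" using X(2) e(1) by (rule order_tendstoD)
        then have "eventually (\<lambda>n. indicator ?P z *\<^sub>R f z
            = indicator (?P - (\<Union>p\<in>?D. ball p (X n))) z *\<^sub>R f z) sequentially"
        proof eventually_elim
          case (elim n)
          have "z \<notin> (\<Union>p\<in>?D. ball p (X n))"
          proof
            assume "z \<in> (\<Union>p\<in>?D. ball p (X n))"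
            then obtain p where "p \<in> ?D" "dist z p < e" using elim by (auto simp: dist_commute)
            then show False using e(2) by (auto simp: subset_iff)
          qed
          then show ?case by (auto simp: indicator_def)
        qed
        then show ?case by (rule Lim_transform_eventually[OF tendsto_const])
      qed
    qed
    then show "(\<lambda>n. set_lebesgue_integral lborel (?P - (\<Union>p\<in>?D. ball p (X n))) f) \<longlonglongrightarrow> I"
      using S(5) by (simp add: set_lebesgue_integral_def)
  qed simp
  ultimately show ?thesis unfolding has_reg_integral_E_def Let_def using S(1)
    by (intro exI[of _ S]) (simp add: translates_def)
qed

section \<open>Quasi-periodic meromorphic functions\<close>

text \<open>A countable set has empty interior, so its complement is dense.\<close>

lemma continuous_eq_off_countable:
  fixes f g :: "complex \<Rightarrow> complex"
  assumes "countable D" "continuous_on UNIV f" "continuous_on UNIV g" "\<And>z. z \<notin> D \<Longrightarrow> f z = g z"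
  shows "f z = g z"
proof -
  have "closed {z. f z = g z}" using assms by (intro closed_Collect_eq)
  moreover have "interior D = {}"
  proof (rule ccontr)
    assume "interior D \<noteq> {}"
    then obtain x e where "e > 0" "ball x e \<subseteq> D" by (auto simp: mem_interior)
    then show False using assms(1) uncountable_ball countable_subset by blast
  qed
  then have "closure (- D) = UNIV" by (simp add: closure_complement)
  moreover have "- D \<subseteq> {z. f z = g z}" using assms by auto
  ultimately show ?thesis using closure_minimal by blast
qed

lemma entire_extension:
  fixes f :: "complex \<Rightarrow> complex"
  assumes hol: "f holomorphic_on - D" and D: "closed D"
    and rem: "\<And>p. p \<in> D \<Longrightarrow> \<exists>r>0. \<exists>h. h holomorphic_on ball p r \<and>
      ball p r - {p} \<subseteq> - D \<and> (\<forall>z\<in>ball p r - {p}. f z = h z)"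
  obtains F where "F holomorphic_on UNIV" "\<And>z. z \<notin> D \<Longrightarrow> F z = f z"
proof
  have an: "remove_sings f z = f z" if "z \<notin> D" for z
    using hol D that by (intro remove_sings_at_analytic) (auto simp: analytic_on_open open_Compl analytic_at)
  then show "\<And>z. z \<notin> D \<Longrightarrow> remove_sings f z = f z" by simp
  have "remove_sings f analytic_on {p}" for p
  proof (cases "p \<in> D")
    case True
    then obtain r h where h: "r > 0" "h holomorphic_on ball p r"
      "ball p r - {p} \<subseteq> - D" "\<And>z. z \<in> ball p r - {p} \<Longrightarrow> f z = h z" using rem by blast
    have "(h \<longlongrightarrow> h p) (at p)"
      using holomorphic_on_imp_continuous_on[OF h(2)] h(1) by (simp add: continuous_on_eq_continuous_at isContD)
    moreover have "eventually (\<lambda>z. z \<in> ball p r - {p}) (at p)"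
      using h(1) by (intro eventually_at_in_open) auto
    then have "eventually (\<lambda>z. h z = f z) (at p)" by eventually_elim (use h in auto)
    ultimately have "(f \<longlongrightarrow> h p) (at p)" by (rule Lim_transform_eventually)
    then have "remove_sings f p = h p" by (rule remove_sings_eqI)
    then have "remove_sings f z = h z" if "z \<in> ball p r" for z
      using that an[of z] h by (cases "z = p") auto
    then have "remove_sings f holomorphic_on ball p r" using h(2) holomorphic_transform by metis
    then show ?thesis unfolding analytic_at using h(1) by (intro exI[of _ "ball p r"]) auto
  next
    case False
    have "f holomorphic_on - D \<longleftrightarrow> remove_sings f holomorphic_on - D"
      using an by (intro holomorphic_cong) auto
    then show ?thesis using hol D False by (auto simp: analytic_at open_Compl intro!: exI[of _ "- D"])
  qed
  then show "remove_sings f holomorphic_on UNIV"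
    by (meson UNIV_I analytic_imp_holomorphic analytic_on_analytic_at analytic_on_subset open_UNIV)
qed

lemma fundamental_parallelogram_cover:
  assumes "Im \<tau> > 0"
  obtains p l where "z = p + l" "p \<in> fundamental_parallelogram \<tau>" "l \<in> lattice \<tau>"
proof -
  define t where "t = Im z / Im \<tau>"
  define s where "s = Re z - t * Re \<tau>"
  have z: "z = of_real s + of_real t * \<tau>" using assms by (simp add: complex_eq_iff s_def t_def)
  have "of_real (frac s) + of_real (frac t) * \<tau> \<in> fundamental_parallelogram \<tau>"
    using fundamental_parallelogram_iff[OF assms] frac_lt_1[of s] frac_lt_1[of t] by simp
  moreover have "z = (of_real (frac s) + of_real (frac t) * \<tau>) + (of_int \<lfloor>s\<rfloor> + of_int \<lfloor>t\<rfloor> * \<tau>)"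
    unfolding z by (simp add: frac_def complex_eq_iff algebra_simps)
  ultimately show ?thesis using that latticeI by blast
qed

text \<open>Under translation by \<tau> the absolute value of \<open>f\<close> is multiplied by
  \<open>exp (2 * pi * Im s)\<close>. The factor \<open>exp (\<i> * of_real \<beta> * z)\<close> has
  absolute value \<open>exp (- \<beta> * Im z)\<close>, which undoes exactly this and is unaffected
  by translation by 1. So the norm of the product is doubly periodic, hence bounded, and Liouville's
  theorem applies.\<close>

lemma quasi_periodic_entire:
  assumes \<tau>: "Im \<tau> > 0" and hol: "f holomorphic_on UNIV"
    and per: "\<And>z. f (z + 1) = f z" "\<And>z. f (z + \<tau>) = exp (- 2 * pi * \<i> * s) * f z"
  shows "\<exists>c. \<forall>z. f z = c * exp (- \<i> * of_real (2 * pi * Im s / Im \<tau>) * z)"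
proof -
  define \<beta> where "\<beta> = 2 * pi * Im s / Im \<tau>"
  define g where "g = (\<lambda>z. f z * exp (\<i> * of_real \<beta> * z))"
  have n1: "norm (g (z + 1)) = norm (g z)" for z
    by (simp add: g_def per norm_mult norm_exp_eq_Re)
  have nt: "norm (g (z + \<tau>)) = norm (g z)" for z
  proof -
    have b: "\<beta> * Im \<tau> = 2 * pi * Im s" using \<tau> by (simp add: \<beta>_def)
    have "norm (g (z + \<tau>)) = norm (f z) * (exp (2 * pi * Im s) * exp (- (\<beta> * (Im z + Im \<tau>))))"
      by (simp add: g_def per norm_mult norm_exp_eq_Re)
    also have "exp (2 * pi * Im s) * exp (- (\<beta> * (Im z + Im \<tau>))) = exp (- (\<beta> * Im z))"
      unfolding exp_add[symmetric] b[symmetric] by (simp add: algebra_simps)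
    finally show ?thesis by (simp add: g_def norm_mult norm_exp_eq_Re)
  qed
  have hg: "g holomorphic_on UNIV" unfolding g_def by (intro holomorphic_intros hol)
  then have "continuous_on (closure (fundamental_parallelogram \<tau>)) g"
    using holomorphic_on_imp_continuous_on continuous_on_subset by blast
  then have "bounded (g ` closure (fundamental_parallelogram \<tau>))"
    using fundamental_parallelogram_bounded
    by (intro compact_imp_bounded compact_continuous_image) (auto simp: compact_closure)
  then obtain M where M: "\<And>z. z \<in> closure (fundamental_parallelogram \<tau>) \<Longrightarrow> norm (g z) \<le> M"
    unfolding bounded_iff by blast
  have "norm (g z) \<le> M" for z
  proof -
    obtain p l where "z = p + l" "p \<in> fundamental_parallelogram \<tau>" "l \<in> lattice \<tau>"
      using fundamental_parallelogram_cover[OF \<tau>] .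
    then show ?thesis
      using lattice_periodic[of "\<lambda>z. norm (g z)", OF n1 nt, of l p] M[of p] closure_subset by auto
  qed
  then have "bounded (range g)" by (auto simp: bounded_iff)
  from Liouville_theorem[OF hg this] obtain c where c: "\<And>z. g z = c" by (auto simp: constant_on_def)
  have "f z = c * exp (- \<i> * of_real \<beta> * z)" for z
  proof -
    have "f z = g z * exp (- (\<i> * of_real \<beta> * z))" by (simp add: g_def mult.assoc flip: exp_add)
    then show ?thesis by (simp add: c)
  qed
  then show ?thesis unfolding \<beta>_def by blast
qed

text \<open>Removability is assumed at the representatives in \<open>S\<close> only.
  Quasi-periodicity carries a local extension from \<open>q\<close> to \<open>q + l\<close>, since
  the two germs differ by a constant factor; the resulting entire function inherits the
  quasi-periods by density.\<close>

lemma quasi_periodic_meromorphic: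
  assumes \<tau>: "Im \<tau> > 0" and S: "finite S" and hol: "f holomorphic_on - translates \<tau> S"
    and per: "\<And>z. z \<notin> translates \<tau> S \<Longrightarrow> f (z + 1) = f z"
      "\<And>z. z \<notin> translates \<tau> S \<Longrightarrow> f (z + \<tau>) = exp (- 2 * pi * \<i> * s) * f z"
    and rem: "\<And>p. p \<in> S \<Longrightarrow> \<exists>r>0. \<exists>h. h holomorphic_on ball p r \<and> (\<forall>z\<in>ball p r - {p}. f z = h z)"
  shows "\<exists>c. \<forall>z. z \<notin> translates \<tau> S \<longrightarrow> f z = c * exp (- \<i> * of_real (2 * pi * Im s / Im \<tau>) * z)"
proof -
  let ?D = "translates \<tau> S"
  have inv1: "z + of_int a \<notin> ?D" if "z \<notin> ?D" for z and a :: int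
    using that translates_add_iff[of "of_int a" \<tau> z S] latticeI[of a 0 \<tau>] by simp
  have inv2: "z + of_int a * \<tau> \<notin> ?D" if "z \<notin> ?D" for z and a :: int
    using that translates_add_iff[of "of_int a * \<tau>" \<tau> z S] latticeI[of 0 a \<tau>] by simp
  have P1: "f (z + of_int a) = f z" if "z \<notin> ?D" for a :: int and z
  proof (induction a rule: int_induct[of _ 0])
    case (step1 i)
    then show ?case using per(1)[OF inv1[OF that, of i]] by (simp add: algebra_simps)
  next
    case (step2 i)
    then show ?case using per(1)[OF inv1[OF that, of "i - 1"]] by (simp add: algebra_simps)
  qed simp
  define \<mu> where "\<mu> = exp (- 2 * pi * \<i> * s)"
  have \<mu>: "\<mu> \<noteq> 0" by (simp add: \<mu>_def)
  \<comment> \<open>The constant is the power of \<open>\<mu>\<close> with exponent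
    \<open>a\<close>; induction in both directions produces it together with its being
    nonzero.\<close>
  have P2: "\<exists>c\<noteq>0. \<forall>z. z \<notin> ?D \<longrightarrow> f (z + of_int a * \<tau>) = c * f z" for a :: int
  proof (induction a rule: int_induct[of _ 0])
    case base
    then show ?case by (intro exI[of _ 1]) auto
  next
    case (step1 i)
    then obtain c where c: "c \<noteq> 0" "\<And>z. z \<notin> ?D \<Longrightarrow> f (z + of_int i * \<tau>) = c * f z" by blast
    show ?case
    proof (intro exI[of _ "\<mu> * c"] conjI allI impI)
      fix z assume "z \<notin> ?D"
      then show "f (z + of_int (i + 1) * \<tau>) = \<mu> * c * f z"
        using per(2)[OF inv2[of z i]] c(2)[of z] by (simp add: \<mu>_def algebra_simps)
    qed (use \<mu> c in auto)
  next
    case (step2 i)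
    then obtain c where c: "c \<noteq> 0" "\<And>z. z \<notin> ?D \<Longrightarrow> f (z + of_int i * \<tau>) = c * f z" by blast
    show ?case
    proof (intro exI[of _ "c / \<mu>"] conjI allI impI)
      fix z assume "z \<notin> ?D"
      then have "\<mu> * f (z + of_int (i - 1) * \<tau>) = c * f z"
        using per(2)[OF inv2[of z "i - 1"]] c(2)[of z] by (simp add: \<mu>_def algebra_simps)
      then show "f (z + of_int (i - 1) * \<tau>) = c / \<mu> * f z" using \<mu> by (simp add: field_simps)
    qed (use \<mu> c in auto)
  qed
  have "\<exists>r>0. \<exists>h. h holomorphic_on ball p r \<and> ball p r - {p} \<subseteq> - ?D \<and> (\<forall>z\<in>ball p r - {p}. f z = h z)"
    if p: "p \<in> ?D" for p
  proof -
    obtain q l where q: "p = q + l" "q \<in> S" "l \<in> lattice \<tau>" using p unfolding translates_def by blast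
    obtain a b where l: "l = of_int a + of_int b * \<tau>" using q(3) by (rule latticeE)
    obtain c where c: "c \<noteq> 0" "\<And>z. z \<notin> ?D \<Longrightarrow> f (z + of_int b * \<tau>) = c * f z" using P2[of b] by blast
    obtain r h where h: "r > 0" "h holomorphic_on ball q r" "\<And>z. z \<in> ball q r - {q} \<Longrightarrow> f z = h z"
      using rem[OF q(2)] by blast
    obtain r' where r': "r' > 0" "r' \<le> r" "ball p r' - {p} \<subseteq> - ?D"
      using translates_punctured_ball[OF \<tau> S h(1)] .
    have hol': "(\<lambda>z. c * h (z - l)) holomorphic_on ball p r'"
    proof -
      have "(\<lambda>z. z - l) ` ball p r' \<subseteq> ball q r"
        using q(1) r' by (auto simp: dist_norm algebra_simps)
      then have "(h \<circ> (\<lambda>z. z - l)) holomorphic_on ball p r'"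
        by (intro holomorphic_on_compose_gen[OF _ h(2)] holomorphic_intros)
      then show ?thesis by (auto simp: o_def intro!: holomorphic_intros)
    qed
    have "f z = c * h (z - l)" if z: "z \<in> ball p r' - {p}" for z
    proof -
      have zD: "z \<notin> ?D" using z r' by auto
      have "z - l \<notin> ?D" using zD translates_add_iff[OF q(3), of "z - l" S] by simp
      moreover from this have "z - l + of_int b * \<tau> \<notin> ?D" by (rule inv2)
      ultimately have "f (z - l + of_int b * \<tau> + of_int a) = c * f (z - l)"
        by (simp add: P1 c)
      moreover have "z - l \<in> ball q r - {q}" using z q(1) r' by (auto simp: dist_norm algebra_simps)
      ultimately show ?thesis using h(3) by (simp add: l)
    qed
    then show ?thesis using hol' r' by blast
  qed
  then obtain F where F: "F holomorphic_on UNIV" "\<And>z. z \<notin> ?D \<Longrightarrow> F z = f z"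
    using entire_extension[OF hol closed_translates'[OF \<tau> S]] by metis
  have cF: "continuous_on UNIV F" using F(1) by (rule holomorphic_on_imp_continuous_on)
  have cFt: "continuous_on UNIV (\<lambda>z. F (z + c))" for c
    by (intro continuous_on_compose2[OF cF] continuous_intros) auto
  have "F (z + 1) = F z" for z
    by (rule continuous_eq_off_countable[OF countable_translates[OF S, of \<tau>] cFt cF])
      (use F(2) per(1) inv1[of _ 1] in auto)
  moreover have "F (z + \<tau>) = exp (- 2 * pi * \<i> * s) * F z" for z
    by (rule continuous_eq_off_countable[OF countable_translates[OF S, of \<tau>] cFt])
      (use F(2) per(2) inv2[of _ 1] in \<open>auto intro!: continuous_intros cF\<close>)
  ultimately show ?thesis using quasi_periodic_entire[OF \<tau> F(1)] F(2) by metis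
qed

text \<open>A nonzero multiple of \<open>exp (- \<i> * \<beta> * z)\<close> is 1-periodic only if
  \<open>\<beta> = - 2 * pi * m\<close> with an integer \<open>m\<close>, and then its multiplier
  for \<tau> has the required value only if \<open>s = k - m * \<tau>\<close> with an integer
  \<open>k\<close>. This contradicts \<open>s\<close> being off the lattice.\<close>

lemma quasi_periodic_eq_0:
  assumes \<tau>: "Im \<tau> > 0" and S: "finite S" and hol: "f holomorphic_on - translates \<tau> S"
    and per: "\<And>z. z \<notin> translates \<tau> S \<Longrightarrow> f (z + 1) = f z"
      "\<And>z. z \<notin> translates \<tau> S \<Longrightarrow> f (z + \<tau>) = exp (- 2 * pi * \<i> * s) * f z"
    and rem: "\<And>p. p \<in> S \<Longrightarrow> \<exists>r>0. \<exists>h. h holomorphic_on ball p r \<and> (\<forall>z\<in>ball p r - {p}. f z = h z)"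
    and s: "s \<notin> lattice \<tau>" and z: "z \<notin> translates \<tau> S"
  shows "f z = 0"
proof -
  define \<beta> where "\<beta> = 2 * pi * Im s / Im \<tau>"
  obtain c where c: "\<And>z. z \<notin> translates \<tau> S \<Longrightarrow> f z = c * exp (- \<i> * of_real \<beta> * z)"
    using quasi_periodic_meromorphic[OF \<tau> S hol per rem] unfolding \<beta>_def by blast
  have z1: "z + 1 \<notin> translates \<tau> S" "z + \<tau> \<notin> translates \<tau> S"
    using z translates_add_iff[OF lattice_1] translates_add_iff[OF lattice_tau] by auto
  have "c = 0"
  proof (rule ccontr)
    assume c0: "c \<noteq> 0"
    have "exp (- \<i> * of_real \<beta> * (z + 1)) = exp (- \<i> * of_real \<beta> * z)"
      using per(1)[OF z] c[OF z] c[OF z1(1)] c0 by simp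
    moreover have "exp (- \<i> * of_real \<beta> * (z + 1))
        = exp (- \<i> * of_real \<beta>) * exp (- \<i> * of_real \<beta> * z)"
      by (simp add: algebra_simps flip: exp_add)
    ultimately have "exp (- \<i> * of_real \<beta>) = 1" by simp
    then obtain m :: int where "- \<i> * of_real \<beta> = of_int (2 * m) * of_real pi * \<i>"
      unfolding exp_eq_1 by (auto simp: complex_eq_iff)
    then have "- \<beta> = 2 * real_of_int m * pi" by (simp add: complex_eq_iff)
    then have m: "\<beta> = - 2 * pi * of_int m" by (simp add: algebra_simps)
    have "exp (- \<i> * of_real \<beta> * (z + \<tau>)) = exp (- 2 * pi * \<i> * s) * exp (- \<i> * of_real \<beta> * z)"
      using per(2)[OF z] c[OF z] c[OF z1(2)] c0 by simp
    moreover have "exp (- \<i> * of_real \<beta> * (z + \<tau>)) = exp (- \<i> * of_real \<beta> * \<tau> + 2 * pi * \<i> * s)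
        * (exp (- 2 * pi * \<i> * s) * exp (- \<i> * of_real \<beta> * z))"
      by (simp add: algebra_simps flip: exp_add)
    ultimately have "exp (- \<i> * of_real \<beta> * \<tau> + 2 * pi * \<i> * s) = 1" by simp
    then obtain k :: int where "- \<i> * of_real \<beta> * \<tau> + 2 * pi * \<i> * s = of_int (2 * k) * of_real pi * \<i>"
      unfolding exp_eq_1 by (auto simp: complex_eq_iff)
    then have "(2 * of_real pi * \<i>) * (of_int m * \<tau> + s) = (2 * of_real pi * \<i>) * of_int k"
      unfolding m by (simp add: algebra_simps)
    then have "of_int m * \<tau> + s = of_int k" by (subst (asm) mult_cancel_left) auto
    then have "s = of_int k + of_int (- m) * \<tau>" by (simp add: algebra_simps)
    then show False using s latticeI[of k "- m" \<tau>] by simp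
  qed
  then show ?thesis using c[OF z] by simp
qed

text \<open>Numerator and denominator both remain holomorphic after division by
  \<open>z - p\<close>, and the new denominator has the nonzero value \<open>deriv g p\<close> at
  \<open>p\<close>.\<close>

lemma removable_simple_zero:
  fixes f g :: "complex \<Rightarrow> complex"
  assumes hf: "f holomorphic_on ball p r" and hg: "g holomorphic_on ball p r" and r: "r > 0"
    and z: "f p = 0" "g p = 0" "deriv g p \<noteq> 0"
  obtains r' h where "r' > 0" "r' \<le> r" "h holomorphic_on ball p r'"
    "\<And>z. z \<in> ball p r' - {p} \<Longrightarrow> g z \<noteq> 0 \<and> f z / g z = h z"
proof -
  define q where "q = (\<lambda>f z. if z = p then deriv f p else (f z - f p) / (z - p) :: complex)"
  have q: "q f holomorphic_on ball p r" "q g holomorphic_on ball p r"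
    unfolding q_def using pole_lemma_open[OF hf] pole_lemma_open[OF hg] by auto
  have "q g p \<noteq> 0" using z by (simp add: q_def)
  moreover have "continuous (at p) (q g)"
    using holomorphic_on_imp_continuous_on[OF q(2)] r by (simp add: continuous_on_eq_continuous_at)
  ultimately obtain e where e: "e > 0" "\<And>y. dist p y < e \<Longrightarrow> q g y \<noteq> 0"
    using continuous_at_avoid[of p "q g" 0] by blast
  define r' where "r' = min e r"
  show ?thesis
  proof (rule that[of r' "\<lambda>z. q f z / q g z"])
    show "(\<lambda>z. q f z / q g z) holomorphic_on ball p r'"
      by (intro holomorphic_intros holomorphic_on_subset[OF q(1)] holomorphic_on_subset[OF q(2)])
        (use e in \<open>auto simp: r'_def\<close>)
    fix y assume y: "y \<in> ball p r' - {p}"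
    then have "q g y \<noteq> 0" "y \<noteq> p" using e(2)[of y] by (auto simp: r'_def)
    then show "g y \<noteq> 0 \<and> f y / g y = q f y / q g y"
      using z by (auto simp: q_def)
  qed (use e r in \<open>auto simp: r'_def\<close>)
qed

section \<open>The Frobenius determinant formula\<close>

locale jacobi_theta =
  fixes \<tau> :: complex and \<theta> :: "complex \<Rightarrow> complex"
  assumes tau: "Im \<tau> > 0" and theta: "odd_jacobi_theta \<tau> \<theta>"
begin

abbreviation "\<Lambda> \<equiv> lattice \<tau>"

lemma theta_holomorphic: "\<theta> holomorphic_on A"
proof -
  have "\<theta> holomorphic_on UNIV" using theta unfolding odd_jacobi_theta_def by blast
  then show ?thesis by (rule holomorphic_on_subset) simp
qed

lemma theta_holomorphic_compose [holomorphic_intros]: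
  "f holomorphic_on A \<Longrightarrow> (\<lambda>z. \<theta> (f z)) holomorphic_on A"
  using holomorphic_on_compose_gen[OF _ theta_holomorphic[of UNIV], of f A] by (simp add: o_def)

lemma theta_minus: "\<theta> (- z) = - \<theta> z"
  using theta unfolding odd_jacobi_theta_def by blast

lemma theta_diff_commute: "\<theta> (x - y) = - \<theta> (y - x)"
  using theta_minus[of "y - x"] by simp

lemma theta_eq_0_iff: "\<theta> z = 0 \<longleftrightarrow> z \<in> \<Lambda>"
  using theta unfolding odd_jacobi_theta_def by blast

lemma theta_0: "\<theta> 0 = 0"
  by (simp add: theta_eq_0_iff)

lemma deriv_theta_0: "deriv \<theta> 0 = 1"
  using theta unfolding odd_jacobi_theta_def by blast

lemma theta_add_1: "\<theta> (z + 1) = - \<theta> z"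
  using theta unfolding odd_jacobi_theta_def by blast

lemma theta_add_tau: "\<theta> (z + \<tau>) = - exp (- pi * \<i> * \<tau>) * exp (- 2 * pi * \<i> * z) * \<theta> z"
  using theta unfolding odd_jacobi_theta_def by blast

lemma theta_simple_zero:
  assumes "l \<in> \<Lambda>"
  obtains r g where "r > 0" "g holomorphic_on ball l r" "\<And>z. z \<in> ball l r \<Longrightarrow> g z \<noteq> 0"
    "\<And>z. z \<in> ball l r \<Longrightarrow> \<theta> z = g z * (z - l)"
proof -
  have z1: "zorder \<theta> l = 1" using theta assms unfolding odd_jacobi_theta_def by blast
  \<comment> \<open>The point 1/2 witnesses that \<theta> does not vanish identically, which the
    factorization at a zero of given order presupposes.\<close>
  have "of_real (1/2) \<notin> \<Lambda>"
  proof
    assume "of_real (1/2) \<in> \<Lambda>"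
    then obtain a b where *: "of_real (1/2) = of_int a + of_int b * \<tau>" by (rule latticeE)
    have "b = 0" using arg_cong[OF *, of Im] tau by simp
    then have "1/2 = real_of_int a" using arg_cong[OF *, of Re] by simp
    then have "real_of_int (2 * a) = real_of_int 1" by simp
    then have "2 * a = 1" by (simp only: of_int_eq_iff)
    then show False by presburger
  qed
  then have "\<exists>w\<in>UNIV. \<theta> w \<noteq> 0" using theta_eq_0_iff by blast
  from zorder_exist_zero[OF theta_holomorphic[of UNIV] open_UNIV connected_UNIV UNIV_I this, of l] z1
  obtain r where r: "r > 0" "zor_poly \<theta> l holomorphic_on cball l r"
    "\<And>w. w \<in> cball l r \<Longrightarrow> \<theta> w = zor_poly \<theta> l w * (w - l) \<and> zor_poly \<theta> l w \<noteq> 0"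
    by auto
  show ?thesis
    by (rule that[of r "zor_poly \<theta> l"]) (use r in \<open>auto intro: holomorphic_on_subset\<close>)
qed

definition kronecker :: "complex \<Rightarrow> complex \<Rightarrow> complex" where
  "kronecker x s = \<theta> (x + s) / (\<theta> x * \<theta> s)"

lemma theta_quotient_add_1: "\<theta> (z + 1 + w) / \<theta> (z + 1) = \<theta> (z + w) / \<theta> z"
  using theta_add_1[of "z + w"] theta_add_1[of z] by (simp add: add_ac)

text \<open>At a zero of \<theta> both quotients are 0 by the convention for division, so the
  identity holds for all \<open>z\<close>; this later makes \<open>phi\<close> periodic at every
  point.\<close>

lemma theta_quotient_add_tau:
  "\<theta> (z + \<tau> + w) / \<theta> (z + \<tau>) = exp (- 2 * pi * \<i> * w) * (\<theta> (z + w) / \<theta> z)"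
proof -
  have "exp (- 2 * pi * \<i> * (z + w)) = exp (- 2 * pi * \<i> * w) * exp (- 2 * pi * \<i> * z)"
    by (simp add: algebra_simps flip: exp_add)
  then show ?thesis using theta_add_tau[of "z + w"] theta_add_tau[of z]
    by (simp add: add_ac)
qed

lemma kronecker_add_1: "kronecker (x + 1) s = kronecker x s"
  unfolding kronecker_def divide_divide_eq_left[symmetric] theta_quotient_add_1 ..

lemma kronecker_add_tau: "kronecker (x + \<tau>) s = exp (- 2 * pi * \<i> * s) * kronecker x s"
  unfolding kronecker_def divide_divide_eq_left[symmetric] theta_quotient_add_tau by simp

definition kronecker_det :: "nat set \<Rightarrow> (nat \<Rightarrow> complex) \<Rightarrow> (nat \<Rightarrow> complex) \<Rightarrow> complex \<Rightarrow> complex" where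
  "kronecker_det S x y s =
    (\<Sum>\<sigma> | \<sigma> permutes S. of_int (sign \<sigma>) * (\<Prod>i\<in>S. kronecker (x i - y (\<sigma> i)) s))"

text \<open>The opposite orders of \<open>i\<close> and \<open>j\<close> in the two factors make the
  term symmetric. So it depends only on the unordered pair, and a new index may be inserted at any
  position.\<close>

definition cauchy_numerator :: "nat set \<Rightarrow> (nat \<Rightarrow> complex) \<Rightarrow> (nat \<Rightarrow> complex) \<Rightarrow> complex" where
  "cauchy_numerator S x y = (\<Prod>i\<in>S. \<Prod>j | j \<in> S \<and> i < j. \<theta> (x i - x j) * \<theta> (y j - y i))"

lemma cauchy_numerator_cong:
  assumes "\<And>i. i \<in> S \<Longrightarrow> x i = x' i" "\<And>i. i \<in> S \<Longrightarrow> y i = y' i"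
  shows "cauchy_numerator S x y = cauchy_numerator S x' y'"
  unfolding cauchy_numerator_def using assms by (intro prod.cong refl) auto

lemma cauchy_numerator_insert:
  assumes "finite S" "a \<notin> S"
  shows "cauchy_numerator (insert a S) x y
    = cauchy_numerator S x y * (\<Prod>i\<in>S. \<theta> (x i - x a) * \<theta> (y a - y i))"
proof -
  let ?f = "\<lambda>i j. \<theta> (x i - x j) * \<theta> (y j - y i)"
  have f: "?f i j = ?f j i" for i j
    using theta_diff_commute[of "x i" "x j"] theta_diff_commute[of "y i" "y j"] by simp
  have a: "(\<Prod>j | j \<in> insert a S \<and> a < j. ?f a j) = (\<Prod>j\<in>S. if a < j then ?f j a else 1)"
  proof -
    have "(\<Prod>j | j \<in> insert a S \<and> a < j. ?f a j) = (\<Prod>j\<in>S \<inter> {j. a < j}. ?f a j)"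
      by (rule prod.cong) auto
    also have "\<dots> = (\<Prod>j\<in>S. if a < j then ?f a j else 1)"
      using assms prod.inter_restrict[of S "?f a" "{j. a < j}"] by simp
    finally show ?thesis using f by (simp cong: if_cong)
  qed
  have i: "(\<Prod>j | j \<in> insert a S \<and> i < j. ?f i j)
      = (if i < a then ?f i a else 1) * (\<Prod>j | j \<in> S \<and> i < j. ?f i j)" if "i \<in> S" for i
  proof (cases "i < a")
    case True
    then have "{j. j \<in> insert a S \<and> i < j} = insert a {j. j \<in> S \<and> i < j}" by auto
    then show ?thesis using True assms by simp
  next
    case False
    then have "{j. j \<in> insert a S \<and> i < j} = {j. j \<in> S \<and> i < j}" by auto
    then show ?thesis using False by simp
  qed
  have "cauchy_numerator (insert a S) x y
      = (\<Prod>j\<in>S. if a < j then ?f j a else 1) * (\<Prod>i\<in>S. (if i < a then ?f i a else 1) * (\<Prod>j | j \<in> S \<and> i < j. ?f i j))"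
    unfolding cauchy_numerator_def using assms a i by (simp cong: prod.cong)
  also have "\<dots> = cauchy_numerator S x y * (\<Prod>i\<in>S. (if a < i then ?f i a else 1) * (if i < a then ?f i a else 1))"
    unfolding cauchy_numerator_def prod.distrib by (simp add: mult_ac)
  also have "(\<Prod>i\<in>S. (if a < i then ?f i a else 1) * (if i < a then ?f i a else 1)) = (\<Prod>i\<in>S. ?f i a)"
    using assms by (intro prod.cong) auto
  finally show ?thesis .
qed

text \<open>Expansion along row \<open>a\<close>. For \<open>b \<noteq> a\<close> the minor has
  column \<open>a\<close> in the place of column \<open>b\<close>, which keeps it indexed by
  \<open>S\<close> and costs one transposition, whence the sign.\<close>

lemma kronecker_det_insert:
  assumes "finite S" "a \<notin> S"
  shows "kronecker_det (insert a S) x y s = (\<Sum>b\<in>insert a S. (if b = a then 1 else - 1) *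
    kronecker (x a - y b) s * kronecker_det S x (y(b := y a)) s)"
proof -
  have "kronecker_det (insert a S) x y s = (\<Sum>b\<in>insert a S. \<Sum>q | q permutes S.
      of_int (sign (Transposition.transpose a b \<circ> q)) *
      (\<Prod>i\<in>insert a S. kronecker (x i - y ((Transposition.transpose a b \<circ> q) i)) s))"
    unfolding kronecker_det_def by (rule sum_over_permutations_insert[OF assms])
  also have "\<dots> = (\<Sum>b\<in>insert a S. \<Sum>q | q permutes S. (if b = a then 1 else - 1) *
      kronecker (x a - y b) s * (of_int (sign q) * (\<Prod>i\<in>S. kronecker (x i - (y(b := y a)) (q i)) s)))"
  proof (intro sum.cong refl)
    fix b q assume b: "b \<in> insert a S" and q: "q \<in> {q. q permutes S}"
    then have p: "q permutes S" by simp
    have sg: "sign (Transposition.transpose a b \<circ> q) = (if b = a then 1 else - 1) * sign q"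
    proof -
      have "permutation q" using p assms(1) permutation_permutes by blast
      then show ?thesis by (simp add: sign_compose permutation_swap_id sign_swap_id)
    qed
    have qa: "q a = a" using p assms(2) by (rule permutes_not_in)
    have "kronecker (x i - y ((Transposition.transpose a b \<circ> q) i)) s = kronecker (x i - (y(b := y a)) (q i)) s"
      if "i \<in> S" for i
    proof -
      have "q i \<in> S" using p that by (simp add: permutes_in_image)
      then have "q i \<noteq> a" using assms(2) by auto
      then show ?thesis by (auto simp: Transposition.transpose_def)
    qed
    then show "of_int (sign (Transposition.transpose a b \<circ> q)) *
      (\<Prod>i\<in>insert a S. kronecker (x i - y ((Transposition.transpose a b \<circ> q) i)) s)
      = (if b = a then 1 else - 1) * kronecker (x a - y b) s *
        (of_int (sign q) * (\<Prod>i\<in>S. kronecker (x i - (y(b := y a)) (q i)) s))"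
      using assms by (simp add: sg qa)
  qed
  finally show ?thesis by (simp add: kronecker_det_def sum_distrib_left)
qed

definition cauchy_product :: "nat set \<Rightarrow> (nat \<Rightarrow> complex) \<Rightarrow> (nat \<Rightarrow> complex) \<Rightarrow> complex \<Rightarrow> complex" where
  "cauchy_product S x y s = \<theta> (s + (\<Sum>i\<in>S. x i - y i)) / \<theta> s * cauchy_numerator S x y
    / (\<Prod>i\<in>S. \<Prod>j\<in>S. \<theta> (x i - y j))"

text \<open>
  As functions of \<open>z = x a\<close>, the determinant and the product have the same quasi-periods and the
  same residues at the points \<open>y b\<close>.
\<close>

theorem frobenius_determinant:
  assumes "finite S" and s: "s \<notin> \<Lambda>"
    and "\<And>i j. i \<in> S \<Longrightarrow> j \<in> S \<Longrightarrow> x i - y j \<notin> \<Lambda>"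
    and "\<And>i j. i \<in> S \<Longrightarrow> j \<in> S \<Longrightarrow> i \<noteq> j \<Longrightarrow> y i - y j \<notin> \<Lambda>"
  shows "kronecker_det S x y s = cauchy_product S x y s"
  using assms(1,3,4)
proof (induction S arbitrary: x y rule: finite_induct)
  case empty
  then show ?case using s by (simp add: kronecker_det_def cauchy_product_def cauchy_numerator_def theta_eq_0_iff)
next
  case (insert a S)
  define ep where "ep = (\<lambda>b. if b = a then 1 else - 1 :: complex)"
  define det where "det = (\<lambda>b. kronecker_det S x (y(b := y a)) s)"
  \<comment> \<open>All factors of \<open>cauchy_product (insert a S) x y s\<close> that do not
    involve \<open>x a\<close>; the remaining ones are \<open>num\<close> and \<open>den\<close> at
    \<open>x a\<close>.\<close>
  define K where "K = cauchy_numerator S x y * (\<Prod>i\<in>S. \<theta> (y a - y i)) /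
    (\<theta> s * (\<Prod>i\<in>S. \<Prod>j\<in>S. \<theta> (x i - y j)) * (\<Prod>i\<in>S. \<theta> (x i - y a)))"
  define W where "W = s + (\<Sum>i\<in>S. x i - y i)"
  define num where "num = (\<lambda>z. \<theta> (z - y a + W) * (\<Prod>i\<in>S. \<theta> (x i - z)))"
  define den where "den = (\<lambda>z. \<Prod>j\<in>insert a S. \<theta> (z - y j))"
  define f where "f = (\<lambda>z. (\<Sum>b\<in>insert a S. ep b * kronecker (z - y b) s * det b) - K * num z / den z)"
  define D where "D = translates \<tau> (y ` insert a S)"
  have ths: "\<theta> s \<noteq> 0" using s theta_eq_0_iff by simp
  have finD: "finite (y ` insert a S)" using insert by simp
  have nz: "\<theta> (z - y j) \<noteq> 0" if "z \<notin> D" "j \<in> insert a S" for z j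
    using that by (auto simp: theta_eq_0_iff translates_iff D_def)
  have xa: "x a \<notin> D" using insert.prems(1)[of a] by (auto simp: translates_iff D_def)
  have f_xa: "f (x a) = kronecker_det (insert a S) x y s - cauchy_product (insert a S) x y s"
  proof -
    have "(\<Sum>b\<in>insert a S. ep b * kronecker (x a - y b) s * det b) = kronecker_det (insert a S) x y s"
      unfolding kronecker_det_insert[OF insert.hyps(1,2)] by (simp add: ep_def det_def)
    moreover have "K * num (x a) / den (x a) = cauchy_product (insert a S) x y s"
    proof -
      have "(\<Prod>i\<in>insert a S. \<Prod>j\<in>insert a S. \<theta> (x i - y j))
          = den (x a) * ((\<Prod>i\<in>S. \<Prod>j\<in>S. \<theta> (x i - y j)) * (\<Prod>i\<in>S. \<theta> (x i - y a)))"
        using insert.hyps by (simp add: den_def prod.distrib)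
      moreover have "s + (\<Sum>i\<in>insert a S. x i - y i) = x a - y a + W"
        using insert.hyps by (simp add: W_def)
      ultimately show ?thesis
        unfolding cauchy_product_def K_def num_def
        using cauchy_numerator_insert[OF insert.hyps(1,2), of x y] by (simp add: prod.distrib mult_ac)
    qed
    ultimately show ?thesis by (simp add: f_def)
  qed
  have "f (x a) = 0"
  proof (rule quasi_periodic_eq_0[OF tau finD, folded D_def, OF _ _ _ _ s xa])
    show "f holomorphic_on - D"
      unfolding f_def kronecker_def num_def den_def using ths nz insert.hyps
      by (intro holomorphic_intros) auto
    \<comment> \<open>In this form every factor is a quotient
      \<open>\<theta> (v + d) / \<theta> v\<close> with multiplier
      \<open>exp (- 2 * pi * \<i> * d)\<close> for \<tau>. The shifts \<open>d\<close> add up to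
      \<open>s\<close>, as they do for \<open>kronecker\<close>.\<close>
    have quot: "num z / den z = (\<theta> (z - y a + W) / \<theta> (z - y a)) *
        (\<Prod>i\<in>S. - (\<theta> (z - y i + (y i - x i)) / \<theta> (z - y i)))" for z
    proof -
      have "\<theta> (x i - z) = - \<theta> (z - y i + (y i - x i))" for i
        using theta_diff_commute[of "x i" z] by simp
      then have "(\<Prod>i\<in>S. - (\<theta> (z - y i + (y i - x i)) / \<theta> (z - y i)))
          = (\<Prod>i\<in>S. \<theta> (x i - z) / \<theta> (z - y i))"
        by (simp only: minus_divide_left)
      also have "\<dots> = (\<Prod>i\<in>S. \<theta> (x i - z)) / (\<Prod>i\<in>S. \<theta> (z - y i))"
        by (rule prod_dividef)
      finally show ?thesis
        using insert.hyps by (simp only: num_def den_def prod.insert times_divide_times_eq not_False_eq_True)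
    qed
    show "f (z + 1) = f z" for z
    proof -
      have "num (z + 1) / den (z + 1) = num z / den z"
      proof -
        have A: "\<theta> (z + 1 - y b + w) / \<theta> (z + 1 - y b) = \<theta> (z - y b + w) / \<theta> (z - y b)" for b w
          using theta_quotient_add_1[of "z - y b" w] by (simp add: diff_add_eq)
        show ?thesis unfolding quot A ..
      qed
      moreover have "kronecker (z + 1 - y b) s = kronecker (z - y b) s" for b
        using kronecker_add_1[of "z - y b" s] by (simp add: diff_add_eq)
      ultimately show ?thesis unfolding f_def times_divide_eq_right[symmetric] by simp
    qed
    show "f (z + \<tau>) = exp (- 2 * pi * \<i> * s) * f z" for z
    proof -
      have A: "\<theta> (z + \<tau> - y b + w) / \<theta> (z + \<tau> - y b)
          = exp (- 2 * pi * \<i> * w) * (\<theta> (z - y b + w) / \<theta> (z - y b))" for b w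
        using theta_quotient_add_tau[of "z - y b" w] by (simp add: diff_add_eq)
      have "num (z + \<tau>) / den (z + \<tau>) = (exp (- 2 * pi * \<i> * W) * (\<theta> (z - y a + W) / \<theta> (z - y a))) *
        (\<Prod>i\<in>S. - (exp (- 2 * pi * \<i> * (y i - x i)) * (\<theta> (z - y i + (y i - x i)) / \<theta> (z - y i))))"
        unfolding quot A ..
      also have "\<dots> = (exp (- 2 * pi * \<i> * W) * (\<Prod>i\<in>S. exp (- 2 * pi * \<i> * (y i - x i)))) * (num z / den z)"
        unfolding quot mult_minus_right[symmetric] prod.distrib by (simp only: mult_ac)
      also have "exp (- 2 * pi * \<i> * W) * (\<Prod>i\<in>S. exp (- 2 * pi * \<i> * (y i - x i))) = exp (- 2 * pi * \<i> * s)"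
      proof -
        have "exp (- 2 * pi * \<i> * W) * (\<Prod>i\<in>S. exp (- 2 * pi * \<i> * (y i - x i)))
            = exp (- 2 * pi * \<i> * (W + (\<Sum>i\<in>S. y i - x i)))"
        proof -
          have "(\<Prod>i\<in>S. exp (- 2 * pi * \<i> * (y i - x i))) = exp (- 2 * pi * \<i> * (\<Sum>i\<in>S. y i - x i))"
            by (simp only: exp_sum[OF insert.hyps(1), symmetric] sum_distrib_left)
          then show ?thesis by (simp only: distrib_left exp_add)
        qed
        moreover have "W + (\<Sum>i\<in>S. y i - x i) = s" by (simp add: W_def sum_subtractf)
        ultimately show ?thesis by simp
      qed
      finally have "num (z + \<tau>) / den (z + \<tau>) = exp (- 2 * pi * \<i> * s) * (num z / den z)" .
      moreover have "kronecker (z + \<tau> - y b) s = exp (- 2 * pi * \<i> * s) * kronecker (z - y b) s" for b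
        using kronecker_add_tau[of "z - y b" s] by (simp add: diff_add_eq)
      ultimately show ?thesis unfolding f_def times_divide_eq_right[symmetric]
        by (simp add: right_diff_distrib sum_distrib_left mult_ac)
    qed
    fix p assume "p \<in> y ` insert a S"
    then obtain b where b: "b \<in> insert a S" "p = y b" by auto
    let ?R = "insert a S - {b}"
    \<comment> \<open>This is \<open>f z * \<theta> (z - y b)\<close> with the pole at
      \<open>y b\<close> cleared. Its vanishing at \<open>p\<close> says that the residues of the
      determinant and of the product agree there.\<close>
    define N where "N = (\<lambda>z. ep b * (\<theta> (z - y b + s) / \<theta> s) * det b
      + (\<Sum>c\<in>?R. ep c * kronecker (z - y c) s * det c) * \<theta> (z - y b)
      - K * num z / (\<Prod>j\<in>?R. \<theta> (z - y j)))"
    obtain r where r: "r > 0" "ball p r - {p} \<subseteq> - D"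
      using translates_punctured_ball[OF tau finD, folded D_def, of 1 p] by auto
    have nzR: "\<theta> (z - y c) \<noteq> 0" if "z \<in> ball p r" "c \<in> ?R" for z c
    proof (cases "z = p")
      case True
      then show ?thesis using insert.prems(2)[of b c] b that by (auto simp: theta_eq_0_iff)
    next
      case False
      then show ?thesis using nz[of z c] r that by auto
    qed
    have hN: "N holomorphic_on ball p r"
      unfolding N_def kronecker_def num_def using ths nzR insert.hyps
      by (intro holomorphic_intros) auto
    have "N p = 0"
    proof -
      define Tb where "Tb = S - {b}"
      have finT: "finite Tb" "b \<notin> Tb" "a \<notin> Tb" using insert.hyps by (auto simp: Tb_def)
      have IH: "det b = cauchy_product S x (y(b := y a)) s"
        unfolding det_def
      proof (rule insert.IH)
        fix i j assume "i \<in> S" "j \<in> S"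
        then show "x i - (y(b := y a)) j \<notin> \<Lambda>" using insert.prems(1) by auto
      next
        fix i j assume "i \<in> S" "j \<in> S" "i \<noteq> j"
        then show "(y(b := y a)) i - (y(b := y a)) j \<notin> \<Lambda>" using insert.prems(2) insert.hyps by auto
      qed
      have N: "N p = ep b * det b - K * num p / (\<Prod>j\<in>?R. \<theta> (p - y j))"
        using ths by (simp add: N_def b(2) theta_0)
      have nzp: "(\<Prod>j\<in>?R. \<theta> (p - y j)) \<noteq> 0" using nzR[of p] r insert.hyps by (simp del: Diff_insert0)
      have nz1: "(\<Prod>i\<in>S. \<Prod>j\<in>S. \<theta> (x i - y j)) \<noteq> 0" "(\<Prod>i\<in>S. \<theta> (x i - y a)) \<noteq> 0"
        using insert.prems(1) insert.hyps by (auto simp: theta_eq_0_iff)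
      show ?thesis
      proof (cases "b = a")
        case True
        then have R: "?R = S" "S - {a} = S" using insert.hyps by auto
        have "num p = \<theta> W * (\<Prod>i\<in>S. \<theta> (x i - y a))" by (simp add: num_def b(2) True)
        moreover have "(\<Prod>j\<in>?R. \<theta> (p - y j)) = (\<Prod>i\<in>S. \<theta> (y a - y i))" by (simp add: R b(2) True)
        moreover have "det b = \<theta> W / \<theta> s * cauchy_numerator S x y / (\<Prod>i\<in>S. \<Prod>j\<in>S. \<theta> (x i - y j))"
          using IH True by (simp add: cauchy_product_def W_def)
        ultimately show ?thesis using nzp nz1 ths by (simp add: N True ep_def K_def field_simps)
      next
        case False
        then have bS: "b \<in> S" using b by simp
        then have SI: "S = insert b Tb" by (auto simp: Tb_def)
        have R: "?R = insert a Tb" using False insert.hyps by (auto simp: Tb_def)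
        let ?y = "y(b := y a)"
        have num_p: "num p = \<theta> (y b - y a + W) * (\<theta> (x b - y b) * (\<Prod>i\<in>Tb. \<theta> (x i - y b)))"
          using finT by (simp add: num_def b(2) SI)
        have prodR: "(\<Prod>j\<in>?R. \<theta> (p - y j)) = \<theta> (y b - y a) * (\<Prod>i\<in>Tb. \<theta> (y b - y i))"
          using finT by (simp add: R b(2))
        have q1: "cauchy_numerator S x y = cauchy_numerator Tb x y *
            ((\<Prod>i\<in>Tb. \<theta> (x i - x b)) * (\<Prod>i\<in>Tb. \<theta> (y b - y i)))"
          unfolding SI using cauchy_numerator_insert[OF finT(1,2)] by (simp add: prod.distrib)
        have q2: "cauchy_numerator S x ?y = cauchy_numerator Tb x y *
            ((\<Prod>i\<in>Tb. \<theta> (x i - x b)) * (\<Prod>i\<in>Tb. \<theta> (y a - y i)))"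
        proof -
          have "cauchy_numerator Tb x ?y = cauchy_numerator Tb x y"
            using finT by (intro cauchy_numerator_cong) auto
          moreover have "(\<Prod>i\<in>Tb. \<theta> (?y b - ?y i)) = (\<Prod>i\<in>Tb. \<theta> (y a - y i))"
            using finT by (intro prod.cong) auto
          ultimately show ?thesis
            unfolding SI using cauchy_numerator_insert[OF finT(1,2), of x ?y] by (simp add: prod.distrib)
        qed
        have dS: "(\<Prod>i\<in>S. \<Prod>j\<in>S. \<theta> (x i - y j)) = (\<Prod>i\<in>S. \<theta> (x i - y b)) * (\<Prod>i\<in>S. \<Prod>j\<in>Tb. \<theta> (x i - y j))"
          using finT by (simp add: SI prod.distrib)
        have dS': "(\<Prod>i\<in>S. \<Prod>j\<in>S. \<theta> (x i - ?y j)) = (\<Prod>i\<in>S. \<theta> (x i - y a)) * (\<Prod>i\<in>S. \<Prod>j\<in>Tb. \<theta> (x i - y j))"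
        proof -
          have "(\<Prod>j\<in>S. \<theta> (x i - ?y j)) = \<theta> (x i - y a) * (\<Prod>j\<in>Tb. \<theta> (x i - y j))" for i
            using finT by (simp add: SI) (auto intro!: prod.cong)
          then show ?thesis by (simp add: prod.distrib)
        qed
        have sum': "s + (\<Sum>i\<in>S. x i - ?y i) = y b - y a + W"
        proof -
          have "(\<Sum>i\<in>Tb. x i - ?y i) = (\<Sum>i\<in>Tb. x i - y i)" using finT by (intro sum.cong) auto
          then show ?thesis using finT by (simp add: SI W_def)
        qed
        have pS: "(\<Prod>i\<in>S. \<theta> (y a - y i)) = \<theta> (y a - y b) * (\<Prod>i\<in>Tb. \<theta> (y a - y i))"
          "(\<Prod>i\<in>S. \<theta> (x i - y b)) = \<theta> (x b - y b) * (\<Prod>i\<in>Tb. \<theta> (x i - y b))"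
          using finT by (simp_all add: SI)
        have det_b: "det b = \<theta> (y b - y a + W) / \<theta> s * (cauchy_numerator Tb x y *
            ((\<Prod>i\<in>Tb. \<theta> (x i - x b)) * (\<Prod>i\<in>Tb. \<theta> (y a - y i))))
            / ((\<Prod>i\<in>S. \<theta> (x i - y a)) * (\<Prod>i\<in>S. \<Prod>j\<in>Tb. \<theta> (x i - y j)))"
          unfolding IH cauchy_product_def q2 dS' sum' ..
        have ab: "\<theta> (y a - y b) = - \<theta> (y b - y a)" by (rule theta_diff_commute)
        have nz2: "\<theta> (y b - y a) \<noteq> 0" "(\<Prod>i\<in>Tb. \<theta> (y b - y i)) \<noteq> 0"
          using nzp unfolding prodR by auto
        have nz3: "\<theta> (x b - y b) \<noteq> 0" "(\<Prod>i\<in>Tb. \<theta> (x i - y b)) \<noteq> 0"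
          "(\<Prod>i\<in>S. \<Prod>j\<in>Tb. \<theta> (x i - y j)) \<noteq> 0"
          using nz1(1) unfolding dS pS by auto
        have "K * num p / (\<Prod>j\<in>?R. \<theta> (p - y j)) = - det b"
          unfolding K_def num_p prodR q1 dS pS det_b ab
          using nz2 nz3 nz1(2) ths by (simp add: divide_simps)
        then show ?thesis using False by (simp add: N ep_def)
      qed
    qed
    have hT: "(\<lambda>z. \<theta> (z - y b)) holomorphic_on ball p r" by (intro holomorphic_intros)
    have dT: "deriv (\<lambda>z. \<theta> (z - y b)) p = 1"
    proof -
      have "(\<theta> has_field_derivative 1) (at (p - y b))"
        using holomorphic_derivI[OF theta_holomorphic[of UNIV], of 0] deriv_theta_0 b(2) by simp
      then have "((\<lambda>z. \<theta> (z - y b)) has_field_derivative 1 * 1) (at p)"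
        by (rule DERIV_chain2) (auto intro!: derivative_eq_intros)
      then show ?thesis by (simp add: DERIV_imp_deriv)
    qed
    obtain r' h where r': "r' > 0" "r' \<le> r" "h holomorphic_on ball p r'"
      "\<And>z. z \<in> ball p r' - {p} \<Longrightarrow> \<theta> (z - y b) \<noteq> 0 \<and> N z / \<theta> (z - y b) = h z"
      by (rule removable_simple_zero[OF hN hT r(1) \<open>N p = 0\<close>]) (use b(2) dT theta_0 in auto)
    have "f z = h z" if z: "z \<in> ball p r' - {p}" for z
    proof -
      have t: "\<theta> (z - y b) \<noteq> 0" using r' z by blast
      have zr: "z \<in> ball p r" using z r' by auto
      have "den z = \<theta> (z - y b) * (\<Prod>j\<in>?R. \<theta> (z - y j))"
        unfolding den_def using b(1) insert.hyps by (subst prod.remove[of _ b]) auto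
      moreover have "(\<Sum>c\<in>insert a S. ep c * kronecker (z - y c) s * det c)
          = ep b * kronecker (z - y b) s * det b + (\<Sum>c\<in>?R. ep c * kronecker (z - y c) s * det c)"
        using b(1) insert.hyps by (subst sum.remove[of _ b]) auto
      ultimately have "f z = N z / \<theta> (z - y b)"
        unfolding f_def N_def using t
        by (simp add: kronecker_def[of "z - y b"] diff_divide_distrib add_divide_distrib mult.commute[of "\<theta> (z - y b)"])
      then show ?thesis using r' z by auto
    qed
    then show "\<exists>r>0. \<exists>h. h holomorphic_on ball p r \<and> (\<forall>z\<in>ball p r - {p}. f z = h z)"
      using r' by blast
  qed
  then show ?case using f_xa by simp
qed

end

section \<open>Convolution of Kronecker functions\<close>

lemma Ck_on_compose_affine:
  fixes e :: real
  assumes "Ck_on k S f" "\<And>z. z \<in> T \<Longrightarrow> c + of_real e * z \<in> S"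
  shows "Ck_on k T (\<lambda>z. f (c + of_real e * z))"
  using assms(1)
proof (induction k arbitrary: f)
  case 0
  then have "continuous_on S f" by simp
  then show ?case
    unfolding Ck_on.simps
    by (rule continuous_on_compose2) (use assms(2) in \<open>auto intro!: continuous_intros\<close>)
next
  case (Suc k)
  obtain fx fy where f: "\<And>z. z \<in> S \<Longrightarrow> (f has_derivative (\<lambda>h. of_real (Re h) * fx z + of_real (Im h) * fy z)) (at z)"
    "Ck_on k S fx" "Ck_on k S fy" using Ck_on_SucE[OF Suc.prems(1)] by blast
  show ?case
  proof (rule Ck_on_SucI)
    show "((\<lambda>z. f (c + of_real e * z)) has_derivative (\<lambda>h. of_real (Re h) * (of_real e * fx (c + of_real e * z))
      + of_real (Im h) * (of_real e * fy (c + of_real e * z)))) (at z)" if z: "z \<in> T" for z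
    proof -
      have "((\<lambda>z. c + of_real e * z) has_derivative (\<lambda>h. of_real e * h)) (at z)"
        by (auto intro!: derivative_eq_intros)
      from has_derivative_compose[OF this f(1)[OF assms(2)[OF z]]]
      show ?thesis by (rule has_derivative_eq_rhs) (simp add: algebra_simps)
    qed
    show "Ck_on k T (\<lambda>z. of_real e * fx (c + of_real e * z))" "Ck_on k T (\<lambda>z. of_real e * fy (c + of_real e * z))"
      by (intro Ck_on_mult Ck_on_const Suc.IH f)+
  qed
qed

lemma smooth_on_reflect:
  assumes "smooth_on S f" "\<And>z. z \<in> T \<Longrightarrow> c - z \<in> S"
  shows "smooth_on T (\<lambda>z. f (c - z))"
  using assms Ck_on_compose_affine[of _ S f T c "-1"] by (auto simp: smooth_on_def)

lemma smooth_on_translate: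
  assumes "smooth_on S f" "\<And>z. z \<in> T \<Longrightarrow> z - c \<in> S"
  shows "smooth_on T (\<lambda>z. f (z - c))"
  using assms Ck_on_compose_affine[of _ S f T "-c" 1] by (auto simp: smooth_on_def)

lemma simple_pole_at_translate:
  assumes "simple_pole_at f (p - c)"
  shows "simple_pole_at (\<lambda>z. f (z - c)) p"
proof -
  obtain r g where g: "r > 0" "smooth_on (ball (p - c) r) g"
    "\<And>z. z \<in> ball (p - c) r - {p - c} \<Longrightarrow> f z = g z / (z - (p - c))"
    using assms unfolding simple_pole_at_def by blast
  have i: "z - c \<in> ball (p - c) r" if "z \<in> ball p r" for z
    using that by (simp add: dist_norm)
  have "f (z - c) = g (z - c) / (z - p)" if "z \<in> ball p r - {p}" for z
    using g(3)[of "z - c"] i[of z] that by auto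
  moreover have "smooth_on (ball p r) (\<lambda>z. g (z - c))"
    using g(2) i by (rule smooth_on_translate)
  ultimately show ?thesis unfolding simple_pole_at_def using g(1) by blast
qed

lemma bounded_pole_at_translate:
  assumes "bounded_pole_at f (p - c)"
  shows "bounded_pole_at (\<lambda>z. f (z - c)) p"
proof -
  obtain r g where g: "r > 0" "smooth_on (ball (p - c) r) g" "g (p - c) = 0"
    "\<And>z. z \<in> ball (p - c) r - {p - c} \<Longrightarrow> f z = g z / (z - (p - c))"
    using assms unfolding bounded_pole_at_def by blast
  have i: "z - c \<in> ball (p - c) r" if "z \<in> ball p r" for z
    using that by (simp add: dist_norm)
  have "f (z - c) = g (z - c) / (z - p)" if "z \<in> ball p r - {p}" for z
    using g(4)[of "z - c"] i[of z] that by auto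
  moreover have "smooth_on (ball p r) (\<lambda>z. g (z - c))"
    using g(2) i by (rule smooth_on_translate)
  ultimately show ?thesis unfolding bounded_pole_at_def using g(1,3) by blast
qed

lemma simple_pole_at_reflect:
  assumes "simple_pole_at f (c - p)"
  shows "simple_pole_at (\<lambda>z. f (c - z)) p"
proof -
  obtain r g where g: "r > 0" "smooth_on (ball (c - p) r) g"
    "\<And>z. z \<in> ball (c - p) r - {c - p} \<Longrightarrow> f z = g z / (z - (c - p))"
    using assms unfolding simple_pole_at_def by blast
  have i: "c - z \<in> ball (c - p) r" if "z \<in> ball p r" for z
    using that by (simp add: dist_norm norm_minus_commute)
  have "f (c - z) = (- 1) * g (c - z) / (z - p)" if "z \<in> ball p r - {p}" for z
    proof -
    have "z \<noteq> p" "p \<noteq> z" using that by auto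
    then show ?thesis using g(3)[of "c - z"] i[of z] that by (simp add: field_simps)
  qed
  moreover have "smooth_on (ball p r) (\<lambda>z. (- 1) * g (c - z))"
    by (intro smooth_on_mult smooth_on_const smooth_on_reflect[OF g(2)] i)
  ultimately show ?thesis unfolding simple_pole_at_def using g(1) by blast
qed

lemma bounded_pole_at_reflect:
  assumes "bounded_pole_at f (c - p)"
  shows "bounded_pole_at (\<lambda>z. f (c - z)) p"
proof -
  obtain r g where g: "r > 0" "smooth_on (ball (c - p) r) g" "g (c - p) = 0"
    "\<And>z. z \<in> ball (c - p) r - {c - p} \<Longrightarrow> f z = g z / (z - (c - p))"
    using assms unfolding bounded_pole_at_def by blast
  have i: "c - z \<in> ball (c - p) r" if "z \<in> ball p r" for z
    using that by (simp add: dist_norm norm_minus_commute)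
  have "f (c - z) = (- 1) * g (c - z) / (z - p)" if "z \<in> ball p r - {p}" for z
    proof -
    have "z \<noteq> p" "p \<noteq> z" using that by auto
    then show ?thesis using g(4)[of "c - z"] i[of z] that by (simp add: field_simps)
  qed
  moreover have "smooth_on (ball p r) (\<lambda>z. (- 1) * g (c - z))"
    by (intro smooth_on_mult smooth_on_const smooth_on_reflect[OF g(2)] i)
  ultimately show ?thesis unfolding bounded_pole_at_def using g(1,3)
    by (intro exI[of _ r] conjI exI[of _ "\<lambda>z. (- 1) * g (c - z)"]) auto
qed

definition smooth_at :: "(complex \<Rightarrow> complex) \<Rightarrow> complex \<Rightarrow> bool" where
  "smooth_at f p \<longleftrightarrow> (\<exists>r>0. smooth_on (ball p r) f)"

lemma smooth_at_open: "smooth_on S f \<Longrightarrow> open S \<Longrightarrow> p \<in> S \<Longrightarrow> smooth_at f p"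
  unfolding smooth_at_def by (meson open_contains_ball smooth_on_subset)

lemma smooth_at_translate:
  assumes "smooth_at f (p - c)" shows "smooth_at (\<lambda>z. f (z - c)) p"
proof -
  obtain r where r: "r > 0" "smooth_on (ball (p - c) r) f" using assms unfolding smooth_at_def by blast
  have "smooth_on (ball p r) (\<lambda>z. f (z - c))"
    by (rule smooth_on_translate[OF r(2)]) (simp add: dist_norm)
  then show ?thesis using r unfolding smooth_at_def by blast
qed

lemma smooth_at_reflect:
  assumes "smooth_at f (c - p)" shows "smooth_at (\<lambda>z. f (c - z)) p"
proof -
  obtain r where r: "r > 0" "smooth_on (ball (c - p) r) f" using assms unfolding smooth_at_def by blast
  have "smooth_on (ball p r) (\<lambda>z. f (c - z))"
    by (rule smooth_on_reflect[OF r(2)]) (simp add: dist_norm norm_minus_commute)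
  then show ?thesis using r unfolding smooth_at_def by blast
qed

lemma bounded_pole_at_imp_simple_pole_at: "bounded_pole_at f p \<Longrightarrow> simple_pole_at f p"
  unfolding bounded_pole_at_def simple_pole_at_def by blast

lemma smooth_at_imp_bounded_pole_at:
  assumes "smooth_at f p" shows "bounded_pole_at f p"
proof -
  obtain r where r: "r > 0" "smooth_on (ball p r) f" using assms unfolding smooth_at_def by blast
  have "smooth_on (ball p r) (\<lambda>z. f z * (z - p))"
    by (intro smooth_on_mult r smooth_on_holomorphic holomorphic_intros) auto
  then show ?thesis unfolding bounded_pole_at_def using r
    by (intro exI[of _ r] conjI exI[of _ "\<lambda>z. f z * (z - p)"]) auto
qed

lemma smooth_at_mult:
  assumes "smooth_at f p" "smooth_at g p"
  shows "smooth_at (\<lambda>z. f z * g z) p"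
proof -
  obtain r where r: "r > 0" "smooth_on (ball p r) f" using assms(1) unfolding smooth_at_def by blast
  obtain s where s: "s > 0" "smooth_on (ball p s) g" using assms(2) unfolding smooth_at_def by blast
  have "smooth_on (ball p (min r s)) (\<lambda>z. f z * g z)"
    by (intro smooth_on_mult smooth_on_subset[OF r(2)] smooth_on_subset[OF s(2)]) auto
  moreover have "min r s > 0" using r s by simp
  ultimately show ?thesis unfolding smooth_at_def by blast
qed

lemma smooth_at_const: "smooth_at (\<lambda>_. c) p"
  unfolding smooth_at_def using smooth_on_const zero_less_one by blast

lemma simple_pole_at_mult:
  assumes "simple_pole_at f p" "smooth_at h p"
  shows "simple_pole_at (\<lambda>z. f z * h z) p"
proof -
  obtain r g where g: "r > 0" "smooth_on (ball p r) g" "\<And>z. z \<in> ball p r - {p} \<Longrightarrow> f z = g z / (z - p)"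
    using assms(1) unfolding simple_pole_at_def by blast
  obtain s where s: "s > 0" "smooth_on (ball p s) h" using assms(2) unfolding smooth_at_def by blast
  have "smooth_on (ball p (min r s)) (\<lambda>z. g z * h z)"
    by (intro smooth_on_mult smooth_on_subset[OF g(2)] smooth_on_subset[OF s(2)]) auto
  then show ?thesis unfolding simple_pole_at_def using g s
    by (intro exI[of _ "min r s"] conjI exI[of _ "\<lambda>z. g z * h z"]) auto
qed

lemma bounded_pole_at_mult:
  assumes "bounded_pole_at f p" "smooth_at h p"
  shows "bounded_pole_at (\<lambda>z. f z * h z) p"
proof -
  obtain r g where g: "r > 0" "smooth_on (ball p r) g" "g p = 0"
    "\<And>z. z \<in> ball p r - {p} \<Longrightarrow> f z = g z / (z - p)"
    using assms(1) unfolding bounded_pole_at_def by blast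
  obtain s where s: "s > 0" "smooth_on (ball p s) h" using assms(2) unfolding smooth_at_def by blast
  have "smooth_on (ball p (min r s)) (\<lambda>z. g z * h z)"
    by (intro smooth_on_mult smooth_on_subset[OF g(2)] smooth_on_subset[OF s(2)]) auto
  then show ?thesis unfolding bounded_pole_at_def using g s
    by (intro exI[of _ "min r s"] conjI exI[of _ "\<lambda>z. g z * h z"]) auto
qed

lemma bounded_pole_at_add:
  assumes "bounded_pole_at f p" "bounded_pole_at g p"
  shows "bounded_pole_at (\<lambda>z. f z + g z) p"
proof -
  obtain r f' where f: "r > 0" "smooth_on (ball p r) f'" "f' p = 0"
    "\<And>z. z \<in> ball p r - {p} \<Longrightarrow> f z = f' z / (z - p)"
    using assms(1) unfolding bounded_pole_at_def by blast
  obtain s g' where g: "s > 0" "smooth_on (ball p s) g'" "g' p = 0"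
    "\<And>z. z \<in> ball p s - {p} \<Longrightarrow> g z = g' z / (z - p)"
    using assms(2) unfolding bounded_pole_at_def by blast
  have "smooth_on (ball p (min r s)) (\<lambda>z. f' z + g' z)"
    by (intro smooth_on_add smooth_on_subset[OF f(2)] smooth_on_subset[OF g(2)]) auto
  then show ?thesis unfolding bounded_pole_at_def using f g
    by (intro exI[of _ "min r s"] conjI exI[of _ "\<lambda>z. f' z + g' z"]) (auto simp: add_divide_distrib)
qed

lemma higher_deriv_exp_cmult: "(deriv ^^ n) (\<lambda>s. exp (k * s)) = (\<lambda>s. k ^ n * exp (k * s :: complex))"
proof (induction n)
  case (Suc n)
  have "deriv (\<lambda>s. k ^ n * exp (k * s)) s = k ^ Suc n * exp (k * s)" for s
    by (rule DERIV_imp_deriv) (auto intro!: derivative_eq_intros)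
  then show ?case using Suc by auto
qed simp

context jacobi_theta
begin

section \<open>The doubly periodic Kronecker function and its Taylor coefficients\<close>

definition cc :: complex where "cc = of_real (pi / Im \<tau>)"

lemma cc_nonzero: "cc \<noteq> 0"
  using tau by (simp add: cc_def)

text \<open>This fixes the constant in \<open>phi\<close>: the exponential factor then cancels the
  multiplier of \<open>kronecker\<close> for \<tau>, and it is unchanged by the translation by
  1.\<close>

lemma cc_tau: "cc * (cnj \<tau> - \<tau>) = - 2 * pi * \<i>"
  using tau by (simp add: cc_def complex_eq_iff)

definition phi :: "complex \<Rightarrow> complex \<Rightarrow> complex" where
  "phi x s = exp (- cc * (cnj x - x) * s) * kronecker x s"

lemma phi_add_1: "phi (x + 1) = phi x"
  by (auto simp: phi_def kronecker_add_1 fun_eq_iff)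

lemma phi_add_tau: "phi (x + \<tau>) = phi x"
proof
  fix s
  have "exp (- cc * (cnj (x + \<tau>) - (x + \<tau>)) * s)
      = exp (- cc * (cnj x - x) * s) * exp (- (cc * (cnj \<tau> - \<tau>)) * s)"
    by (simp add: algebra_simps flip: exp_add)
  also have "exp (- (cc * (cnj \<tau> - \<tau>)) * s) = exp (2 * pi * \<i> * s)"
    unfolding cc_tau by simp
  finally have "phi (x + \<tau>) s = exp (- cc * (cnj x - x) * s) * kronecker x s *
      (exp (2 * pi * \<i> * s) * exp (- 2 * pi * \<i> * s))"
    unfolding phi_def kronecker_add_tau by (simp only: mult_ac)
  also have "exp (2 * pi * \<i> * s) * exp (- 2 * pi * \<i> * s) = 1"
    by (simp flip: exp_add)
  finally show "phi (x + \<tau>) s = phi x s" by (simp add: phi_def)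
qed

text \<open>The Taylor coefficient of \<open>phi x\<close> at the point \<open>s\<close>. The point
  precedes \<open>x\<close> because \<open>s\<close> is fixed during the integration and these are
  then functions on the torus.\<close>

definition coeff_phi :: "nat \<Rightarrow> complex \<Rightarrow> complex \<Rightarrow> complex" where
  "coeff_phi n s x = (deriv ^^ n) (phi x) s / fact n"

lemma coeff_phi_periodic: "l \<in> \<Lambda> \<Longrightarrow> coeff_phi n s (x + l) = coeff_phi n s x"
  by (rule lattice_periodic) (simp_all add: coeff_phi_def phi_add_1 phi_add_tau)

text \<open>Leibniz' rule separates the dependence on \<open>x\<close>: \<open>hol_coeff\<close> is
  entire in \<open>x\<close>, \<open>exp_coeff\<close> carries the whole dependence on
  \<open>cnj x\<close>, and the poles come only from the remaining factor
  \<open>1 / \<theta> x\<close>.\<close>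

definition hol_coeff :: "nat \<Rightarrow> complex \<Rightarrow> complex \<Rightarrow> complex" where
  "hol_coeff m s x = (deriv ^^ m) (\<lambda>s. \<theta> (x + s) / \<theta> s) s / fact m"

definition exp_coeff :: "nat \<Rightarrow> complex \<Rightarrow> complex \<Rightarrow> complex" where
  "exp_coeff i s x = (- cc * (cnj x - x)) ^ i * exp (- cc * (cnj x - x) * s) / fact i"

definition num_coeff :: "nat \<Rightarrow> complex \<Rightarrow> complex \<Rightarrow> complex" where
  "num_coeff n s x = (\<Sum>i\<le>n. exp_coeff i s x * hol_coeff (n - i) s x)"

lemma open_lattice_compl: "open (- \<Lambda>)"
proof -
  have "translates \<tau> {0} = \<Lambda>" by (auto simp: translates_iff)
  then show ?thesis using closed_translates'[OF tau, of "{0}"] by (simp add: open_Compl)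
qed

lemma coeff_phi_eq:
  assumes s: "s \<notin> \<Lambda>"
  shows "coeff_phi n s x = num_coeff n s x / \<theta> x"
proof -
  have f: "(\<lambda>s. exp (- cc * (cnj x - x) * s)) holomorphic_on - \<Lambda>" by (intro holomorphic_intros)
  have g: "(\<lambda>s. \<theta> (x + s) / \<theta> s) holomorphic_on - \<Lambda>"
    by (intro holomorphic_intros) (auto simp: theta_eq_0_iff)
  have "phi x = (\<lambda>s. (1 / \<theta> x) * (exp (- cc * (cnj x - x) * s) * (\<theta> (x + s) / \<theta> s)))"
    by (simp add: phi_def kronecker_def fun_eq_iff)
  then have "(deriv ^^ n) (phi x) s = (1 / \<theta> x) * (deriv ^^ n) (\<lambda>s. exp (- cc * (cnj x - x) * s) * (\<theta> (x + s) / \<theta> s)) s"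
    using higher_deriv_cmult[OF holomorphic_on_mult[OF f g] _ open_lattice_compl, of s n "1 / \<theta> x"] s by simp
  also have "(deriv ^^ n) (\<lambda>s. exp (- cc * (cnj x - x) * s) * (\<theta> (x + s) / \<theta> s)) s
      = (\<Sum>i = 0..n. of_nat (n choose i) * (deriv ^^ i) (\<lambda>s. exp (- cc * (cnj x - x) * s)) s *
          (deriv ^^ (n - i)) (\<lambda>s. \<theta> (x + s) / \<theta> s) s)"
    using higher_deriv_mult[OF f g open_lattice_compl, of s n] s by simp
  also have "\<dots> = (\<Sum>i\<le>n. fact n * (exp_coeff i s x * hol_coeff (n - i) s x))"
  proof (rule sum.cong)
    fix i assume i: "i \<in> {..n}"
    then have "of_nat (n choose i) = (fact n / (fact i * fact (n - i)) :: complex)"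
      by (simp add: binomial_fact)
    then show "of_nat (n choose i) * (deriv ^^ i) (\<lambda>s. exp (- cc * (cnj x - x) * s)) s *
          (deriv ^^ (n - i)) (\<lambda>s. \<theta> (x + s) / \<theta> s) s = fact n * (exp_coeff i s x * hol_coeff (n - i) s x)"
      unfolding higher_deriv_exp_cmult exp_coeff_def hol_coeff_def by simp
  qed auto
  also have "\<dots> = fact n * num_coeff n s x" by (simp add: num_coeff_def sum_distrib_left)
  finally show ?thesis by (simp add: coeff_phi_def)
qed

lemma hol_coeff_holomorphic:
  assumes s: "s \<notin> \<Lambda>"
  shows "hol_coeff m s holomorphic_on UNIV"
proof -
  have "hol_coeff m s = (\<lambda>x. (\<Sum>i = 0..m. of_nat (m choose i) * (deriv ^^ i) \<theta> (x + s) *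
      (deriv ^^ (m - i)) (\<lambda>s. inverse (\<theta> s)) s) / fact m)"
  proof
    fix x
    have f: "(\<lambda>s. \<theta> (x + s)) holomorphic_on - \<Lambda>" by (intro holomorphic_intros)
    have g: "(\<lambda>s. inverse (\<theta> s)) holomorphic_on - \<Lambda>"
      by (intro holomorphic_intros) (auto simp: theta_eq_0_iff)
    have "(deriv ^^ m) (\<lambda>s. \<theta> (x + s) / \<theta> s) s = (\<Sum>i = 0..m. of_nat (m choose i) *
        (deriv ^^ i) (\<lambda>s. \<theta> (x + s)) s * (deriv ^^ (m - i)) (\<lambda>s. inverse (\<theta> s)) s)"
      using higher_deriv_mult[OF f g open_lattice_compl, of s m] s by (simp add: divide_inverse)
    moreover have "(deriv ^^ i) (\<lambda>s. \<theta> (x + s)) s = (deriv ^^ i) \<theta> (x + s)" for i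
      using higher_deriv_compose_linear'[OF theta_holomorphic[of UNIV] open_UNIV open_UNIV UNIV_I, where u = 1 and c = x and z = s]
      by (simp add: add.commute)
    ultimately show "hol_coeff m s x = (\<Sum>i = 0..m. of_nat (m choose i) * (deriv ^^ i) \<theta> (x + s) *
      (deriv ^^ (m - i)) (\<lambda>s. inverse (\<theta> s)) s) / fact m" by (simp add: hol_coeff_def)
  qed
  moreover have "(\<lambda>x. (deriv ^^ i) \<theta> (x + s)) holomorphic_on UNIV" for i
  proof -
    have "((deriv ^^ i) \<theta> \<circ> (\<lambda>x. x + s)) holomorphic_on UNIV"
      by (rule holomorphic_on_compose_gen[where t = UNIV])
        (auto intro!: holomorphic_intros holomorphic_higher_deriv theta_holomorphic)
    then show ?thesis by (simp add: o_def)
  qed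
  then have "(\<lambda>x. (\<Sum>i = 0..m. of_nat (m choose i) * (deriv ^^ i) \<theta> (x + s) *
      (deriv ^^ (m - i)) (\<lambda>s. inverse (\<theta> s)) s) / fact m) holomorphic_on UNIV"
    by (intro holomorphic_on_divide holomorphic_on_sum holomorphic_on_mult holomorphic_on_const) auto
  ultimately show ?thesis by simp
qed

lemma hol_coeff_0:
  assumes s: "s \<notin> \<Lambda>"
  shows "hol_coeff m s 0 = (if m = 0 then 1 else 0)"
proof -
  have "(\<lambda>s. \<theta> (0 + s) / \<theta> s) holomorphic_on - \<Lambda>"
    by (intro holomorphic_intros) (auto simp: theta_eq_0_iff)
  then have "(deriv ^^ m) (\<lambda>s. \<theta> (0 + s) / \<theta> s) s = (deriv ^^ m) (\<lambda>s. 1) s"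
    by (rule higher_deriv_transform_within_open[OF _ _ open_lattice_compl])
      (use s in \<open>auto simp: theta_eq_0_iff\<close>)
  then show ?thesis by (simp add: hol_coeff_def)
qed

text \<open>For \<open>x = 0\<close> the function of \<open>s\<close> whose coefficients these are
  is constantly 1 off the lattice. Since \<open>\<theta>\<close> has derivative 1 at 0, the
  coefficient of order 0 has residue 1 there, and the higher ones stay bounded.\<close>

lemma num_coeff_0:
  assumes s: "s \<notin> \<Lambda>"
  shows "num_coeff n s 0 = (if n = 0 then 1 else 0)"
proof -
  have "num_coeff n s 0 = (\<Sum>i\<le>n. if i = 0 then hol_coeff n s 0 else 0)"
    unfolding num_coeff_def by (rule sum.cong) (auto simp: exp_coeff_def)
  also have "\<dots> = hol_coeff n s 0" by (simp add: sum.delta)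
  finally show ?thesis using hol_coeff_0[OF s] by simp
qed

lemma exp_coeff_smooth: "smooth_on S (exp_coeff i s)"
proof -
  have d: "smooth_on S (\<lambda>x. - cc * (cnj x + - 1 * x))"
    by (intro smooth_on_mult smooth_on_add smooth_on_const smooth_on_cnj
        smooth_on_subset[OF smooth_on_holomorphic[OF holomorphic_on_ident open_UNIV]]) auto
  have "smooth_on S (\<lambda>x. ((- cc * (cnj x + - 1 * x)) ^ i * exp ((- cc * (cnj x + - 1 * x)) * s)) * (1 / fact i))"
    by (intro smooth_on_mult smooth_on_power smooth_on_exp d smooth_on_const)
  moreover have "exp_coeff i s = (\<lambda>x. ((- cc * (cnj x + - 1 * x)) ^ i * exp ((- cc * (cnj x + - 1 * x)) * s)) * (1 / fact i))"
    by (simp add: exp_coeff_def fun_eq_iff)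
  ultimately show ?thesis by simp
qed

lemma num_coeff_smooth:
  assumes s: "s \<notin> \<Lambda>"
  shows "smooth_on S (num_coeff n s)"
  unfolding num_coeff_def[abs_def]
proof (rule smooth_on_sum, rule smooth_on_mult[OF exp_coeff_smooth])
  show "smooth_on S (hol_coeff (n - i) s)" for i
    by (rule smooth_on_subset[OF smooth_on_holomorphic[OF hol_coeff_holomorphic[OF s] open_UNIV]]) simp
qed

lemma inverse_theta_holomorphic: "(\<lambda>x. inverse (\<theta> x)) holomorphic_on - \<Lambda>"
  by (intro holomorphic_intros) (auto simp: theta_eq_0_iff)

lemma coeff_phi_eq':
  "s \<notin> \<Lambda> \<Longrightarrow> coeff_phi n s = (\<lambda>x. num_coeff n s x * inverse (\<theta> x))"
  by (simp add: coeff_phi_eq fun_eq_iff divide_inverse)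

lemma coeff_phi_smooth:
  assumes s: "s \<notin> \<Lambda>"
  shows "smooth_on (- \<Lambda>) (coeff_phi n s)"
  unfolding coeff_phi_eq'[OF s]
  by (rule smooth_on_mult[OF num_coeff_smooth[OF s]
        smooth_on_holomorphic[OF inverse_theta_holomorphic open_lattice_compl]])

lemma coeff_phi_smooth_at: "s \<notin> \<Lambda> \<Longrightarrow> p \<notin> \<Lambda> \<Longrightarrow> smooth_at (coeff_phi n s) p"
  by (rule smooth_at_open[OF coeff_phi_smooth open_lattice_compl]) auto

lemma theta_pole:
  assumes "l \<in> \<Lambda>"
  obtains r h where "r > 0" "h holomorphic_on ball l r" "\<And>z. z \<in> ball l r - {l} \<Longrightarrow> inverse (\<theta> z) = h z / (z - l)"
proof -
  obtain r g where g: "r > 0" "g holomorphic_on ball l r" "\<And>z. z \<in> ball l r \<Longrightarrow> g z \<noteq> 0"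
    "\<And>z. z \<in> ball l r \<Longrightarrow> \<theta> z = g z * (z - l)"
    using theta_simple_zero[OF assms] by metis
  show ?thesis
    by (rule that[of r "\<lambda>z. inverse (g z)"])
      (use g in \<open>auto intro!: holomorphic_intros simp: divide_simps\<close>)
qed

lemma coeff_phi_simple_pole:
  assumes s: "s \<notin> \<Lambda>"
  shows "simple_pole_at (coeff_phi n s) p"
proof (cases "p \<in> \<Lambda>")
  case True
  obtain r h where h: "r > 0" "h holomorphic_on ball p r"
    "\<And>z. z \<in> ball p r - {p} \<Longrightarrow> inverse (\<theta> z) = h z / (z - p)" using theta_pole[OF True] by metis
  have "smooth_on (ball p r) (\<lambda>z. num_coeff n s z * h z)"
    by (intro smooth_on_mult num_coeff_smooth[OF s] smooth_on_holomorphic[OF h(2)]) auto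
  then show ?thesis unfolding simple_pole_at_def using h
    by (intro exI[of _ r] conjI exI[of _ "\<lambda>z. num_coeff n s z * h z"])
      (auto simp: coeff_phi_eq[OF s] divide_inverse[of _ "\<theta> _"])
next
  case False
  then show ?thesis
    by (intro bounded_pole_at_imp_simple_pole_at smooth_at_imp_bounded_pole_at coeff_phi_smooth_at[OF s])
qed

text \<open>Proved at 0, where \<open>num_coeff_0\<close> gives the zero of the numerator, and moved
  to the other lattice points by periodicity of the quotient, because the numerator alone is not
  periodic.\<close>

lemma coeff_phi_bounded_pole:
  assumes s: "s \<notin> \<Lambda>" and n: "n \<ge> 1"
  shows "bounded_pole_at (coeff_phi n s) p"
proof (cases "p \<in> \<Lambda>")
  case True
  obtain r h where h: "r > 0" "h holomorphic_on ball 0 r"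
    "\<And>z. z \<in> ball 0 r - {0} \<Longrightarrow> inverse (\<theta> z) = h z / (z - 0)" using theta_pole[of 0] lattice_0 by metis
  have "smooth_on (ball 0 r) (\<lambda>z. num_coeff n s z * h z)"
    by (intro smooth_on_mult num_coeff_smooth[OF s] smooth_on_holomorphic[OF h(2)]) auto
  then have "bounded_pole_at (coeff_phi n s) (p - p)" unfolding bounded_pole_at_def using h n
    by (intro exI[of _ r] conjI exI[of _ "\<lambda>z. num_coeff n s z * h z"])
      (auto simp: coeff_phi_eq[OF s] divide_inverse[of _ "\<theta> _"] num_coeff_0[OF s])
  from bounded_pole_at_translate[OF this] show ?thesis
    using coeff_phi_periodic[OF lattice_minus[OF True], of n s] by simp
next
  case False
  then show ?thesis by (intro smooth_at_imp_bounded_pole_at coeff_phi_smooth_at[OF s])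
qed

text \<open>\<open>exp_coeff i s x\<close> is the coefficient of \<open>t ^ i\<close> in
  \<open>exp (- cc * (cnj x - x) * (s + t))\<close>, and the derivative of this exponential with
  respect to \<open>cnj x\<close> is \<open>- cc * (s + t)\<close> times itself. The factor
  \<open>t\<close> lowers the order by one.\<close>

lemma exp_coeff_wirtinger:
  "\<exists>a. has_wirtinger (exp_coeff i s) x a (- cc * s * exp_coeff i s x - cc * (if i = 0 then 0 else exp_coeff (i - 1) s x))"
proof -
  have w: "has_wirtinger (\<lambda>x. cnj x - x) x (0 - 1) (1 - 0)"
    by (intro has_wirtinger_diff has_wirtinger_cnj has_wirtinger_holomorphic) (auto intro!: derivative_eq_intros)
  define D where "D = (\<lambda>u. - cc * s * ((- cc * u) ^ i * exp (- cc * u * s) / fact i)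
      - cc * (if i = 0 then 0 else (- cc * u) ^ (i - 1) * exp (- cc * u * s) / fact (i - 1)))"
  have "((\<lambda>u. (- cc * u) ^ i * exp (- cc * u * s) / fact i) has_field_derivative D u) (at u)" for u
  proof (cases i)
    case 0
    then show ?thesis unfolding D_def by (auto intro!: derivative_eq_intros)
  next
    case (Suc j)
    have fs: "(fact (Suc j) :: complex) = of_nat (Suc j) * fact j" by simp
    have "((\<lambda>u. (- cc * u) ^ i * exp (- cc * u * s) / fact i) has_field_derivative
      (of_nat (Suc j) * (- cc * u) ^ j * (- cc) * exp (- cc * u * s)
        + exp (- cc * u * s) * (- cc * s) * (- cc * u) ^ Suc j) / fact (Suc j)) (at u)"
      unfolding Suc
    proof (rule DERIV_cdivide)
      have "((\<lambda>u. (- cc * u) ^ Suc j) has_field_derivative of_nat (Suc j) * (- cc * u) ^ j * (- cc)) (at u)"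
        by (rule derivative_eq_intros refl | simp)+
      moreover have "((\<lambda>u. exp (- cc * u * s)) has_field_derivative exp (- cc * u * s) * (- cc * s)) (at u)"
        by (auto intro!: derivative_eq_intros)
      ultimately show "((\<lambda>u. (- cc * u) ^ Suc j * exp (- cc * u * s)) has_field_derivative
        of_nat (Suc j) * (- cc * u) ^ j * (- cc) * exp (- cc * u * s)
        + exp (- cc * u * s) * (- cc * s) * (- cc * u) ^ Suc j) (at u)"
        by (rule DERIV_mult)
    qed
    also have "(of_nat (Suc j) * (- cc * u) ^ j * (- cc) * exp (- cc * u * s)
        + exp (- cc * u * s) * (- cc * s) * (- cc * u) ^ Suc j) / fact (Suc j) = D u"
    proof -
      have "of_nat (Suc j) * (- cc * u) ^ j * (- cc) * exp (- cc * u * s) / fact (Suc j)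
          = - cc * ((- cc * u) ^ j * exp (- cc * u * s) / fact j)"
        unfolding fs by (simp del: of_nat_Suc)
      moreover have "exp (- cc * u * s) * (- cc * s) * (- cc * u) ^ Suc j / fact (Suc j)
          = - cc * s * ((- cc * u) ^ Suc j * exp (- cc * u * s) / fact (Suc j))"
        by (simp only: times_divide_eq_right mult_ac)
      ultimately show ?thesis unfolding add_divide_distrib D_def Suc by simp
    qed
    finally show ?thesis .
  qed
  from has_wirtinger_compose[OF w this]
  have "has_wirtinger (exp_coeff i s) x (D (cnj x - x) * (0 - 1)) (D (cnj x - x) * (1 - 0))"
    by (simp add: exp_coeff_def[abs_def])
  moreover have "D (cnj x - x) * (1 - 0)
      = - cc * s * exp_coeff i s x - cc * (if i = 0 then 0 else exp_coeff (i - 1) s x)"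
    by (simp add: D_def exp_coeff_def)
  ultimately show ?thesis by auto
qed

text \<open>The case distinction matters: on natural numbers \<open>0 - 1\<close> is 0, while the
  coefficient before order 0 must be 0.\<close>

definition coeff_pred :: "nat \<Rightarrow> complex \<Rightarrow> complex \<Rightarrow> complex" where
  "coeff_pred n s x = (if n = 0 then 0 else coeff_phi (n - 1) s x)"

lemma coeff_phi_wirtinger:
  assumes s: "s \<notin> \<Lambda>" and x: "x \<notin> \<Lambda>"
  shows "\<exists>a. has_wirtinger (coeff_phi n s) x a (- cc * s * coeff_phi n s x - cc * coeff_pred n s x)"
proof -
  let ?B = "\<lambda>i. - cc * s * exp_coeff i s x - cc * (if i = 0 then 0 else exp_coeff (i - 1) s x)"
  have "\<forall>i. \<exists>a. has_wirtinger (exp_coeff i s) x a (?B i)" by (intro allI exp_coeff_wirtinger)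
  from choice[OF this] obtain a where a: "\<And>i. has_wirtinger (exp_coeff i s) x (a i) (?B i)" by blast
  have h: "has_wirtinger (hol_coeff m s) x (deriv (hol_coeff m s) x) 0" for m
    using holomorphic_derivI[OF hol_coeff_holomorphic[OF s] open_UNIV UNIV_I] by (rule has_wirtinger_holomorphic)
  have t: "has_wirtinger (\<lambda>x. inverse (\<theta> x)) x (deriv (\<lambda>x. inverse (\<theta> x)) x) 0"
    using holomorphic_derivI[OF inverse_theta_holomorphic open_lattice_compl] x by (intro has_wirtinger_holomorphic) auto
  have "has_wirtinger (num_coeff n s) x
      (\<Sum>i\<le>n. a i * hol_coeff (n - i) s x + exp_coeff i s x * deriv (hol_coeff (n - i) s) x)
      (\<Sum>i\<le>n. ?B i * hol_coeff (n - i) s x + exp_coeff i s x * 0)"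
    unfolding num_coeff_def[abs_def] by (intro has_wirtinger_sum has_wirtinger_mult a h)
  also have "(\<Sum>i\<le>n. ?B i * hol_coeff (n - i) s x + exp_coeff i s x * 0)
      = - cc * s * num_coeff n s x - cc * (if n = 0 then 0 else num_coeff (n - 1) s x)"
  proof -
    have "(\<Sum>i\<le>n. (if i = 0 then 0 else exp_coeff (i - 1) s x) * hol_coeff (n - i) s x)
        = (if n = 0 then 0 else num_coeff (n - 1) s x)"
    proof (cases n)
      case (Suc m)
      then show ?thesis by (simp add: sum.atMost_Suc_shift num_coeff_def del: sum.atMost_Suc)
    qed simp
    moreover have "(\<Sum>i\<le>n. ?B i * hol_coeff (n - i) s x + exp_coeff i s x * 0)
        = - cc * s * num_coeff n s x
          - cc * (\<Sum>i\<le>n. (if i = 0 then 0 else exp_coeff (i - 1) s x) * hol_coeff (n - i) s x)"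
      unfolding num_coeff_def sum_distrib_left sum_subtractf[symmetric]
      by (rule sum.cong) (auto simp: left_diff_distrib)
    ultimately show ?thesis by simp
  qed
  finally have n: "has_wirtinger (num_coeff n s) x
      (\<Sum>i\<le>n. a i * hol_coeff (n - i) s x + exp_coeff i s x * deriv (hol_coeff (n - i) s) x)
      (- cc * s * num_coeff n s x - cc * (if n = 0 then 0 else num_coeff (n - 1) s x))" .
  note e = coeff_phi_eq'[OF s, of n]
  have B: "(- cc * s * num_coeff n s x - cc * (if n = 0 then 0 else num_coeff (n - 1) s x)) * inverse (\<theta> x)
      + num_coeff n s x * 0 = - cc * s * coeff_phi n s x - cc * coeff_pred n s x"
    by (simp add: coeff_pred_def coeff_phi_eq[OF s] divide_inverse algebra_simps)
  from has_wirtinger_mult[OF n t] show ?thesis unfolding B unfolding e by blast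
qed

text \<open>The logarithmic derivative of \<theta> completed to a doubly periodic function; off the
  lattice it is the Eisenstein-Kronecker function of order 1. The common denominator shows that the
  numerator is smooth everywhere and that the residue at 0 is 1.\<close>

definition E1 :: "complex \<Rightarrow> complex" where
  "E1 x = (deriv \<theta> x - cc * (cnj x - x) * \<theta> x) / \<theta> x"

lemma has_wirtinger_dbar_eq: "has_wirtinger f z a b \<Longrightarrow> b = b' \<Longrightarrow> \<exists>a. has_wirtinger f z a b'"
  by blast

lemma deriv_theta_add_1: "deriv \<theta> (z + 1) = - deriv \<theta> z"
proof -
  have d: "(\<theta> has_field_derivative deriv \<theta> w) (at w)" for w
    using holomorphic_derivI[OF theta_holomorphic[of UNIV] open_UNIV UNIV_I] .
  have "((\<lambda>z. \<theta> (z + 1)) has_field_derivative deriv \<theta> (z + 1) * 1) (at z)"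
    by (rule DERIV_chain2[OF d]) (auto intro!: derivative_eq_intros)
  moreover have "((\<lambda>z. \<theta> (z + 1)) has_field_derivative - deriv \<theta> z) (at z)"
    unfolding theta_add_1 by (rule DERIV_minus[OF d])
  ultimately show ?thesis using DERIV_unique by fastforce
qed

lemma deriv_theta_add_tau:
  "deriv \<theta> (z + \<tau>) = - exp (- pi * \<i> * \<tau>) * exp (- 2 * pi * \<i> * z) * (deriv \<theta> z - 2 * pi * \<i> * \<theta> z)"
proof -
  have d: "(\<theta> has_field_derivative deriv \<theta> w) (at w)" for w
    using holomorphic_derivI[OF theta_holomorphic[of UNIV] open_UNIV UNIV_I] .
  have "((\<lambda>z. \<theta> (z + \<tau>)) has_field_derivative deriv \<theta> (z + \<tau>) * 1) (at z)"
    by (rule DERIV_chain2[OF d]) (auto intro!: derivative_eq_intros)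
  moreover have "((\<lambda>z. \<theta> (z + \<tau>)) has_field_derivative
      - exp (- pi * \<i> * \<tau>) * exp (- 2 * pi * \<i> * z) * (deriv \<theta> z - 2 * pi * \<i> * \<theta> z)) (at z)"
    unfolding theta_add_tau by (rule derivative_eq_intros d refl | simp)+ (simp add: algebra_simps)
  ultimately show ?thesis using DERIV_unique by fastforce
qed

lemma E1_periodic: "l \<in> \<Lambda> \<Longrightarrow> E1 (x + l) = E1 x"
proof (rule lattice_periodic)
  show "E1 (z + 1) = E1 z" for z
    unfolding E1_def deriv_theta_add_1 theta_add_1
    by (cases "\<theta> z = 0") (simp_all add: field_simps)
  show "E1 (z + \<tau>) = E1 z" for z
  proof -
    define q where "q = - exp (- pi * \<i> * \<tau>) * exp (- 2 * pi * \<i> * z)"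
    have q: "q \<noteq> 0" by (simp add: q_def)
    have "cc * (cnj (z + \<tau>) - (z + \<tau>)) = cc * (cnj z - z) + cc * (cnj \<tau> - \<tau>)"
      by (simp add: algebra_simps)
    also have "\<dots> = cc * (cnj z - z) - 2 * pi * \<i>" unfolding cc_tau by simp
    finally have e: "cc * (cnj (z + \<tau>) - (z + \<tau>)) = cc * (cnj z - z) - 2 * pi * \<i>" .
    have "E1 (z + \<tau>) = (q * (deriv \<theta> z - 2 * pi * \<i> * \<theta> z) - (cc * (cnj z - z) - 2 * pi * \<i>) * (q * \<theta> z)) / (q * \<theta> z)"
      unfolding E1_def deriv_theta_add_tau theta_add_tau e q_def ..
    also have "q * (deriv \<theta> z - 2 * pi * \<i> * \<theta> z) - (cc * (cnj z - z) - 2 * pi * \<i>) * (q * \<theta> z)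
        = q * (deriv \<theta> z - cc * (cnj z - z) * \<theta> z)" by (simp add: algebra_simps)
    finally show ?thesis using q by (simp add: E1_def)
  qed
qed

lemma deriv_theta_holomorphic: "deriv \<theta> holomorphic_on S"
  using holomorphic_deriv[OF theta_holomorphic[of UNIV] open_UNIV] holomorphic_on_subset by blast

lemma E1_num_smooth: "smooth_on S (\<lambda>x. deriv \<theta> x - cc * (cnj x - x) * \<theta> x)"
proof -
  have "smooth_on UNIV (\<lambda>x. (deriv \<theta> x + cc * x * \<theta> x) + (- cc * cnj x) * \<theta> x)"
    by (intro smooth_on_add smooth_on_mult smooth_on_const smooth_on_cnj
        smooth_on_holomorphic[OF _ open_UNIV] holomorphic_intros deriv_theta_holomorphic theta_holomorphic)
  moreover have "(\<lambda>x. (deriv \<theta> x + cc * x * \<theta> x) + (- cc * cnj x) * \<theta> x)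
      = (\<lambda>x. deriv \<theta> x - cc * (cnj x - x) * \<theta> x)"
    by (simp add: fun_eq_iff algebra_simps)
  ultimately show ?thesis by (metis smooth_on_subset subset_UNIV)
qed

lemma E1_smooth: "smooth_on (- \<Lambda>) E1"
proof -
  have "smooth_on (- \<Lambda>) (\<lambda>x. (deriv \<theta> x - cc * (cnj x - x) * \<theta> x) * inverse (\<theta> x))"
    by (intro smooth_on_mult E1_num_smooth smooth_on_holomorphic[OF inverse_theta_holomorphic open_lattice_compl])
  then show ?thesis by (simp add: E1_def[abs_def] divide_inverse)
qed

lemma E1_smooth_at: "p \<notin> \<Lambda> \<Longrightarrow> smooth_at E1 p"
  by (rule smooth_at_open[OF E1_smooth open_lattice_compl]) auto

lemma E1_wirtinger:
  assumes x: "x \<notin> \<Lambda>"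
  shows "\<exists>a. has_wirtinger E1 x a (- cc)"
proof -
  have t: "has_wirtinger (\<lambda>x. inverse (\<theta> x)) x (deriv (\<lambda>x. inverse (\<theta> x)) x) 0"
    using holomorphic_derivI[OF inverse_theta_holomorphic open_lattice_compl] x by (intro has_wirtinger_holomorphic) auto
  have t1: "has_wirtinger \<theta> x (deriv \<theta> x) 0"
    by (rule has_wirtinger_holomorphic[OF holomorphic_derivI[OF theta_holomorphic[of UNIV] open_UNIV UNIV_I]])
  have t2: "has_wirtinger (deriv \<theta>) x (deriv (deriv \<theta>) x) 0"
    by (rule has_wirtinger_holomorphic[OF holomorphic_derivI[OF deriv_theta_holomorphic[of UNIV] open_UNIV UNIV_I]])
  have w: "has_wirtinger (\<lambda>x. cnj x - x) x (0 - 1) (1 - 0)"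
    by (intro has_wirtinger_diff has_wirtinger_cnj has_wirtinger_holomorphic) (auto intro!: derivative_eq_intros)
  note * = has_wirtinger_mult[OF has_wirtinger_diff[OF t2
        has_wirtinger_mult[OF has_wirtinger_mult[OF has_wirtinger_const[of cc] w] t1]] t]
  have e: "E1 = (\<lambda>z. (deriv \<theta> z - cc * (cnj z - z) * \<theta> z) * inverse (\<theta> z))"
    by (simp add: E1_def fun_eq_iff divide_inverse)
  have "\<theta> x \<noteq> 0" using x theta_eq_0_iff by simp
  then show ?thesis unfolding e by (intro has_wirtinger_dbar_eq[OF *]) simp
qed

lemma torus_integral_imp_eq:
  "torus_integral \<tau> f I \<Longrightarrow> set_lebesgue_integral lborel (fundamental_parallelogram \<tau>) f = I"
  unfolding torus_integral_def by blast

text \<open>The two factors of a convolution have their poles in the different classes of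
  \<open>a\<close> and \<open>b\<close>, so at every point at least one of them is smooth.\<close>

lemma pair_not_both: "b - a \<notin> \<Lambda> \<Longrightarrow> p - a \<in> \<Lambda> \<Longrightarrow> b - p \<notin> \<Lambda>"
  using lattice_add[of "b - p" \<tau> "p - a"] by auto

lemma pair_smooth_at:
  assumes s: "s \<notin> \<Lambda>"
  shows "p - a \<notin> \<Lambda> \<Longrightarrow> smooth_at (\<lambda>u. coeff_phi n s (u - a)) p"
    and "b - p \<notin> \<Lambda> \<Longrightarrow> smooth_at (\<lambda>u. coeff_phi n s (b - u)) p"
  using smooth_at_translate[OF coeff_phi_smooth_at[OF s]] smooth_at_reflect[OF coeff_phi_smooth_at[OF s]]
  by auto

lemma conv_simple_pole:
  assumes s: "s \<notin> \<Lambda>" and ab: "b - a \<notin> \<Lambda>"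
  shows "simple_pole_at (\<lambda>u. coeff_phi n s (u - a) * coeff_phi m s (b - u)) p"
proof (cases "p - a \<in> \<Lambda>")
  case True
  show ?thesis
    by (rule simple_pole_at_mult[OF simple_pole_at_translate[OF coeff_phi_simple_pole[OF s]]
          pair_smooth_at(2)[OF s pair_not_both[OF ab True]]])
next
  case False
  show ?thesis
    using simple_pole_at_mult[OF simple_pole_at_reflect[OF coeff_phi_simple_pole[OF s]]
          pair_smooth_at(1)[OF s False, of n], where c1 = b]
    by (simp add: mult.commute)
qed

lemma conv_bounded_pole:
  assumes s: "s \<notin> \<Lambda>" and ab: "b - a \<notin> \<Lambda>" and n: "n \<ge> 1" and m: "m \<ge> 1 \<or> b - p \<notin> \<Lambda>"
  shows "bounded_pole_at (\<lambda>u. coeff_phi n s (u - a) * coeff_phi m s (b - u)) p"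
proof (cases "b - p \<in> \<Lambda>")
  case False
  show ?thesis
    by (rule bounded_pole_at_mult[OF bounded_pole_at_translate[OF coeff_phi_bounded_pole[OF s n]]
          pair_smooth_at(2)[OF s False]])
next
  case True
  then have F: "p - a \<notin> \<Lambda>" using pair_not_both[OF ab] by auto
  have "m \<ge> 1" using m True by auto
  from bounded_pole_at_mult[OF bounded_pole_at_reflect[OF coeff_phi_bounded_pole[OF s this]]
          pair_smooth_at(1)[OF s F, of n], where c1 = b]
  show ?thesis by (simp add: mult.commute)
qed

lemma translates_pair: "u \<notin> translates \<tau> {a, b} \<Longrightarrow> u - a \<notin> \<Lambda> \<and> b - u \<notin> \<Lambda>"
  using lattice_diff_commute by (auto simp: translates_iff)

lemma conv_smooth:
  assumes s: "s \<notin> \<Lambda>"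
  shows "smooth_on (- translates \<tau> {a, b}) (\<lambda>u. coeff_phi n s (u - a) * coeff_phi m s (b - u))"
  by (intro smooth_on_mult smooth_on_translate[OF coeff_phi_smooth[OF s]] smooth_on_reflect[OF coeff_phi_smooth[OF s]])
    (auto dest: translates_pair)

lemma coeff_phi_reflect_periodic: "l \<in> \<Lambda> \<Longrightarrow> coeff_phi n s (b - (u + l)) = coeff_phi n s (b - u)"
  using coeff_phi_periodic[OF lattice_minus, of l n s "b - u"] by (simp add: algebra_simps)

lemma coeff_phi_translate_periodic: "l \<in> \<Lambda> \<Longrightarrow> coeff_phi n s (u + l - a) = coeff_phi n s (u - a)"
  using coeff_phi_periodic[of l n s "u - a"] by (simp add: algebra_simps)

lemma E1_reflect_periodic: "l \<in> \<Lambda> \<Longrightarrow> E1 (b - (u + l)) = E1 (b - u)"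
  using E1_periodic[OF lattice_minus, of l "b - u"] by (simp add: algebra_simps)

text \<open>Reflection in the second factor reverses the sign of its derivative, so the two terms
  that contain \<open>s\<close> cancel. What is left trades one order of the first factor against
  one of the second.\<close>

lemma conv_wirtinger:
  assumes s: "s \<notin> \<Lambda>" and u: "u \<notin> translates \<tau> {a, b}"
  shows "\<exists>c. has_wirtinger (\<lambda>u. coeff_phi n s (u - a) * coeff_phi m s (b - u)) u c
    (- cc * coeff_pred n s (u - a) * coeff_phi m s (b - u) + cc * coeff_phi n s (u - a) * coeff_pred m s (b - u))"
proof -
  obtain c1 where 1: "has_wirtinger (coeff_phi n s) (u - a) c1
      (- cc * s * coeff_phi n s (u - a) - cc * coeff_pred n s (u - a))"
    using coeff_phi_wirtinger[OF s] translates_pair[OF u] by blast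
  obtain c2 where 2: "has_wirtinger (coeff_phi m s) (b - u) c2
      (- cc * s * coeff_phi m s (b - u) - cc * coeff_pred m s (b - u))"
    using coeff_phi_wirtinger[OF s] translates_pair[OF u] by blast
  note * = has_wirtinger_mult[OF has_wirtinger_translate[OF 1] has_wirtinger_reflect[OF 2]]
  show ?thesis
    by (rule has_wirtinger_dbar_eq[OF *]) (simp add: algebra_simps)
qed

definition conv :: "complex \<Rightarrow> nat \<Rightarrow> nat \<Rightarrow> complex \<Rightarrow> complex \<Rightarrow> complex" where
  "conv s n m a b = set_lebesgue_integral lborel (fundamental_parallelogram \<tau>)
    (\<lambda>u. coeff_phi n s (u - a) * coeff_phi m s (b - u))"

lemma conv_integrable:
  assumes "s \<notin> \<Lambda>" "b - a \<notin> \<Lambda>"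
  shows "set_integrable lborel (fundamental_parallelogram \<tau>) (\<lambda>u. coeff_phi n s (u - a) * coeff_phi m s (b - u))"
  using torus_integrable[OF tau] conv_simple_pole[OF assms] by blast

text \<open>Stokes' theorem for the product of orders \<open>Suc n\<close> and \<open>Suc m\<close>:
  both orders are at least 1, so the product is bounded near both poles.\<close>

lemma conv_shift:
  assumes s: "s \<notin> \<Lambda>" and ab: "b - a \<notin> \<Lambda>"
  shows "conv s n (Suc m) a b = conv s (Suc n) m a b"
proof -
  let ?P = "fundamental_parallelogram \<tau>"
  let ?F = "\<lambda>n m u. coeff_phi n s (u - a) * coeff_phi m s (b - u)"
  have "set_lebesgue_integral lborel ?P (\<lambda>u. - cc * ?F n (Suc m) u + cc * ?F (Suc n) m u) = 0"
  proof (rule integral_dbar_eq_0[OF tau countable_translates conv_smooth[OF s, of a b "Suc n" "Suc m"]])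
    show "bounded_pole_at (?F (Suc n) (Suc m)) p" for p
      by (rule conv_bounded_pole[OF s ab]) auto
    show "\<exists>c. has_wirtinger (?F (Suc n) (Suc m)) u c (- cc * ?F n (Suc m) u + cc * ?F (Suc n) m u)"
      if "u \<notin> translates \<tau> {a, b}" for u
      using conv_wirtinger[OF s that, of "Suc n" "Suc m"] by (simp add: coeff_pred_def mult.assoc)
  qed (simp_all add: coeff_phi_translate_periodic coeff_phi_reflect_periodic)
  then have "- cc * conv s n (Suc m) a b + cc * conv s (Suc n) m a b = 0"
    using conv_integrable[OF s ab] by (simp add: conv_def set_integral_add)
  then have "cc * (conv s (Suc n) m a b - conv s n (Suc m) a b) = 0" by (simp add: algebra_simps)
  then show ?thesis using cc_nonzero by simp
qed

text \<open>Subtracting \<open>E1\<close> with the right coefficient removes the pole at \<open>b\<close> and makes Stokes' theorem applicable.\<close>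

lemma conv_0:
  assumes s: "s \<notin> \<Lambda>" and ab: "b - a \<notin> \<Lambda>"
  shows "conv s n 0 a b = - of_real (Im \<tau>) * coeff_phi (Suc n) s (b - a)"
proof -
  let ?P = "fundamental_parallelogram \<tau>"
  let ?F = "\<lambda>n m u. coeff_phi n s (u - a) * coeff_phi m s (b - u)"
  \<comment> \<open>At \<open>u = b\<close> both \<open>coeff_phi 0 s (b - u)\<close> and
    \<open>E1 (b - u)\<close> have the same residue, so the coefficient is the value at
    \<open>b\<close> of the other factor.\<close>
  define \<kappa> where "\<kappa> = coeff_phi (Suc n) s (b - a)"
  define g where "g = (\<lambda>u. ?F (Suc n) 0 u + (- \<kappa>) * E1 (b - u))"
  have b0: "bounded_pole_at (\<lambda>v. coeff_phi (Suc n) s ((b - a) - v) * coeff_phi 0 s v + (- \<kappa>) * E1 v) (p - p)" for p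
  proof -
    obtain r h where h: "r > 0" "h holomorphic_on ball 0 r"
      "\<And>z. z \<in> ball 0 r - {0} \<Longrightarrow> inverse (\<theta> z) = h z / (z - 0)" using theta_pole[of 0] lattice_0 by metis
    have "smooth_at (\<lambda>v. coeff_phi (Suc n) s ((b - a) - v)) 0"
      using ab by (intro smooth_at_reflect coeff_phi_smooth_at[OF s]) simp
    then obtain r' where r': "r' > 0" "smooth_on (ball 0 r') (\<lambda>v. coeff_phi (Suc n) s ((b - a) - v))"
      unfolding smooth_at_def by blast
    define G where "G = (\<lambda>v. (coeff_phi (Suc n) s ((b - a) - v) * num_coeff 0 s v
        + (- \<kappa>) * (deriv \<theta> v - cc * (cnj v - v) * \<theta> v)) * h v)"
    have "smooth_on (ball 0 (min r r')) G" unfolding G_def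
      by (intro smooth_on_mult smooth_on_add smooth_on_subset[OF r'(2)] num_coeff_smooth[OF s]
          smooth_on_const E1_num_smooth smooth_on_subset[OF smooth_on_holomorphic[OF h(2)]]) auto
    moreover have "G 0 = 0" by (simp add: G_def num_coeff_0[OF s] theta_0 deriv_theta_0 \<kappa>_def)
    moreover have "coeff_phi (Suc n) s ((b - a) - v) * coeff_phi 0 s v + (- \<kappa>) * E1 v = G v / (v - 0)"
      if "v \<in> ball 0 (min r r') - {0}" for v
    proof -
      have "inverse (\<theta> v) = h v / (v - 0)" using h(3) that by auto
      then show ?thesis
        by (simp add: G_def coeff_phi_eq[OF s, of 0] E1_def divide_inverse algebra_simps)
    qed
    ultimately show ?thesis unfolding bounded_pole_at_def using h(1) r'(1)
      by (intro exI[of _ "min r r'"] conjI exI[of _ G]) auto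
  qed
  have bp: "bounded_pole_at g p" for p
  proof (cases "b - p \<in> \<Lambda>")
    case True
    have "bounded_pole_at (\<lambda>v. coeff_phi (Suc n) s ((b - a) - v) * coeff_phi 0 s v + (- \<kappa>) * E1 v) (b - p)"
    proof -
      have "coeff_phi (Suc n) s ((b - a) - (v - (b - p))) = coeff_phi (Suc n) s ((b - a) - v)"
        "coeff_phi 0 s (v - (b - p)) = coeff_phi 0 s v" "E1 (v - (b - p)) = E1 v" for v
        using coeff_phi_reflect_periodic[OF lattice_minus[OF True], of "Suc n" s "b - a" v]
          coeff_phi_periodic[OF lattice_minus[OF True], of 0 s v] E1_periodic[OF lattice_minus[OF True], of v]
        by (simp_all only: add_uminus_conv_diff)
      then show ?thesis using bounded_pole_at_translate[OF b0[of "b - p"]] by (simp only:)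
    qed
    from bounded_pole_at_reflect[OF this] show ?thesis by (simp add: g_def)
  next
    case False
    have "smooth_at (\<lambda>u. - \<kappa> * E1 (b - u)) p"
      by (intro smooth_at_mult smooth_at_const smooth_at_reflect E1_smooth_at False)
    then show ?thesis unfolding g_def
      by (intro bounded_pole_at_add conv_bounded_pole[OF s ab] smooth_at_imp_bounded_pole_at)
        (use False in auto)
  qed
  \<comment> \<open>The derivative of \<open>E1\<close> with respect to \<open>cnj x\<close> is
    constant, so the correction contributes a constant integrand, hence \<open>\<kappa>\<close>
    times the area \<open>Im \<tau>\<close>.\<close>
  have "set_lebesgue_integral lborel ?P (\<lambda>u. - cc * ?F n 0 u + - cc * \<kappa>) = 0"
  proof (rule integral_dbar_eq_0[OF tau countable_translates _ _ _ bp])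
    show "smooth_on (- translates \<tau> {a, b}) g" unfolding g_def
      by (intro smooth_on_add conv_smooth[OF s] smooth_on_mult smooth_on_const smooth_on_reflect[OF E1_smooth])
        (auto dest: translates_pair)
    fix u assume u: "u \<notin> translates \<tau> {a, b}"
    obtain c1 where 1: "has_wirtinger (?F (Suc n) 0) u c1 (- cc * coeff_pred (Suc n) s (u - a) * coeff_phi 0 s (b - u)
        + cc * coeff_phi (Suc n) s (u - a) * coeff_pred 0 s (b - u))"
      using conv_wirtinger[OF s u] by blast
    obtain c2 where 2: "has_wirtinger E1 (b - u) c2 (- cc)"
      using E1_wirtinger translates_pair[OF u] by blast
    note * = has_wirtinger_add[OF 1 has_wirtinger_mult[OF has_wirtinger_const[of "- \<kappa>"] has_wirtinger_reflect[OF 2]]]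
    show "\<exists>c. has_wirtinger g u c (- cc * ?F n 0 u + - cc * \<kappa>)"
      unfolding g_def by (rule has_wirtinger_dbar_eq[OF *]) (simp add: coeff_pred_def)
  qed (simp_all add: g_def coeff_phi_translate_periodic coeff_phi_reflect_periodic E1_reflect_periodic)
  moreover have "set_lebesgue_integral lborel ?P (\<lambda>u. - cc * ?F n 0 u + - cc * \<kappa>)
      = - cc * conv s n 0 a b + of_real (Im \<tau>) * (- cc * \<kappa>)"
  proof -
    have i1: "set_integrable lborel ?P (\<lambda>u. - cc * ?F n 0 u)"
      using conv_integrable[OF s ab, of n 0] by (intro set_integrable_mult_right) auto
    have i2: "set_integrable lborel ?P (\<lambda>u. - cc * \<kappa>)"
      using torus_integral_const[OF tau] torus_integrable[OF tau] unfolding torus_integral_def by blast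
    have "set_lebesgue_integral lborel ?P (\<lambda>u. - cc * ?F n 0 u) = - cc * conv s n 0 a b"
      unfolding conv_def by (rule set_integral_mult_right)
    then show ?thesis
      using set_integral_add(2)[OF i1 i2] torus_integral_imp_eq[OF torus_integral_const[OF tau, of "- cc * \<kappa>"]]
      by (simp only:)
  qed
  ultimately have "- cc * conv s n 0 a b + of_real (Im \<tau>) * (- cc * \<kappa>) = 0" by simp
  then have "cc * conv s n 0 a b = cc * (- of_real (Im \<tau>) * \<kappa>)"
    by (simp add: algebra_simps eq_neg_iff_add_eq_0)
  then show ?thesis using cc_nonzero unfolding \<kappa>_def mult_cancel_left by simp
qed

lemma conv_eq:
  assumes s: "s \<notin> \<Lambda>" and ab: "b - a \<notin> \<Lambda>"
  shows "conv s n m a b = - of_real (Im \<tau>) * coeff_phi (Suc (n + m)) s (b - a)"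
proof (induction m arbitrary: n)
  case 0
  then show ?case using conv_0[OF s ab] by simp
next
  case (Suc m)
  then show ?case using conv_shift[OF s ab, of n m] by simp
qed

lemma torus_integral_conv:
  assumes s: "s \<notin> \<Lambda>" and ab: "b - a \<notin> \<Lambda>"
  shows "torus_integral \<tau> (\<lambda>u. coeff_phi n s (u - a) * coeff_phi m s (b - u))
    (- of_real (Im \<tau>) * coeff_phi (Suc (n + m)) s (b - a))"
  unfolding torus_integral_def
  using conv_smooth[OF s, of a b n m] conv_simple_pole[OF s ab, of n m] conv_eq[OF s ab, of n m]
  by (intro exI[of _ "{a, b}"] conjI allI)
    (simp_all add: coeff_phi_translate_periodic coeff_phi_reflect_periodic conv_def)

section \<open>Integration of the determinant\<close>

text \<open>A pointwise version of \<open>has_iterated_reg_integral\<close>: the exceptional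
  positions are described at every stage by one set \<open>\<Gamma>\<close> of forbidden differences
  instead of an unspecified null set, and every single integral converges absolutely. Linear
  combinations then need no reasoning about null sets.\<close>

primrec generic_torus_integral :: "complex set \<Rightarrow> nat list \<Rightarrow> ((nat \<Rightarrow> complex) \<Rightarrow> complex) \<Rightarrow> complex \<Rightarrow> bool" where
  "generic_torus_integral \<Gamma> [] F I \<longleftrightarrow> F (\<lambda>_. undefined) = I"
| "generic_torus_integral \<Gamma> (k # ks) F I \<longleftrightarrow>
    (\<exists>G. (\<forall>z. (\<forall>i\<in>set ks. \<forall>j\<in>set ks. i \<noteq> j \<longrightarrow> z i - z j \<notin> \<Gamma>) \<longrightarrow>
      torus_integral \<tau> (\<lambda>u. F (z(k := u))) (G z)) \<and> generic_torus_integral \<Gamma> ks G I)"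

lemma generic_torus_integral_add:
  "generic_torus_integral \<Gamma> ks F I \<Longrightarrow> generic_torus_integral \<Gamma> ks F' I' \<Longrightarrow>
    generic_torus_integral \<Gamma> ks (\<lambda>z. F z + F' z) (I + I')"
proof (induction ks arbitrary: F F' I I')
  case (Cons k ks)
  obtain G where G: "generic_torus_integral \<Gamma> ks G I"
    "\<And>z. (\<forall>i\<in>set ks. \<forall>j\<in>set ks. i \<noteq> j \<longrightarrow> z i - z j \<notin> \<Gamma>) \<Longrightarrow> torus_integral \<tau> (\<lambda>u. F (z(k := u))) (G z)"
    using Cons.prems(1) by auto
  obtain G' where G': "generic_torus_integral \<Gamma> ks G' I'"
    "\<And>z. (\<forall>i\<in>set ks. \<forall>j\<in>set ks. i \<noteq> j \<longrightarrow> z i - z j \<notin> \<Gamma>) \<Longrightarrow> torus_integral \<tau> (\<lambda>u. F' (z(k := u))) (G' z)"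
    using Cons.prems(2) by auto
  show ?case
    unfolding generic_torus_integral.simps
    by (intro exI[of _ "\<lambda>z. G z + G' z"] conjI allI impI torus_integral_add[OF tau] G(2) G'(2)
        Cons.IH[OF G(1) G'(1)])
qed simp

lemma generic_torus_integral_cmult:
  "generic_torus_integral \<Gamma> ks F I \<Longrightarrow> generic_torus_integral \<Gamma> ks (\<lambda>z. c * F z) (c * I)"
proof (induction ks arbitrary: F I)
  case (Cons k ks)
  obtain G where G: "generic_torus_integral \<Gamma> ks G I"
    "\<And>z. (\<forall>i\<in>set ks. \<forall>j\<in>set ks. i \<noteq> j \<longrightarrow> z i - z j \<notin> \<Gamma>) \<Longrightarrow> torus_integral \<tau> (\<lambda>u. F (z(k := u))) (G z)"
    using Cons.prems(1) by auto
  show ?case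
    unfolding generic_torus_integral.simps
    by (intro exI[of _ "\<lambda>z. c * G z"] conjI allI impI torus_integral_cmult G(2) Cons.IH[OF G(1)])
qed simp

lemma generic_torus_integral_0: "generic_torus_integral \<Gamma> ks (\<lambda>z. 0) 0"
proof (induction ks)
  case (Cons k ks)
  then show ?case using torus_integral_const[OF tau, of 0]
    unfolding generic_torus_integral.simps by (intro exI[of _ "\<lambda>_. 0"] conjI allI impI) auto
qed simp

lemma generic_torus_integral_sum:
  "finite A \<Longrightarrow> (\<And>i. i \<in> A \<Longrightarrow> generic_torus_integral \<Gamma> ks (F i) (I i)) \<Longrightarrow>
    generic_torus_integral \<Gamma> ks (\<lambda>z. \<Sum>i\<in>A. F i z) (\<Sum>i\<in>A. I i)"
  by (induction A rule: finite_induct) (auto intro: generic_torus_integral_0 generic_torus_integral_add)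

end

text \<open>For a single forbidden value the exceptional set is null by Fubini: once the other
  coordinates are fixed, \<open>z i\<close> has only one possible value. There are countably many
  such sets.\<close>

lemma AE_PiM_diff_notin:
  fixes \<Gamma> :: "complex set"
  assumes I: "finite I" and \<Gamma>: "countable \<Gamma>"
  shows "AE z in PiM I (\<lambda>_. lborel). \<forall>i\<in>I. \<forall>j\<in>I. i \<noteq> j \<longrightarrow> z i - z j \<notin> \<Gamma>"
proof -
  interpret product_sigma_finite "\<lambda>_. lborel :: complex measure" ..
  have "AE z in PiM I (\<lambda>_. lborel). z i - z j \<noteq> \<gamma>" if ij: "i \<in> I" "j \<in> I" "i \<noteq> j" for i j and \<gamma> :: complex
  proof -
    let ?A = "{z \<in> space (PiM I (\<lambda>_. lborel :: complex measure)). z i - z j = \<gamma>}"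
    have A[measurable]: "?A \<in> sets (PiM I (\<lambda>_. lborel))"
    proof -
      have [measurable]: "(\<lambda>z. z i) \<in> borel_measurable (PiM I (\<lambda>_. lborel :: complex measure))"
        "(\<lambda>z. z j) \<in> borel_measurable (PiM I (\<lambda>_. lborel :: complex measure))"
        using measurable_component_singleton[OF ij(1), of "\<lambda>_. lborel :: complex measure"]
          measurable_component_singleton[OF ij(2), of "\<lambda>_. lborel :: complex measure"] by simp_all
      show ?thesis by measurable
    qed
    define J where "J = I - {i}"
    have J: "I = insert i J" "i \<notin> J" "finite J" "j \<in> J" using ij I by (auto simp: J_def)
    have "emeasure (PiM I (\<lambda>_. lborel)) ?A = (\<integral>\<^sup>+z. indicator ?A z \<partial>PiM (insert i J) (\<lambda>_. lborel))"
      using A by (simp add: J(1))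
    also have "\<dots> = (\<integral>\<^sup>+x. (\<integral>\<^sup>+y. indicator ?A (x(i := y)) \<partial>lborel) \<partial>PiM J (\<lambda>_. lborel))"
      using A J by (intro product_nn_integral_insert) (auto simp: J(1))
    also have "\<dots> = (\<integral>\<^sup>+x. 0 \<partial>PiM J (\<lambda>_. lborel :: complex measure))"
    proof (rule nn_integral_cong)
      fix x
      have "(\<integral>\<^sup>+y. indicator ?A (x(i := y)) \<partial>lborel) \<le> (\<integral>\<^sup>+y. indicator {\<gamma> + x j} y \<partial>lborel)"
        using ij(3) by (intro nn_integral_mono) (auto simp: indicator_def algebra_simps)
      also have "\<dots> = 0" by simp
      finally show "(\<integral>\<^sup>+y. indicator ?A (x(i := y)) \<partial>lborel) = 0" by simp
    qed
    finally have "?A \<in> null_sets (PiM I (\<lambda>_. lborel))" using A by (auto simp: null_sets_def)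
    then show ?thesis by (rule AE_I') auto
  qed
  then have *: "AE z in PiM I (\<lambda>_. lborel). \<forall>\<gamma>\<in>\<Gamma>. z i - z j \<noteq> \<gamma>" if "i \<in> I" "j \<in> I" "i \<noteq> j" for i j
    using that \<Gamma> by (subst AE_ball_countable) auto
  have "AE z in PiM I (\<lambda>_. lborel). i \<noteq> j \<longrightarrow> z i - z j \<notin> \<Gamma>" if "i \<in> I" "j \<in> I" for i j
  proof (cases "i = j")
    case False
    from *[OF that this] show ?thesis by eventually_elim auto
  qed simp
  then show ?thesis by (intro AE_finite_allI I)
qed

context jacobi_theta
begin

lemma generic_torus_integral_imp_iterated:
  assumes "countable \<Gamma>" "generic_torus_integral \<Gamma> ks F I"
  shows "has_iterated_reg_integral \<tau> ks F I"
  using assms(2)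
proof (induction ks arbitrary: F)
  case (Cons k ks)
  obtain G where G: "generic_torus_integral \<Gamma> ks G I"
    "\<And>z. (\<forall>i\<in>set ks. \<forall>j\<in>set ks. i \<noteq> j \<longrightarrow> z i - z j \<notin> \<Gamma>) \<Longrightarrow> torus_integral \<tau> (\<lambda>u. F (z(k := u))) (G z)"
    using Cons.prems by auto
  have "AE z in PiM (set ks) (\<lambda>_. lborel). has_reg_integral_E \<tau> (\<lambda>u. F (z(k := u))) (G z)"
    using AE_PiM_diff_notin[OF finite_set assms(1), of ks]
    by eventually_elim (rule torus_integral_imp_reg_integral[OF tau G(2)])
  then show ?case using Cons.IH[OF G(1)] by auto
qed simp

text \<open>The shape that is preserved by integrating out variables: row \<open>i\<close> carries
  the order \<open>p i\<close> and the accumulated parameter \<open>W i\<close>. The original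
  determinant has all orders 0.\<close>

definition cycle_sum :: "nat set \<Rightarrow> (nat \<Rightarrow> nat) \<Rightarrow> (nat \<Rightarrow> complex) \<Rightarrow> complex \<Rightarrow> (nat \<Rightarrow> complex) \<Rightarrow> complex" where
  "cycle_sum S p W s z =
    (\<Sum>\<sigma> | \<sigma> permutes S. of_int (sign \<sigma>) * (\<Prod>i\<in>S. coeff_phi (p i) s (z i + W i - z (\<sigma> i))))"

text \<open>A permutation of \<open>insert k S\<close> is a permutation \<open>q\<close> of
  \<open>S\<close> followed by a transposition of \<open>k\<close> with some \<open>b\<close>. For
  \<open>b = k\<close> the point \<open>k\<close> stays fixed. Otherwise write
  \<open>b = q i\<close>: then \<open>k\<close> is placed on the arrow from \<open>i\<close> to
  \<open>q i\<close>, the sign changes, and \<open>z k\<close> occurs in exactly two factors, which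
  form a convolution.\<close>

lemma cycle_sum_insert:
  assumes S: "finite S" "k \<notin> S"
  shows "cycle_sum (insert k S) p W s (z(k := u)) = (\<Sum>q | q permutes S.
    of_int (sign q) * (coeff_phi (p k) s (W k) * (\<Prod>i\<in>S. coeff_phi (p i) s (z i + W i - z (q i))))
    + (\<Sum>i\<in>S. - (of_int (sign q) * (\<Prod>j\<in>S - {i}. coeff_phi (p j) s (z j + W j - z (q j)))) *
        (coeff_phi (p k) s (u - (z (q i) - W k)) * coeff_phi (p i) s (z i + W i - u))))"
proof -
  let ?z = "z(k := u)"
  let ?t = "\<lambda>\<sigma>. of_int (sign \<sigma>) * (\<Prod>i\<in>insert k S. coeff_phi (p i) s (?z i + W i - ?z (\<sigma> i)))"
  have "cycle_sum (insert k S) p W s ?z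
      = (\<Sum>b\<in>insert k S. \<Sum>q | q permutes S. ?t (Transposition.transpose k b \<circ> q))"
    unfolding cycle_sum_def by (rule sum_over_permutations_insert[OF S])
  also have "\<dots> = (\<Sum>q | q permutes S. \<Sum>b\<in>insert k S. ?t (Transposition.transpose k b \<circ> q))"
    by (rule sum.swap)
  also have "\<dots> = (\<Sum>q | q permutes S. ?t q + (\<Sum>i\<in>S. ?t (Transposition.transpose k (q i) \<circ> q)))"
  proof (rule sum.cong[OF refl])
    fix q assume "q \<in> {q. q permutes S}"
    then have q: "q permutes S" by simp
    have "(\<Sum>b\<in>S. ?t (Transposition.transpose k b \<circ> q)) = (\<Sum>i\<in>S. ?t (Transposition.transpose k (q i) \<circ> q))"
      using sum.reindex_bij_betw[OF permutes_imp_bij[OF q], of "\<lambda>b. ?t (Transposition.transpose k b \<circ> q)"] by simp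
    moreover have "Transposition.transpose k k \<circ> q = q" by simp
    ultimately show "(\<Sum>b\<in>insert k S. ?t (Transposition.transpose k b \<circ> q))
        = ?t q + (\<Sum>i\<in>S. ?t (Transposition.transpose k (q i) \<circ> q))"
      using sum.insert[OF S, of "\<lambda>b. ?t (Transposition.transpose k b \<circ> q)"] by (simp only:)
  qed
  also have "\<dots> = (\<Sum>q | q permutes S.
    of_int (sign q) * (coeff_phi (p k) s (W k) * (\<Prod>i\<in>S. coeff_phi (p i) s (z i + W i - z (q i))))
    + (\<Sum>i\<in>S. - (of_int (sign q) * (\<Prod>j\<in>S - {i}. coeff_phi (p j) s (z j + W j - z (q j)))) *
        (coeff_phi (p k) s (u - (z (q i) - W k)) * coeff_phi (p i) s (z i + W i - u))))"
  proof (rule sum.cong[OF refl])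
    fix q assume "q \<in> {q. q permutes S}"
    then have q: "q permutes S" by simp
    have qk: "q k = k" using q S(2) by (rule permutes_not_in)
    have qS: "q i \<in> S" if "i \<in> S" for i using q that by (simp add: permutes_in_image)
    have qnk: "q i \<noteq> k" if "i \<in> S" for i using qS[OF that] S(2) by auto
    have nk: "i \<noteq> k" if "i \<in> S" for i using that S(2) by auto
    have "(\<Prod>i\<in>S. coeff_phi (p i) s (?z i + W i - ?z (q i))) = (\<Prod>i\<in>S. coeff_phi (p i) s (z i + W i - z (q i)))"
      by (rule prod.cong) (auto simp: nk qnk)
    then have 1: "?t q = of_int (sign q) * (coeff_phi (p k) s (W k) * (\<Prod>i\<in>S. coeff_phi (p i) s (z i + W i - z (q i))))"
      using S by (simp add: qk)
    have 2: "?t (Transposition.transpose k (q i) \<circ> q)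
        = - (of_int (sign q) * (\<Prod>j\<in>S - {i}. coeff_phi (p j) s (z j + W j - z (q j)))) *
        (coeff_phi (p k) s (u - (z (q i) - W k)) * coeff_phi (p i) s (z i + W i - u))" if i: "i \<in> S" for i
    proof -
      let ?\<sigma> = "Transposition.transpose k (q i) \<circ> q"
      have "permutation q" using q S(1) permutation_permutes by blast
      then have sg: "sign ?\<sigma> = - sign q"
        using qnk[OF i] by (simp add: sign_compose permutation_swap_id sign_swap_id)
      have \<sigma>: "?\<sigma> k = q i" "?\<sigma> i = k" by (simp_all add: qk)
      have "?\<sigma> j = q j" if "j \<in> S - {i}" for j
      proof -
        have "q j \<noteq> q i" using that permutes_inj[OF q] by (auto simp: inj_eq)
        then show ?thesis using qnk that by (simp add: Transposition.transpose_def)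
      qed
      then have "(\<Prod>j\<in>S - {i}. coeff_phi (p j) s (?z j + W j - ?z (?\<sigma> j)))
          = (\<Prod>j\<in>S - {i}. coeff_phi (p j) s (z j + W j - z (q j)))"
        using nk qnk by (intro prod.cong) auto
      moreover have "(\<Prod>j\<in>insert k S. coeff_phi (p j) s (?z j + W j - ?z (?\<sigma> j)))
          = coeff_phi (p k) s (u + W k - z (q i)) * (coeff_phi (p i) s (z i + W i - u) *
            (\<Prod>j\<in>S - {i}. coeff_phi (p j) s (?z j + W j - ?z (?\<sigma> j))))"
        using S i nk qnk \<sigma> by (simp add: prod.remove[of S i])
      ultimately show ?thesis unfolding sg by (simp add: algebra_simps)
    qed
    show "?t q + (\<Sum>i\<in>S. ?t (Transposition.transpose k (q i) \<circ> q)) =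
      of_int (sign q) * (coeff_phi (p k) s (W k) * (\<Prod>i\<in>S. coeff_phi (p i) s (z i + W i - z (q i))))
    + (\<Sum>i\<in>S. - (of_int (sign q) * (\<Prod>j\<in>S - {i}. coeff_phi (p j) s (z j + W j - z (q j)))) *
        (coeff_phi (p k) s (u - (z (q i) - W k)) * coeff_phi (p i) s (z i + W i - u)))"
      unfolding 1 by (intro arg_cong2[where f = "(+)"] refl sum.cong 2)
  qed
  finally show ?thesis .
qed

text \<open>Integrating out \<open>z k\<close> closes a fixed point of the permutation or merges \<open>k\<close> into its predecessor \<open>i\<close>.\<close>

lemma torus_integral_cycle_sum:
  assumes s: "s \<notin> \<Lambda>" and S: "finite S" "k \<notin> S"
    and gen: "\<And>i j. i \<in> S \<Longrightarrow> j \<in> S \<Longrightarrow> z i + W i + W k - z j \<notin> \<Lambda>"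
  shows "torus_integral \<tau> (\<lambda>u. cycle_sum (insert k S) p W s (z(k := u)))
    (of_real (Im \<tau>) * (coeff_phi (p k) s (W k) * cycle_sum S p W s z
      + (\<Sum>i\<in>S. cycle_sum S (p(i := Suc (p i + p k))) (W(i := W i + W k)) s z)))"
proof -
  let ?P = "\<lambda>q i. \<Prod>j\<in>S - {i}. coeff_phi (p j) s (z j + W j - z (q j))"
  define A where "A = (\<lambda>q. of_real (Im \<tau>) * (of_int (sign q) *
      (coeff_phi (p k) s (W k) * (\<Prod>i\<in>S. coeff_phi (p i) s (z i + W i - z (q i))))))"
  define B where "B = (\<lambda>q i. - (of_int (sign q) * ?P q i) *
      (- of_real (Im \<tau>) * coeff_phi (Suc (p k + p i)) s (z i + W i - (z (q i) - W k))))"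
  have "torus_integral \<tau> (\<lambda>u. cycle_sum (insert k S) p W s (z(k := u)))
      (\<Sum>q | q permutes S. A q + (\<Sum>i\<in>S. B q i))"
    unfolding cycle_sum_insert[OF S] A_def B_def
  proof (intro torus_integral_sum[OF tau] torus_integral_add[OF tau] torus_integral_const[OF tau]
      torus_integral_cmult torus_integral_conv[OF s] finite_permutations S(1))
    fix q i assume "q \<in> {q. q permutes S}" and i: "i \<in> S"
    then have "q i \<in> S" by (simp add: permutes_in_image)
    then show "z i + W i - (z (q i) - W k) \<notin> \<Lambda>" using gen[OF i, of "q i"] by (simp add: algebra_simps)
  qed
  also have "(\<Sum>q | q permutes S. A q + (\<Sum>i\<in>S. B q i))
      = of_real (Im \<tau>) * (coeff_phi (p k) s (W k) * cycle_sum S p W s z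
      + (\<Sum>i\<in>S. cycle_sum S (p(i := Suc (p i + p k))) (W(i := W i + W k)) s z))"
  proof -
    have a: "(\<Sum>q | q permutes S. A q) = of_real (Im \<tau>) * (coeff_phi (p k) s (W k) * cycle_sum S p W s z)"
      unfolding A_def cycle_sum_def sum_distrib_left by (intro sum.cong refl) (simp add: mult_ac)
    have b: "(\<Sum>q | q permutes S. B q i) = of_real (Im \<tau>) * cycle_sum S (p(i := Suc (p i + p k))) (W(i := W i + W k)) s z"
      if i: "i \<in> S" for i
      unfolding cycle_sum_def sum_distrib_left
    proof (rule sum.cong[OF refl])
      fix q
      have "(\<Prod>j\<in>S. coeff_phi ((p(i := Suc (p i + p k))) j) s (z j + (W(i := W i + W k)) j - z (q j)))
          = coeff_phi (Suc (p i + p k)) s (z i + (W i + W k) - z (q i)) * ?P q i"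
      proof -
        have "(\<Prod>j\<in>S - {i}. coeff_phi ((p(i := Suc (p i + p k))) j) s (z j + (W(i := W i + W k)) j - z (q j))) = ?P q i"
          by (rule prod.cong) auto
        then show ?thesis using S(1) i by (simp add: prod.remove[of S i])
      qed
      moreover have "z i + W i - (z (q i) - W k) = z i + (W i + W k) - z (q i)" by simp
      ultimately show "B q i = of_real (Im \<tau>) * (of_int (sign q) *
        (\<Prod>j\<in>S. coeff_phi ((p(i := Suc (p i + p k))) j) s (z j + (W(i := W i + W k)) j - z (q j))))"
        unfolding B_def by (simp only: add.commute[of "p k" "p i"]) (simp add: mult_ac)
    qed
    have "(\<Sum>q | q permutes S. A q + (\<Sum>i\<in>S. B q i))
        = (\<Sum>q | q permutes S. A q) + (\<Sum>i\<in>S. \<Sum>q | q permutes S. B q i)"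
      unfolding sum.distrib by (subst sum.swap) simp
    also have "\<dots> = of_real (Im \<tau>) * (coeff_phi (p k) s (W k) * cycle_sum S p W s z)
        + (\<Sum>i\<in>S. of_real (Im \<tau>) * cycle_sum S (p(i := Suc (p i + p k))) (W(i := W i + W k)) s z)"
      unfolding a by (intro arg_cong2[where f = "(+)"] refl sum.cong b)
    finally show ?thesis by (simp add: distrib_left sum_distrib_left)
  qed
  finally show ?thesis .
qed

text \<open>Merging orders m and n gives m + n + 1, so it is the order plus one that adds up. Hence
  the labels \<open>Suc (p i)\<close>, and the order of a whole cycle is the sum of its labels minus
  one.\<close>

definition cycle_value :: "nat set \<Rightarrow> (nat \<Rightarrow> nat) \<Rightarrow> (nat \<Rightarrow> complex) \<Rightarrow> complex \<Rightarrow> complex" where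
  "cycle_value S p W s =
    partition_sum S (cycle_weight (\<lambda>N x. coeff_phi (N - 1) s x) (\<lambda>i. Suc (p i)) W)"

lemma cycle_value_insert:
  assumes "finite S" "k \<notin> S"
  shows "cycle_value (insert k S) p W s = coeff_phi (p k) s (W k) * cycle_value S p W s
    + (\<Sum>i\<in>S. cycle_value S (p(i := Suc (p i + p k))) (W(i := W i + W k)) s)"
proof -
  have "(\<lambda>j. Suc ((p(i := Suc (p i + p k))) j)) = (\<lambda>j. Suc (p j))(i := Suc (p i) + Suc (p k))" for i
    by auto
  then show ?thesis unfolding cycle_value_def
    using partition_sum_cycle_weight_insert[OF assms, of "\<lambda>N x. coeff_phi (N - 1) s x" "\<lambda>i. Suc (p i)" W]
    by simp
qed

text \<open>Induction for arbitrary \<open>p\<close> and \<open>W\<close>, because merging changes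
  both. A subset sum of merged parameters is a subset sum of the old ones, over \<open>A\<close> or
  over \<open>insert k A\<close>; so both hypotheses on \<open>W\<close> survive and the same
  \<open>\<Gamma>\<close> serves at all stages.\<close>

lemma generic_torus_integral_cycle_sum:
  assumes s: "s \<notin> \<Lambda>"
  shows "distinct ks \<Longrightarrow> (\<And>A. A \<subseteq> set ks \<Longrightarrow> A \<noteq> {} \<Longrightarrow> (\<Sum>i\<in>A. W i) \<notin> \<Lambda>) \<Longrightarrow>
    (\<And>A l. A \<subseteq> set ks \<Longrightarrow> l \<in> \<Lambda> \<Longrightarrow> l - (\<Sum>i\<in>A. W i) \<in> \<Gamma>) \<Longrightarrow>
    generic_torus_integral \<Gamma> ks (cycle_sum (set ks) p W s) (of_real (Im \<tau>) ^ length ks * cycle_value (set ks) p W s)"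
proof (induction ks arbitrary: p W)
  case Nil
  then show ?case by (simp add: cycle_sum_def cycle_value_def)
next
  case (Cons k ks)
  let ?S = "set ks"
  have k: "k \<notin> ?S" using Cons.prems(1) by simp
  define p' where "p' = (\<lambda>i. p(i := Suc (p i + p k)))"
  define W' where "W' = (\<lambda>i. W(i := W i + W k))"
  have sumW': "(\<Sum>j\<in>A. W' i j) = (if i \<in> A then (\<Sum>j\<in>insert k A. W j) else (\<Sum>j\<in>A. W j))"
    if "A \<subseteq> ?S" for A i
  proof (cases "i \<in> A")
    case True
    have fin: "finite A" using that finite_subset by auto
    have "(\<Sum>j\<in>A. W' i j) = W i + W k + (\<Sum>j\<in>A - {i}. W j)"
      using True fin by (subst sum.remove[of A i]) (auto simp: W'_def intro!: sum.cong)
    also have "\<dots> = (\<Sum>j\<in>insert k A. W j)"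
      using True fin k that by (subst sum.insert) (auto simp: sum.remove[of A i])
    finally show ?thesis using True by simp
  next
    case False
    then have "(\<Sum>j\<in>A. W' i j) = (\<Sum>j\<in>A. W j)" by (intro sum.cong) (auto simp: W'_def)
    then show ?thesis using False by simp
  qed
  let ?c = "of_real (Im \<tau>) :: complex"
  define G where "G = (\<lambda>z. ?c * (coeff_phi (p k) s (W k) * cycle_sum ?S p W s z
      + (\<Sum>i\<in>?S. cycle_sum ?S (p' i) (W' i) s z)))"
  have IH0: "generic_torus_integral \<Gamma> ks (cycle_sum ?S p W s) (?c ^ length ks * cycle_value ?S p W s)"
    using Cons.prems by (intro Cons.IH) auto
  have IHi: "generic_torus_integral \<Gamma> ks (cycle_sum ?S (p' i) (W' i) s) (?c ^ length ks * cycle_value ?S (p' i) (W' i) s)" for i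
  proof (rule Cons.IH)
    show "distinct ks" using Cons.prems by simp
    fix A assume A: "A \<subseteq> ?S"
    then have A': "A \<subseteq> set (k # ks)" "insert k A \<subseteq> set (k # ks)" by auto
    show "(\<Sum>i'\<in>A. W' i i') \<notin> \<Lambda>" if "A \<noteq> {}"
      using Cons.prems(2)[OF A'(1)] Cons.prems(2)[OF A'(2)] that by (simp add: sumW'[OF A])
    show "l - (\<Sum>i'\<in>A. W' i i') \<in> \<Gamma>" if "l \<in> \<Lambda>" for l
      using Cons.prems(3)[OF A'(1) that] Cons.prems(3)[OF A'(2) that] by (simp add: sumW'[OF A])
  qed
  have "generic_torus_integral \<Gamma> ks G (?c * (coeff_phi (p k) s (W k) * (?c ^ length ks * cycle_value ?S p W s)
      + (\<Sum>i\<in>?S. ?c ^ length ks * cycle_value ?S (p' i) (W' i) s)))"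
    unfolding G_def
    by (intro generic_torus_integral_cmult generic_torus_integral_add generic_torus_integral_sum IH0 IHi) auto
  moreover have "?c * (coeff_phi (p k) s (W k) * (?c ^ length ks * cycle_value ?S p W s)
      + (\<Sum>i\<in>?S. ?c ^ length ks * cycle_value ?S (p' i) (W' i) s))
      = ?c ^ length (k # ks) * cycle_value (set (k # ks)) p W s"
    using cycle_value_insert[OF finite_set k, of p W s]
    by (simp add: p'_def W'_def sum_distrib_left[symmetric] algebra_simps)
  moreover have "torus_integral \<tau> (\<lambda>u. cycle_sum (set (k # ks)) p W s (z(k := u))) (G z)"
    if z: "\<forall>i\<in>?S. \<forall>j\<in>?S. i \<noteq> j \<longrightarrow> z i - z j \<notin> \<Gamma>" for z
  proof -
    \<comment> \<open>For \<open>i = j\<close> this is the condition on the parameters, applied to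
      \<open>{i, k}\<close>; for \<open>i \<noteq> j\<close> it follows from the genericity of
      \<open>z\<close>.\<close>
    have "z i + W i + W k - z j \<notin> \<Lambda>" if ij: "i \<in> ?S" "j \<in> ?S" for i j
    proof
      assume l: "z i + W i + W k - z j \<in> \<Lambda>"
      have ik: "{i, k} \<subseteq> set (k # ks)" "{i, k} \<noteq> {}" "(\<Sum>j\<in>{i, k}. W j) = W i + W k"
      proof -
        have "i \<noteq> k" using ij k by auto
        then show "(\<Sum>j\<in>{i, k}. W j) = W i + W k" by simp
      qed (use ij in auto)
      show False
      proof (cases "i = j")
        case True
        then show False using l Cons.prems(2)[OF ik(1,2)] ik(3) by simp
      next
        case False
        have "z i - z j \<in> \<Gamma>"
          using Cons.prems(3)[OF ik(1) l] ik(3) by (simp add: algebra_simps)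
        then show False using z ij False by blast
      qed
    qed
    then show ?thesis
      using torus_integral_cycle_sum[OF s finite_set k, of z W p] by (simp add: G_def p'_def W'_def)
  qed
  ultimately show ?case unfolding generic_torus_integral.simps by (intro exI[of _ G]) auto
qed

end

section \<open>Eisenstein summation\<close>

text \<open>This is pi times the cotangent of \<open>pi * z\<close>, written so that its limits
  \<open>- pi * \<i>\<close> and \<open>pi * \<i>\<close> for \<open>Im z\<close> tending to plus
  and minus infinity can be read off.\<close>

definition pi_cot :: "complex \<Rightarrow> complex" where
  "pi_cot z = pi * \<i> * (exp (2 * pi * \<i> * z) + 1) / (exp (2 * pi * \<i> * z) - 1)"

lemma exp_2pi_i_eq_1_iff: "exp (2 * pi * \<i> * z) = 1 \<longleftrightarrow> z \<in> \<int>"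
proof
  assume "exp (2 * pi * \<i> * z) = 1"
  then obtain n :: int where n: "Re (2 * pi * \<i> * z) = 0" "Im (2 * pi * \<i> * z) = of_int (2 * n) * pi"
    unfolding exp_eq_1 by auto
  then have "z = of_int n" by (simp add: complex_eq_iff)
  then show "z \<in> \<int>" by simp
next
  assume "z \<in> \<int>"
  then obtain n where n: "z = of_int n" by (rule Ints_cases)
  show "exp (2 * pi * \<i> * z) = 1"
    unfolding exp_eq_1 n by (auto intro!: exI[of _ n])
qed

lemma pi_cot_minus: "pi_cot (- z) = - pi_cot z"
proof -
  define e where "e = exp (2 * pi * \<i> * z)"
  have e: "e \<noteq> 0" by (simp add: e_def)
  have m: "exp (2 * pi * \<i> * (- z)) = 1 / e" by (simp add: e_def exp_minus inverse_eq_divide)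
  have "(1 / e + 1) / (1 / e - 1) = ((e + 1) / e) / (- (e - 1) / e)"
    using e by (simp add: add_divide_distrib diff_divide_distrib)
  also have "\<dots> = (e + 1) / (- (e - 1))" using e by simp
  also have "\<dots> = - ((e + 1) / (e - 1))" by (rule minus_divide_right[symmetric])
  finally have q: "(1 / e + 1) / (1 / e - 1) = - ((e + 1) / (e - 1))" .
  show ?thesis unfolding pi_cot_def m e_def[symmetric] times_divide_eq_right[symmetric] q by simp
qed

lemma pi_cot_add_1: "pi_cot (z + 1) = pi_cot z"
proof -
  have "exp (2 * pi * \<i> * (z + 1)) = exp (2 * pi * \<i> * z) * exp (2 * pi * \<i>)"
    by (simp only: distrib_left exp_add mult_1_right)
  also have "exp (2 * pi * \<i>) = 1" using exp_2pi_i_eq_1_iff[of 1] by simp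
  finally show ?thesis by (simp add: pi_cot_def)
qed

lemma pi_cot_holomorphic: "pi_cot holomorphic_on - \<int>"
  unfolding pi_cot_def by (intro holomorphic_intros) (use exp_2pi_i_eq_1_iff in auto)

lemma pi_cot_bound:
  assumes "norm (exp (2 * pi * \<i> * z)) \<le> t" "t < 1"
  shows "norm (pi_cot z + pi * \<i>) \<le> 2 * pi * t / (1 - t)"
proof -
  define e where "e = exp (2 * pi * \<i> * z)"
  have "norm (1 - e) \<ge> 1 - t" using assms norm_triangle_ineq2[of 1 e] by (simp add: e_def)
  then have n: "norm (e - 1) \<ge> 1 - t" by (simp add: norm_minus_commute)
  then have "e \<noteq> 1" using assms by auto
  then have "pi_cot z + pi * \<i> = 2 * pi * \<i> * e / (e - 1)"
    unfolding pi_cot_def e_def[symmetric] by (simp add: field_simps)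
  then have "norm (pi_cot z + pi * \<i>) = 2 * pi * norm e / norm (e - 1)"
    by (simp add: norm_divide norm_mult)
  also have "\<dots> \<le> 2 * pi * t / (1 - t)"
  proof (intro frac_le mult_left_mono mult_nonneg_nonneg)
    show "0 \<le> t" using assms(1) norm_ge_zero order_trans by blast
  qed (use assms n in \<open>auto simp: e_def\<close>)
  finally show ?thesis .
qed

text \<open>The logarithmic derivative of the reflection formula for
  \<open>Gamma z * Gamma (1 - z)\<close>. It reduces derivatives of the cotangent to
  \<open>Polygamma\<close>, which is defined by the series over half of the integers.\<close>

lemma pi_cot_eq_Digamma:
  assumes z: "z \<notin> \<int>"
  shows "pi_cot z = Digamma (1 - z) - Digamma z"
proof -
  define f where "f = (\<lambda>z. Gamma z * Gamma (1 - z) :: complex)"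
  have z': "z \<notin> \<int>\<^sub>\<le>\<^sub>0" "1 - z \<notin> \<int>\<^sub>\<le>\<^sub>0"
    using z by (auto simp: nonpos_Ints_def) (metis Ints_1 Ints_diff Ints_of_int diff_diff_eq2 add_diff_cancel_left' add.commute z)
  have s0: "sin (pi * z) \<noteq> 0"
  proof
    assume "sin (pi * z) = 0"
    then obtain n :: int where "of_real pi * z = of_real (n * pi)" unfolding sin_eq_0 by blast
    then have "of_real pi * z = of_real pi * of_int n" by simp
    then show False using z by (subst (asm) mult_cancel_left) auto
  qed
  have fe: "f z = of_real pi / sin (of_real pi * z)" for z
    unfolding f_def by (rule Gamma_reflection_complex)
  have d1: "(f has_field_derivative f z * (Digamma z - Digamma (1 - z))) (at z)"
    unfolding f_def by (rule derivative_eq_intros refl z' | simp add: z')+ (simp add: algebra_simps)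
  have d2: "(f has_field_derivative f z * (- (pi * cos (pi * z) / sin (pi * z)))) (at z)"
    unfolding fe[abs_def] by (rule derivative_eq_intros refl s0 | simp)+
  have "f z \<noteq> 0" using s0 by (simp add: fe)
  then have *: "Digamma (1 - z) - Digamma z = pi * cos (pi * z) / sin (pi * z)"
  proof -
    have "Digamma z - Digamma (1 - z) = - (pi * cos (pi * z) / sin (pi * z))"
      using DERIV_unique[OF d1 d2] \<open>f z \<noteq> 0\<close> unfolding mult_cancel_left by blast
    then show ?thesis by (metis minus_diff_eq minus_minus)
  qed
  define E where "E = exp (\<i> * (pi * z))"
  have E: "E \<noteq> 0" "exp (- (\<i> * (pi * z))) = inverse E" "exp (2 * pi * \<i> * z) = E * E"
    by (simp_all add: E_def exp_minus exp_add[symmetric] algebra_simps)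
  have "E * E \<noteq> 1" using z exp_2pi_i_eq_1_iff[of z] E by simp
  then have "pi * cos (pi * z) / sin (pi * z) = pi_cot z"
    unfolding cos_exp_eq sin_exp_eq pi_cot_def E(2,3) E_def[symmetric] using E(1)
    by (simp add: field_simps)
  then show ?thesis using * by simp
qed

lemma notin_nonpos_Ints: "(z::complex) \<notin> \<int> \<Longrightarrow> z \<notin> \<int>\<^sub>\<le>\<^sub>0 \<and> 1 - z \<notin> \<int>\<^sub>\<le>\<^sub>0"
proof -
  assume z: "z \<notin> \<int>"
  have "1 - z \<notin> \<int>" using z Ints_diff[of 1 "1 - z"] by auto
  then show ?thesis using z nonpos_Ints_subset_Ints by auto
qed

lemma open_Compl_Ints: "open (- \<int> :: complex set)"
  using closed_Ints by (simp add: open_Compl)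

lemma Digamma_shift_holomorphic:
  assumes "\<And>s. s \<in> A \<Longrightarrow> c + e * s \<notin> \<int>\<^sub>\<le>\<^sub>0"
  shows "(\<lambda>s::complex. Digamma (c + e * s)) holomorphic_on A"
proof -
  have "(Digamma \<circ> (\<lambda>s. c + e * s)) holomorphic_on A"
    by (rule holomorphic_on_compose_gen[where t = "- \<int>\<^sub>\<le>\<^sub>0"])
      (use assms in \<open>auto intro!: holomorphic_intros\<close>)
  then show ?thesis by (simp add: o_def)
qed

lemma higher_deriv_Digamma_affine:
  fixes z c e :: complex
  assumes "open A" "z \<in> A" "\<And>s. s \<in> A \<Longrightarrow> c + e * s \<notin> \<int>\<^sub>\<le>\<^sub>0"
  shows "(deriv ^^ n) (\<lambda>s. Digamma (c + e * s)) z = e ^ n * Polygamma n (c + e * z)"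
proof -
  have "(deriv ^^ n) (\<lambda>s. Digamma (e * s + c)) z = e ^ n * (deriv ^^ n) Digamma (e * z + c)"
    by (rule higher_deriv_compose_linear'[where T = "- \<int>\<^sub>\<le>\<^sub>0" and S = A])
      (use assms in \<open>auto intro!: holomorphic_intros simp: add.commute open_Compl\<close>)
  then show ?thesis
    using higher_deriv_Polygamma[of "c + e * z" n 0] assms by (simp add: add.commute)
qed

lemma higher_deriv_pi_cot:
  assumes z: "z \<notin> \<int>"
  shows "(deriv ^^ n) pi_cot z = (- 1) ^ n * Polygamma n (1 - z) - Polygamma n z"
proof -
  have n: "1 + - 1 * s \<notin> \<int>\<^sub>\<le>\<^sub>0" "0 + 1 * s \<notin> \<int>\<^sub>\<le>\<^sub>0" if "s \<in> - \<int>" for s :: complex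
    using notin_nonpos_Ints[of s] that by auto
  have h: "(\<lambda>s::complex. Digamma (1 + - 1 * s)) holomorphic_on - \<int>" "(\<lambda>s::complex. Digamma (0 + 1 * s)) holomorphic_on - \<int>"
    by (intro Digamma_shift_holomorphic n; assumption)+
  have "(deriv ^^ n) pi_cot z = (deriv ^^ n) (\<lambda>s. Digamma (1 + - 1 * s) - Digamma (0 + 1 * s)) z"
    by (rule higher_deriv_transform_within_open[OF pi_cot_holomorphic holomorphic_on_diff[OF h] open_Compl_Ints])
      (use z pi_cot_eq_Digamma in auto)
  also have "\<dots> = (deriv ^^ n) (\<lambda>s. Digamma (1 + - 1 * s)) z - (deriv ^^ n) (\<lambda>s. Digamma (0 + 1 * s)) z"
    by (rule higher_deriv_diff[OF h open_Compl_Ints]) (use z in auto)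
  also have "\<dots> = (- 1) ^ n * Polygamma n (1 + - 1 * z) - 1 ^ n * Polygamma n (0 + 1 * z)"
    by (subst higher_deriv_Digamma_affine[OF open_Compl_Ints _ n(1)], (use z in simp), assumption,
        subst higher_deriv_Digamma_affine[OF open_Compl_Ints _ n(2)], (use z in simp), assumption) (rule refl)
  finally show ?thesis by simp
qed

lemma norm_summable_inverse_power:
  fixes w :: complex
  assumes m: "m \<ge> 2"
  shows "summable (\<lambda>k. norm (inverse ((w + of_nat k) ^ m)))"
proof (rule summable_comparison_test_ev)
  have "summable (\<lambda>k. inverse (real k ^ m))" using inverse_power_summable[OF m, where 'a = real] by simp
  then show "summable (\<lambda>k. 2 ^ m * inverse (real k ^ m))" by (rule summable_mult)
  have "eventually (\<lambda>k. real k > 2 * norm w) sequentially"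
    by (rule eventually_compose_filterlim[OF eventually_gt_at_top filterlim_real_sequentially])
  then show "eventually (\<lambda>k. norm (norm (inverse ((w + of_nat k) ^ m))) \<le> 2 ^ m * inverse (real k ^ m)) sequentially"
  proof eventually_elim
    case (elim k)
    have "real k - norm w \<le> norm (w + of_nat k)"
      using norm_diff_ineq[of "of_nat k :: complex" w] by (simp add: add.commute)
    then have le: "real k / 2 \<le> norm (w + of_nat k)" using elim by simp
    have kp: "real k > 0" using elim norm_ge_zero[of w] by linarith
    have "norm (inverse ((w + of_nat k) ^ m)) = inverse (norm (w + of_nat k) ^ m)"
      by (simp add: norm_inverse norm_power)
    also have "\<dots> \<le> inverse ((real k / 2) ^ m)"
      using le kp by (intro le_imp_inverse_le power_mono) auto
    also have "\<dots> = 2 ^ m * inverse (real k ^ m)" by (simp add: power_divide field_simps)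
    finally show ?case by simp
  qed
qed

text \<open>For odd \<open>n\<close>, both halves of the sum over the integers carry the sign \<open>+\<close>.\<close>

lemma Polygamma_has_sum:
  fixes w :: complex
  assumes n: "odd n"
  shows "((\<lambda>k. 1 / (w + of_nat k) ^ Suc n) has_sum (Polygamma n w / fact n)) (UNIV :: nat set)"
proof -
  have n0: "n \<noteq> 0" using n by (cases n) auto
  have s: "summable (\<lambda>k. norm (1 / (w + of_nat k) ^ Suc n))"
    using norm_summable_inverse_power[of "Suc n" w] n0 by (simp add: inverse_eq_divide)
  have "Polygamma n w = fact n * (\<Sum>k. inverse ((w + of_nat k) ^ Suc n))"
    using n n0 by (simp add: Polygamma_def)
  then have "Polygamma n w / fact n = (\<Sum>k. 1 / (w + of_nat k) ^ Suc n)"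
    by (simp add: inverse_eq_divide)
  then show ?thesis using norm_summable_imp_has_sum[OF s] summable_norm_cancel[OF s] by (simp add: summable_sums)
qed

text \<open>The negative integers are enumerated as \<open>- 1 - k\<close>, the form in which the
  argument \<open>1 - w\<close> of the reflection delivers them.\<close>

lemma has_sum_int_split:
  fixes f :: "int \<Rightarrow> complex"
  assumes "((\<lambda>k. f (int k)) has_sum a) (UNIV :: nat set)" "((\<lambda>k. f (- 1 - int k)) has_sum b) (UNIV :: nat set)"
  shows "(f has_sum (a + b)) UNIV"
proof -
  have "(f has_sum a) (range int)" using assms(1) by (subst has_sum_reindex) (auto simp: o_def)
  moreover have "(f has_sum b) (range (\<lambda>k. - 1 - int k))"
    using assms(2) by (subst has_sum_reindex) (auto simp: o_def inj_on_def)
  moreover have "range int \<inter> range (\<lambda>k. - 1 - int k) = {}" by auto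
  moreover have "range int \<union> range (\<lambda>k. - 1 - int k) = UNIV"
  proof -
    have "x \<in> range int \<union> range (\<lambda>k. - 1 - int k)" for x
    proof (cases "x \<ge> 0")
      case True
      then have "x = int (nat x)" by simp
      then show ?thesis by blast
    next
      case False
      then have "x = - 1 - int (nat (- 1 - x))" by simp
      then show ?thesis by blast
    qed
    then show ?thesis by blast
  qed
  ultimately show ?thesis using has_sum_Un_disjoint by metis
qed

lemma pi_cot_deriv_has_sum:
  assumes n: "odd n" and w: "w \<notin> \<int>"
  shows "((\<lambda>a::int. 1 / (of_int a + w) ^ Suc n) has_sum (- (deriv ^^ n) pi_cot w / fact n)) UNIV"
proof -
  have "((\<lambda>a::int. 1 / (of_int a + w) ^ Suc n) has_sum (Polygamma n w / fact n + Polygamma n (1 - w) / fact n)) UNIV"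
  proof (rule has_sum_int_split)
    show "((\<lambda>k. 1 / (of_int (int k) + w) ^ Suc n) has_sum Polygamma n w / fact n) UNIV"
      using Polygamma_has_sum[OF n, of w] by (simp add: add.commute)
    have "(of_int (- 1 - int k) + w) ^ Suc n = (1 - w + of_nat k) ^ Suc n" for k
    proof -
      have "of_int (- 1 - int k) + w = - (1 - w + of_nat k)" by simp
      moreover have "even (Suc n)" using n by simp
      ultimately show ?thesis by (simp only: power_minus_even)
    qed
    then show "((\<lambda>k. 1 / (of_int (- 1 - int k) + w) ^ Suc n) has_sum Polygamma n (1 - w) / fact n) UNIV"
      using Polygamma_has_sum[OF n, of "1 - w"] by (simp only:)
  qed
  moreover have "Polygamma n w / fact n + Polygamma n (1 - w) / fact n = - (deriv ^^ n) pi_cot w / fact n"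
    unfolding higher_deriv_pi_cot[OF w] using n by (simp add: add_divide_distrib)
  ultimately show ?thesis by simp
qed

lemma Polygamma_1_has_sum:
  assumes n: "odd n"
  shows "((\<lambda>a::int. 1 / (of_int a :: complex) ^ Suc n) has_sum (2 * Polygamma n 1 / fact n)) (- {0})"
proof -
  have p: "((\<lambda>k. 1 / (1 + of_nat k :: complex) ^ Suc n) has_sum (Polygamma n 1 / fact n)) UNIV"
    by (rule Polygamma_has_sum[OF n])
  have 1: "((\<lambda>a::int. 1 / (of_int a :: complex) ^ Suc n) has_sum (Polygamma n 1 / fact n)) (range (\<lambda>k. 1 + int k))"
    using p by (subst has_sum_reindex) (auto simp: o_def inj_on_def)
  have 2: "((\<lambda>a::int. 1 / (of_int a :: complex) ^ Suc n) has_sum (Polygamma n 1 / fact n)) (range (\<lambda>k. - 1 - int k))"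
  proof (subst has_sum_reindex)
    have "(of_int (- 1 - int k) :: complex) ^ Suc n = (1 + of_nat k) ^ Suc n" for k
    proof -
      have "(of_int (- 1 - int k) :: complex) = - (1 + of_nat k)" by simp
      moreover have "even (Suc n)" using n by simp
      ultimately show ?thesis by (simp only: power_minus_even)
    qed
    then show "(((\<lambda>a::int. 1 / (of_int a :: complex) ^ Suc n) \<circ> (\<lambda>k. - 1 - int k)) has_sum (Polygamma n 1 / fact n)) UNIV"
      using p by (simp only: o_def)
  qed (auto simp: inj_on_def)
  have "range (\<lambda>k. 1 + int k) \<union> range (\<lambda>k. - 1 - int k) = - {0}"
  proof -
    have "x \<in> range (\<lambda>k. 1 + int k) \<union> range (\<lambda>k. - 1 - int k)" if "x \<noteq> 0" for x
    proof (cases "x \<ge> 0")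
      case True
      then have "x = 1 + int (nat (x - 1))" using that by simp
      then show ?thesis by blast
    next
      case False
      then have "x = - 1 - int (nat (- 1 - x))" by simp
      then show ?thesis by blast
    qed
    then show ?thesis by auto
  qed
  moreover have "range (\<lambda>k. 1 + int k) \<inter> range (\<lambda>k. - 1 - int k) = {}" by auto
  ultimately show ?thesis using has_sum_Un_disjoint[OF 1 2] by simp
qed

section \<open>Summing cotangents over the rows of the lattice\<close>

context jacobi_theta
begin

text \<open>The absolute value of the usual nome \<open>exp (pi * \<i> * \<tau>)\<close>.\<close>

definition nome :: real where "nome = exp (- pi * Im \<tau>)"

lemma nome: "0 < nome" "nome < 1"
  using tau by (simp_all add: nome_def)

text \<open>The hypothesis keeps \<open>z + b * \<tau>\<close> at height at least
  \<open>b * Im \<tau> / 2\<close>, where \<open>exp (2 * pi * \<i> * _)\<close> has norm at most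
  \<open>nome ^ b\<close>. The second bound is the first at \<open>- z\<close>, as the cotangent is
  odd.\<close>

lemma pi_cot_tau_bound:
  assumes "b \<ge> 1" "\<bar>Im z\<bar> \<le> real b * Im \<tau> / 2"
  shows "norm (pi_cot (z + of_nat b * \<tau>) + pi * \<i>) \<le> 2 * pi / (1 - nome) * nome ^ b"
    and "norm (pi_cot (z - of_nat b * \<tau>) - pi * \<i>) \<le> 2 * pi / (1 - nome) * nome ^ b"
proof -
  have B: "norm (pi_cot (z + of_nat b * \<tau>) + pi * \<i>) \<le> 2 * pi / (1 - nome) * nome ^ b"
    if "\<bar>Im z\<bar> \<le> real b * Im \<tau> / 2" for z
  proof -
    have q: "nome ^ b \<le> nome" using nome power_decreasing[of 1 b nome] assms(1) by simp
    have "norm (exp (2 * pi * \<i> * (z + of_nat b * \<tau>))) = exp (- (2 * pi * (Im z + real b * Im \<tau>)))"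
      by (simp add: norm_exp_eq_Re)
    also have "\<dots> \<le> exp (- (2 * pi * (real b * Im \<tau> / 2)))"
    proof -
      have "real b * Im \<tau> / 2 \<le> Im z + real b * Im \<tau>"
        using that abs_ge_minus_self[of "Im z"] by linarith
      then show ?thesis by simp
    qed
    also have "\<dots> = nome ^ b" by (simp add: nome_def exp_of_nat_mult[symmetric] mult_ac)
    finally have "norm (pi_cot (z + of_nat b * \<tau>) + pi * \<i>) \<le> 2 * pi * nome ^ b / (1 - nome ^ b)"
      using q nome by (intro pi_cot_bound) auto
    also have "\<dots> \<le> 2 * pi * nome ^ b / (1 - nome)"
      using q nome by (intro divide_left_mono) auto
    finally show ?thesis by simp
  qed
  show "norm (pi_cot (z + of_nat b * \<tau>) + pi * \<i>) \<le> 2 * pi / (1 - nome) * nome ^ b"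
    by (rule B) fact
  have "pi_cot (z - of_nat b * \<tau>) - pi * \<i> = - (pi_cot (- z + of_nat b * \<tau>) + pi * \<i>)"
    using pi_cot_minus[of "z - of_nat b * \<tau>"] by simp
  then show "norm (pi_cot (z - of_nat b * \<tau>) - pi * \<i>) \<le> 2 * pi / (1 - nome) * nome ^ b"
    using B[of "- z"] assms(2) by (simp only: norm_minus_cancel) simp
qed

text \<open>The rows \<open>Suc b\<close> and \<open>- Suc b\<close> are taken together because
  their cotangents tend to opposite nonzero constants, so that only the pairs form a convergent
  series.\<close>

definition cot_pair :: "nat \<Rightarrow> complex \<Rightarrow> complex" where
  "cot_pair b z = pi_cot (z + of_nat (Suc b) * \<tau>) + pi_cot (z - of_nat (Suc b) * \<tau>)"

definition cot_tail :: "complex \<Rightarrow> complex" where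
  "cot_tail z = (\<Sum>b. cot_pair b z)"

lemma cot_pair_bound:
  assumes "\<bar>Im z\<bar> \<le> real (Suc b) * Im \<tau> / 2"
  shows "norm (cot_pair b z) \<le> 4 * pi / (1 - nome) * nome ^ Suc b"
proof -
  have "cot_pair b z = (pi_cot (z + of_nat (Suc b) * \<tau>) + pi * \<i>) + (pi_cot (z - of_nat (Suc b) * \<tau>) - pi * \<i>)"
    by (simp add: cot_pair_def)
  then have "norm (cot_pair b z) \<le> norm (pi_cot (z + of_nat (Suc b) * \<tau>) + pi * \<i>)
      + norm (pi_cot (z - of_nat (Suc b) * \<tau>) - pi * \<i>)" by (metis norm_triangle_ineq)
  then show ?thesis using pi_cot_tau_bound[of "Suc b" z] assms by simp
qed

lemma summable_nome: "summable (\<lambda>b. c * nome ^ Suc b)"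
proof -
  have "summable (\<lambda>b. (c * nome) * nome ^ b)"
    using nome by (intro summable_mult summable_geometric) auto
  then show ?thesis by (simp add: mult_ac)
qed

text \<open>The M-test from the index on where the rows are far away from \<open>A\<close>; the
  finitely many earlier terms may have poles in \<open>A\<close>.\<close>

lemma cot_pair_uniform_limit:
  assumes "bounded A"
  shows "uniform_limit A (\<lambda>N z. \<Sum>b<N. cot_pair b z) cot_tail sequentially"
  unfolding cot_tail_def[abs_def]
proof (rule Weierstrass_m_test_ev[OF _ summable_nome])
  obtain R where R: "\<And>z. z \<in> A \<Longrightarrow> norm z \<le> R" using assms by (auto simp: bounded_iff)
  have "eventually (\<lambda>b. real b > 2 * R / Im \<tau>) sequentially"
    by (rule eventually_compose_filterlim[OF eventually_gt_at_top filterlim_real_sequentially])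
  then show "eventually (\<lambda>b. \<forall>z\<in>A. norm (cot_pair b z) \<le> 4 * pi / (1 - nome) * nome ^ Suc b) sequentially"
  proof eventually_elim
    case (elim b)
    show ?case
    proof
      fix z assume "z \<in> A"
      then have "\<bar>Im z\<bar> \<le> R" using R[of z] abs_Im_le_cmod[of z] by simp
      moreover have "R \<le> real (Suc b) * Im \<tau> / 2"
      proof -
        have "2 * R < real b * Im \<tau>" using elim tau by (simp add: field_simps)
        then show ?thesis using tau by (simp add: algebra_simps)
      qed
      ultimately show "norm (cot_pair b z) \<le> 4 * pi / (1 - nome) * nome ^ Suc b"
        by (intro cot_pair_bound) simp
    qed
  qed
qed

lemma cot_pair_sums: "(\<lambda>N. \<Sum>b<N. cot_pair b z) \<longlonglongrightarrow> cot_tail z"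
  using tendsto_uniform_limitI[OF cot_pair_uniform_limit[of "{z}"]] by simp

text \<open>What is removed is the pole set of \<open>cot_tail\<close>, the lattice without its row
  of integers.\<close>

definition tail_domain :: "complex set" where "tail_domain = - (\<Lambda> - \<int>)"

lemma open_tail_domain: "open tail_domain"
proof -
  have "translates \<tau> {0} = \<Lambda>" by (auto simp: translates_iff)
  then show ?thesis using closed_translates[OF tau, of "{0}" \<int>]
    unfolding tail_domain_def by (simp only: open_Compl finite.intros)
qed

lemma multiple_tau_Ints:
  assumes "z + of_int b * \<tau> \<in> \<int>" "b \<noteq> 0"
  shows "z \<notin> tail_domain"
proof -
  obtain a where a: "z + of_int b * \<tau> = of_int a" using assms by (elim Ints_cases)
  then have z: "z = of_int a + of_int (- b) * \<tau>" by (simp add: algebra_simps)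
  have "z \<notin> \<int>"
  proof
    assume "z \<in> \<int>"
    then have "Im z = 0" by (auto elim: Ints_cases)
    then show False using z assms tau by simp
  qed
  moreover have "z \<in> \<Lambda>" unfolding z by (rule latticeI)
  ultimately show ?thesis by (simp add: tail_domain_def)
qed

lemma cot_pair_holomorphic: "cot_pair b holomorphic_on tail_domain"
proof -
  have "(pi_cot \<circ> (\<lambda>z. z + of_int (int (Suc b)) * \<tau>)) holomorphic_on tail_domain"
    "(pi_cot \<circ> (\<lambda>z. z + of_int (- int (Suc b)) * \<tau>)) holomorphic_on tail_domain"
    by (rule holomorphic_on_compose_gen[OF _ pi_cot_holomorphic];
        use multiple_tau_Ints in \<open>auto intro!: holomorphic_intros simp del: of_int_minus of_int_of_nat_eq of_nat_Suc\<close>)+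
  then have "(\<lambda>z. (pi_cot \<circ> (\<lambda>z. z + of_int (int (Suc b)) * \<tau>)) z
      + (pi_cot \<circ> (\<lambda>z. z + of_int (- int (Suc b)) * \<tau>)) z) holomorphic_on tail_domain"
    by (rule holomorphic_on_add)
  also have "(\<lambda>z. (pi_cot \<circ> (\<lambda>z. z + of_int (int (Suc b)) * \<tau>)) z
      + (pi_cot \<circ> (\<lambda>z. z + of_int (- int (Suc b)) * \<tau>)) z) = cot_pair b"
  proof
    fix z
    have "z + of_int (- int (Suc b)) * \<tau> = z - of_nat (Suc b) * \<tau>"
      by (simp only: of_int_minus of_int_of_nat_eq mult_minus_left add_uminus_conv_diff)
    then show "(pi_cot \<circ> (\<lambda>z. z + of_int (int (Suc b)) * \<tau>)) z
      + (pi_cot \<circ> (\<lambda>z. z + of_int (- int (Suc b)) * \<tau>)) z = cot_pair b z"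
      by (simp only: o_def cot_pair_def of_int_of_nat_eq)
  qed
  finally show ?thesis .
qed

lemma cot_tail_holomorphic: "cot_tail holomorphic_on tail_domain"
proof (rule holomorphic_uniform_sequence[OF open_tail_domain])
  show "(\<lambda>z. \<Sum>b<N. cot_pair b z) holomorphic_on tail_domain" for N
    by (intro holomorphic_on_sum cot_pair_holomorphic)
  fix x assume "x \<in> tail_domain"
  then obtain d where "d > 0" "cball x d \<subseteq> tail_domain"
    using open_tail_domain open_contains_cball by blast
  then show "\<exists>d>0. cball x d \<subseteq> tail_domain \<and>
      uniform_limit (cball x d) (\<lambda>N z. \<Sum>b<N. cot_pair b z) cot_tail sequentially"
    using cot_pair_uniform_limit by auto
qed

lemma cot_tail_minus: "cot_tail (- z) = - cot_tail z"
proof -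
  have "cot_pair b (- z) = - cot_pair b z" for b
    using pi_cot_minus[of "z - of_nat (Suc b) * \<tau>"] pi_cot_minus[of "z + of_nat (Suc b) * \<tau>"]
    by (simp add: cot_pair_def add.commute)
  then have "(\<lambda>N. \<Sum>b<N. cot_pair b (- z)) \<longlonglongrightarrow> - cot_tail z"
    using tendsto_minus[OF cot_pair_sums[of z]] by (simp add: sum_negf)
  then show ?thesis using cot_pair_sums LIMSEQ_unique by blast
qed

lemma cot_tail_add_1: "cot_tail (z + 1) = cot_tail z"
proof -
  have "cot_pair b (z + 1) = cot_pair b z" for b
    using pi_cot_add_1[of "z - of_nat (Suc b) * \<tau>"] pi_cot_add_1[of "z + of_nat (Suc b) * \<tau>"]
    by (simp only: cot_pair_def diff_add_eq add.assoc add.commute[of 1])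
  then show ?thesis by (simp add: cot_tail_def)
qed

text \<open>Translation by \<tau> moves a symmetric partial sum by one row: the term at
  \<open>z + Suc N * \<tau>\<close> is gained and the one at \<open>z - N * \<tau>\<close> is lost.
  Their limits \<open>- pi * \<i>\<close> and \<open>pi * \<i>\<close> account for the
  defect.\<close>

lemma cot_tail_add_tau: "pi_cot (z + \<tau>) + cot_tail (z + \<tau>) = pi_cot z + cot_tail z - 2 * pi * \<i>"
proof -
  define P where "P = (\<lambda>N z. pi_cot z + (\<Sum>b<N. cot_pair b z))"
  have tel: "P N (z + \<tau>) = P N z + pi_cot (z + of_nat (Suc N) * \<tau>) - pi_cot (z - of_nat N * \<tau>)" for N
  proof (induction N)
    case (Suc N)
    have "cot_pair N (z + \<tau>) = pi_cot (z + of_nat (Suc (Suc N)) * \<tau>) + pi_cot (z - of_nat N * \<tau>)"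
      by (simp add: cot_pair_def algebra_simps)
    moreover have "P (Suc N) w = P N w + cot_pair N w" for w by (simp add: P_def)
    ultimately show ?case using Suc by (simp add: cot_pair_def[of N z])
  qed (simp add: P_def)
  define c where "c = 2 * pi / (1 - nome)"
  have "(\<lambda>N. c * nome ^ N) \<longlonglongrightarrow> c * 0"
    using nome by (intro tendsto_mult tendsto_const LIMSEQ_power_zero) auto
  then have c0: "(\<lambda>N. c * nome ^ N) \<longlonglongrightarrow> 0" by simp
  have ev: "eventually (\<lambda>N. N \<ge> 1 \<and> \<bar>Im z\<bar> \<le> real N * Im \<tau> / 2) sequentially"
  proof -
    have "eventually (\<lambda>N. real N > 2 * \<bar>Im z\<bar> / Im \<tau>) sequentially"
      by (rule eventually_compose_filterlim[OF eventually_gt_at_top filterlim_real_sequentially])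
    then show ?thesis using eventually_ge_at_top[of 1]
      by eventually_elim (use tau in \<open>auto simp: field_simps\<close>)
  qed
  have l1: "(\<lambda>N. pi_cot (z + of_nat N * \<tau>) + pi * \<i>) \<longlonglongrightarrow> 0"
    by (rule Lim_null_comparison[OF _ c0], use ev in eventually_elim)
      (use pi_cot_tau_bound(1) in \<open>auto simp: c_def\<close>)
  have l2: "(\<lambda>N. pi_cot (z - of_nat N * \<tau>) - pi * \<i>) \<longlonglongrightarrow> 0"
    by (rule Lim_null_comparison[OF _ c0], use ev in eventually_elim)
      (use pi_cot_tau_bound(2) in \<open>auto simp: c_def\<close>)
  have "(\<lambda>N. P N z + ((pi_cot (z + of_nat (Suc N) * \<tau>) + pi * \<i>) - (pi_cot (z - of_nat N * \<tau>) - pi * \<i>) - 2 * pi * \<i>))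
      \<longlonglongrightarrow> (pi_cot z + cot_tail z) + (0 - 0 - 2 * pi * \<i>)"
    unfolding P_def by (intro tendsto_intros cot_pair_sums LIMSEQ_Suc[OF l1] l2)
  moreover have "P N z + ((pi_cot (z + of_nat (Suc N) * \<tau>) + pi * \<i>) - (pi_cot (z - of_nat N * \<tau>) - pi * \<i>) - 2 * pi * \<i>)
      = P N (z + \<tau>)" for N by (simp add: tel)
  ultimately have "(\<lambda>N. P N (z + \<tau>)) \<longlonglongrightarrow> pi_cot z + cot_tail z - 2 * pi * \<i>" by simp
  moreover have "(\<lambda>N. P N (z + \<tau>)) \<longlonglongrightarrow> pi_cot (z + \<tau>) + cot_tail (z + \<tau>)"
    unfolding P_def by (intro tendsto_intros cot_pair_sums)
  ultimately show ?thesis using LIMSEQ_unique by blast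
qed

section \<open>The logarithmic derivative of theta as a sum of cotangents\<close>

lemma open_reduced_domain: "open (- (\<Lambda> - {0}))"
proof -
  have "translates \<tau> {0} = \<Lambda>" by (auto simp: translates_iff)
  then show ?thesis using closed_translates[OF tau, of "{0}" "{0}"] by (simp only: open_Compl finite.intros)
qed

definition theta_red :: "complex \<Rightarrow> complex" where
  "theta_red s = (if s = 0 then 1 else \<theta> s / s)"

lemma theta_red_holomorphic: "theta_red holomorphic_on A"
proof -
  have "(\<lambda>z. if z = 0 then deriv \<theta> 0 else (\<theta> z - \<theta> 0) / (z - 0)) holomorphic_on UNIV"
    by (rule pole_lemma_open[OF theta_holomorphic open_UNIV])
  moreover have "(\<lambda>z. if z = 0 then deriv \<theta> 0 else (\<theta> z - \<theta> 0) / (z - 0)) = theta_red"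
    by (auto simp: theta_red_def fun_eq_iff theta_0 deriv_theta_0)
  ultimately show ?thesis using holomorphic_on_subset by auto
qed

lemma theta_red_nonzero: "s \<notin> \<Lambda> - {0} \<Longrightarrow> theta_red s \<noteq> 0"
  by (auto simp: theta_red_def theta_eq_0_iff)

lemma theta_red_minus: "theta_red (- s) = theta_red s"
  by (simp add: theta_red_def theta_minus)

text \<open>Removing the zero of \<theta> at 0 before taking the logarithmic derivative makes it
  regular there, so that it has Taylor coefficients at 0.\<close>

definition log_deriv_red :: "complex \<Rightarrow> complex" where
  "log_deriv_red s = deriv theta_red s / theta_red s"

lemma log_deriv_red_holomorphic: "log_deriv_red holomorphic_on - (\<Lambda> - {0})"
  unfolding log_deriv_red_def
  by (intro holomorphic_intros holomorphic_deriv[OF theta_red_holomorphic[of UNIV], THEN holomorphic_on_subset]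
      theta_red_holomorphic) (use theta_red_nonzero in auto)

lemma log_deriv_red_minus: "log_deriv_red (- s) = - log_deriv_red s"
proof -
  have d: "(theta_red has_field_derivative deriv theta_red w) (at w)" for w
    using holomorphic_derivI[OF theta_red_holomorphic[of UNIV] open_UNIV UNIV_I] .
  have "((\<lambda>s. theta_red (- s)) has_field_derivative deriv theta_red (- s) * (- 1)) (at s)"
    by (rule DERIV_chain2[OF d]) (auto intro!: derivative_eq_intros)
  then have "deriv theta_red (- s) * (- 1) = deriv theta_red s"
    unfolding theta_red_minus using DERIV_unique[OF _ d] by blast
  then have "deriv theta_red (- s) = - deriv theta_red s" by (metis mult_minus1_right minus_minus)
  then show ?thesis by (simp add: log_deriv_red_def theta_red_minus)
qed

lemma log_deriv_red_eq:
  assumes "s \<notin> \<Lambda>"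
  shows "log_deriv_red s = deriv \<theta> s / \<theta> s - 1 / s"
proof -
  have s0: "s \<noteq> 0" using assms by auto
  have t: "\<theta> s \<noteq> 0" using assms theta_eq_0_iff by simp
  have "(\<theta> has_field_derivative deriv \<theta> s) (at s)"
    using holomorphic_derivI[OF theta_holomorphic[of UNIV] open_UNIV UNIV_I] .
  from DERIV_divide[OF this DERIV_ident s0]
  have "((\<lambda>s. \<theta> s / s) has_field_derivative (deriv \<theta> s * s - \<theta> s * 1) / (s * s)) (at s)" .
  then have "(theta_red has_field_derivative (deriv \<theta> s * s - \<theta> s * 1) / (s * s)) (at s)"
    by (rule DERIV_cong_ev[THEN iffD1, rotated -1, OF _ refl _ refl])
      (use s0 in \<open>auto simp: theta_red_def intro!: eventually_mono[OF t1_space_nhds]\<close>)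
  then have "deriv theta_red s = (deriv \<theta> s * s - \<theta> s * 1) / (s * s)" by (rule DERIV_imp_deriv)
  then show ?thesis using s0 t by (simp add: log_deriv_red_def theta_red_def field_simps)
qed

lemma deriv_theta_minus: "deriv \<theta> (- z) = deriv \<theta> z"
proof -
  have d: "(\<theta> has_field_derivative deriv \<theta> w) (at w)" for w
    using holomorphic_derivI[OF theta_holomorphic[of UNIV] open_UNIV UNIV_I] .
  have "((\<lambda>z. \<theta> (- z)) has_field_derivative deriv \<theta> (- z) * (- 1)) (at z)"
    by (rule DERIV_chain2[OF d]) (auto intro!: derivative_eq_intros)
  moreover have "((\<lambda>z. \<theta> (- z)) has_field_derivative - deriv \<theta> z) (at z)"
    unfolding theta_minus by (rule DERIV_minus[OF d])
  ultimately show ?thesis using DERIV_unique by fastforce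
qed

lemma Ints_subset_lattice: "\<int> \<subseteq> \<Lambda>"
proof
  fix x :: complex assume "x \<in> \<int>"
  then obtain a where "x = of_int a" by (rule Ints_cases)
  then show "x \<in> \<Lambda>" using latticeI[of a 0 \<tau>] by simp
qed

lemma ball_0_1_Ints:
  assumes "s \<in> ball (0::complex) 1" "s \<noteq> 0"
  shows "s \<notin> \<int>"
proof
  assume "s \<in> \<int>"
  then obtain a where a: "s = of_int a" by (rule Ints_cases)
  then have "\<bar>real_of_int a\<bar> < 1" using assms(1) by simp
  then have "a = 0" by linarith
  then show False using a assms(2) by simp
qed

lemma ball_nonpos_Ints:
  assumes "s \<in> ball (0::complex) 1"
  shows "1 + - 1 * s \<notin> \<int>\<^sub>\<le>\<^sub>0" "1 + 1 * s \<notin> \<int>\<^sub>\<le>\<^sub>0"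
proof -
  have "1 + t \<notin> \<int>\<^sub>\<le>\<^sub>0" if "norm t < 1" for t :: complex
  proof
    assume "1 + t \<in> \<int>\<^sub>\<le>\<^sub>0"
    then obtain n where n: "1 + t = of_int n" "n \<le> 0" by (elim nonpos_Ints_cases)
    then have "Re (1 + t) = of_int n" by simp
    then have "Re (1 + t) \<le> 0" using n(2) by simp
    then show False using that abs_Re_le_cmod[of t] by simp
  qed
  from this[of "- s"] this[of s] show "1 + - 1 * s \<notin> \<int>\<^sub>\<le>\<^sub>0" "1 + 1 * s \<notin> \<int>\<^sub>\<le>\<^sub>0"
    using assms by auto
qed

text \<open>The regular part of \<open>pi_cot\<close> at 0. The form of the arguments fits the
  pattern \<open>c + e * s\<close> of the lemmas on \<open>Digamma\<close>.\<close>

definition Digamma_part :: "complex \<Rightarrow> complex" where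
  "Digamma_part s = Digamma (1 + - 1 * s) - Digamma (1 + 1 * s)"

lemma Digamma_part_holomorphic: "Digamma_part holomorphic_on ball 0 1"
  unfolding Digamma_part_def[abs_def]
  by (intro holomorphic_on_diff Digamma_shift_holomorphic ball_nonpos_Ints)

lemma pi_cot_eq_Digamma_part:
  assumes "s \<in> ball 0 1" "s \<noteq> 0"
  shows "pi_cot s = 1 / s + Digamma_part s"
  using pi_cot_eq_Digamma[OF ball_0_1_Ints[OF assms]] Digamma_plus1[OF assms(2)]
  by (simp add: Digamma_part_def add.commute)

lemma zero_in_tail_domain: "0 \<in> tail_domain"
  by (simp add: tail_domain_def)

text \<open>The difference of both sides is entire, elliptic and odd.\<close>

lemma log_deriv_theta_eq_cot:
  assumes z: "z \<notin> \<Lambda>"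
  shows "deriv \<theta> z / \<theta> z = pi_cot z + cot_tail z"
proof -
  define f where "f = (\<lambda>z. deriv \<theta> z / \<theta> z - (pi_cot z + cot_tail z))"
  have L: "translates \<tau> {0} = \<Lambda>" by (auto simp: translates_iff)
  \<comment> \<open>With quasi-period parameter 0 the exponential is 1, so the conclusion says that
    \<open>f\<close> is constant off the lattice; oddness then makes the constant 0.\<close>
  have "\<exists>c. \<forall>z. z \<notin> translates \<tau> {0} \<longrightarrow> f z = c * exp (- \<i> * of_real (2 * pi * Im 0 / Im \<tau>) * z)"
  proof (rule quasi_periodic_meromorphic[OF tau])
    show "f holomorphic_on - translates \<tau> {0}"
      unfolding f_def L
      by (intro holomorphic_intros deriv_theta_holomorphic theta_holomorphic
          holomorphic_on_subset[OF pi_cot_holomorphic] holomorphic_on_subset[OF cot_tail_holomorphic])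
        (use theta_eq_0_iff Ints_subset_lattice in \<open>auto simp: tail_domain_def\<close>)
    show "f (z + 1) = f z" for z
      by (simp add: f_def deriv_theta_add_1 theta_add_1 pi_cot_add_1 cot_tail_add_1)
    show "f (z + \<tau>) = exp (- 2 * pi * \<i> * 0) * f z" if "z \<notin> translates \<tau> {0}" for z
    proof -
      define q where "q = - exp (- pi * \<i> * \<tau>) * exp (- 2 * pi * \<i> * z)"
      have q: "q \<noteq> 0" by (simp add: q_def)
      have t: "\<theta> z \<noteq> 0" using that theta_eq_0_iff by (simp add: L)
      have "deriv \<theta> (z + \<tau>) / \<theta> (z + \<tau>) = q * (deriv \<theta> z - 2 * pi * \<i> * \<theta> z) / (q * \<theta> z)"
        unfolding deriv_theta_add_tau theta_add_tau q_def ..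
      also have "\<dots> = deriv \<theta> z / \<theta> z - 2 * pi * \<i>" using q t by (simp add: field_simps)
      finally show ?thesis unfolding f_def cot_tail_add_tau by simp
    qed
    fix p :: complex assume "p \<in> {0}"
    then have p: "p = 0" by simp
    have "open (- (\<Lambda> - {0}) \<inter> tail_domain \<inter> ball 0 1)"
      using open_reduced_domain open_tail_domain by auto
    moreover have "0 \<in> - (\<Lambda> - {0}) \<inter> tail_domain \<inter> ball 0 1" using zero_in_tail_domain by simp
    ultimately obtain r where r: "r > 0" "ball 0 r \<subseteq> - (\<Lambda> - {0}) \<inter> tail_domain \<inter> ball 0 1"
      by (meson open_contains_ball)
    have "(\<lambda>s. log_deriv_red s - (Digamma_part s + cot_tail s)) holomorphic_on ball 0 r"
      by (intro holomorphic_intros holomorphic_on_subset[OF log_deriv_red_holomorphic]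
          holomorphic_on_subset[OF Digamma_part_holomorphic] holomorphic_on_subset[OF cot_tail_holomorphic])
        (use r in auto)
    moreover have "f s = log_deriv_red s - (Digamma_part s + cot_tail s)" if s: "s \<in> ball 0 r - {0}" for s
    proof -
      have "s \<in> - (\<Lambda> - {0}) \<inter> tail_domain \<inter> ball 0 1" using s r(2) by blast
      then have "s \<notin> \<Lambda>" "s \<in> ball 0 1" "s \<noteq> 0" using s by auto
      then show ?thesis by (simp add: f_def log_deriv_red_eq pi_cot_eq_Digamma_part)
    qed
    ultimately show "\<exists>r>0. \<exists>h. h holomorphic_on ball p r \<and> (\<forall>z\<in>ball p r - {p}. f z = h z)"
      unfolding p using r(1) by blast
  qed simp
  then obtain c where c: "\<And>z. z \<notin> \<Lambda> \<Longrightarrow> f z = c" unfolding L by auto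
  have "f (- z) = - f z"
    by (simp add: f_def deriv_theta_minus theta_minus pi_cot_minus cot_tail_minus)
  then have "c = - c" using c[OF z] c[of "- z"] z by simp
  then have "c = 0" by simp
  then show ?thesis using c[OF z] by (simp add: f_def)
qed

text \<open>The pole \<open>1 / s\<close> cancels on both sides of the cotangent expansion. The
  \<open>Digamma\<close> part yields the row of integers, \<open>cot_tail\<close> all other
  rows.\<close>

lemma higher_deriv_log_deriv_red:
  assumes n: "odd n"
  shows "(deriv ^^ n) log_deriv_red 0 = - 2 * Polygamma n 1 + (deriv ^^ n) cot_tail 0"
proof -
  let ?U = "- (\<Lambda> - {0}) \<inter> tail_domain \<inter> ball 0 1"
  have o: "open ?U" using open_reduced_domain open_tail_domain by auto
  have 0: "0 \<in> ?U" using zero_in_tail_domain by simp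
  have h1: "log_deriv_red holomorphic_on ?U" by (rule holomorphic_on_subset[OF log_deriv_red_holomorphic]) auto
  have h2: "Digamma_part holomorphic_on ?U" by (rule holomorphic_on_subset[OF Digamma_part_holomorphic]) auto
  have h3: "cot_tail holomorphic_on ?U" by (rule holomorphic_on_subset[OF cot_tail_holomorphic]) auto
  have "log_deriv_red s = Digamma_part s + cot_tail s" if s: "s \<in> ?U" for s
  proof (cases "s = 0")
    case True
    have "cot_tail 0 = 0" using cot_tail_minus[of 0] by simp
    moreover have "log_deriv_red 0 = 0" using log_deriv_red_minus[of 0] by simp
    ultimately show ?thesis by (simp add: True Digamma_part_def)
  next
    case False
    then have "s \<notin> \<Lambda>" "s \<in> ball 0 1" using s by auto
    then show ?thesis using False log_deriv_theta_eq_cot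
      by (simp add: log_deriv_red_eq pi_cot_eq_Digamma_part)
  qed
  then have "(deriv ^^ n) log_deriv_red 0 = (deriv ^^ n) (\<lambda>s. Digamma_part s + cot_tail s) 0"
    by (intro higher_deriv_transform_within_open[OF h1 holomorphic_on_add[OF h2 h3] o 0])
  also have "\<dots> = (deriv ^^ n) Digamma_part 0 + (deriv ^^ n) cot_tail 0"
    by (rule higher_deriv_add[OF h2 h3 o 0])
  also have "(deriv ^^ n) Digamma_part 0 = (deriv ^^ n) (\<lambda>s. Digamma (1 + - 1 * s)) 0 - (deriv ^^ n) (\<lambda>s. Digamma (1 + 1 * s)) (0::complex)"
    unfolding Digamma_part_def[abs_def]
  proof (rule higher_deriv_diff[OF _ _ open_ball])
    show "(\<lambda>s. Digamma (1 + - 1 * s)) holomorphic_on ball (0::complex) 1"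
      "(\<lambda>s. Digamma (1 + 1 * s)) holomorphic_on ball (0::complex) 1"
      by (intro Digamma_shift_holomorphic ball_nonpos_Ints; assumption)+
  qed simp
  also have "\<dots> = (- 1) ^ n * Polygamma n (1 + - 1 * 0) - 1 ^ n * Polygamma n (1 + 1 * 0)"
    by (rule arg_cong2[where f = "(-)"]; rule higher_deriv_Digamma_affine[OF open_ball centre_in_ball[THEN iffD2, OF zero_less_one]];
        erule ball_nonpos_Ints)
  finally show ?thesis using n by simp
qed

section \<open>Lattice sums and the Taylor coefficients of the logarithmic derivative\<close>

definition row_sum :: "nat \<Rightarrow> int \<Rightarrow> complex" where
  "row_sum m b = (\<Sum>\<^sub>\<infinity>a\<in>{a :: int. (a, b) \<noteq> (0, 0)}. 1 / (of_int a + of_int b * \<tau>) ^ m)"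

lemma multiple_tau_not_Ints: "b \<noteq> 0 \<Longrightarrow> of_int b * \<tau> \<notin> \<int>"
  using multiple_tau_Ints[of 0 b] zero_in_tail_domain by auto

lemma row_has_sum:
  assumes n: "odd n" and b: "b \<noteq> 0"
  shows "((\<lambda>a. 1 / (of_int a + of_int b * \<tau>) ^ Suc n) has_sum row_sum (Suc n) b) UNIV"
    and "row_sum (Suc n) b = - (deriv ^^ n) pi_cot (of_int b * \<tau>) / fact n"
proof -
  have "{a :: int. (a, b) \<noteq> (0, 0)} = UNIV" using b by auto
  moreover note h = pi_cot_deriv_has_sum[OF n multiple_tau_not_Ints[OF b]]
  ultimately show *: "row_sum (Suc n) b = - (deriv ^^ n) pi_cot (of_int b * \<tau>) / fact n"
    unfolding row_sum_def using infsumI[OF h] by simp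
  show "((\<lambda>a. 1 / (of_int a + of_int b * \<tau>) ^ Suc n) has_sum row_sum (Suc n) b) UNIV"
    unfolding * by (rule h)
qed

lemma row_sum_0:
  assumes n: "odd n"
  shows "row_sum (Suc n) 0 = 2 * Polygamma n 1 / fact n"
proof -
  have "{a :: int. (a, 0 :: int) \<noteq> (0, 0)} = - {0}" by auto
  then show ?thesis unfolding row_sum_def using infsumI[OF Polygamma_1_has_sum[OF n]] by simp
qed

text \<open>Cauchy's inequality on the disc of radius \<open>Im \<tau> / 2\<close> about
  \<open>b * \<tau>\<close>, which keeps at least this distance from the real axis. It is applied to
  the cotangent minus its limit, a constant that disappears from derivatives of order at least
  1.\<close>

lemma higher_deriv_pi_cot_bound:
  assumes n: "n \<ge> 1" and b: "b \<noteq> 0"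
  shows "norm ((deriv ^^ n) pi_cot (of_int b * \<tau>))
    \<le> fact n * (2 * pi / (1 - nome) * nome ^ nat \<bar>b\<bar>) / (Im \<tau> / 2) ^ n"
proof -
  define r where "r = Im \<tau> / 2"
  have r: "r > 0" using tau by (simp add: r_def)
  define c where "c = (if b > 0 then pi * \<i> else - pi * \<i>)"
  define k where "k = nat \<bar>b\<bar>"
  have k: "k \<ge> 1" using b by (simp add: k_def)
  have cb: "cball (of_int b * \<tau>) r \<subseteq> - \<int>"
  proof
    fix z assume z: "z \<in> cball (of_int b * \<tau>) r"
    have "\<bar>of_int b * Im \<tau> - Im z\<bar> \<le> r"
      using z abs_Im_le_cmod[of "of_int b * \<tau> - z"] by (auto simp: dist_norm)
    moreover have "\<bar>of_int b * Im \<tau>\<bar> \<ge> Im \<tau>"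
    proof -
      have "1 \<le> \<bar>real_of_int b\<bar>" using b by linarith
      then show ?thesis using tau by (simp add: abs_mult)
    qed
    ultimately have "Im z \<noteq> 0" using tau by (auto simp: r_def)
    then show "z \<in> - \<int>" by (auto elim: Ints_cases)
  qed
  have hol: "pi_cot holomorphic_on - \<int>" by (rule pi_cot_holomorphic)
  have "norm ((deriv ^^ n) (\<lambda>z. pi_cot z + c) (of_int b * \<tau>)) \<le> fact n * (2 * pi / (1 - nome) * nome ^ k) / r ^ n"
  proof (rule Cauchy_inequality)
    show "(\<lambda>z. pi_cot z + c) holomorphic_on ball (of_int b * \<tau>) r"
      by (intro holomorphic_intros holomorphic_on_subset[OF hol] order_trans[OF ball_subset_cball cb])
    show "continuous_on (cball (of_int b * \<tau>) r) (\<lambda>z. pi_cot z + c)"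
      using cb by (intro continuous_intros holomorphic_on_imp_continuous_on holomorphic_on_subset[OF hol])
    fix z assume z: "norm (of_int b * \<tau> - z) = r"
    have im: "\<bar>Im (z - of_int b * \<tau>)\<bar> \<le> real k * Im \<tau> / 2"
    proof -
      have "\<bar>Im (z - of_int b * \<tau>)\<bar> \<le> r"
        using z abs_Im_le_cmod[of "z - of_int b * \<tau>"] by (simp only: norm_minus_commute)
      also have "\<dots> \<le> real k * r" using k r by simp
      finally show ?thesis by (simp add: r_def)
    qed
    show "norm (pi_cot z + c) \<le> 2 * pi / (1 - nome) * nome ^ k"
    proof (cases "b > 0")
      case True
      then have "(of_nat k :: complex) = of_int b" by (simp add: k_def)
      then show ?thesis using pi_cot_tau_bound(1)[OF k im] True by (simp add: c_def)
    next
      case False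
      then have "(of_nat k :: complex) = - of_int b" by (simp add: k_def)
      then show ?thesis using pi_cot_tau_bound(2)[OF k im] False by (simp add: c_def)
    qed
  qed (fact r)
  moreover have "(deriv ^^ n) (\<lambda>z. pi_cot z + c) (of_int b * \<tau>) = (deriv ^^ n) pi_cot (of_int b * \<tau>)"
    using higher_deriv_add[OF hol holomorphic_on_const open_Compl_Ints, of "of_int b * \<tau>" n c]
      multiple_tau_not_Ints[OF b] n by simp
  ultimately show ?thesis by (simp add: r_def k_def)
qed

text \<open>Locally uniform convergence allows termwise differentiation of \<open>cot_tail\<close>,
  but this gives only the sum over pairs of rows. The derivatives decay like powers of
  \<open>nome\<close>, so the positive and the negative rows converge absolutely by themselves and
  can be separated; the row 0 is added from \<open>Polygamma\<close>.\<close>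

lemma row_sum_infsum:
  assumes n: "odd n"
  shows "((\<lambda>b. row_sum (Suc n) b) has_sum (- (deriv ^^ n) log_deriv_red 0 / fact n)) UNIV"
proof -
  have n1: "n \<ge> 1" using n by (cases n) auto
  let ?s = "row_sum (Suc n)"
  define D where "D = (\<lambda>b. (deriv ^^ n) pi_cot (of_int b * \<tau>))"
  have cp: "(deriv ^^ n) (cot_pair b) 0 = D (int (Suc b)) + D (- int (Suc b))" for b
  proof -
    have i: "of_int (int (Suc b)) * \<tau> = of_nat (Suc b) * \<tau>" "of_int (- int (Suc b)) * \<tau> = - (of_nat (Suc b) * \<tau>)"
      by (simp_all only: of_int_of_nat_eq of_int_minus mult_minus_left)
    have sh: "(deriv ^^ n) (\<lambda>z. pi_cot (1 * z + c)) 0 = 1 ^ n * (deriv ^^ n) pi_cot (1 * 0 + c)"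
      and hsh: "(\<lambda>z. pi_cot (1 * z + c)) holomorphic_on tail_domain"
      if "\<And>z. z \<in> tail_domain \<Longrightarrow> z + c \<notin> \<int>" for c
    proof -
      show "(deriv ^^ n) (\<lambda>z. pi_cot (1 * z + c)) 0 = 1 ^ n * (deriv ^^ n) pi_cot (1 * 0 + c)"
        by (rule higher_deriv_compose_linear'[OF pi_cot_holomorphic open_tail_domain open_Compl_Ints zero_in_tail_domain])
          (use that in auto)
      have "(pi_cot \<circ> (\<lambda>z. 1 * z + c)) holomorphic_on tail_domain"
        by (rule holomorphic_on_compose_gen[OF _ pi_cot_holomorphic])
          (use that in \<open>auto intro!: holomorphic_intros\<close>)
      then show "(\<lambda>z. pi_cot (1 * z + c)) holomorphic_on tail_domain" by (simp add: o_def)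
    qed
    have c1: "z + of_int (int (Suc b)) * \<tau> \<notin> \<int>" "z + of_int (- int (Suc b)) * \<tau> \<notin> \<int>" if "z \<in> tail_domain" for z
      using multiple_tau_Ints[of z "int (Suc b)"] multiple_tau_Ints[of z "- int (Suc b)"] that by auto
    have "cot_pair b = (\<lambda>z. pi_cot (1 * z + of_int (int (Suc b)) * \<tau>) + pi_cot (1 * z + of_int (- int (Suc b)) * \<tau>))"
      unfolding i by (simp only: cot_pair_def[abs_def] mult_1 add_uminus_conv_diff)
    then have "(deriv ^^ n) (cot_pair b) 0 = (deriv ^^ n) (\<lambda>z. pi_cot (1 * z + of_int (int (Suc b)) * \<tau>)) 0
        + (deriv ^^ n) (\<lambda>z. pi_cot (1 * z + of_int (- int (Suc b)) * \<tau>)) 0"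
      using higher_deriv_add[OF hsh[OF c1(1)] hsh[OF c1(2)] open_tail_domain zero_in_tail_domain, of n] by simp
    moreover have "(deriv ^^ n) (\<lambda>z. pi_cot (1 * z + of_int (int (Suc b)) * \<tau>)) 0 = D (int (Suc b))"
      using sh[OF c1(1)] by (simp only: D_def power_one mult_1 mult_zero_right add_0)
    moreover have "(deriv ^^ n) (\<lambda>z. pi_cot (1 * z + of_int (- int (Suc b)) * \<tau>)) 0 = D (- int (Suc b))"
      using sh[OF c1(2)] by (simp only: D_def power_one mult_1 mult_zero_right add_0)
    ultimately show ?thesis by (simp only:)
  qed
  have lim: "(\<lambda>N. (deriv ^^ n) (\<lambda>z. \<Sum>b<N. cot_pair b z) 0) \<longlonglongrightarrow> (deriv ^^ n) cot_tail 0"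
  proof -
    let ?A = "tail_domain \<inter> ball 0 1"
    have "uniform_limit ?A (\<lambda>N z. \<Sum>b<N. cot_pair b z) cot_tail sequentially"
      by (rule cot_pair_uniform_limit) (auto intro: bounded_subset[OF bounded_ball])
    then show ?thesis
      by (rule higher_deriv_complex_uniform_limit)
        (use open_tail_domain zero_in_tail_domain in
          \<open>auto intro!: always_eventually holomorphic_on_sum holomorphic_on_subset[OF cot_pair_holomorphic]\<close>)
  qed
  have "(deriv ^^ n) (\<lambda>z. \<Sum>b<N. cot_pair b z) 0 = (\<Sum>b<N. (deriv ^^ n) (cot_pair b) 0)" for N
  proof (induction N)
    case (Suc N)
    have "(\<lambda>z. \<Sum>b<N. cot_pair b z) holomorphic_on tail_domain"
      by (intro holomorphic_on_sum cot_pair_holomorphic)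
    from higher_deriv_add[OF this cot_pair_holomorphic open_tail_domain zero_in_tail_domain] Suc
    show ?case by simp
  qed (use n1 in simp)
  with lim have tail: "(\<lambda>b. D (int (Suc b)) + D (- int (Suc b))) sums (deriv ^^ n) cot_tail 0"
    unfolding sums_def cp by simp
  define C where "C = fact n * (2 * pi / (1 - nome)) / (Im \<tau> / 2) ^ n"
  have bd: "norm (D (int (Suc b))) \<le> C * nome ^ Suc b" "norm (D (- int (Suc b))) \<le> C * nome ^ Suc b" for b
    using higher_deriv_pi_cot_bound[OF n1, of "int (Suc b)"] higher_deriv_pi_cot_bound[OF n1, of "- int (Suc b)"]
    by (simp_all add: D_def C_def field_simps del: of_nat_Suc nat_int_add)
  have sn: "summable (\<lambda>b. norm (D (int (Suc b))))" "summable (\<lambda>b. norm (D (- int (Suc b))))"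
    by (rule summable_comparison_test'[OF summable_nome[of C], of 0], unfold real_norm_def abs_norm_cancel, rule bd,
        rule summable_comparison_test'[OF summable_nome[of C], of 0], unfold real_norm_def abs_norm_cancel, rule bd)
  have sD: "?s b = - D b / fact n" if "b \<noteq> 0" for b
    using row_has_sum(2)[OF n that] by (simp add: D_def)
  have hs: "((\<lambda>b. D (int (Suc b))) has_sum (\<Sum>b. D (int (Suc b)))) UNIV"
    "((\<lambda>b. D (- int (Suc b))) has_sum (\<Sum>b. D (- int (Suc b)))) UNIV"
    by (rule norm_summable_imp_has_sum[OF sn(1) summable_sums[OF summable_norm_cancel[OF sn(1)]]],
        rule norm_summable_imp_has_sum[OF sn(2) summable_sums[OF summable_norm_cancel[OF sn(2)]]])
  have tot: "(\<Sum>b. D (int (Suc b))) + (\<Sum>b. D (- int (Suc b))) = (deriv ^^ n) cot_tail 0"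
    using suminf_add[OF summable_norm_cancel[OF sn(1)] summable_norm_cancel[OF sn(2)]] sums_unique[OF tail] by simp
  have p: "(?s has_sum (- (\<Sum>b. D (int (Suc b))) / fact n)) (range (\<lambda>k. int (Suc k)))"
  proof (subst has_sum_reindex)
    have "((\<lambda>b. (- 1 / fact n) * D (int (Suc b))) has_sum (- 1 / fact n) * (\<Sum>b. D (int (Suc b)))) UNIV"
      by (intro has_sum_cmult_right hs)
    then show "((?s \<circ> (\<lambda>k. int (Suc k))) has_sum (- (\<Sum>b. D (int (Suc b))) / fact n)) UNIV"
      using sD[of "int (Suc _)"] by (simp add: o_def del: of_nat_Suc)
  qed (auto simp: inj_on_def)
  have q: "(?s has_sum (- (\<Sum>b. D (- int (Suc b))) / fact n)) (range (\<lambda>k. - int (Suc k)))"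
  proof (subst has_sum_reindex)
    have "((\<lambda>b. (- 1 / fact n) * D (- int (Suc b))) has_sum (- 1 / fact n) * (\<Sum>b. D (- int (Suc b)))) UNIV"
      by (intro has_sum_cmult_right hs)
    then show "((?s \<circ> (\<lambda>k. - int (Suc k))) has_sum (- (\<Sum>b. D (- int (Suc b))) / fact n)) UNIV"
      using sD[of "- int (Suc _)"] by (simp add: o_def del: of_nat_Suc)
  qed (auto simp: inj_on_def)
  have z: "(?s has_sum (2 * Polygamma n 1 / fact n)) {0}"
    using row_sum_0[OF n] has_sum_finite[of "{0}" ?s] by simp
  have "(?s has_sum (- (\<Sum>b. D (int (Suc b))) / fact n + - (\<Sum>b. D (- int (Suc b))) / fact n))
      (range (\<lambda>k. int (Suc k)) \<union> range (\<lambda>k. - int (Suc k)))"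
    by (rule has_sum_Un_disjoint[OF p q]) auto
  then have "(?s has_sum (- (\<Sum>b. D (int (Suc b))) / fact n + - (\<Sum>b. D (- int (Suc b))) / fact n + 2 * Polygamma n 1 / fact n))
      (range (\<lambda>k. int (Suc k)) \<union> range (\<lambda>k. - int (Suc k)) \<union> {0})"
    by (rule has_sum_Un_disjoint[OF _ z]) auto
  moreover have "range (\<lambda>k. int (Suc k)) \<union> range (\<lambda>k. - int (Suc k)) \<union> {0} = UNIV"
  proof -
    have "x \<in> range (\<lambda>k. int (Suc k)) \<union> range (\<lambda>k. - int (Suc k)) \<union> {0}" for x
    proof (cases x "0 :: int" rule: linorder_cases)
      case less
      then have "x = - int (Suc (nat (- x - 1)))" by simp
      then show ?thesis by blast
    next
      case greater
      then have "x = int (Suc (nat (x - 1)))" by simp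
      then show ?thesis by blast
    qed auto
    then show ?thesis by blast
  qed
  moreover have "- (\<Sum>b. D (int (Suc b))) / fact n + - (\<Sum>b. D (- int (Suc b))) / fact n + 2 * Polygamma n 1 / fact n
      = - (deriv ^^ n) log_deriv_red 0 / fact n"
    unfolding higher_deriv_log_deriv_red[OF n] tot[symmetric] by (simp add: field_simps)
  ultimately show ?thesis by simp
qed

lemma lattice_norm_bound:
  obtains K where "K > 0"
    "\<And>a b :: int. \<bar>of_int a\<bar> \<le> K * norm (of_int a + of_int b * \<tau>)"
    "\<And>a b :: int. \<bar>of_int b\<bar> \<le> K * norm (of_int a + of_int b * \<tau>)"
proof
  \<comment> \<open>From \<open>|b| \<le> |z| / Im \<tau>\<close>, by imaginary parts, and
    \<open>|a| \<le> |z| + |b| * |\<tau>|\<close>.\<close>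
  define K where "K = 1 + (norm \<tau> + 1) / Im \<tau>"
  show "K > 0" unfolding K_def using tau by (intro add_pos_nonneg) auto
  fix a b :: int
  define z where "z = of_int a + of_int b * \<tau>"
  have "\<bar>of_int b\<bar> * Im \<tau> = \<bar>Im z\<bar>" using tau by (simp add: z_def abs_mult)
  then have "\<bar>of_int b\<bar> * Im \<tau> \<le> norm z" using abs_Im_le_cmod[of z] by simp
  then have b: "\<bar>of_int b\<bar> \<le> norm z / Im \<tau>" using tau by (simp add: field_simps)
  have "norm (of_int a :: complex) = norm (z - of_int b * \<tau>)" by (simp add: z_def)
  also have "\<dots> \<le> norm z + \<bar>of_int b\<bar> * norm \<tau>" using norm_triangle_ineq4[of z "of_int b * \<tau>"] by (simp add: norm_mult)
  also have "\<dots> \<le> norm z + norm z / Im \<tau> * norm \<tau>" by (intro add_left_mono mult_right_mono b) simp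
  also have "\<dots> \<le> K * norm z" using tau by (simp add: K_def field_simps)
  finally show "\<bar>of_int a\<bar> \<le> K * norm z" by simp
  have "norm z / Im \<tau> \<le> K * norm z" using tau by (simp add: K_def field_simps)
  with b show "\<bar>of_int b\<bar> \<le> K * norm z" by simp
qed

lemma summable_inverse_1_plus_square_int: "(\<lambda>a :: int. 1 / (1 + (of_int a)\<^sup>2 :: real)) summable_on UNIV"
proof -
  have s: "(\<lambda>k :: nat. 1 / (1 + (of_nat k)\<^sup>2 :: real)) summable_on UNIV"
  proof (subst summable_on_UNIV_nonneg_real_iff)
    have "summable (\<lambda>k. inverse (real k ^ 2))" by (rule inverse_power_summable) simp
    then show "summable (\<lambda>k :: nat. 1 / (1 + (of_nat k)\<^sup>2 :: real))"
    proof (rule summable_comparison_test_ev[rotated])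
      show "\<forall>\<^sub>F k in sequentially. norm (1 / (1 + (real k)\<^sup>2)) \<le> inverse ((real k)\<^sup>2)"
        using eventually_gt_at_top[of 0] by eventually_elim (auto simp: inverse_eq_divide intro!: frac_le)
    qed
  qed simp
  have "(\<lambda>a :: int. 1 / (1 + (of_int a)\<^sup>2 :: real)) summable_on range int"
    by (subst summable_on_reindex) (use s in \<open>auto simp: o_def\<close>)
  moreover have "(\<lambda>a :: int. 1 / (1 + (of_int a)\<^sup>2 :: real)) summable_on range (\<lambda>k. - int k)"
    by (subst summable_on_reindex) (use s in \<open>auto simp: o_def inj_on_def\<close>)
  moreover have "range int \<union> range (\<lambda>k. - int k) = UNIV"
  proof -
    have "x \<in> range int \<union> range (\<lambda>k. - int k)" for x by (cases x rule: int_cases2) auto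
    then show ?thesis by blast
  qed
  ultimately show ?thesis
    using summable_on_union[of _ "range int" "range (\<lambda>k. - int k)"] by metis
qed

text \<open>\<open>N = K * norm (a + b * \<tau>)\<close> dominates \<open>|a|\<close>,
  \<open>|b|\<close> and 1, so \<open>(1 + a^2) * (1 + b^2)\<close> is at most
  \<open>4 * N ^ 4\<close>, hence at most \<open>4 * N ^ m\<close>. This gives a majorant that is a
  product of two convergent one-dimensional series.\<close>

lemma lattice_sum_abs_summable:
  assumes m: "m \<ge> 4"
  shows "(\<lambda>(b :: int, a :: int). 1 / (of_int a + of_int b * \<tau>) ^ m) summable_on
    (SIGMA b:UNIV. {a. (a, b) \<noteq> (0, 0)})"
proof (rule abs_summable_summable)
  obtain K where K: "K > 0"
    "\<And>a b :: int. \<bar>of_int a\<bar> \<le> K * norm (of_int a + of_int b * \<tau>)"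
    "\<And>a b :: int. \<bar>of_int b\<bar> \<le> K * norm (of_int a + of_int b * \<tau>)"
    using lattice_norm_bound by blast
  let ?h = "\<lambda>a :: int. 1 / (1 + (of_int a)\<^sup>2 :: real)"
  have "(\<lambda>x :: int \<times> int. ?h (fst x) * ?h (snd x)) summable_on (SIGMA b:UNIV. UNIV)"
  proof (rule summable_on_SigmaI)
    fix b :: int
    show "((\<lambda>a. ?h (fst (b, a)) * ?h (snd (b, a))) has_sum ?h b * infsum ?h UNIV) UNIV"
      unfolding fst_conv snd_conv by (rule has_sum_cmult_right[OF has_sum_infsum[OF summable_inverse_1_plus_square_int]])
  next
    show "(\<lambda>b. ?h b * infsum ?h UNIV) summable_on UNIV"
      by (rule summable_on_cmult_left[OF summable_inverse_1_plus_square_int])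
  qed simp
  from summable_on_subset_banach[OF this, of "SIGMA b:UNIV. {a. (a, b) \<noteq> (0, 0)}"]
  have "(\<lambda>x :: int \<times> int. 4 * K ^ m * (?h (fst x) * ?h (snd x))) summable_on (SIGMA b:UNIV. {a. (a, b) \<noteq> (0, 0)})"
    by (intro summable_on_cmult_right) auto
  then show "(\<lambda>x :: int \<times> int. norm (case x of (b, a) \<Rightarrow> 1 / (of_int a + of_int b * \<tau>) ^ m)) summable_on
      (SIGMA b:UNIV. {a. (a, b) \<noteq> (0, 0)})"
  proof (rule summable_on_comparison_test)
    fix x :: "int \<times> int" assume x: "x \<in> (SIGMA b:UNIV. {a. (a, b) \<noteq> (0, 0)})"
    obtain b a where ba: "x = (b, a)" "(a, b) \<noteq> (0, 0)" using x by auto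
    define N where "N = K * norm (of_int a + of_int b * \<tau>)"
    have A: "\<bar>of_int a\<bar> \<le> N" and B: "\<bar>of_int b\<bar> \<le> N" using K(2)[of a b] K(3)[of b a] by (simp_all add: N_def)
    have N: "N \<ge> 1"
    proof (cases "a = 0")
      case True
      then have "\<bar>real_of_int b\<bar> \<ge> 1" using ba by auto
      with B show ?thesis by simp
    next
      case False
      then have "\<bar>real_of_int a\<bar> \<ge> 1" by auto
      with A show ?thesis by simp
    qed
    have sq: "1 + (of_int c)\<^sup>2 \<le> 2 * N\<^sup>2" if "\<bar>of_int c\<bar> \<le> N" for c
      using power_mono[OF that, of 2] power_mono[OF N, of 2] by simp
    have "(1 + (of_int b)\<^sup>2) * (1 + (of_int a)\<^sup>2) \<le> (2 * N\<^sup>2) * (2 * N\<^sup>2)"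
      by (intro mult_mono sq A B) auto
    also have "\<dots> = 4 * N ^ 4" by (simp add: power4_eq_xxxx power2_eq_square)
    also have "\<dots> \<le> 4 * N ^ m" using m N by (intro mult_left_mono power_increasing) auto
    also have "\<dots> = 4 * K ^ m * norm (of_int a + of_int b * \<tau>) ^ m" by (simp add: N_def power_mult_distrib)
    finally have le: "(1 + (of_int b)\<^sup>2) * (1 + (of_int a)\<^sup>2) \<le> 4 * K ^ m * norm (of_int a + of_int b * \<tau>) ^ m" .
    have "norm (of_int a + of_int b * \<tau>) ^ m > 0"
    proof -
      have "norm (of_int a + of_int b * \<tau>) \<noteq> 0" using N by (auto simp: N_def)
      then show ?thesis by simp
    qed
    moreover have "(0 :: real) < (1 + (of_int b)\<^sup>2) * (1 + (of_int a)\<^sup>2)"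
      by (intro mult_pos_pos add_pos_nonneg) auto
    ultimately have "1 / norm (of_int a + of_int b * \<tau>) ^ m \<le> 4 * K ^ m / ((1 + (of_int b)\<^sup>2) * (1 + (of_int a)\<^sup>2))"
      using le by (simp add: divide_simps mult_ac)
    then show "norm (case x of (b, a) \<Rightarrow> 1 / (of_int a + of_int b * \<tau>) ^ m) \<le> 4 * K ^ m * (?h (fst x) * ?h (snd x))"
      by (simp add: ba norm_divide norm_power)
  qed auto
qed

lemma lattice_injective: "of_int a + of_int b * \<tau> = of_int a' + of_int b' * \<tau> \<Longrightarrow> a = a' \<and> b = b'"
  using tau by (auto simp: complex_eq_iff)

text \<open>Absolute convergence permits summation row by row; for the exponent 2 the rows are part
  of the definition of \<open>eisenstein_2G\<close>.\<close>

lemma eisenstein_2G_eq_infsum_row_sum: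
  assumes m: "even m" "m \<ge> 4"
  shows "eisenstein_2G \<tau> m = infsum (row_sum m) UNIV"
proof -
  let ?P = "SIGMA b:UNIV. {a :: int. (a, b) \<noteq> (0, 0 :: int)}"
  let ?h = "\<lambda>(b :: int, a :: int). of_int a + of_int b * \<tau>"
  have inj: "inj_on ?h ?P" using lattice_injective by (auto simp: inj_on_def)
  have img: "lattice \<tau> - {0} = ?h ` ?P"
  proof (intro set_eqI iffI)
    fix z assume z: "z \<in> lattice \<tau> - {0}"
    then obtain a b where "z = of_int a + of_int b * \<tau>" by (auto elim: latticeE)
    with z show "z \<in> ?h ` ?P" by (intro image_eqI[of _ _ "(b, a)"]) auto
  next
    fix z assume "z \<in> ?h ` ?P"
    then obtain a b where "z = of_int a + of_int b * \<tau>" "(a, b) \<noteq> (0, 0)" by auto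
    with lattice_injective[of a b 0 0] show "z \<in> lattice \<tau> - {0}" by (auto simp: lattice_def)
  qed
  have "eisenstein_2G \<tau> m = infsum (\<lambda>l. 1 / l ^ m) (?h ` ?P)"
    using m by (simp add: eisenstein_2G_def img)
  also have "\<dots> = infsum ((\<lambda>l. 1 / l ^ m) \<circ> ?h) ?P" by (rule infsum_reindex[OF inj])
  also have "\<dots> = infsum (\<lambda>(b :: int, a :: int). 1 / (of_int a + of_int b * \<tau>) ^ m) ?P"
    by (intro infsum_cong) auto
  also have "\<dots> = infsum (row_sum m) UNIV"
    unfolding row_sum_def[abs_def] by (rule infsum_Sigma'_banach[OF lattice_sum_abs_summable[OF m(2)], symmetric])
  finally show ?thesis .
qed

text \<open>For odd \<open>n\<close> this is the sum over rows. For even \<open>n\<close> the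
  function is odd, so the derivative vanishes, in agreement with the value 0 of
  \<open>eisenstein_2G\<close> at odd indices.\<close>

lemma log_deriv_red_taylor: "(deriv ^^ n) log_deriv_red 0 = - fact n * eisenstein_2G \<tau> (Suc n)"
proof (cases "odd n")
  case True
  then have "infsum (row_sum (Suc n)) UNIV = - (deriv ^^ n) log_deriv_red 0 / fact n"
    by (intro infsumI row_sum_infsum)
  moreover have "eisenstein_2G \<tau> (Suc n) = infsum (row_sum (Suc n)) UNIV"
  proof (cases "n = 1")
    case True
    then show ?thesis by (simp add: eisenstein_2G_def row_sum_def[abs_def] numeral_2_eq_2)
  next
    case False
    with True have "n \<ge> 3" by (auto elim!: oddE)
    with True show ?thesis by (intro eisenstein_2G_eq_infsum_row_sum) auto
  qed
  ultimately show ?thesis by (simp add: field_simps)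
next
  case False
  have o: "open (- (\<Lambda> - {0}))" by (rule open_reduced_domain)
  have "(deriv ^^ n) (\<lambda>s. log_deriv_red (- 1 * s + 0)) 0 = (- 1) ^ n * (deriv ^^ n) log_deriv_red (- 1 * 0 + 0)"
    by (rule higher_deriv_compose_linear'[OF log_deriv_red_holomorphic o o]) auto
  moreover have "(\<lambda>s. log_deriv_red (- 1 * s + 0)) = (\<lambda>s. - log_deriv_red s)"
    using log_deriv_red_minus by (simp add: fun_eq_iff)
  moreover have "(deriv ^^ n) (\<lambda>s. - log_deriv_red s) 0 = - (deriv ^^ n) log_deriv_red 0"
    by (rule higher_deriv_uminus[OF log_deriv_red_holomorphic o]) simp
  ultimately have "- (deriv ^^ n) log_deriv_red 0 = (deriv ^^ n) log_deriv_red 0" using False by simp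
  then have "(deriv ^^ n) log_deriv_red 0 = 0" by (simp add: complex_eq_iff)
  with False show ?thesis by (simp add: eisenstein_2G_def)
qed

end

section \<open>The dependence on the auxiliary parameter\<close>

lemma higher_deriv_reciprocal:
  fixes s :: complex
  shows "s \<noteq> 0 \<Longrightarrow> (deriv ^^ n) (\<lambda>s. 1 / s) s = (- 1) ^ n * fact n / s ^ Suc n"
proof (induction n arbitrary: s)
  case (Suc n)
  have "((\<lambda>s. (- 1) ^ n * fact n / s ^ Suc n) has_field_derivative
      - ((- 1) ^ n * fact n * (of_nat (Suc n) * s ^ n)) / (s ^ Suc n * s ^ Suc n)) (at s)"
    using Suc.prems by (auto intro!: derivative_eq_intros simp del: power_Suc of_nat_Suc)
  then have "((deriv ^^ n) (\<lambda>s. 1 / s) has_field_derivative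
      - ((- 1) ^ n * fact n * (of_nat (Suc n) * s ^ n)) / (s ^ Suc n * s ^ Suc n)) (at s)"
    by (rule has_field_derivative_transform_within_open[where S = "- {0}"]) (use Suc in auto)
  then have "(deriv ^^ Suc n) (\<lambda>s. 1 / s) s = - ((- 1) ^ n * fact n * (of_nat (Suc n) * s ^ n)) / (s ^ Suc n * s ^ Suc n)"
    by (simp add: DERIV_imp_deriv)
  also have "\<dots> = (- 1) ^ Suc n * fact (Suc n) / s ^ Suc (Suc n)"
    using Suc.prems by (simp add: field_simps)
  finally show ?case .
qed simp

text \<open>The equation determines each coefficient of a solution from the earlier ones.\<close>

lemma fps_linear_ode_unique:
  fixes F G L :: "complex fps"
  assumes "fps_deriv F = F * L" "fps_deriv G = G * L" "fps_nth F 0 = fps_nth G 0"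
  shows "F = G"
proof -
  define D where "D = F - G"
  have d: "fps_deriv D = D * L" using assms by (simp add: D_def algebra_simps)
  have "fps_nth D n = 0" for n
  proof (induction n rule: less_induct)
    case (less n)
    show ?case
    proof (cases n)
      case 0
      then show ?thesis using assms(3) by (simp add: D_def)
    next
      case (Suc m)
      have "of_nat (Suc m) * fps_nth D (Suc m) = fps_nth (fps_deriv D) m" by simp
      also have "\<dots> = (\<Sum>i=0..m. fps_nth D i * fps_nth L (m - i))" unfolding d fps_mult_nth ..
      also have "\<dots> = 0" using less Suc by (intro sum.neutral) auto
      finally show ?thesis using Suc by (simp del: of_nat_Suc)
    qed
  qed
  then have "D = 0" by (simp add: fps_eq_iff)
  then show ?thesis by (simp add: D_def)
qed

text \<open>As \<alpha> is additive, the exponential factors of the blocks multiply to the same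
  number for every partition. This is why a sum over partitions has a quasi-period at all.\<close>

lemma partition_sum_mult_exp:
  fixes \<alpha> :: "'b::comm_monoid_add \<Rightarrow> complex"
  assumes S: "finite S" and \<alpha>: "\<And>x y. \<alpha> (x + y) = \<alpha> x + \<alpha> y" "\<alpha> 0 = 0"
  shows "partition_sum S (\<lambda>B. exp (\<alpha> (\<Sum>i\<in>B. W i)) * g B) = exp (\<alpha> (\<Sum>i\<in>S. W i)) * partition_sum S g"
  unfolding partition_sum_def sum_distrib_left
proof (rule sum.cong[OF refl])
  have \<alpha>_sum: "\<alpha> (\<Sum>i\<in>B. W i) = (\<Sum>i\<in>B. \<alpha> (W i))" for B
    by (induction B rule: infinite_finite_induct) (auto simp: \<alpha>)
  fix \<pi> assume "\<pi> \<in> {\<pi>. partition_on S \<pi>}"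
  then have \<pi>: "partition_on S \<pi>" by simp
  have "(\<Prod>B\<in>\<pi>. exp (\<alpha> (\<Sum>i\<in>B. W i))) = exp (\<Sum>B\<in>\<pi>. \<Sum>i\<in>B. \<alpha> (W i))"
    using finite_elements[OF S \<pi>] by (simp add: \<alpha>_sum exp_sum)
  also have "(\<Sum>B\<in>\<pi>. \<Sum>i\<in>B. \<alpha> (W i)) = (\<Sum>i\<in>\<Union>\<pi>. \<alpha> (W i))"
  proof (rule sum.Union_disjoint[symmetric, unfolded o_def])
    show "\<forall>A\<in>\<pi>. finite A" using S \<pi> by (auto simp: partition_on_def intro: finite_subset)
    show "\<forall>A\<in>\<pi>. \<forall>B\<in>\<pi>. A \<noteq> B \<longrightarrow> A \<inter> B = {}" using \<pi> by (auto simp: partition_on_def disjoint_def)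
  qed
  also have "\<Union>\<pi> = S" using \<pi> by (simp add: partition_on_def)
  finally show "(\<Prod>B\<in>\<pi>. exp (\<alpha> (\<Sum>i\<in>B. W i)) * g B) = exp (\<alpha> (\<Sum>i\<in>S. W i)) * (\<Prod>B\<in>\<pi>. g B)"
    by (simp add: prod.distrib \<alpha>_sum)
qed

context jacobi_theta
begin

text \<open>This is \<open>s * phi w s\<close>, extended holomorphically over \<open>s = 0\<close>
  by using \<open>theta_red\<close> for the denominator.\<close>

definition phi_red :: "complex \<Rightarrow> complex \<Rightarrow> complex" where
  "phi_red w s = exp (- cc * (cnj w - w) * s) * \<theta> (w + s) / (\<theta> w * theta_red s)"

lemma phi_eq_phi_red: "s \<noteq> 0 \<Longrightarrow> phi w s = phi_red w s / s"
  by (simp add: phi_def phi_red_def kronecker_def theta_red_def)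

lemma phi_red_0: "w \<notin> \<Lambda> \<Longrightarrow> phi_red w 0 = 1"
  by (simp add: phi_red_def theta_red_def theta_eq_0_iff)

lemma phi_red_holomorphic: "w \<notin> \<Lambda> \<Longrightarrow> phi_red w holomorphic_on - (\<Lambda> - {0})"
  unfolding phi_red_def
  by (intro holomorphic_intros theta_red_holomorphic theta_holomorphic_compose)
    (use theta_red_nonzero theta_eq_0_iff in auto)

definition log_deriv_phi_red :: "complex \<Rightarrow> complex \<Rightarrow> complex" where
  "log_deriv_phi_red w s = - cc * (cnj w - w) + deriv \<theta> (w + s) / \<theta> (w + s) - log_deriv_red s"

lemma deriv_phi_red:
  assumes w: "w \<notin> \<Lambda>" and s: "s \<notin> \<Lambda> - {0}" "w + s \<notin> \<Lambda>"
  shows "deriv (phi_red w) s = phi_red w s * log_deriv_phi_red w s"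
proof -
  have d\<theta>: "(\<theta> has_field_derivative deriv \<theta> u) (at u)" for u
    using holomorphic_derivI[OF theta_holomorphic[of UNIV] open_UNIV UNIV_I] .
  have dr: "(theta_red has_field_derivative deriv theta_red s) (at s)"
    using holomorphic_derivI[OF theta_red_holomorphic[of UNIV] open_UNIV UNIV_I] .
  have d: "((\<lambda>s. \<theta> (w + s)) has_field_derivative deriv \<theta> (w + s) * 1) (at s)"
    by (rule DERIV_chain2[OF d\<theta>]) (auto intro!: derivative_eq_intros)
  have nz: "\<theta> w \<noteq> 0" "\<theta> (w + s) \<noteq> 0" "theta_red s \<noteq> 0"
    using assms theta_eq_0_iff theta_red_nonzero by auto
  define k where "k = - cc * (cnj w - w)"
  have "((\<lambda>s. exp (k * s) * \<theta> (w + s) / (\<theta> w * theta_red s)) has_field_derivative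
      ((exp (k * s) * k * \<theta> (w + s) + exp (k * s) * deriv \<theta> (w + s)) * (\<theta> w * theta_red s)
        - exp (k * s) * \<theta> (w + s) * (\<theta> w * deriv theta_red s)) / ((\<theta> w * theta_red s) * (\<theta> w * theta_red s))) (at s)"
    using nz by (auto intro!: derivative_eq_intros d dr simp: mult_ac)
  then have "deriv (phi_red w) s = ((exp (k * s) * k * \<theta> (w + s) + exp (k * s) * deriv \<theta> (w + s)) * (\<theta> w * theta_red s)
        - exp (k * s) * \<theta> (w + s) * (\<theta> w * deriv theta_red s)) / ((\<theta> w * theta_red s) * (\<theta> w * theta_red s))"
    unfolding phi_red_def[abs_def] k_def by (rule DERIV_imp_deriv)
  also have "\<dots> = (exp (k * s) * \<theta> (w + s) / (\<theta> w * theta_red s)) *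
      (k + deriv \<theta> (w + s) / \<theta> (w + s) - deriv theta_red s / theta_red s)"
    using nz by (simp add: field_simps)
  finally show ?thesis by (simp only: phi_red_def log_deriv_phi_red_def log_deriv_red_def k_def)
qed

text \<open>The three summands of \<open>log_deriv_phi_red\<close> yield those of
  \<open>EK_star\<close>: the constant contributes to order 1 only, the shifted quotient gives the
  derivatives of the logarithm of \<theta> at \<open>w\<close>, and
  \<open>log_deriv_red_taylor\<close> supplies the lattice sum.\<close>

lemma higher_deriv_log_deriv_phi_red:
  assumes w: "w \<notin> \<Lambda>"
  shows "(deriv ^^ n) (log_deriv_phi_red w) 0 = EK_star \<tau> \<theta> (Suc n) w"
    and "log_deriv_phi_red w holomorphic_on {s. s \<notin> \<Lambda> - {0} \<and> w + s \<notin> \<Lambda>}"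
    and "open {s. s \<notin> \<Lambda> - {0} \<and> w + s \<notin> \<Lambda>}"
proof -
  let ?A = "{s. s \<notin> \<Lambda> - {0} \<and> w + s \<notin> \<Lambda>}"
  have "?A = - (\<Lambda> - {0}) \<inter> (\<lambda>s. w + s) -` (- \<Lambda>)" by auto
  moreover have "open ((\<lambda>s. w + s) -` (- \<Lambda>))"
    by (rule open_vimage[OF open_lattice_compl]) (intro continuous_intros)
  ultimately show o: "open ?A" by (simp only: open_Int open_reduced_domain)
  have h: "(\<lambda>u. deriv \<theta> u / \<theta> u) holomorphic_on - \<Lambda>"
    by (intro holomorphic_intros deriv_theta_holomorphic theta_holomorphic) (auto simp: theta_eq_0_iff)
  have "(\<lambda>s. (\<lambda>u. deriv \<theta> u / \<theta> u) (1 * s + w)) holomorphic_on ?A"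
    by (rule holomorphic_on_compose_gen[OF _ h, unfolded o_def]) (auto intro!: holomorphic_intros simp: add.commute)
  then have h1: "(\<lambda>s. deriv \<theta> (w + s) / \<theta> (w + s)) holomorphic_on ?A" by (simp add: add.commute)
  have h2: "log_deriv_red holomorphic_on ?A" by (rule holomorphic_on_subset[OF log_deriv_red_holomorphic]) auto
  show hL: "log_deriv_phi_red w holomorphic_on ?A"
    unfolding log_deriv_phi_red_def by (intro holomorphic_intros h1 h2)
  have 0: "0 \<in> ?A" using w by simp
  have "(deriv ^^ n) (log_deriv_phi_red w) 0 = (deriv ^^ n) (\<lambda>s. - cc * (cnj w - w) + deriv \<theta> (w + s) / \<theta> (w + s)) 0
      - (deriv ^^ n) log_deriv_red 0"
    unfolding log_deriv_phi_red_def[abs_def] by (rule higher_deriv_diff[OF _ h2 o 0]) (intro holomorphic_intros h1)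
  also have "(deriv ^^ n) (\<lambda>s. - cc * (cnj w - w) + deriv \<theta> (w + s) / \<theta> (w + s)) 0
      = (deriv ^^ n) (\<lambda>s. - cc * (cnj w - w)) 0 + (deriv ^^ n) (\<lambda>s. deriv \<theta> (w + s) / \<theta> (w + s)) 0"
    by (rule higher_deriv_add[OF holomorphic_on_const h1 o 0])
  also have "(deriv ^^ n) (\<lambda>s. deriv \<theta> (w + s) / \<theta> (w + s)) (0 :: complex)
      = (deriv ^^ n) (\<lambda>u. deriv \<theta> u / \<theta> u) w"
  proof -
    have "(deriv ^^ n) (\<lambda>s. (\<lambda>u. deriv \<theta> u / \<theta> u) (1 * s + w)) 0 = 1 ^ n * (deriv ^^ n) (\<lambda>u. deriv \<theta> u / \<theta> u) (1 * 0 + w)"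
      by (rule higher_deriv_compose_linear'[OF h o open_lattice_compl 0]) (auto simp: add.commute)
    then show ?thesis by (simp add: add.commute)
  qed
  finally show "(deriv ^^ n) (log_deriv_phi_red w) 0 = EK_star \<tau> \<theta> (Suc n) w"
    by (simp add: EK_star_def log_deriv_red_taylor cc_def)
qed

text \<open>The expansion of \<open>phi_red w\<close> and the exponential series defining
  \<open>B_hat\<close> solve the same linear equation \<open>Y' = Y * L\<close> with constant term
  1. Comparing solutions as formal power series avoids choosing a logarithm of
  \<open>phi_red w\<close>.\<close>

lemma higher_deriv_phi_red:
  assumes w: "w \<notin> \<Lambda>"
  shows "(deriv ^^ n) (phi_red w) 0 = B_hat \<tau> \<theta> n w"
proof -
  let ?A = "{s. s \<notin> \<Lambda> - {0} \<and> w + s \<notin> \<Lambda>}"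
  let ?Y = "fps_expansion (phi_red w) 0" and ?L = "fps_expansion (log_deriv_phi_red w) 0"
  let ?F = "Abs_fps (\<lambda>k. if k = 0 then 0 else EK_star \<tau> \<theta> k w / fact k)"
  have o: "open ?A" and hL: "log_deriv_phi_red w holomorphic_on ?A" by (rule higher_deriv_log_deriv_phi_red[OF w])+
  have 0: "0 \<in> ?A" using w by simp
  have Y: "phi_red w has_fps_expansion ?Y"
    by (rule has_fps_expansion_fps_expansion[OF open_reduced_domain _ phi_red_holomorphic[OF w]]) simp
  have L: "log_deriv_phi_red w has_fps_expansion ?L"
    by (rule has_fps_expansion_fps_expansion[OF o 0 hL])
  have "deriv (phi_red w) has_fps_expansion ?Y * ?L"
  proof (subst has_fps_expansion_cong)
    show "(\<lambda>s. phi_red w s * log_deriv_phi_red w s) has_fps_expansion ?Y * ?L"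
      by (rule has_fps_expansion_mult[OF Y L])
    show "\<forall>\<^sub>F s in nhds 0. deriv (phi_red w) s = phi_red w s * log_deriv_phi_red w s"
      using eventually_nhds_in_open[OF o 0] by eventually_elim (use deriv_phi_red[OF w] in auto)
  qed simp
  then have ode: "fps_deriv ?Y = ?Y * ?L" using has_fps_expansion_deriv[OF Y] fps_expansion_unique_complex by blast
  have LF: "fps_deriv ?F = ?L"
    by (rule fps_ext) (simp add: fps_expansion_def higher_deriv_log_deriv_phi_red(1)[OF w] field_simps del: of_nat_Suc)
  have "?Y = fps_exp 1 oo ?F"
  proof (rule fps_linear_ode_unique[OF ode])
    show "fps_deriv (fps_exp 1 oo ?F) = (fps_exp 1 oo ?F) * ?L"
      using LF by (subst fps_compose_deriv) auto
    show "fps_nth ?Y 0 = fps_nth (fps_exp 1 oo ?F) 0"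
      using phi_red_0[OF w] by (simp add: fps_expansion_def)
  qed
  from arg_cong[OF this, of "\<lambda>F. fact n * fps_nth F n"] show ?thesis
    by (simp add: B_hat_def fps_expansion_def)
qed

text \<open>The difference quotient of \<open>phi_red w\<close> at 0, that is \<open>phi w s\<close>
  without its polar part \<open>1 / s\<close>.\<close>

definition phi_reg :: "complex \<Rightarrow> complex \<Rightarrow> complex" where
  "phi_reg w s = (if s = 0 then deriv (phi_red w) 0 else (phi_red w s - phi_red w 0) / (s - 0))"

lemma phi_reg_holomorphic: "w \<notin> \<Lambda> \<Longrightarrow> phi_reg w holomorphic_on - (\<Lambda> - {0})"
  unfolding phi_reg_def[abs_def] by (rule pole_lemma_open[OF phi_red_holomorphic open_reduced_domain])

lemma phi_eq_phi_reg: "w \<notin> \<Lambda> \<Longrightarrow> s \<noteq> 0 \<Longrightarrow> phi w s = 1 / s + phi_reg w s"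
  by (simp add: phi_eq_phi_red phi_reg_def phi_red_0 field_simps)

text \<open>Compare coefficients in \<open>phi_red w s = 1 + s * phi_reg w s\<close>. The factor
  \<open>s\<close> shifts the index, and the quotient of \<open>fact (Suc n)\<close> by
  \<open>fact n\<close> is the block size in the denominators of the final formula.\<close>

lemma higher_deriv_phi_reg:
  assumes w: "w \<notin> \<Lambda>"
  shows "(deriv ^^ n) (phi_reg w) 0 = B_hat \<tau> \<theta> (Suc n) w / of_nat (Suc n)"
proof -
  let ?A = "- (\<Lambda> - {0})"
  have o: "open ?A" by (rule open_reduced_domain)
  have 0: "0 \<in> ?A" by simp
  have R: "phi_reg w has_fps_expansion fps_expansion (phi_reg w) 0"
    by (rule has_fps_expansion_fps_expansion[OF o 0 phi_reg_holomorphic[OF w]])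
  have "(\<lambda>s. 1 + s * phi_reg w s) has_fps_expansion 1 + fps_X * fps_expansion (phi_reg w) 0"
    by (intro fps_expansion_intros R)
  moreover have "(\<lambda>s. 1 + s * phi_reg w s) = phi_red w"
    using phi_red_0[OF w] by (auto simp: phi_reg_def fun_eq_iff)
  ultimately have "phi_red w has_fps_expansion 1 + fps_X * fps_expansion (phi_reg w) 0" by (simp only:)
  then have "fps_nth (1 + fps_X * fps_expansion (phi_reg w) 0) (Suc n) = (deriv ^^ Suc n) (phi_red w) 0 / fact (Suc n)"
    by (rule fps_nth_fps_expansion)
  also have "\<dots> = B_hat \<tau> \<theta> (Suc n) w / fact (Suc n)" by (simp only: higher_deriv_phi_red[OF w])
  finally show ?thesis by (simp add: fps_expansion_def field_simps del: of_nat_Suc)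
qed

lemma phi_holomorphic: "w \<notin> \<Lambda> \<Longrightarrow> phi w holomorphic_on - \<Lambda>"
  unfolding phi_def kronecker_def
  by (intro holomorphic_intros theta_holomorphic_compose) (auto simp: theta_eq_0_iff)

text \<open>Multiplied by \<open>fact n\<close> with \<open>n = card B - 1\<close>, the polar part
  becomes the alternating weight of \<open>partition_sum_add_alternating\<close> at
  \<open>x = 1 / s\<close>.\<close>

lemma coeff_phi_eq_phi_reg:
  assumes w: "w \<notin> \<Lambda>" and s: "s \<notin> \<Lambda>"
  shows "coeff_phi n s w = (- 1) ^ n / s ^ Suc n + (deriv ^^ n) (phi_reg w) s / fact n"
proof -
  have s0: "s \<in> - \<Lambda>" "s \<noteq> 0" using s by auto
  have h1: "(\<lambda>s. 1 / s) holomorphic_on - \<Lambda>" by (intro holomorphic_intros) auto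
  have h2: "phi_reg w holomorphic_on - \<Lambda>" by (rule holomorphic_on_subset[OF phi_reg_holomorphic[OF w]]) auto
  have "(deriv ^^ n) (phi w) s = (deriv ^^ n) (\<lambda>s. 1 / s + phi_reg w s) s"
    by (rule higher_deriv_transform_within_open[OF phi_holomorphic[OF w] _ open_lattice_compl s0(1)])
      (auto intro!: holomorphic_intros h1 h2 phi_eq_phi_reg[OF w])
  also have "\<dots> = (deriv ^^ n) (\<lambda>s. 1 / s) s + (deriv ^^ n) (phi_reg w) s"
    by (rule higher_deriv_add[OF h1 h2 open_lattice_compl s0(1)])
  finally show ?thesis by (simp add: coeff_phi_def higher_deriv_reciprocal[OF s0(2)] add_divide_distrib)
qed

lemma coeff_phi_shift:
  assumes w: "w \<notin> \<Lambda>" and s: "s \<notin> \<Lambda>" and l: "l \<in> \<Lambda>"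
    and q: "\<And>s. s \<notin> \<Lambda> \<Longrightarrow> phi w (s + l) = c * phi w s"
  shows "coeff_phi n (s + l) w = c * coeff_phi n s w"
proof -
  have s': "s \<in> - \<Lambda>" using s by simp
  have "(\<lambda>s. phi w (1 * s + l)) holomorphic_on - \<Lambda>"
    by (rule holomorphic_on_compose_gen[OF _ phi_holomorphic[OF w], unfolded o_def])
      (use l lattice_add_iff in \<open>auto intro!: holomorphic_intros\<close>)
  then have "(deriv ^^ n) (\<lambda>s. phi w (1 * s + l)) s = (deriv ^^ n) (\<lambda>s. c * phi w s) s"
    by (rule higher_deriv_transform_within_open[OF _ _ open_lattice_compl s'])
      (use q in \<open>auto intro!: holomorphic_intros phi_holomorphic[OF w]\<close>)
  moreover have "(deriv ^^ n) (\<lambda>s. phi w (1 * s + l)) s = 1 ^ n * (deriv ^^ n) (phi w) (1 * s + l)"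
    by (rule higher_deriv_compose_linear'[OF phi_holomorphic[OF w] open_lattice_compl open_lattice_compl s'])
      (use l lattice_add_iff in auto)
  moreover have "(deriv ^^ n) (\<lambda>s. c * phi w s) s = c * (deriv ^^ n) (phi w) s"
    by (rule higher_deriv_cmult[OF phi_holomorphic[OF w] s' open_lattice_compl])
  ultimately show ?thesis by (simp add: coeff_phi_def)
qed

text \<open>\<open>kronecker\<close> is symmetric, so its behaviour in the second variable is that
  in the first; only the exponential factor is left over here.\<close>

lemma phi_shift_1: "phi w (s + 1) = exp (- cc * (cnj w - w)) * phi w s"
proof -
  have "kronecker w (s + 1) = kronecker w s"
    using kronecker_add_1[of s w] by (simp add: kronecker_def add.commute mult.commute)
  moreover have "exp (- cc * (cnj w - w) * (s + 1)) = exp (- cc * (cnj w - w) * s) * exp (- cc * (cnj w - w))"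
    by (simp add: distrib_left flip: exp_add)
  ultimately show ?thesis by (simp only: phi_def mult_ac)
qed

lemma phi_shift_tau: "phi w (s + \<tau>) = exp (- cc * (cnj w - w) * \<tau> - 2 * pi * \<i> * w) * phi w s"
proof -
  have "kronecker w (s + \<tau>) = exp (- 2 * pi * \<i> * w) * kronecker w s"
    using kronecker_add_tau[of s w] by (simp add: kronecker_def add.commute mult.commute)
  moreover have "exp (- cc * (cnj w - w) * (s + \<tau>)) = exp (- cc * (cnj w - w) * s) * exp (- cc * (cnj w - w) * \<tau>)"
    by (simp add: distrib_left flip: exp_add)
  moreover have "exp (- cc * (cnj w - w) * \<tau> - 2 * pi * \<i> * w) = exp (- cc * (cnj w - w) * \<tau>) * exp (- 2 * pi * \<i> * w)"
    by (simp add: exp_diff exp_minus divide_inverse)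
  ultimately show ?thesis by (simp only: phi_def mult_ac)
qed

definition block_value :: "(nat \<Rightarrow> complex) \<Rightarrow> complex \<Rightarrow> nat set \<Rightarrow> complex" where
  "block_value W s B = fact (card B - 1) * coeff_phi (card B - 1) s (\<Sum>i\<in>B. W i)"

definition reg_block_value :: "(nat \<Rightarrow> complex) \<Rightarrow> complex \<Rightarrow> nat set \<Rightarrow> complex" where
  "reg_block_value W s B = (deriv ^^ (card B - 1)) (phi_reg (\<Sum>i\<in>B. W i)) s"

lemma cycle_value_eq: "cycle_value S (\<lambda>_. 0) W s = partition_sum S (block_value W s)"
  unfolding cycle_value_def cycle_weight_def block_value_def[abs_def] by simp

lemma cycle_value_eq_reg:
  assumes S: "finite S" and W: "\<And>A. A \<subseteq> S \<Longrightarrow> A \<noteq> {} \<Longrightarrow> (\<Sum>i\<in>A. W i) \<notin> \<Lambda>" and s: "s \<notin> \<Lambda>"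
  shows "cycle_value S (\<lambda>_. 0) W s = partition_sum S (reg_block_value W s)
    + (1 / s) * (\<Sum>j\<in>S. partition_sum (S - {j}) (reg_block_value W s))"
proof -
  have "partition_sum S (block_value W s) = partition_sum S
      (\<lambda>B. (- 1) ^ (card B - 1) * fact (card B - 1) * (1 / s) ^ card B + reg_block_value W s B)"
  proof (rule partition_sum_cong)
    fix B assume B: "B \<subseteq> S" "B \<noteq> {}"
    then have "card B > 0" using S by (meson card_gt_0_iff finite_subset)
    then have c: "Suc (card B - 1) = card B" by simp
    show "block_value W s B = (- 1) ^ (card B - 1) * fact (card B - 1) * (1 / s) ^ card B + reg_block_value W s B"
      unfolding block_value_def reg_block_value_def coeff_phi_eq_phi_reg[OF W[OF B] s] c
      by (simp add: distrib_left power_one_over)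
  qed
  then show ?thesis unfolding cycle_value_eq partition_sum_add_alternating[OF S] .
qed

lemma partition_sum_holomorphic:
  assumes "\<And>B. B \<subseteq> S \<Longrightarrow> B \<noteq> {} \<Longrightarrow> (\<lambda>s. g s B) holomorphic_on X"
  shows "(\<lambda>s. partition_sum S (g s)) holomorphic_on X"
  unfolding partition_sum_def
  by (intro holomorphic_on_sum holomorphic_on_prod) (use assms in \<open>auto simp: partition_on_def\<close>)

lemma reg_block_value_holomorphic:
  assumes "(\<Sum>i\<in>B. W i) \<notin> \<Lambda>"
  shows "(\<lambda>s. reg_block_value W s B) holomorphic_on - (\<Lambda> - {0})"
  unfolding reg_block_value_def by (intro holomorphic_higher_deriv phi_reg_holomorphic assms open_reduced_domain)

lemma cycle_value_shift:
  assumes S: "finite S" and W: "\<And>A. A \<subseteq> S \<Longrightarrow> A \<noteq> {} \<Longrightarrow> (\<Sum>i\<in>A. W i) \<notin> \<Lambda>" and s: "s \<notin> \<Lambda>"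
    and l: "l \<in> \<Lambda>" and q: "\<And>w s. phi w (s + l) = exp (\<alpha> w) * phi w s"
    and \<alpha>: "\<And>x y. \<alpha> (x + y) = \<alpha> x + \<alpha> y" "\<alpha> 0 = 0"
  shows "cycle_value S (\<lambda>_. 0) W (s + l) = exp (\<alpha> (\<Sum>i\<in>S. W i)) * cycle_value S (\<lambda>_. 0) W s"
  unfolding cycle_value_eq partition_sum_mult_exp[OF S \<alpha>, symmetric]
  by (rule partition_sum_cong) (simp add: block_value_def coeff_phi_shift[OF W s l q])

lemma cycle_value_closed_form:
  assumes S: "finite S" "S \<noteq> {}" and W: "\<And>A. A \<subseteq> S \<Longrightarrow> A \<noteq> {} \<Longrightarrow> (\<Sum>i\<in>A. W i) \<notin> \<Lambda>" and s: "s \<notin> \<Lambda>"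
  shows "cycle_value S (\<lambda>_. 0) W s = (\<Sum>j\<in>S. partition_sum (S - {j})
    (\<lambda>B. B_hat \<tau> \<theta> (card B) (\<Sum>i\<in>B. W i) / of_nat (card B))) * phi (\<Sum>i\<in>S. W i) s"
proof -
  define w where "w = (\<Sum>i\<in>S. W i)"
  have w: "w \<notin> \<Lambda>" unfolding w_def using W S by blast
  define C where "C = (\<Sum>j\<in>S. partition_sum (S - {j})
    (\<lambda>B. B_hat \<tau> \<theta> (card B) (\<Sum>i\<in>B. W i) / of_nat (card B)))"
  \<comment> \<open>This factor cancels the multiplier of \<open>phi w\<close> for the translation
    by 1 and turns the one for \<tau> into \<open>exp (- 2 * pi * \<i> * w)\<close>, the form
    required by \<open>quasi_periodic_eq_0\<close> with parameter \<open>w\<close>.\<close>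
  define e where "e = (\<lambda>s. exp (cc * (cnj w - w) * s))"
  define f where "f = (\<lambda>s. e s * (cycle_value S (\<lambda>_. 0) W s - C * phi w s))"
  define P where "P = (\<lambda>s. partition_sum S (reg_block_value W s))"
  define Q where "Q = (\<lambda>s. \<Sum>j\<in>S. partition_sum (S - {j}) (reg_block_value W s))"
  let ?\<Omega> = "- (\<Lambda> - {0})"
  have tr: "translates \<tau> {0} = \<Lambda>" by (auto simp: translates_iff)
  have P: "P holomorphic_on ?\<Omega>" unfolding P_def
    by (intro partition_sum_holomorphic reg_block_value_holomorphic W)
  have Q: "Q holomorphic_on ?\<Omega>" unfolding Q_def
    by (intro holomorphic_on_sum partition_sum_holomorphic reg_block_value_holomorphic W) auto
  have Q0: "Q 0 = C"
    unfolding Q_def C_def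
  proof (intro sum.cong refl partition_sum_cong)
    fix j B assume B: "B \<subseteq> S - {j}" "B \<noteq> {}"
    then have "card B > 0" using S by (meson card_gt_0_iff finite_subset finite_Diff)
    then have c: "Suc (card B - 1) = card B" by simp
    have "(\<Sum>i\<in>B. W i) \<notin> \<Lambda>" by (rule W) (use B in auto)
    from higher_deriv_phi_reg[OF this, of "card B - 1"]
    show "reg_block_value W 0 B = B_hat \<tau> \<theta> (card B) (\<Sum>i\<in>B. W i) / of_nat (card B)"
      unfolding reg_block_value_def c .
  qed
  \<comment> \<open>The polar parts \<open>Q 0 / s\<close> and \<open>C / s\<close> cancel because
    \<open>Q 0 = C\<close>; the rest of \<open>f\<close> is holomorphic at 0.\<close>
  define h where "h = (\<lambda>s. e s * (P s + (if s = 0 then deriv Q 0 else (Q s - Q 0) / (s - 0)) - C * phi_reg w s))"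
  have eh: "e holomorphic_on X" for X unfolding e_def by (intro holomorphic_intros)
  have hh: "h holomorphic_on ?\<Omega>"
    unfolding h_def
    by (intro holomorphic_on_mult holomorphic_on_add holomorphic_on_diff holomorphic_on_const eh P
        pole_lemma_open[OF Q open_reduced_domain] phi_reg_holomorphic[OF w])
  have fh: "f s = h s" if "s \<notin> \<Lambda>" for s
  proof -
    have "s \<noteq> 0" using that by auto
    moreover have "cycle_value S (\<lambda>_. 0) W s = P s + (1 / s) * Q s"
      unfolding P_def Q_def by (rule cycle_value_eq_reg[OF S(1) W that])
    ultimately show ?thesis
      unfolding f_def h_def Q0 by (simp add: phi_eq_phi_reg[OF w] field_simps)
  qed
  have alg: "x * (E * a - C * (E * b)) = (x * E) * (a - C * b)" for x E a b
    by (simp add: algebra_simps)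
  have "f s = 0"
  proof (rule quasi_periodic_eq_0[OF tau, where S = "{0}" and s = w and f = f], unfold tr)
    show "f holomorphic_on - \<Lambda>"
      by (subst holomorphic_cong[OF refl, of _ f h]) (use fh in \<open>auto intro: holomorphic_on_subset[OF hh]\<close>)
    show "f (z + 1) = f z" if z: "z \<notin> \<Lambda>" for z
    proof -
      have "cycle_value S (\<lambda>_. 0) W (z + 1) = exp (- cc * (cnj w - w)) * cycle_value S (\<lambda>_. 0) W z"
        unfolding w_def
        by (rule cycle_value_shift[OF S(1) W z lattice_1 phi_shift_1]) (simp_all add: algebra_simps)
      moreover have "e (z + 1) * exp (- cc * (cnj w - w)) = e z"
        by (simp add: e_def algebra_simps flip: exp_add)
      ultimately show ?thesis by (simp only: f_def phi_shift_1 alg)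
    qed
    show "f (z + \<tau>) = exp (- 2 * pi * \<i> * w) * f z" if z: "z \<notin> \<Lambda>" for z
    proof -
      have "cycle_value S (\<lambda>_. 0) W (z + \<tau>) = exp (- cc * (cnj w - w) * \<tau> - 2 * pi * \<i> * w) * cycle_value S (\<lambda>_. 0) W z"
        unfolding w_def
        by (rule cycle_value_shift[OF S(1) W z lattice_tau phi_shift_tau]) (simp_all add: algebra_simps)
      moreover have "e (z + \<tau>) * exp (- cc * (cnj w - w) * \<tau> - 2 * pi * \<i> * w) = exp (- 2 * pi * \<i> * w) * e z"
        by (simp add: e_def algebra_simps flip: exp_add)
      ultimately show ?thesis by (simp only: f_def phi_shift_tau alg mult.assoc)
    qed
    show "\<exists>r>0. \<exists>h. h holomorphic_on ball p r \<and> (\<forall>z\<in>ball p r - {p}. f z = h z)" if "p \<in> {0}" for p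
    proof -
      obtain r where r: "r > 0" "ball 0 r \<subseteq> ?\<Omega>" using open_reduced_domain open_contains_ball[of ?\<Omega>] by auto
      have p: "p = 0" using \<open>p \<in> {0}\<close> by simp
      have "\<forall>z\<in>ball 0 r - {0}. f z = h z" by (intro ballI fh) (use r in auto)
      with r(1) holomorphic_on_subset[OF hh r(2)] show ?thesis
        unfolding p by (intro exI[of _ r] exI[of _ h] conjI)
    qed
  qed (use w s in auto)
  then show ?thesis by (simp add: f_def e_def C_def w_def)
qed

end

section \<open>Matching the integrand with the determinant\<close>

lemma prod_square_eq_diagonal_pairs:
  fixes g :: "'a::linorder \<Rightarrow> 'a \<Rightarrow> 'b::comm_monoid_mult"
  assumes S: "finite S"
  shows "(\<Prod>i\<in>S. \<Prod>j\<in>S. g i j) = (\<Prod>i\<in>S. g i i) * (\<Prod>i\<in>S. \<Prod>j | j \<in> S \<and> i < j. g i j * g j i)"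
proof -
  have "(\<Prod>j\<in>S. g i j) = g i i * ((\<Prod>j | j \<in> S \<and> i < j. g i j) * (\<Prod>j | j \<in> S \<and> j < i. g i j))" if "i \<in> S" for i
  proof -
    have "S = insert i ({j. j \<in> S \<and> i < j} \<union> {j. j \<in> S \<and> j < i})" using that by auto
    then have "(\<Prod>j\<in>S. g i j) = prod (g i) (insert i ({j. j \<in> S \<and> i < j} \<union> {j. j \<in> S \<and> j < i}))" by simp
    also have "\<dots> = g i i * prod (g i) ({j. j \<in> S \<and> i < j} \<union> {j. j \<in> S \<and> j < i})"
      using S by (subst prod.insert) auto
    also have "prod (g i) ({j. j \<in> S \<and> i < j} \<union> {j. j \<in> S \<and> j < i})
        = (\<Prod>j | j \<in> S \<and> i < j. g i j) * (\<Prod>j | j \<in> S \<and> j < i. g i j)"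
      using S by (subst prod.union_disjoint) auto
    finally show ?thesis .
  qed
  then have "(\<Prod>i\<in>S. \<Prod>j\<in>S. g i j) = (\<Prod>i\<in>S. g i i) * ((\<Prod>i\<in>S. \<Prod>j | j \<in> S \<and> i < j. g i j)
      * (\<Prod>i\<in>S. \<Prod>j | j \<in> S \<and> j < i. g i j))"
    by (simp add: prod.distrib)
  also have "(\<Prod>i\<in>S. \<Prod>j | j \<in> S \<and> j < i. g i j) = (\<Prod>j\<in>S. \<Prod>i | i \<in> S \<and> j < i. g i j)"
    by (rule prod.swap_restrict[OF S S])
  finally show ?thesis by (simp add: prod.distrib)
qed

context jacobi_theta
begin

text \<open>Once the other variables are generic, the integrands may differ on finitely many classes
  of the first variable. After the first integration both have the same integral, so later stages
  coincide.\<close>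

lemma generic_torus_integral_cong:
  assumes "generic_torus_integral \<Gamma> (k # ks) F I"
    and eq: "\<And>z. (\<forall>i\<in>set ks. \<forall>j\<in>set ks. i \<noteq> j \<longrightarrow> z i - z j \<notin> \<Gamma>) \<Longrightarrow>
      \<exists>T. finite T \<and> (\<forall>u. u \<notin> translates \<tau> T \<longrightarrow> F (z(k := u)) = F' (z(k := u)))"
  shows "generic_torus_integral \<Gamma> (k # ks) F' I"
proof -
  obtain G where G: "generic_torus_integral \<Gamma> ks G I"
    "\<And>z. (\<forall>i\<in>set ks. \<forall>j\<in>set ks. i \<noteq> j \<longrightarrow> z i - z j \<notin> \<Gamma>) \<Longrightarrow> torus_integral \<tau> (\<lambda>u. F (z(k := u))) (G z)"
    using assms(1) by auto
  have "torus_integral \<tau> (\<lambda>u. F' (z(k := u))) (G z)"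
    if z: "\<forall>i\<in>set ks. \<forall>j\<in>set ks. i \<noteq> j \<longrightarrow> z i - z j \<notin> \<Gamma>" for z
  proof -
    obtain T where "finite T" "\<And>u. u \<notin> translates \<tau> T \<Longrightarrow> F (z(k := u)) = F' (z(k := u))" using eq[OF z] by blast
    then show ?thesis by (rule torus_integral_cong[OF tau G(2)[OF z]])
  qed
  with G(1) show ?thesis by auto
qed

text \<open>For every permutation the arguments \<open>z i + W i - z (\<sigma> i)\<close> add up to
  the sum of the \<open>W i\<close>, so the exponential factors multiply to a number independent of
  \<sigma> and of \<open>z\<close>.\<close>

lemma cycle_sum_eq_kronecker_det:
  assumes S: "finite S"
  shows "cycle_sum S (\<lambda>_. 0) W s z
    = exp (- cc * (cnj (\<Sum>i\<in>S. W i) - (\<Sum>i\<in>S. W i)) * s) * kronecker_det S (\<lambda>i. z i + W i) z s"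
  unfolding cycle_sum_def kronecker_det_def sum_distrib_left
proof (rule sum.cong[OF refl])
  fix \<sigma> assume "\<sigma> \<in> {\<sigma>. \<sigma> permutes S}"
  then have \<sigma>: "\<sigma> permutes S" by simp
  define x where "x = (\<lambda>i. z i + W i - z (\<sigma> i))"
  have "(\<Sum>i\<in>S. z (\<sigma> i)) = (\<Sum>i\<in>S. z i)" using sum.permute[OF \<sigma>, of z] by (simp add: o_def)
  then have "(\<Sum>i\<in>S. x i) = (\<Sum>i\<in>S. W i)" by (simp add: x_def sum_subtractf sum.distrib)
  then have "- cc * (cnj (\<Sum>i\<in>S. W i) - (\<Sum>i\<in>S. W i)) * s = (\<Sum>i\<in>S. - cc * (cnj (x i) - x i) * s)"
    by (simp flip: \<open>(\<Sum>i\<in>S. x i) = (\<Sum>i\<in>S. W i)\<close> add: sum_subtractf sum_distrib_left[symmetric] sum_distrib_right[symmetric] sum_negf)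
  then have "exp (- cc * (cnj (\<Sum>i\<in>S. W i) - (\<Sum>i\<in>S. W i)) * s) = (\<Prod>i\<in>S. exp (- cc * (cnj (x i) - x i) * s))"
    by (simp only: exp_sum[OF S])
  then show "of_int (sign \<sigma>) * (\<Prod>i\<in>S. coeff_phi 0 s (z i + W i - z (\<sigma> i)))
      = exp (- cc * (cnj (\<Sum>i\<in>S. W i) - (\<Sum>i\<in>S. W i)) * s)
        * (of_int (sign \<sigma>) * (\<Prod>i\<in>S. kronecker (z i + W i - z (\<sigma> i)) s))"
    by (simp add: coeff_phi_def phi_def prod.distrib x_def)
qed

lemma omega_eq_cycle_sum:
  assumes w: "\<And>i. i \<in> {1..n} \<Longrightarrow> w i \<notin> \<Lambda>" and W: "(\<Sum>i=1..n. w i) \<notin> \<Lambda>"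
    and s: "s \<notin> \<Lambda>" "(\<Sum>i=1..n. w i) + s \<notin> \<Lambda>"
    and z: "\<And>i j. i \<in> {1..n} \<Longrightarrow> j \<in> {1..n} \<Longrightarrow> i \<noteq> j \<Longrightarrow> z i - z j \<notin> \<Lambda>"
      "\<And>i j. i \<in> {1..n} \<Longrightarrow> j \<in> {1..n} \<Longrightarrow> i \<noteq> j \<Longrightarrow> z i + w i - z j \<notin> \<Lambda>"
  shows "omega \<tau> \<theta> n w z
    = 1 / (phi (\<Sum>i=1..n. w i) s * of_real (Im \<tau>) ^ n) * cycle_sum {1..n} (\<lambda>_. 0) w s z"
proof -
  let ?S = "{1..n}" and ?W = "\<Sum>i=1..n. w i"
  define e where "e = exp (- cc * (cnj ?W - ?W) * s)"
  define A where "A = (\<Prod>i=1..n. \<Prod>j=i+1..n. \<theta> (z i + w i - z j - w j) * \<theta> (z i - z j))"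
  define B where "B = (\<Prod>i=1..n. \<Prod>j=i+1..n. \<theta> (z i + w i - z j) * \<theta> (z i - w j - z j))"
  define D where "D = (\<Prod>i=1..n. \<theta> (w i))"
  \<comment> \<open>One sign per pair of indices. It arises in the numerator and in the denominator
    of the Cauchy product, from reversing one argument of \<theta> in each, and cancels.\<close>
  define p where "p = (\<Prod>i=1..n. \<Prod>j=i+1..n. (- 1 :: complex))"
  have p: "p \<noteq> 0" by (simp add: p_def)
  have J: "{j. j \<in> ?S \<and> i < j} = {i+1..n}" if "i \<in> ?S" for i using that by auto
  have "cauchy_numerator ?S (\<lambda>i. z i + w i) z = (\<Prod>i=1..n. \<Prod>j=i+1..n. (- 1) * (\<theta> (z i + w i - z j - w j) * \<theta> (z i - z j)))"
    unfolding cauchy_numerator_def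
  proof (intro prod.cong J refl)
    fix i j
    have "\<theta> (z j - z i) = - \<theta> (z i - z j)" using theta_minus[of "z i - z j"] by simp
    then show "\<theta> (z i + w i - (z j + w j)) * \<theta> (z j - z i) = (- 1) * (\<theta> (z i + w i - z j - w j) * \<theta> (z i - z j))"
      by (simp add: diff_diff_eq)
  qed
  then have num: "cauchy_numerator ?S (\<lambda>i. z i + w i) z = p * A" by (simp only: prod.distrib p_def A_def)
  have "(\<Prod>i\<in>?S. \<Prod>j\<in>?S. \<theta> (z i + w i - z j))
      = (\<Prod>i\<in>?S. \<theta> (z i + w i - z i)) * (\<Prod>i\<in>?S. \<Prod>j | j \<in> ?S \<and> i < j. \<theta> (z i + w i - z j) * \<theta> (z j + w j - z i))"
    by (rule prod_square_eq_diagonal_pairs) simp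
  also have "(\<Prod>i\<in>?S. \<Prod>j | j \<in> ?S \<and> i < j. \<theta> (z i + w i - z j) * \<theta> (z j + w j - z i))
      = (\<Prod>i=1..n. \<Prod>j=i+1..n. (- 1) * (\<theta> (z i + w i - z j) * \<theta> (z i - w j - z j)))"
  proof (intro prod.cong J refl)
    fix i j
    have "\<theta> (z j + w j - z i) = - \<theta> (z i - w j - z j)"
      using theta_minus[of "z i - w j - z j"] by (simp add: algebra_simps)
    then show "\<theta> (z i + w i - z j) * \<theta> (z j + w j - z i) = (- 1) * (\<theta> (z i + w i - z j) * \<theta> (z i - w j - z j))" by simp
  qed
  finally have den: "(\<Prod>i\<in>?S. \<Prod>j\<in>?S. \<theta> (z i + w i - z j)) = D * (p * B)"
    by (simp only: prod.distrib p_def B_def D_def add_diff_cancel_left')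
  have "kronecker_det ?S (\<lambda>i. z i + w i) z s = cauchy_product ?S (\<lambda>i. z i + w i) z s"
  proof (rule frobenius_determinant[OF _ s(1)])
    show "z i + w i - z j \<notin> \<Lambda>" if "i \<in> {1..n}" "j \<in> {1..n}" for i j
      using that w z(2) by (cases "i = j") auto
  qed (use z(1) in auto)
  also have "\<dots> = \<theta> (s + ?W) / \<theta> s * (p * A) / (D * (p * B))"
    unfolding cauchy_product_def num den by simp
  finally have cyc: "cycle_sum ?S (\<lambda>_. 0) w s z = e * (\<theta> (s + ?W) / \<theta> s * A / (D * B))"
    using p cycle_sum_eq_kronecker_det[of ?S w s z] by (simp add: e_def)
  have nz: "\<theta> (?W + s) \<noteq> 0" "\<theta> s \<noteq> 0" "\<theta> ?W \<noteq> 0" "e \<noteq> 0" using s W theta_eq_0_iff by (auto simp: e_def)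
  have "omega \<tau> \<theta> n w z = \<theta> ?W / D * (A / B) * (1 / of_real (Im \<tau>)) ^ n"
    by (simp add: omega_def A_def B_def D_def)
  moreover have "phi ?W s = e * (\<theta> (?W + s) / (\<theta> ?W * \<theta> s))" by (simp add: phi_def kronecker_def e_def)
  ultimately show ?thesis unfolding cyc using nz
    by (simp add: add.commute[of s] power_one_over)
qed

lemma ex_generic_parameter: "\<exists>s. s \<notin> \<Lambda> \<and> W + s \<notin> \<Lambda>"
proof (rule ccontr)
  assume "\<nexists>s. s \<notin> \<Lambda> \<and> W + s \<notin> \<Lambda>"
  then have "UNIV \<subseteq> \<Lambda> \<union> (\<lambda>l. l - W) ` \<Lambda>" by (auto intro!: image_eqI[of _ _ "W + _"])
  then have "countable (UNIV :: complex set)"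
    by (rule countable_subset) (simp add: countable_lattice)
  then show False using uncountable_UNIV_complex by simp
qed

lemma has_reg_integral_En_omega:
  assumes n: "n \<ge> 1" and w: "\<And>I. I \<subseteq> {1..n} \<Longrightarrow> I \<noteq> {} \<Longrightarrow> (\<Sum>i\<in>I. w i) \<notin> \<Lambda>"
  shows "has_reg_integral_En \<tau> n (omega \<tau> \<theta> n w)
    (\<Sum>j=1..n. partition_sum ({1..n} - {j}) (\<lambda>B. B_hat \<tau> \<theta> (card B) (\<Sum>i\<in>B. w i) / of_nat (card B)))"
proof -
  define W where "W = (\<Sum>i=1..n. w i)"
  define C where "C = (\<Sum>j=1..n. partition_sum ({1..n} - {j}) (\<lambda>B. B_hat \<tau> \<theta> (card B) (\<Sum>i\<in>B. w i) / of_nat (card B)))"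
  \<comment> \<open>Poles met at any stage are shifted by subset sums of the \<open>w i\<close>, so
    these differences are the only ones at which two poles can collide. The empty subset covers
    congruent \<open>z i\<close> and \<open>z j\<close>.\<close>
  define \<Gamma> where "\<Gamma> = (\<Union>A\<in>Pow {1..n}. (\<lambda>l. l - (\<Sum>i\<in>A. w i)) ` \<Lambda>)"
  obtain s where s: "s \<notin> \<Lambda>" "W + s \<notin> \<Lambda>" using ex_generic_parameter by blast
  define c where "c = phi W s * of_real (Im \<tau>) ^ n"
  have W: "W \<notin> \<Lambda>" unfolding W_def by (rule w) (use n in auto)
  have w1: "w i \<notin> \<Lambda>" if "i \<in> {1..n}" for i using w[of "{i}"] that by simp
  have ph: "phi W s \<noteq> 0" using s W by (simp add: phi_def kronecker_def theta_eq_0_iff)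
  then have c: "c \<noteq> 0" using tau by (simp add: c_def)
  have \<Gamma>: "countable \<Gamma>" unfolding \<Gamma>_def by (intro countable_UN countable_image countable_lattice countable_finite) auto
  have in\<Gamma>: "l - (\<Sum>i\<in>A. w i) \<in> \<Gamma>" if "A \<subseteq> {1..n}" "l \<in> \<Lambda>" for A l using that by (auto simp: \<Gamma>_def)
  have set: "set [1..<Suc n] = {1..n}" by auto
  have "generic_torus_integral \<Gamma> [1..<Suc n] (cycle_sum {1..n} (\<lambda>_. 0) w s)
      (of_real (Im \<tau>) ^ length [1..<Suc n] * cycle_value {1..n} (\<lambda>_. 0) w s)"
    by (rule generic_torus_integral_cycle_sum[OF s(1), of "[1..<Suc n]", unfolded set, OF distinct_upt w in\<Gamma>])
  moreover have "length [1..<Suc n] = n" by simp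
  moreover have "cycle_value {1..n} (\<lambda>_. 0) w s = C * phi W s"
    unfolding C_def W_def by (rule cycle_value_closed_form[OF _ _ w s(1)]) (use n in auto)
  ultimately have "generic_torus_integral \<Gamma> [1..<Suc n] (cycle_sum {1..n} (\<lambda>_. 0) w s) (c * C)"
    by (simp only: c_def mult_ac)
  from generic_torus_integral_cmult[OF this, of "1 / c"] c
  have I: "generic_torus_integral \<Gamma> [1..<Suc n] (\<lambda>z. 1 / c * cycle_sum {1..n} (\<lambda>_. 0) w s z) C" by simp
  have ks: "[1..<Suc n] = 1 # [2..<Suc n]" "set [2..<Suc n] = {2..n}"
    using n by (auto simp: upt_conv_Cons numeral_2_eq_2 simp del: upt_Suc)
  have "generic_torus_integral \<Gamma> (1 # [2..<Suc n]) (omega \<tau> \<theta> n w) C"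
  proof (rule generic_torus_integral_cong[OF I[unfolded ks(1)]], unfold ks(2))
    fix z assume z: "\<forall>i\<in>{2..n}. \<forall>j\<in>{2..n}. i \<noteq> j \<longrightarrow> z i - z j \<notin> \<Gamma>"
    \<comment> \<open>The classes of \<open>z 1\<close> for which it is congruent to some
      \<open>z j\<close>, or one of the factors of the denominator that involve \<open>z 1\<close>
      vanishes.\<close>
    define T where "T = (\<Union>j\<in>{2..n}. {z j, z j - w 1, z j + w j})"
    have "1 / c * cycle_sum {1..n} (\<lambda>_. 0) w s (z(1 := u)) = omega \<tau> \<theta> n w (z(1 := u))"
      if u: "u \<notin> translates \<tau> T" for u
    proof -
      have uT: "u - p \<notin> \<Lambda>" if "p \<in> T" for p using u that by (auto simp: translates_iff)
      have z\<Gamma>: "z i - z j \<notin> \<Lambda>" "z i + w i - z j \<notin> \<Lambda>" if "i \<in> {2..n}" "j \<in> {2..n}" "i \<noteq> j" for i j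
      proof -
        have *: "z i - z j \<notin> \<Gamma>" using z that by blast
        show "z i - z j \<notin> \<Lambda>" using * in\<Gamma>[of "{}" "z i - z j"] by auto
        show "z i + w i - z j \<notin> \<Lambda>"
          using * in\<Gamma>[of "{i}" "z i + w i - z j"] that by (auto simp: algebra_simps)
      qed
      have u1: "u - z j \<notin> \<Lambda>" "z j - u \<notin> \<Lambda>" "u + w 1 - z j \<notin> \<Lambda>" "z j + w j - u \<notin> \<Lambda>" if j: "j \<in> {2..n}" for j
      proof -
        have T: "z j \<in> T" "z j - w 1 \<in> T" "z j + w j \<in> T" using j by (auto simp: T_def)
        show "u - z j \<notin> \<Lambda>" "z j - u \<notin> \<Lambda>" using uT[OF T(1)] lattice_diff_commute by auto
        show "u + w 1 - z j \<notin> \<Lambda>" using uT[OF T(2)] by (simp add: algebra_simps)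
        show "z j + w j - u \<notin> \<Lambda>" using uT[OF T(3)] lattice_diff_commute by blast
      qed
      have "omega \<tau> \<theta> n w (z(1 := u)) = 1 / c * cycle_sum {1..n} (\<lambda>_. 0) w s (z(1 := u))"
        unfolding c_def W_def
      proof (rule omega_eq_cycle_sum[OF w1 W[unfolded W_def] s(1) s(2)[unfolded W_def]])
        fix i j assume ij: "i \<in> {1..n}" "j \<in> {1..n}" "i \<noteq> j"
        then consider "i = 1" "j \<in> {2..n}" | "j = 1" "i \<in> {2..n}" | "i \<in> {2..n}" "j \<in> {2..n}" by force
        then show "(z(1 := u)) i - (z(1 := u)) j \<notin> \<Lambda>" "(z(1 := u)) i + w i - (z(1 := u)) j \<notin> \<Lambda>"
          by (cases; use ij u1 z\<Gamma> in auto)+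
      qed
      then show ?thesis by (rule sym)
    qed
    then show "\<exists>T. finite T \<and> (\<forall>u. u \<notin> translates \<tau> T \<longrightarrow>
        1 / c * cycle_sum {1..n} (\<lambda>_. 0) w s (z(1 := u)) = omega \<tau> \<theta> n w (z(1 := u)))"
      by (intro exI[of _ T]) (auto simp: T_def)
  qed
  then show ?thesis
    unfolding has_reg_integral_En_def C_def[symmetric] ks(1) by (rule generic_torus_integral_imp_iterated[OF \<Gamma>])
qed

end

theorem theorem1p1:
  fixes n :: nat and \<tau> :: complex and \<theta> :: "complex \<Rightarrow> complex" and w :: "nat \<Rightarrow> complex"
  assumes "n \<ge> 1"
    and "Im \<tau> > 0"
    and "odd_jacobi_theta \<tau> \<theta>"
    and "\<And>I. I \<subseteq> {1..n} \<Longrightarrow> I \<noteq> {} \<Longrightarrow> (\<Sum>i\<in>I. w i) \<notin> lattice \<tau>"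
  shows "has_reg_integral_En \<tau> n (omega \<tau> \<theta> n w)
           (\<Sum>j=1..n. \<Sum>\<pi> | partition_on ({1..n} - {j}) \<pi>.
              \<Prod>B\<in>\<pi>. B_hat \<tau> \<theta> (card B) (\<Sum>i\<in>B. w i) / of_nat (card B))"
proof -
  interpret jacobi_theta \<tau> \<theta> using assms by unfold_locales
  show ?thesis
    unfolding partition_sum_def[symmetric] by (rule has_reg_integral_En_omega[OF assms(1)]) (rule assms(4))
qed

end
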